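(* (1) For the formal potential $\mathcal V^{\mathrm{ev}}(x)=\frac{x^2}{2}-\sum_{n\ge2}\frac{t^{n-1}x^{2n}}{2n}$, the planar limit $\mathcal F_0(t)=\sum_{n\ge1}f_nt^n$ has the Taylor expansion $$\mathcal F_0(t)=\frac t2+\frac{47t^2}{24}+\frac{49t^3}{4}+\frac{11839t^4}{120}+\frac{9283t^5}{10}+\frac{3260543t^6}{336}+\frac{18387797t^7}{168}+\frac{941448191t^8}{720}+\frac{490223647t^9}{30}+\frac{93171535189t^{10}}{440}+O(t^{11}),$$ and its radius of convergence is $t_0=\frac{4-3\sqrt[3]{2}}{4}$. In addition, $$f_n=\frac13\sqrt{\frac{2\sqrt[3]2-1}{\pi}}\;\frac{\big(\frac{4}{4-3\sqrt[3]2}\big)^n}{n^{7/2}}\Big(1-\frac{243-8\sqrt[3]2}{72n}+\frac{91881-2640\sqrt[3]2-5696\sqrt[3]4}{10368n^2}+O\Big(\frac1{n^3}\Big)\Big).$$ (2) For the formal potential $\mathcal V(x)=\frac{x^2}2-\sum_{n\ge3}\frac{t^{n/2-1}x^n}{n}$, the planar limit $\mathcal F_0(t)=\sum_{n\ge1}f_nt^n$ has the Taylor expansion $$\mathcal F_0(t)=\frac{7t}{6}+\frac{109t^2}{8}+\frac{15631t^3}{60}+\frac{256629t^4}{40}+\frac{38720767t^5}{210}+\frac{658811733t^6}{112}+O(t^7).$$ Its radius of convergence is $t_0$, the only positive root of $$-11-128t+41088t^2-20480t^3+4096t^4=0.$$ The coefficients $f_n$ have the asymptotic expansion $$f_n\sim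 c\,\frac{(1/t_0)^n}{n^{7/2}}\Big(1+\frac{d_1}{n}+\frac{d_2}{n^2}+O\Big(\frac1{n^3}\Big)\Big)$$ with $$c=\sqrt{\frac{34133-914556t_0+449856t_0^2-89344t_0^3}{176868\,\pi}},$$ $$d_1=-\frac{36145645+79913928t_0-39094848t_0^2+7808512t_0^3}{11319552},$$ $$d_2=\frac{7806311269+20984001752t_0-10129539392t_0^2+2006727168t_0^3}{1026306048}.$$ Numerically, $t_0=0.0180827901833\ldots$, $1/t_0=55.3012001942\ldots$, $c=0.1786898225\ldots$, $d_1=-3.3197404318\ldots$, $d_2=7.9727292073\ldots$.
   Context: For a formal potential $\frac{x^2}2-\sum_{n\ge1}\frac{a_n}{n}x^n$ with indeterminate $a_n$, let $\mathcal A=\mathbb Q[[a_1,a_2,\dots]]$. With $\mathcal H_N$ the $N\times N$ Hermitian matrices, put $$\mathcal Z=\frac{\int_{\mathcal H_N}\exp\!\big(-N\,\mathrm{Tr}(M^2/2)+N\sum_{n\ge1}\frac{a_n}{n}\mathrm{Tr}(M^n)\big)dM}{\int_{\mathcal H_N}\exp(-N\,\mathrm{Tr}(M^2/2))dM},$$ expanded in powers of the $a_n$ and integrated coefficient by coefficient against the normalized Gaussian; $\log\mathcal Z=\sum_{g\ge0}N^{2-2g}\mathcal F_g$ with $\mathcal F_g\in\mathcal A$, and $\mathcal F_0$ is the formal planar limit. For a specific potential whose coefficients $a_n$ depend on $t$, the planar limit $\mathcal F_0(t)\in\mathbb Q[[t]]$ is obtained by substituting those coefficients: in (1), $a_{2n}=t^{n-1}$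 for $n\ge2$ and all other $a_n=0$; in (2), $a_n=t^{n/2-1}$ for $n\ge3$ and $a_1=a_2=0$. *)

theory Defs
  imports
    "HOL-Analysis.Analysis"
    "HOL-Library.Multiset"
    "HOL-Library.Groups_Big_Fun"
    "HOL-Library.Landau_Symbols"
    "Jordan_Normal_Form.Matrix"
begin

section \<open>Power series in infinitely many indeterminates\<close>

text \<open>
  A formal power series in indeterminates \<open>a\<^sub>0, a\<^sub>1, a\<^sub>2, \<dots>\<close> is given by its coefficient
  function; the monomial \<open>\<Prod>\<^sub>n a\<^sub>n ^ m\<^sub>n\<close> is the multiset containing each \<open>n\<close> with
  multiplicity \<open>m\<^sub>n\<close>. The indeterminate \<open>a\<^sub>0\<close> never occurs in the series below.
\<close>

type_synonym 'a mps = "nat multiset \<Rightarrow> 'a"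

definition mps_one :: "'a::zero_neq_one mps" where
  "mps_one m = (if m = {#} then 1 else 0)"

definition mps_minus :: "'a::ab_group_add mps \<Rightarrow> 'a mps \<Rightarrow> 'a mps" where
  "mps_minus F G m = F m - G m"

definition mps_times :: "'a::comm_ring_1 mps \<Rightarrow> 'a mps \<Rightarrow> 'a mps" where
  "mps_times F G m = (\<Sum>p\<in>{p. p \<subseteq># m}. F p * G (m - p))"

primrec mps_power :: "'a::comm_ring_1 mps \<Rightarrow> nat \<Rightarrow> 'a mps" where
  "mps_power F 0 = mps_one"
| "mps_power F (Suc k) = mps_times F (mps_power F k)"

text \<open>
  \<open>log F = \<Sum>\<^sub>k\<^sub>\<ge>\<^sub>1 (-1)^(k+1) (F - 1)^k / k\<close>, for \<open>F\<close> with constant coefficient \<open>1\<close>. Since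
  \<open>(F - 1)^k\<close> then has no terms of total degree below \<open>k\<close>, only \<open>k \<le> size m\<close> contribute to the
  coefficient of \<open>m\<close>.
\<close>

definition mps_log :: "'a::field_char_0 mps \<Rightarrow> 'a mps" where
  "mps_log F m =
    (\<Sum>k=1..size m. (-1) ^ (k + 1) / of_nat k * mps_power (mps_minus F mps_one) k m)"

text \<open>
  Substitution of \<open>a n\<close> for \<open>a\<^sub>n\<close>. It is meaningful when every power of the new variable receives
  only finitely many nonzero contributions, as is the case when each \<open>a n\<close> with \<open>n \<ge> 1\<close> is
  \<open>0\<close> or a positive power of the variable and every such power occurs finitely often.
\<close>

definition mps_subst :: "'a::comm_ring_1 mps \<Rightarrow> (nat \<Rightarrow> 'a fps) \<Rightarrow> 'a fps" where
  "mps_subst F a = Abs_fps (\<lambda>k. Sum_any (\<lambda>m. F m * fps_nth (\<Prod>n\<in>#m. a n) k))"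


section \<open>The Hermitian matrix integral\<close>

definition mat_trace :: "'a::comm_monoid_add mat \<Rightarrow> 'a" where
  "mat_trace A = (\<Sum>i<dim_row A. A $$ (i, i))"

definition hermitian_mats :: "nat \<Rightarrow> complex mat set" where
  "hermitian_mats N =
    {A \<in> carrier_mat N N. \<forall>i<N. \<forall>j<N. A $$ (j, i) = cnj (A $$ (i, j))}"

text \<open>
  Real coordinates on the Hermitian matrices: \<open>x (i, i)\<close> is the \<open>i\<close>-th diagonal entry and, for
  \<open>i < j\<close>, \<open>x (i, j)\<close> and \<open>x (j, i)\<close> are the real and imaginary parts of the entry at \<open>(i, j)\<close>.
  The measure \<open>dM\<close> is Lebesgue measure in these coordinates; a constant factor in \<open>dM\<close> has no
  effect on the normalized expectation.
\<close>

definition hermitian_of :: "nat \<Rightarrow> (nat \<times> nat \<Rightarrow> real) \<Rightarrow> complex mat" where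
  "hermitian_of N x = mat N N (\<lambda>(i, j).
     if i = j then complex_of_real (x (i, i))
     else if i < j then Complex (x (i, j)) (x (j, i))
     else Complex (x (j, i)) (- x (i, j)))"

lemma bij_betw_hermitian_of:
  "bij_betw (hermitian_of N) (extensional ({..<N} \<times> {..<N})) (hermitian_mats N)"
proof (rule bij_betw_byWitness[where f' = "\<lambda>A. \<lambda>(i, j)\<in>{..<N} \<times> {..<N}.
    if i \<le> j then Re (A $$ (i, j)) else Im (A $$ (j, i))"])
  show "hermitian_of N ` extensional ({..<N} \<times> {..<N}) \<subseteq> hermitian_mats N"
    by (auto simp: hermitian_of_def hermitian_mats_def complex_eq_iff)
  show "\<forall>A\<in>hermitian_mats N. hermitian_of N (\<lambda>(i, j)\<in>{..<N} \<times> {..<N}.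
      if i \<le> j then Re (A $$ (i, j)) else Im (A $$ (j, i))) = A"
  proof (intro ballI eq_matI)
    fix A :: "complex mat" and i j
    assume A: "A \<in> hermitian_mats N" and ij: "i < dim_row A" "j < dim_col A"
    then have ij: "i < N" "j < N" by (auto simp: hermitian_mats_def)
    with A have "A $$ (i, j) = cnj (A $$ (j, i))" "A $$ (i, i) = cnj (A $$ (i, i))"
      unfolding hermitian_mats_def by blast+
    then have "Im (A $$ (i, i)) = 0" "A $$ (i, j) = Complex (Re (A $$ (j, i))) (- Im (A $$ (j, i)))"
      unfolding complex_eq_iff by simp_all
    then show "hermitian_of N (\<lambda>(i, j)\<in>{..<N} \<times> {..<N}.
        if i \<le> j then Re (A $$ (i, j)) else Im (A $$ (j, i))) $$ (i, j) = A $$ (i, j)"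
      using ij
      by (cases i j rule: linorder_cases)
         (auto simp: hermitian_of_def complex_of_real_def)
  qed (auto simp: hermitian_of_def hermitian_mats_def)
qed (auto simp: hermitian_of_def extensional_def fun_eq_iff)

definition hermitian_lborel :: "nat \<Rightarrow> (nat \<times> nat \<Rightarrow> real) measure" where
  "hermitian_lborel N = (\<Pi>\<^sub>M p\<in>{..<N} \<times> {..<N}. lborel)"

definition hermitian_integral :: "nat \<Rightarrow> (complex mat \<Rightarrow> complex) \<Rightarrow> complex" where
  "hermitian_integral N f = (LINT x|hermitian_lborel N. f (hermitian_of N x))"

definition gaussian_weight :: "nat \<Rightarrow> complex mat \<Rightarrow> complex" where
  "gaussian_weight N M = exp (- of_nat N * (mat_trace (M ^\<^sub>m 2) / 2))"

definition gaussian_expectation :: "nat \<Rightarrow> (complex mat \<Rightarrow> complex) \<Rightarrow> complex" where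
  "gaussian_expectation N f =
     hermitian_integral N (\<lambda>M. gaussian_weight N M * f M)
       / hermitian_integral N (gaussian_weight N)"

text \<open>
  The expansion of \<open>exp (N \<Sum>\<^sub>n\<^sub>\<ge>\<^sub>1 a\<^sub>n/n Tr(M^n)) = \<Prod>\<^sub>n\<^sub>\<ge>\<^sub>1 exp (a\<^sub>n (N Tr(M^n)/n))\<close> in powers of
  the \<open>a\<^sub>n\<close>.
\<close>

definition interaction :: "nat \<Rightarrow> complex mat \<Rightarrow> complex mps" where
  "interaction N M m =
     (if 0 \<in># m then 0
      else \<Prod>n\<in>set_mset m.
             (of_nat N * mat_trace (M ^\<^sub>m n) / of_nat n) ^ count m n / fact (count m n))"

definition partition_function :: "nat \<Rightarrow> complex mps" where
  "partition_function N m = gaussian_expectation N (\<lambda>M. interaction N M m)"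


section \<open>The genus expansion and the planar limit\<close>

text \<open>
  \<open>log Z = \<Sum>\<^sub>g\<^sub>\<ge>\<^sub>0 N^(2-2g) F\<^sub>g\<close>, coefficient by coefficient: each coefficient is a Laurent
  polynomial in \<open>N\<close>, so that its values at all \<open>N \<ge> 1\<close> determine every \<open>F\<^sub>g\<close>.
\<close>

definition is_genus_expansion :: "(nat \<Rightarrow> rat mps) \<Rightarrow> bool" where
  "is_genus_expansion F \<longleftrightarrow>
     (\<forall>m. finite {g. F g m \<noteq> 0} \<and>
       (\<forall>N\<ge>1. mps_log (partition_function N) m =
          (\<Sum>g\<in>{g. F g m \<noteq> 0}. of_nat N powi (2 - 2 * int g) * of_rat (F g m))))"

definition genus_free_energy :: "nat \<Rightarrow> rat mps" where
  "genus_free_energy = (THE F. is_genus_expansion F)"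

definition planar_limit :: "rat mps" where
  "planar_limit = genus_free_energy 0"


section \<open>The two potentials\<close>

definition coeffs_even :: "nat \<Rightarrow> rat fps" where
  "coeffs_even n = (if even n \<and> 4 \<le> n then fps_X ^ (n div 2 - 1) else 0)"

text \<open>The series variable is \<open>s = t^(1/2)\<close>, so that \<open>t^(n/2-1) = s^(n-2)\<close>.\<close>

definition coeffs_full :: "nat \<Rightarrow> rat fps" where
  "coeffs_full n = (if 3 \<le> n then fps_X ^ (n - 2) else 0)"

definition planar_even :: "rat fps" where
  "planar_even = mps_subst planar_limit coeffs_even"

definition planar_full_sqrt :: "rat fps" where
  "planar_full_sqrt = mps_subst planar_limit coeffs_full"

text \<open>
  The same planar limit as a series in \<open>t = s^2\<close>. That only even powers of \<open>s\<close> occur is not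
  built in here: it is the equation \<open>planar_full_sqrt = planar_full oo fps_X ^ 2\<close>.
\<close>

definition planar_full :: "rat fps" where
  "planar_full = Abs_fps (\<lambda>n. fps_nth planar_full_sqrt (2 * n))"

definition real_fps :: "rat fps \<Rightarrow> real fps" where
  "real_fps F = Abs_fps (\<lambda>n. of_rat (fps_nth F n))"

end

theory Submission
  imports
    Defs
    "HOL-Probability.Probability"
    "HOL-Complex_Analysis.Complex_Analysis"
    "HOL-Real_Asymp.Real_Asymp"
    "HOL-Computational_Algebra.Polynomial"
    "HOL-Computational_Algebra.Formal_Laurent_Series"
begin

text \<open>
  Gaussian integration by parts yields the loop equations for \<open>log Z\<close>. Induction along them shows that
  each coefficient of \<open>log Z / N\<^sup>2\<close> is a polynomial in \<open>1 / N\<^sup>2\<close>, and their constant terms form a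
  closed system for the planar limit. After the substitution \<open>a\<^sub>n = c\<^sub>n s\<^sup>n\<^sup>-\<^sup>2\<close>, with \<open>s\<^sup>2 = t\<close>, this system
  is a quadratic equation for the resolvent over the ring \<open>\<rat>((y))[[s]]\<close>; it has only one solution, which
  is given by the one-cut ansatz. Differentiating twice in \<open>s\<close> leads to
  \<open>n (n + 1) (n + 2) f\<^sub>n = [t\<^sup>n] t R'(t) / R(t)\<close>, where \<open>R = \<rho>(z)\<close> and \<open>t = z \<Psi>(z)\<close> for rational \<open>\<rho>\<close> and \<open>\<Psi>\<close>.

  By Lagrange inversion the right-hand side is \<open>[z\<^sup>n\<^sup>-\<^sup>1] (\<rho>'/\<rho>) \<Psi>\<^sup>-\<^sup>n\<close>. This gives the Taylor
  coefficients, and writes them as integrals over the circle through the critical point of \<open>z \<Psi>(z)\<close>.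
  With \<open>z \<Psi>(z) = t\<^sub>0 (1 - w\<^sup>2)\<close> and \<open>\<rho>'/\<rho> = (\<Sum>k<8. b\<^sub>k w\<^sup>k w') + w\<^sup>8 C\<close>, integration by parts reduces the
  terms with even \<open>k\<close> to a central binomial coefficient, those with odd \<open>k\<close> vanish, and the remainder is
  of lower order.
\<close>

section \<open>Ring homomorphisms on power series\<close>

text \<open>With infinitely many couplings, \<open>V'\<close> is an infinite series in positive
  powers of \<open>x\<close> and the resolvent one in negative powers, so their product makes no
  sense among plain Laurent series. In the variable \<open>y = s x\<close> it does:
  \<open>s V'(y/s)\<close> is free of \<open>s\<close>, and each power of \<open>s\<close> in
  \<open>s W(y/s)\<close> carries a polynomial in \<open>1/y\<close>. Uniqueness rests on the order
  \<open>s^0\<close> alone, where \<open>s V'(y/s)\<close> has \<open>y\<close>-order exactly 1 and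
  cannot lift a term of \<open>y\<close>-order at most -2 to a regular one. Both \<open>V'\<close>
  are geometric series up to terms of degree one, so the string equations involve the square root
  only at \<open>y = 1\<close> and \<open>y = -1\<close>, and \<open>z\<close> is the parameter that
  makes these values rational: the root is \<open>1 - z\<close> for the even potential and
  \<open>1 / (1 + z)\<close> for the full one. At the saddle point the local series of
  \<open>w\<close> contains an irrational square root. It cancels from the ratios of coefficients
  that enter the \<open>1/n\<close> and \<open>1/n^2\<close> terms; these ratios are rational in the
  saddle point and are certified through a linear differential equation, modulo the polynomial
  equation of the saddle point.\<close>

locale ring_map =
  fixes f :: "'a::comm_ring_1 \<Rightarrow> 'b::comm_ring_1"
  assumes map_add: "f (x + y) = f x + f y" and map_mult: "f (x * y) = f x * f y" and map_1: "f 1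
      = 1"
begin

lemma map_0: "f 0 = 0" using map_add[of 0 0] by simp

lemma map_minus: "f (- x) = - f x"
  using map_add[of x "- x"] by (simp add: map_0 eq_neg_iff_add_eq_0 add.commute)

lemma map_diff: "f (x - y) = f x - f y"
  using map_add[of x "- y"] by (simp add: map_minus)

lemma map_sum: "f (sum g A) = (\<Sum>x\<in>A. f (g x))"
  by (induction A rule: infinite_finite_induct) (auto simp: map_0 map_add)

lemma map_of_nat: "f (of_nat n) = of_nat n"
  by (induction n) (auto simp: map_0 map_add map_1)

end

text \<open>No homomorphism property is assumed here, since differentiation in \<open>y\<close>,
  coefficient extraction and truncation also act coefficientwise in this way.\<close>

definition fps_map :: "('a \<Rightarrow> 'b) \<Rightarrow> 'a fps \<Rightarrow> 'b fps" where
  "fps_map f F = Abs_fps (\<lambda>n. f (fps_nth F n))"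

lemma fps_map_nth [simp]: "fps_nth (fps_map f F) n = f (fps_nth F n)"
  by (simp add: fps_map_def)

context ring_map begin

lemma fps_map_add: "fps_map f (F + G) = fps_map f F + fps_map f G"
  by (rule fps_ext) (simp add: map_add)

lemma fps_map_diff: "fps_map f (F - G) = fps_map f F - fps_map f G"
  by (rule fps_ext) (simp add: map_diff)

lemma fps_map_uminus: "fps_map f (- F) = - fps_map f F"
  by (rule fps_ext) (simp add: map_minus)

lemma fps_map_mult: "fps_map f (F * G) = fps_map f F * fps_map f G"
  by (rule fps_ext) (simp add: fps_mult_nth map_sum map_mult)

lemma fps_map_1: "fps_map f 1 = 1"
  by (rule fps_ext) (simp add: map_0 map_1)

lemma fps_map_0: "fps_map f 0 = 0"
  by (rule fps_ext) (simp add: map_0)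

lemma fps_map_X: "fps_map f fps_X = fps_X"
  by (rule fps_ext) (simp add: fps_X_def map_0 map_1)

lemma fps_map_const: "fps_map f (fps_const c) = fps_const (f c)"
  by (rule fps_ext) (simp add: map_0)

lemma fps_map_power: "fps_map f (F ^ n) = fps_map f F ^ n"
  by (induction n) (simp_all add: fps_map_1 fps_map_mult)

lemma fps_map_of_nat: "fps_map f (of_nat n) = of_nat n"
  by (induction n) (simp_all add: fps_map_0 fps_map_1 fps_map_add)

lemma fps_map_numeral: "fps_map f (numeral n) = numeral n"
  using fps_map_of_nat[of "numeral n"] by simp

lemma fps_map_deriv: "fps_map f (fps_deriv F) = fps_deriv (fps_map f F)"
  by (rule fps_ext) (simp add: map_mult map_add map_1 map_of_nat)

lemmas fps_map_simps = fps_map_add fps_map_diff fps_map_uminus fps_map_mult fps_map_0 fps_map_1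
  fps_map_X fps_map_const fps_map_power fps_map_numeral

end

section \<open>Gaussian integration by parts\<close>

lemma integrable_gauss_power:
  fixes \<kappa> :: real
  assumes "\<kappa> > 0"
  shows "integrable lborel (\<lambda>x. exp (- \<kappa> * x\<^sup>2 / 2) * x ^ e)"
proof -
  have "integrable lborel (\<lambda>x. sqrt (2 * pi * (1 / sqrt \<kappa>)\<^sup>2) * (normal_density 0 (1 / sqrt \<kappa>) x * (x
      - 0) ^ e))"
    by (intro integrable_mult_right integrable_normal_moment) (use assms in simp)
  then show ?thesis
    using assms by (simp add: normal_density_def power_divide field_simps)
qed

lemma gauss_moment_eq:
  fixes \<kappa> :: real
  assumes "\<kappa> > 0"
  shows "(LINT x|lborel. exp (- \<kappa> * x\<^sup>2 / 2) * x ^ e)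
    = sqrt (2 * pi / \<kappa>) * (LINT x|lborel. normal_density 0 (1 / sqrt \<kappa>) x * (x - 0) ^ e)"
  using assms by (simp add: normal_density_def power_divide field_simps flip:
      integral_mult_right_zero)

lemma gauss_moment_0_pos:
  fixes \<kappa> :: real
  assumes "\<kappa> > 0"
  shows "(LINT x|lborel. exp (- \<kappa> * x\<^sup>2 / 2)) > 0"
proof -
  have s: "1 / sqrt \<kappa> > 0" using assms by simp
  show ?thesis
    using gauss_moment_eq[OF assms, of 0] integral_normal_moment_even[OF s, of 0 0] assms by simp
qed

text \<open>Integration by parts in one variable, read off from the closed forms of the even and odd
  normal moments. For \<open>e = 0\<close> the truncated exponent \<open>e - 1\<close> is harmless
  because of the factor \<open>e\<close>.\<close>

lemma gauss_moment_Suc: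
  fixes \<kappa> :: real
  assumes \<kappa>: "\<kappa> > 0"
  shows "(LINT x|lborel. exp (- \<kappa> * x\<^sup>2 / 2) * x ^ Suc e)
    = real e / \<kappa> * (LINT x|lborel. exp (- \<kappa> * x\<^sup>2 / 2) * x ^ (e - 1))"
proof -
  have s: "1 / sqrt \<kappa> > 0" using assms by simp
  show ?thesis
  proof (cases "even e")
    case True
    then obtain k where k: "e = 2 * k" by (auto elim: evenE)
    then have "(LINT x|lborel. exp (- \<kappa> * x\<^sup>2 / 2) * x ^ Suc e) = 0"
      using integral_normal_moment_odd[OF s, of 0 k] by (simp only: gauss_moment_eq[OF \<kappa>]) simp
    moreover have "real e / \<kappa> * (LINT x|lborel. exp (- \<kappa> * x\<^sup>2 / 2) * x ^ (e - 1)) = 0"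
    proof (cases k)
      case 0
      then show ?thesis using k by simp
    next
      case (Suc j)
      then have "e - 1 = 2 * j + 1" using k by simp
      then show ?thesis
        using integral_normal_moment_odd[OF s, of 0 j] by (simp only: gauss_moment_eq[OF \<kappa>])
    qed
    ultimately show ?thesis by simp
  next
    case False
    then obtain k where k: "e = 2 * k + 1" by (auto elim: oddE)
    then have e: "Suc e = 2 * Suc k" "e - 1 = 2 * k" by simp_all
    have f: "fact (2 * Suc k) = (2 * real (Suc k)) * (real e * fact (2 * k))"
      by (simp add: k algebra_simps)
    have "fact (2 * Suc k) / ((2 / (1 / sqrt \<kappa>)\<^sup>2) ^ Suc k * fact (Suc k)) =
      real e / \<kappa> * (fact (2 * k) / ((2 / (1 / sqrt \<kappa>)\<^sup>2) ^ k * fact k))"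
      unfolding f fact_Suc power_Suc using \<kappa> by (simp add: power_divide del: of_nat_Suc)
    then show ?thesis
      unfolding gauss_moment_eq[OF \<kappa>] e integral_normal_moment_even[OF s] by simp
  qed
qed

text \<open>A polynomial is generated together with its formal partial derivatives, so that
  induction reduces integration by parts to monomials, whose Gaussian integrals split into
  one-dimensional moments. In \<open>monom\<close> the exponent \<open>e q - 1\<close> is truncated
  only where the factor \<open>of_nat (e p)\<close> vanishes.\<close>

inductive polyd :: "'i set \<Rightarrow> (('i \<Rightarrow> real) \<Rightarrow> complex) \<Rightarrow> ('i \<Rightarrow> ('i \<Rightarrow> real) \<Rightarrow> complex) \<Rightarrow> bool"
  for I where
  monom: "polyd I (\<lambda>x. c * (\<Prod>q\<in>I. complex_of_real (x q) ^ e q))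
    (\<lambda>p x. c * of_nat (e p) * (\<Prod>q\<in>I. complex_of_real (x q) ^ (if q = p then e q - 1 else e q)))"
| add: "polyd I f f' \<Longrightarrow> polyd I g g' \<Longrightarrow> polyd I (\<lambda>x. f x + g x) (\<lambda>p x. f' p x + g' p x)"

text \<open>The derivative is only meaningful on the coordinates in \<open>I\<close>.\<close>

definition has_pderivs :: "'i set \<Rightarrow> (('i \<Rightarrow> real) \<Rightarrow> complex) \<Rightarrow> ('i \<Rightarrow> ('i \<Rightarrow> real) \<Rightarrow> complex) \<Rightarrow> bool"
  where "has_pderivs I f f' \<longleftrightarrow> (\<exists>f''. polyd I f f'' \<and> (\<forall>p\<in>I. f'' p = f' p))"

lemma has_pderivs_cong:
  assumes "has_pderivs I f f'" "\<And>p x. p \<in> I \<Longrightarrow> g' p x = f' p x"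
  shows "has_pderivs I f g'"
proof -
  have "\<forall>p\<in>I. f' p = g' p" using assms(2) by auto
  with assms(1) show ?thesis unfolding has_pderivs_def by auto
qed

lemma has_pderivs_const: "has_pderivs I (\<lambda>_. c) (\<lambda>_ _. 0)"
  unfolding has_pderivs_def using polyd.monom[of I c "\<lambda>_. 0"] by auto

lemma has_pderivs_coord:
  assumes "finite I" "a \<in> I"
  shows "has_pderivs I (\<lambda>x. complex_of_real (x a)) (\<lambda>p _. if p = a then 1 else 0)"
proof -
  have 1: "(\<lambda>x::'a\<Rightarrow>real. 1 * (\<Prod>q\<in>I. complex_of_real (x q) ^ (if q = a then 1 else 0)))
      = (\<lambda>x. complex_of_real (x a))"
    using assms by (intro ext) (simp add: if_distrib[of "\<lambda>e. _ ^ e"] prod.delta cong: if_cong)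
  have 2: "(\<Prod>q\<in>I. complex_of_real (x q) ^ (if q = p then (if q = a then 1 else 0) - 1 else
      if q = a then 1 else 0)) = 1"
    if "p = a" for p and x :: "'a \<Rightarrow> real"
    using that by (intro prod.neutral) auto
  show ?thesis unfolding has_pderivs_def
  proof (intro exI conjI ballI)
    show "polyd I (\<lambda>x. complex_of_real (x a)) (\<lambda>p x. 1 * of_nat (if p
        = a then 1 else 0) * (\<Prod>q\<in>I. complex_of_real (x q) ^ (if q = p then (if q
        = a then 1 else 0) - 1 else if q = a then 1 else 0)))"
      using polyd.monom[of I 1 "\<lambda>q. if q = a then 1 else 0"] unfolding 1 .
  qed (auto simp: fun_eq_iff 2)
qed

lemma has_pderivs_add:
  assumes "has_pderivs I f f'" "has_pderivs I g g'"
  shows "has_pderivs I (\<lambda>x. f x + g x) (\<lambda>p x. f' p x + g' p x)"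
proof -
  from assms obtain f'' g'' where "polyd I f f''" "polyd I g g''" "\<forall>p\<in>I. f'' p = f' p" "\<forall>p\<in>I. g'' p
      = g' p"
    unfolding has_pderivs_def by auto
  then show ?thesis unfolding has_pderivs_def using polyd.add by fastforce
qed

lemma has_pderivs_monom_mult:
  assumes "finite I"
  shows "polyd I g g' \<Longrightarrow> has_pderivs I (\<lambda>x. (c * (\<Prod>q\<in>I. complex_of_real (x q) ^ e q)) * g x)
    (\<lambda>p x. c * of_nat (e p) * (\<Prod>q\<in>I. complex_of_real (x q) ^ (if q
        = p then e q - 1 else e q)) * g x +
      c * (\<Prod>q\<in>I. complex_of_real (x q) ^ e q) * g' p x)"
proof (induction rule: polyd.induct)
  case (monom d f)
  have 1: "(\<lambda>x::'a\<Rightarrow>real. (c * d) * (\<Prod>q\<in>I. complex_of_real (x q) ^ (e q + f q))) =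
      (\<lambda>x. (c * (\<Prod>q\<in>I. complex_of_real (x q) ^ e q)) * (d * (\<Prod>q\<in>I. complex_of_real (x q) ^ f q)))"
    by (simp add: power_add prod.distrib fun_eq_iff)
  have 2: "of_nat a * (\<Prod>q\<in>I. complex_of_real (x q) ^ (if q = p then e q + f q - 1 else e q + f q)) =
     of_nat a * ((\<Prod>q\<in>I. complex_of_real (x q) ^ (if q
         = p then e q - 1 else e q)) * (\<Prod>q\<in>I. complex_of_real (x q) ^ f q))"
    if "p \<in> I" "a = e p" for p and x :: "'a \<Rightarrow> real" and a
  proof (cases "e p = 0")
    case False
    then show ?thesis unfolding prod.distrib[symmetric]
      by (intro arg_cong2[of _ _ _ _ "(*)"] refl prod.cong) (auto simp: power_add[symmetric])
  qed (use that in simp)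
  have 3: "of_nat a * (\<Prod>q\<in>I. complex_of_real (x q) ^ (if q = p then e q + f q - 1 else e q + f q)) =
     of_nat a * ((\<Prod>q\<in>I. complex_of_real (x q) ^ e q) * (\<Prod>q\<in>I. complex_of_real (x q) ^ (if q
         = p then f q - 1 else f q)))"
    if "p \<in> I" "a = f p" for p and x :: "'a \<Rightarrow> real" and a
  proof (cases "f p = 0")
    case False
    then show ?thesis unfolding prod.distrib[symmetric]
      by (intro arg_cong2[of _ _ _ _ "(*)"] refl prod.cong) (auto simp: power_add[symmetric])
  qed (use that in simp)
  show ?case unfolding has_pderivs_def
  proof (intro exI conjI ballI ext)
    show "polyd I (\<lambda>x. c * (\<Prod>q\<in>I. complex_of_real (x q) ^ e q) * (d
        * (\<Prod>q\<in>I. complex_of_real (x q) ^ f q)))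
      (\<lambda>p x. (c * d) * of_nat (e p + f p) * (\<Prod>q\<in>I. complex_of_real (x q) ^ (if q
          = p then e q + f q - 1 else e q + f q)))"
      using polyd.monom[of I "c * d" "\<lambda>q. e q + f q"] unfolding 1 .
    fix p x assume p: "p \<in> I"
    show "c * d * of_nat (e p + f p) * (\<Prod>q\<in>I. complex_of_real (x q) ^ (if q
        = p then e q + f q - 1 else e q + f q)) =
       c * of_nat (e p) * (\<Prod>q\<in>I. complex_of_real (x q) ^ (if q = p then e q - 1 else e q)) *
         (d * (\<Prod>q\<in>I. complex_of_real (x q) ^ f q)) +
       c * (\<Prod>q\<in>I. complex_of_real (x q) ^ e q) *
         (d * of_nat (f p) * (\<Prod>q\<in>I. complex_of_real (x q) ^ (if q
             = p then f q - 1 else f q)))" (is "?l = ?r")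
    proof -
      let ?P = "\<Prod>q\<in>I. complex_of_real (x q) ^ (if q = p then e q + f q - 1 else e q + f q)"
      have "?l = c * d * (of_nat (e p) * ?P) + c * d * (of_nat (f p) * ?P)"
          by (simp add: algebra_simps)
      also have "\<dots> = ?r" unfolding 2[OF p refl] 3[OF p refl] by (simp add: algebra_simps)
      finally show ?thesis .
    qed
  qed
next
  case (add g1 g1' g2 g2')
  from has_pderivs_add[OF add.IH] show ?case
    by (simp add: algebra_simps)
qed

lemma has_pderivs_mult:
  assumes "finite I" "has_pderivs I f f'" "has_pderivs I g g'"
  shows "has_pderivs I (\<lambda>x. f x * g x) (\<lambda>p x. f' p x * g x + f x * g' p x)"
proof -
  obtain f'' g'' where *: "polyd I f f''" "polyd I g g''" "\<forall>p\<in>I. f'' p = f' p" "\<forall>p\<in>I. g'' p = g' p"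
    using assms unfolding has_pderivs_def by auto
  from *(1) have "has_pderivs I (\<lambda>x. f x * g x) (\<lambda>p x. f'' p x * g x + f x * g'' p x)"
  proof (induction rule: polyd.induct)
    case (monom c e)
    show ?case using has_pderivs_monom_mult[OF assms(1) *(2), of c e] .
  next
    case (add f1 f1' f2 f2')
    from has_pderivs_add[OF add.IH] show ?case by (simp add: algebra_simps)
  qed
  then show ?thesis by (rule has_pderivs_cong) (use * in auto)
qed

theorem gauss_integration_by_parts:
  fixes \<kappa> :: "'i \<Rightarrow> real" and w :: "('i \<Rightarrow> real) \<Rightarrow> complex"
  assumes I: "finite I" and \<kappa>: "\<And>p. p \<in> I \<Longrightarrow> \<kappa> p > 0" and f: "has_pderivs I f f'"
  defines "w \<equiv> \<lambda>x. complex_of_real (\<Prod>q\<in>I. exp (- \<kappa> q * (x q)\<^sup>2 / 2))"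
  defines "M \<equiv> (\<Pi>\<^sub>M p\<in>I. lborel)"
  shows "integrable M (\<lambda>x. w x * f x)"
    and "p \<in> I \<Longrightarrow> (LINT x|M. w x * (of_real (x p) * f x)) = 1 / \<kappa> p * (LINT x|M. w x * f' p x)"
    and "p \<in> I \<Longrightarrow> integrable M (\<lambda>x. w x * f' p x)"
proof -
  interpret product_sigma_finite "\<lambda>_. lborel" by standard
  let ?g = "\<lambda>p x. exp (- \<kappa> p * x\<^sup>2 / 2)"
  have int: "integrable M (\<lambda>x. w x * (c * (\<Prod>q\<in>I. of_real (x q) ^ e q)))"
   and val: "(LINT x|M. w x * (c * (\<Prod>q\<in>I. of_real (x q) ^ e q)))
       = c * of_real (\<Prod>q\<in>I. LINT t|lborel. ?g q t * t ^ e q)" for c e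
  proof -
    have eq: "w x * (c * (\<Prod>q\<in>I. of_real (x q) ^ e q))
        = c * complex_of_real (\<Prod>q\<in>I. ?g q (x q) * x q ^ e q)" for x
      by (simp add: w_def prod.distrib)
    have i: "integrable M (\<lambda>x. \<Prod>q\<in>I. ?g q (x q) * x q ^ e q)"
      unfolding M_def by (intro product_integrable_prod I integrable_gauss_power \<kappa>)
    have v: "(LINT x|M. (\<Prod>q\<in>I. ?g q (x q) * x q ^ e q)) = (\<Prod>q\<in>I. LINT t|lborel. ?g q t * t ^ e q)"
      unfolding M_def by (intro product_integral_prod I integrable_gauss_power \<kappa>)
    show "integrable M (\<lambda>x. w x * (c * (\<Prod>q\<in>I. of_real (x q) ^ e q)))"
      unfolding eq by (intro integrable_mult_right integrable_of_real i)
    show "(LINT x|M. w x * (c * (\<Prod>q\<in>I. of_real (x q) ^ e q)))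
        = c * of_real (\<Prod>q\<in>I. LINT t|lborel. ?g q t * t ^ e q)"
      unfolding eq v[symmetric] by (simp only: integral_mult_right_zero integral_complex_of_real)
  qed
  obtain f'' where f'': "polyd I f f''" "\<forall>p\<in>I. f'' p = f' p" using f unfolding has_pderivs_def
      by auto
  \<comment> \<open>The induction carries the integrability of every integrand along, because the
    case of a sum splits all the integrals.\<close>
  have "integrable M (\<lambda>x. w x * f x) \<and> (\<forall>p\<in>I. integrable M (\<lambda>x. w x * (of_real (x p) * f x))
      \<and> integrable M (\<lambda>x. w x * f'' p x)
     \<and> (LINT x|M. w x * (of_real (x p) * f x)) = 1 / \<kappa> p * (LINT x|M. w x * f'' p x))"
    using f''(1)
  proof (induction rule: polyd.induct)
    case (monom c e)
    show ?case
    proof (intro conjI ballI)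
      show "integrable M (\<lambda>x. w x * (c * (\<Prod>q\<in>I. complex_of_real (x q) ^ e q)))" by (rule int)
      fix p assume p: "p \<in> I"
      have e1: "w x * (complex_of_real (x p) * (c * (\<Prod>q\<in>I. complex_of_real (x q) ^ e q))) =
        w x * (c * (\<Prod>q\<in>I. complex_of_real (x q) ^ (if q = p then Suc (e q) else e q)))" for x
        using I p by (simp add: prod.remove[of I p] cong: prod.cong_simp)
      have m1: "(\<Prod>q\<in>I. LINT t|lborel. ?g q t * t ^ (if q = p then Suc (e q) else e q)) =
        real (e p) / \<kappa> p * (\<Prod>q\<in>I. LINT t|lborel. ?g q t * t ^ (if q = p then e q - 1 else e q))"
        using I p \<kappa>[OF p] gauss_moment_Suc[of "\<kappa> p" "e p"]
            by (simp add: prod.remove[of I p] cong: prod.cong_simp)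
      show "integrable M (\<lambda>x. w x * (complex_of_real (x p) * (c
          * (\<Prod>q\<in>I. complex_of_real (x q) ^ e q))))"
        unfolding e1 by (rule int)
      show "integrable M (\<lambda>x. w x * (c * of_nat (e p) * (\<Prod>q\<in>I. complex_of_real (x q) ^ (if q
          = p then e q - 1 else e q))))"
        by (rule int)
      show "(LINT x|M. w x * (complex_of_real (x p) * (c * (\<Prod>q\<in>I. complex_of_real (x q) ^ e q)))) =
        1 / \<kappa> p * (LINT x|M. w x * (c * of_nat (e p) * (\<Prod>q\<in>I. complex_of_real (x q) ^ (if q
            = p then e q - 1 else e q))))"
        unfolding e1 val m1 by simp
    qed
  next
    case (add f f' g g')
    then show ?case by (simp add: distrib_left)
  qed
  then show "integrable M (\<lambda>x. w x * f x)"
    and "p \<in> I \<Longrightarrow> (LINT x|M. w x * (of_real (x p) * f x)) = 1 / \<kappa> p * (LINT x|M. w x * f' p x)"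
    and "p \<in> I \<Longrightarrow> integrable M (\<lambda>x. w x * f' p x)"
    using f''(2) by auto
qed

lemma gauss_integral_nonzero:
  fixes \<kappa> :: "'i \<Rightarrow> real"
  assumes I: "finite I" and \<kappa>: "\<And>p. p \<in> I \<Longrightarrow> \<kappa> p > 0"
  shows "(LINT x|(\<Pi>\<^sub>M p\<in>I. lborel). complex_of_real (\<Prod>q\<in>I. exp (- \<kappa> q * (x q)\<^sup>2 / 2))) \<noteq> 0"
proof -
  interpret product_sigma_finite "\<lambda>_. lborel" by standard
  have "(LINT x|(\<Pi>\<^sub>M p\<in>I. lborel). (\<Prod>q\<in>I. exp (- \<kappa> q * (x q)\<^sup>2 / 2))) =
      (\<Prod>q\<in>I. LINT t|lborel. exp (- \<kappa> q * t\<^sup>2 / 2))"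
    using integrable_gauss_power[of _ 0] \<kappa> by (intro product_integral_prod I) simp
  also have "\<dots> > 0" by (intro prod_pos gauss_moment_0_pos \<kappa>)
  finally show ?thesis by (simp only: integral_complex_of_real) simp
qed

section \<open>Hermitian matrices in real coordinates\<close>

definition coords :: "nat \<Rightarrow> (nat \<times> nat) set" where
  "coords N = {..<N} \<times> {..<N}"

text \<open>Each off-diagonal coordinate enters the trace of the square twice, once for each of the
  two conjugate entries.\<close>

definition precision :: "nat \<Rightarrow> nat \<times> nat \<Rightarrow> real" where
  "precision N p = (if fst p = snd p then real N else 2 * real N)"

lemma hermitian_of_carrier [simp]: "hermitian_of N x \<in> carrier_mat N N"
  by (simp add: hermitian_of_def)

lemma hermitian_of_dim [simp]: "dim_row (hermitian_of N x) = N" "dim_col (hermitian_of N x) = N"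
  by (simp_all add: hermitian_of_def)

lemma trace_mult:
  assumes "A \<in> carrier_mat N N" "B \<in> carrier_mat N N"
  shows "mat_trace (A * B) = (\<Sum>i<N. \<Sum>j<N. A $$ (i, j) * B $$ (j, i))"
  using assms by (auto simp: mat_trace_def scalar_prod_def atLeast0LessThan intro!: sum.cong)

lemma gaussian_weight_hermitian_of:
  "gaussian_weight N (hermitian_of N x) =
    complex_of_real (\<Prod>q\<in>coords N. exp (- precision N q * (x q)\<^sup>2 / 2))"
proof -
  have "mat_trace (hermitian_of N x ^\<^sub>m 2)
      = (\<Sum>i<N. \<Sum>j<N. hermitian_of N x $$ (i, j) * hermitian_of N x $$ (j, i))"
    by (subst trace_mult[symmetric]) (auto simp: numeral_2_eq_2)
  also have "\<dots> = (\<Sum>i<N. \<Sum>j<N. complex_of_real (if i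
      = j then (x (i, i))\<^sup>2 else (x (i, j))\<^sup>2 + (x (j, i))\<^sup>2))"
    by (intro sum.cong refl) (auto simp: hermitian_of_def complex_eq_iff power2_eq_square)
  also have "\<dots> = complex_of_real (\<Sum>i<N. \<Sum>j<N.
      if i = j then (x (i, i))\<^sup>2 else (x (i, j))\<^sup>2 + (x (j, i))\<^sup>2)"
    by simp
  \<comment> \<open>Diagonal squares are split into two halves, which makes the double sum twice a
    sum over single coordinates.\<close>
  also have "(\<Sum>i<N. \<Sum>j<N. if i = j then (x (i, i))\<^sup>2 else (x (i, j))\<^sup>2 + (x (j, i))\<^sup>2) =
      (\<Sum>i<N. \<Sum>j<N. (if i = j then (x (i, j))\<^sup>2 / 2 else (x (i, j))\<^sup>2) + (if j
          = i then (x (j, i))\<^sup>2 / 2 else (x (j, i))\<^sup>2))"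
    by (intro sum.cong refl) auto
  also have "\<dots> = 2 * (\<Sum>i<N. \<Sum>j<N. if i = j then (x (i, j))\<^sup>2 / 2 else (x (i, j))\<^sup>2)"
    unfolding sum.distrib
    by (subst (2) sum.swap) simp
  finally have tr: "mat_trace (hermitian_of N x ^\<^sub>m 2) = complex_of_real (2 * (\<Sum>i<N. \<Sum>j<N.
      if i = j then (x (i, j))\<^sup>2 / 2 else (x (i, j))\<^sup>2))" .
  have "- real N * (\<Sum>i<N. \<Sum>j<N. if i = j then (x (i, j))\<^sup>2 / 2 else (x (i, j))\<^sup>2) =
     (\<Sum>q\<in>coords N. - precision N q * (x q)\<^sup>2 / 2)"
    unfolding coords_def sum.cartesian_product sum_distrib_left
    by (intro sum.cong refl) (auto simp: precision_def)
  then have "- of_nat N * (mat_trace (hermitian_of N x ^\<^sub>m 2) / 2)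
      = complex_of_real (\<Sum>q\<in>coords N. - precision N q * (x q)\<^sup>2 / 2)"
    unfolding tr by (metis (no_types, lifting) mult_minus_left nonzero_mult_div_cancel_left
        of_real_divide of_real_minus of_real_mult of_real_numeral of_real_of_nat_eq
        zero_neq_numeral)
  then show ?thesis
    unfolding gaussian_weight_def by (simp only: exp_of_real exp_sum of_real_prod) (simp add:
        coords_def exp_sum flip: exp_of_real)
qed

text \<open>\<open>D a b\<close> is the Wirtinger derivative of \<open>f\<close> with respect to the entry at \<open>(a, b)\<close>, the
  entries being treated as independent variables.\<close>

definition entry_deriv :: "nat \<Rightarrow> (complex mat \<Rightarrow> complex) \<Rightarrow> (nat \<Rightarrow> nat \<Rightarrow> complex mat \<Rightarrow> complex) \<Rightarrow>
    bool" where
  "entry_deriv N f D \<longleftrightarrow> (\<exists>f'. has_pderivs (coords N) (\<lambda>x. f (hermitian_of N x)) f' \<and>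
     (\<forall>i<N. \<forall>j<N. \<forall>x. D j i (hermitian_of N x) =
        (if i = j then f' (i, i) x
         else if i < j then (f' (i, j) x + \<i> * f' (j, i) x) / 2
         else (f' (j, i) x - \<i> * f' (i, j) x) / 2)))"

lemma finite_coords [simp]: "finite (coords N)"
  by (simp add: coords_def)

lemma entry_deriv_cong:
  assumes "entry_deriv N f D" "\<And>M. M \<in> carrier_mat N N \<Longrightarrow> g M = f M"
    "\<And>M a b. M \<in> carrier_mat N N \<Longrightarrow> a < N \<Longrightarrow> b < N \<Longrightarrow> D' a b M = D a b M"
  shows "entry_deriv N g D'"
  using assms unfolding entry_deriv_def by auto

lemma entry_deriv_const: "entry_deriv N (\<lambda>_. c) (\<lambda>_ _ _. 0)"
  unfolding entry_deriv_def using has_pderivs_const[of "coords N" c] by fastforce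

lemma entry_deriv_add:
  assumes "entry_deriv N f D" "entry_deriv N g E"
  shows "entry_deriv N (\<lambda>M. f M + g M) (\<lambda>a b M. D a b M + E a b M)"
proof -
  obtain f' g' where
    f: "has_pderivs (coords N) (\<lambda>x. f (hermitian_of N x)) f'"
      "\<forall>i<N. \<forall>j<N. \<forall>x. D j i (hermitian_of N x) = (if i = j then f' (i, i) x
         else if i < j then (f' (i, j) x + \<i> * f' (j, i) x) / 2 else (f' (j, i) x - \<i> * f' (i, j) x)
             / 2)" and
    g: "has_pderivs (coords N) (\<lambda>x. g (hermitian_of N x)) g'"
      "\<forall>i<N. \<forall>j<N. \<forall>x. E j i (hermitian_of N x) = (if i = j then g' (i, i) x
         else if i < j then (g' (i, j) x + \<i> * g' (j, i) x) / 2 else (g' (j, i) x - \<i> * g' (i, j) x)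
             / 2)"
    using assms unfolding entry_deriv_def by auto
  show ?thesis unfolding entry_deriv_def
    by (rule exI, rule conjI[OF has_pderivs_add[OF f(1) g(1)]])
       (simp add: f(2) g(2) field_simps)
qed

lemma entry_deriv_mult:
  assumes "entry_deriv N f D" "entry_deriv N g E"
  shows "entry_deriv N (\<lambda>M. f M * g M) (\<lambda>a b M. D a b M * g M + f M * E a b M)"
proof -
  obtain f' g' where
    f: "has_pderivs (coords N) (\<lambda>x. f (hermitian_of N x)) f'"
      "\<forall>i<N. \<forall>j<N. \<forall>x. D j i (hermitian_of N x) = (if i = j then f' (i, i) x
         else if i < j then (f' (i, j) x + \<i> * f' (j, i) x) / 2 else (f' (j, i) x - \<i> * f' (i, j) x)
             / 2)" and
    g: "has_pderivs (coords N) (\<lambda>x. g (hermitian_of N x)) g'"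
      "\<forall>i<N. \<forall>j<N. \<forall>x. E j i (hermitian_of N x) = (if i = j then g' (i, i) x
         else if i < j then (g' (i, j) x + \<i> * g' (j, i) x) / 2 else (g' (j, i) x - \<i> * g' (i, j) x)
             / 2)"
    using assms unfolding entry_deriv_def by auto
  show ?thesis unfolding entry_deriv_def
    by (rule exI, rule conjI[OF has_pderivs_mult[OF finite_coords f(1) g(1)]])
       (simp add: f(2) g(2) field_simps)
qed

lemma entry_deriv_cmult:
  assumes "entry_deriv N f D"
  shows "entry_deriv N (\<lambda>M. c * f M) (\<lambda>a b M. c * D a b M)"
  using entry_deriv_mult[OF entry_deriv_const[of N c] assms] by simp

lemma entry_deriv_sum:
  assumes "\<And>k. k \<in> A \<Longrightarrow> entry_deriv N (f k) (D k)"
  shows "entry_deriv N (\<lambda>M. \<Sum>k\<in>A. f k M) (\<lambda>a b M. \<Sum>k\<in>A. D k a b M)"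
  using assms
  by (induction A rule: infinite_finite_induct) (auto intro: entry_deriv_add entry_deriv_const)

lemma entry_deriv_entry:
  assumes "a < N" "b < N"
  shows "entry_deriv N (\<lambda>M. M $$ (a, b)) (\<lambda>i j M. if i = a \<and> j = b then 1 else 0)"
proof -
  note c = has_pderivs_coord[OF finite_coords[of N]]
  note m = has_pderivs_mult[OF finite_coords[of N] has_pderivs_const c]
  have ab: "(a, b) \<in> coords N" "(b, a) \<in> coords N" using assms by (auto simp: coords_def)
  consider "a = b" | "a < b" | "b < a" by linarith
  then show ?thesis
  proof cases
    case 1
    have *: "(\<lambda>x. hermitian_of N x $$ (a, b)) = (\<lambda>x. complex_of_real (x (a, b)))"
      using 1 assms by (auto simp: hermitian_of_def)
    show ?thesis unfolding entry_deriv_def *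
      by (rule exI, rule conjI[OF c[OF ab(1)]]) (use 1 in auto)
  next
    case 2
    have *: "(\<lambda>x. hermitian_of N x $$ (a, b))
        = (\<lambda>x. complex_of_real (x (a, b)) + \<i> * complex_of_real (x (b, a)))"
      using 2 assms by (auto simp: hermitian_of_def complex_eq_iff)
    show ?thesis unfolding entry_deriv_def *
      by (rule exI, rule conjI[OF has_pderivs_add[OF c[OF ab(1)] m[OF ab(2)]]]) (use 2 in auto)
  next
    case 3
    have *: "(\<lambda>x. hermitian_of N x $$ (a, b))
        = (\<lambda>x. complex_of_real (x (b, a)) + (-\<i>) * complex_of_real (x (a, b)))"
      using 3 assms by (auto simp: hermitian_of_def complex_eq_iff)
    show ?thesis unfolding entry_deriv_def *
      by (rule exI, rule conjI[OF has_pderivs_add[OF c[OF ab(2)] m[OF ab(1)]]]) (use 3 in auto)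
  qed
qed

context
  fixes N :: nat
  assumes N: "N \<ge> 1"
begin

lemma precision_pos: "precision N p > 0"
  using N by (simp add: precision_def)

lemma hermitian_integral_gaussian_nonzero: "hermitian_integral N (gaussian_weight N) \<noteq> 0"
  unfolding hermitian_integral_def gaussian_weight_hermitian_of hermitian_lborel_def
      coords_def[symmetric]
  by (rule gauss_integral_nonzero) (auto simp: precision_pos)

lemma gaussian_expectation_one: "gaussian_expectation N (\<lambda>_. 1) = 1"
  using hermitian_integral_gaussian_nonzero by (simp add: gaussian_expectation_def)

lemma integrable_gaussian:
  assumes "entry_deriv N f D"
  shows "integrable (hermitian_lborel N) (\<lambda>x. gaussian_weight N (hermitian_of N x)
      * f (hermitian_of N x))"
  using assms gauss_integration_by_parts(1)[of "coords N" "precision N"]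
  unfolding gaussian_weight_hermitian_of hermitian_lborel_def coords_def[symmetric] entry_deriv_def
  by (auto simp: precision_pos)

lemma gaussian_expectation_add:
  assumes "entry_deriv N f D" "entry_deriv N g E"
  shows "gaussian_expectation N (\<lambda>M. f M + g M)
      = gaussian_expectation N f + gaussian_expectation N g"
  unfolding gaussian_expectation_def hermitian_integral_def
  using integrable_gaussian[OF assms(1)] integrable_gaussian[OF assms(2)]
  by (simp add: distrib_left add_divide_distrib)

lemma gaussian_expectation_cmult:
  "gaussian_expectation N (\<lambda>M. c * f M) = c * gaussian_expectation N f"
  unfolding gaussian_expectation_def hermitian_integral_def
  by (simp add: mult.left_commute[of _ c])

lemma gaussian_expectation_sum:
  assumes "\<And>k. k \<in> A \<Longrightarrow> entry_deriv N (f k) (D k)"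
  shows "gaussian_expectation N (\<lambda>M. \<Sum>k\<in>A. f k M) = (\<Sum>k\<in>A. gaussian_expectation N (f k))"
  using assms
proof (induction A rule: infinite_finite_induct)
  case (insert k A)
  then show ?case
    using gaussian_expectation_add[OF _ entry_deriv_sum[of A N f D], of "f k" "D k"] by simp
qed (auto simp: gaussian_expectation_def hermitian_integral_def)

lemma gaussian_expectation_sum_ex:
  assumes "\<And>k. k \<in> A \<Longrightarrow> \<exists>D. entry_deriv N (f k) D"
  shows "gaussian_expectation N (\<lambda>M. \<Sum>k\<in>A. f k M) = (\<Sum>k\<in>A. gaussian_expectation N (f k))"
    and "\<exists>D. entry_deriv N (\<lambda>M. \<Sum>k\<in>A. f k M) D"
proof -
  from assms obtain D where "\<And>k. k \<in> A \<Longrightarrow> entry_deriv N (f k) (D k)" by metis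
  then show "gaussian_expectation N (\<lambda>M. \<Sum>k\<in>A. f k M) = (\<Sum>k\<in>A. gaussian_expectation N (f k))"
    "\<exists>D. entry_deriv N (\<lambda>M. \<Sum>k\<in>A. f k M) D"
    using gaussian_expectation_sum[of A f D] entry_deriv_sum[of A N f D] by auto
qed

lemma gaussian_expectation_sum2:
  assumes "\<And>i j. i \<in> A \<Longrightarrow> j \<in> B \<Longrightarrow> \<exists>D. entry_deriv N (f i j) D"
  shows "gaussian_expectation N (\<lambda>M. \<Sum>i\<in>A. \<Sum>j\<in>B. f i j M)
      = (\<Sum>i\<in>A. \<Sum>j\<in>B. gaussian_expectation N (f i j))"
  using gaussian_expectation_sum_ex[of B] assms
  by (subst gaussian_expectation_sum_ex) (auto intro!: sum.cong)

lemma gaussian_expectation_cong: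
  assumes "\<And>M. M \<in> carrier_mat N N \<Longrightarrow> f M = g M"
  shows "gaussian_expectation N f = gaussian_expectation N g"
  unfolding gaussian_expectation_def hermitian_integral_def using assms by simp

text \<open>The factor 1/2 of the Wirtinger derivative meets the doubled precision of the
  off-diagonal coordinates, so all entries get the same factor \<open>1 / N\<close>. The indices of
  \<open>D\<close> are swapped because the covariance pairs an entry with its conjugate, the
  transposed entry.\<close>

theorem gaussian_expectation_entry:
  assumes f: "entry_deriv N f D" and ij: "i < N" "j < N"
  shows "gaussian_expectation N (\<lambda>M. M $$ (i, j) * f M) = gaussian_expectation N (D j i) / of_nat N"
proof -
  obtain f' where f': "has_pderivs (coords N) (\<lambda>x. f (hermitian_of N x)) f'"
      "\<forall>i<N. \<forall>j<N. \<forall>x. D j i (hermitian_of N x) = (if i = j then f' (i, i) x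
         else if i < j then (f' (i, j) x + \<i> * f' (j, i) x) / 2 else (f' (j, i) x - \<i> * f' (i, j) x)
             / 2)"
    using f unfolding entry_deriv_def by auto
  let ?w = "\<lambda>x. complex_of_real (\<Prod>q\<in>coords N. exp (- precision N q * (x q)\<^sup>2 / 2))"
  let ?M = "\<Pi>\<^sub>M p\<in>coords N. (lborel :: real measure)"
  let ?f = "\<lambda>x. f (hermitian_of N x)"
  note ibp = gauss_integration_by_parts[of "coords N" "precision N",
      OF finite_coords precision_pos f'(1)]
  have c: "(a, b) \<in> coords N" if "a < N" "b < N" for a b using that by (auto simp: coords_def)
  have xint: "integrable ?M (\<lambda>x. ?w x * (of_real (x p) * ?f x))" if "p \<in> coords N" for p
    by (rule gauss_integration_by_parts(1)[OF finite_coords precision_pos])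
       (rule has_pderivs_mult[OF _ has_pderivs_coord f'(1)], use that in auto)
  have dint: "integrable ?M (\<lambda>x. ?w x * f' p x)" if "p \<in> coords N" for p
    using ibp(3) that by blast
  have "(LINT x|?M. ?w x * (hermitian_of N x $$ (i, j) * ?f x))
      = (LINT x|?M. ?w x * D j i (hermitian_of N x)) / of_nat N"
  proof (cases i j rule: linorder_cases)
    case less
    have "(LINT x|?M. ?w x * (hermitian_of N x $$ (i, j) * ?f x)) =
       (LINT x|?M. ?w x * (of_real (x (i, j)) * ?f x) + \<i> * (?w x * (of_real (x (j, i)) * ?f x)))"
      using less ij by (intro Bochner_Integration.integral_cong refl) (auto simp: hermitian_of_def
          Complex_eq algebra_simps)
    also have "\<dots> = (LINT x|?M. ?w x * f' (i, j) x) / (2 * N) + \<i> * ((LINT x|?M. ?w x * f' (j, i) x)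
        / (2 * N))"
      using less xint[OF c[OF ij]] xint[OF c[OF ij(2,1)]] ibp(2)[OF c[OF ij]] ibp(2)[OF c[OF
          ij(2,1)]]
      by (simp add: precision_def)
    also have "\<dots> = (LINT x|?M. (?w x * f' (i, j) x + \<i> * (?w x * f' (j, i) x)) / (2 * of_nat N))"
      using dint[OF c[OF ij]] dint[OF c[OF ij(2,1)]] by (simp add: add_divide_distrib)
    also have "\<dots> = (LINT x|?M. ?w x * D j i (hermitian_of N x) / of_nat N)"
      using less ij N by (intro Bochner_Integration.integral_cong refl) (simp add: f'(2)
          field_simps)
    finally show ?thesis by simp
  next
    case greater
    have "(LINT x|?M. ?w x * (hermitian_of N x $$ (i, j) * ?f x)) =
       (LINT x|?M. ?w x * (of_real (x (j, i)) * ?f x) - \<i> * (?w x * (of_real (x (i, j)) * ?f x)))"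
      using greater ij by (intro Bochner_Integration.integral_cong refl) (auto simp:
          hermitian_of_def Complex_eq algebra_simps)
    also have "\<dots> = (LINT x|?M. ?w x * f' (j, i) x) / (2 * N) - \<i> * ((LINT x|?M. ?w x * f' (i, j) x)
        / (2 * N))"
      using greater xint[OF c[OF ij]] xint[OF c[OF ij(2,1)]] ibp(2)[OF c[OF ij]] ibp(2)[OF c[OF
          ij(2,1)]]
      by (simp add: precision_def)
    also have "\<dots> = (LINT x|?M. (?w x * f' (j, i) x - \<i> * (?w x * f' (i, j) x)) / (2 * of_nat N))"
      using dint[OF c[OF ij]] dint[OF c[OF ij(2,1)]] by (simp add: diff_divide_distrib)
    also have "\<dots> = (LINT x|?M. ?w x * D j i (hermitian_of N x) / of_nat N)"
      using greater ij N by (intro Bochner_Integration.integral_cong refl) (simp add: f'(2)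
          field_simps)
    finally show ?thesis by simp
  next
    case equal
    have "(LINT x|?M. ?w x * (hermitian_of N x $$ (i, j) * ?f x))
        = (LINT x|?M. ?w x * (of_real (x (i, i)) * ?f x))"
      using equal ij by (intro Bochner_Integration.integral_cong refl) (auto simp: hermitian_of_def)
    then show ?thesis using equal ij ibp(2)[OF c[OF ij]] by (simp add: f'(2) precision_def)
  qed
  then show ?thesis
    unfolding gaussian_expectation_def hermitian_integral_def hermitian_lborel_def
        gaussian_weight_hermitian_of coords_def[symmetric]
    by simp
qed

end

section \<open>Derivatives of matrix powers and traces\<close>

lemma entry_deriv_pow:
  assumes "a < N" "b < N"
  shows "entry_deriv N (\<lambda>M. (M ^\<^sub>m k) $$ (a, b))
    (\<lambda>i j M. \<Sum>l<k. (M ^\<^sub>m l) $$ (a, i) * (M ^\<^sub>m (k - 1 - l)) $$ (j, b))"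
  using assms
proof (induction k arbitrary: a b)
  case 0
  have *: "(M ^\<^sub>m 0) $$ (a, b) = (if a = b then 1 else 0)"
      if "M \<in> carrier_mat N N" for M :: "complex mat"
    using that 0 by simp
  show ?case by (rule entry_deriv_cong[OF entry_deriv_const[of N "if a
      = b then 1 else 0"]]) (simp_all add: * del: pow_mat.simps)
next
  case (Suc k)
  have pc: "M ^\<^sub>m l \<in> carrier_mat N N" if "M \<in> carrier_mat N N" for M :: "complex mat" and l
    using that by simp
  have nth: "(M ^\<^sub>m Suc l) $$ (i, b) = (\<Sum>c<N. (M ^\<^sub>m l) $$ (i, c) * M $$ (c, b))"
    if "M \<in> carrier_mat N N" "i < N" for M :: "complex mat" and l i
    using that Suc.prems pc[OF that(1), of l] by (simp add: scalar_prod_def atLeast0LessThan)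
  show ?case
  proof (rule entry_deriv_cong[OF entry_deriv_sum])
    show "entry_deriv N (\<lambda>M. (M ^\<^sub>m k) $$ (a, c) * M $$ (c, b))
       (\<lambda>i j M. (\<Sum>l<k. (M ^\<^sub>m l) $$ (a, i) * (M ^\<^sub>m (k - 1 - l)) $$ (j, c)) * M $$ (c, b)
          + (M ^\<^sub>m k) $$ (a, c) * (if i = c \<and> j = b then 1 else 0))" if "c \<in> {..<N}" for c
      using that Suc by (intro entry_deriv_mult entry_deriv_entry Suc.IH) auto
  next
    fix M :: "complex mat" assume M: "M \<in> carrier_mat N N"
    show "(M ^\<^sub>m Suc k) $$ (a, b) = (\<Sum>c<N. (M ^\<^sub>m k) $$ (a, c) * M $$ (c, b))"
      using nth[OF M] Suc.prems by simp
    fix i j assume ij: "i < N" "j < N"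
    have "(\<Sum>c<N. (\<Sum>l<k. (M ^\<^sub>m l) $$ (a, i) * (M ^\<^sub>m (k - 1 - l)) $$ (j, c)) * M $$ (c, b)) =
        (\<Sum>l<k. (M ^\<^sub>m l) $$ (a, i) * (\<Sum>c<N. (M ^\<^sub>m (k - 1 - l)) $$ (j, c) * M $$ (c, b)))"
      unfolding sum_distrib_left sum_distrib_right by (subst sum.swap) (simp add: mult.assoc)
    also have "\<dots> = (\<Sum>l<k. (M ^\<^sub>m l) $$ (a, i) * (M ^\<^sub>m (Suc k - 1 - l)) $$ (j, b))"
    proof (intro sum.cong refl)
      fix l assume "l \<in> {..<k}"
      then have "Suc k - 1 - l = Suc (k - 1 - l)" by auto
      then show "(M ^\<^sub>m l) $$ (a, i) * (\<Sum>c<N. (M ^\<^sub>m (k - 1 - l)) $$ (j, c) * M $$ (c, b)) =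
          (M ^\<^sub>m l) $$ (a, i) * (M ^\<^sub>m (Suc k - 1 - l)) $$ (j, b)"
        using nth[OF M ij(2), of "k - 1 - l"] by metis
    qed
    finally have 1: "(\<Sum>c<N. (\<Sum>l<k. (M ^\<^sub>m l) $$ (a, i) * (M ^\<^sub>m (k - 1 - l)) $$ (j, c)) * M $$ (c, b))
        =
       (\<Sum>l<k. (M ^\<^sub>m l) $$ (a, i) * (M ^\<^sub>m (Suc k - 1 - l)) $$ (j, b))" .
    have "(\<Sum>c<N. (M ^\<^sub>m k) $$ (a, c) * (if i = c \<and> j = b then 1 else 0)) =
       (\<Sum>c<N. if c = i then (M ^\<^sub>m k) $$ (a, c) * (if j = b then 1 else 0) else 0)"
      by (intro sum.cong) auto
    also have "\<dots> = (M ^\<^sub>m k) $$ (a, i) * (M ^\<^sub>m (Suc k - 1 - k)) $$ (j, b)"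
      using ij M Suc.prems by simp
    finally show "(\<Sum>l<Suc k. (M ^\<^sub>m l) $$ (a, i) * (M ^\<^sub>m (Suc k - 1 - l)) $$ (j, b)) =
        (\<Sum>c<N. (\<Sum>l<k. (M ^\<^sub>m l) $$ (a, i) * (M ^\<^sub>m (k - 1 - l)) $$ (j, c)) * M $$ (c, b)
          + (M ^\<^sub>m k) $$ (a, c) * (if i = c \<and> j = b then 1 else 0))"
      unfolding sum.distrib 1 by simp
  qed
qed

lemma pow_mat_add:
  assumes "M \<in> carrier_mat N N"
  shows "M ^\<^sub>m (k + l) = M ^\<^sub>m k * (M ^\<^sub>m l :: complex mat)"
proof (induction l)
  case 0
  show ?case using assms by (simp add: pow_mat_dim)
next
  case (Suc l)
  have "M ^\<^sub>m k \<in> carrier_mat N N" "M ^\<^sub>m l \<in> carrier_mat N N" using assms by auto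
  with Suc assms show ?case by (simp add: assoc_mult_mat[of _ N N _ N _ N])
qed

lemma pow_mult_entry:
  assumes "(M :: complex mat) \<in> carrier_mat N N" "a < N" "b < N"
  shows "(\<Sum>c<N. (M ^\<^sub>m k) $$ (a, c) * (M ^\<^sub>m l) $$ (c, b)) = (M ^\<^sub>m (k + l)) $$ (a, b)"
proof -
  have "M ^\<^sub>m k \<in> carrier_mat N N" "M ^\<^sub>m l \<in> carrier_mat N N" using assms by auto
  then show ?thesis using assms
    by (auto simp: pow_mat_add[OF assms(1)] scalar_prod_def atLeast0LessThan)
qed

lemma trace_pow_mult:
  assumes "(M :: complex mat) \<in> carrier_mat N N"
  shows "(\<Sum>i<N. \<Sum>j<N. (M ^\<^sub>m k) $$ (i, j) * (M ^\<^sub>m l) $$ (j, i)) = mat_trace (M ^\<^sub>m (k + l))"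
proof -
  have "M ^\<^sub>m (k + l) \<in> carrier_mat N N" using assms by simp
  then show ?thesis using pow_mult_entry[OF assms] by (simp add: mat_trace_def del: pow_mat_dim)
qed

text \<open>Closing the product rule for \<open>M^k\<close> to a trace joins the two pieces of the
  word again, so all \<open>k\<close> summands are equal.\<close>

lemma entry_deriv_trace_pow:
  "entry_deriv N (\<lambda>M. mat_trace (M ^\<^sub>m k)) (\<lambda>i j M. of_nat k * (M ^\<^sub>m (k - 1)) $$ (j, i))"
proof (rule entry_deriv_cong[OF entry_deriv_sum])
  show "entry_deriv N (\<lambda>M. (M ^\<^sub>m k) $$ (a, a))
    (\<lambda>i j M. \<Sum>l<k. (M ^\<^sub>m l) $$ (a, i) * (M ^\<^sub>m (k - 1 - l)) $$ (j, a))" if "a \<in> {..<N}" for a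
    using that by (intro entry_deriv_pow) auto
next
  fix M :: "complex mat" assume M: "M \<in> carrier_mat N N"
  then have "M ^\<^sub>m k \<in> carrier_mat N N" by simp
  then show "mat_trace (M ^\<^sub>m k) = (\<Sum>a<N. (M ^\<^sub>m k) $$ (a, a))"
      by (simp add: mat_trace_def del: pow_mat_dim)
  fix i j assume ij: "i < N" "j < N"
  have "(\<Sum>a<N. \<Sum>l<k. (M ^\<^sub>m l) $$ (a, i) * (M ^\<^sub>m (k - 1 - l)) $$ (j, a)) =
     (\<Sum>l<k. \<Sum>a<N. (M ^\<^sub>m (k - 1 - l)) $$ (j, a) * (M ^\<^sub>m l) $$ (a, i))"
    by (subst sum.swap) (simp add: mult.commute)
  also have "\<dots> = (\<Sum>l<k. (M ^\<^sub>m (k - 1)) $$ (j, i))"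
    by (intro sum.cong refl) (simp add: pow_mult_entry[OF M ij(2,1)])
  finally show "of_nat k * (M ^\<^sub>m (k - 1)) $$ (j, i)
      = (\<Sum>a<N. \<Sum>l<k. (M ^\<^sub>m l) $$ (a, i) * (M ^\<^sub>m (k - 1 - l)) $$ (j, a))"
    by simp
qed

section \<open>The Schwinger--Dyson equations\<close>

text \<open>Multiplication of the integrand by \<open>N Tr(M\<^sup>p)\<close>, as an operator on coefficient functions.\<close>

definition trace_op :: "nat \<Rightarrow> nat \<Rightarrow> complex mps \<Rightarrow> complex mps" where
  "trace_op N p F m = (if p = 0 then of_nat N ^ 2 * F m
     else of_nat p * of_nat (Suc (count m p)) * F (add_mset p m))"

lemma mat_trace_pow_0:
  assumes "M \<in> carrier_mat N N"
  shows "mat_trace (M ^\<^sub>m 0) = (of_nat N :: complex)"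
  using assms by (simp add: mat_trace_def)

lemma interaction_superset:
  assumes "finite A" "set_mset m \<subseteq> A" "0 \<notin># m"
  shows "interaction N M m = (\<Prod>n\<in>A. (of_nat N * mat_trace (M ^\<^sub>m n) / of_nat n) ^ count m n
      / fact (count m n))"
  unfolding interaction_def using assms
  by (auto intro!: prod.mono_neutral_left simp: not_in_iff)

text \<open>On the expansion of the exponential, multiplication by \<open>N Tr(M^p)\<close> is
  \<open>p\<close> times differentiation in \<open>a_p\<close>; for \<open>p = 0\<close> it is the
  number \<open>N * N\<close>.\<close>

lemma trace_op_interaction:
  assumes M: "M \<in> carrier_mat N N"
  shows "trace_op N p (interaction N M) m = of_nat N * mat_trace (M ^\<^sub>m p) * interaction N M m"
proof (cases "p = 0 \<or> 0 \<in># m")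
  case True
  then show ?thesis
    using mat_trace_pow_0[OF M] by (auto simp: trace_op_def power2_eq_square interaction_def simp
        del: pow_mat.simps)
next
  case False
  let ?t = "\<lambda>n. of_nat N * mat_trace (M ^\<^sub>m n) / of_nat n :: complex"
  have "interaction N M (add_mset p m) =
      (\<Prod>n\<in>insert p (set_mset m). ?t n ^ count (add_mset p m) n / fact (count (add_mset p m) n))"
    using False by (intro interaction_superset) auto
  also have "\<dots> = ?t p / of_nat (Suc (count m p)) * (?t p ^ count m p / fact (count m p))
      * (\<Prod>n\<in>insert p (set_mset m) - {p}. ?t n ^ count m n / fact (count m n))"
    by (subst prod.remove[of _ p]) (auto cong: prod.cong_simp)
  also have "\<dots> = ?t p / of_nat (Suc (count m p)) *
      (\<Prod>n\<in>insert p (set_mset m). ?t n ^ count m n / fact (count m n))"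
    by (subst (2) prod.remove[of _ p]) auto
  also have "(\<Prod>n\<in>insert p (set_mset m). ?t n ^ count m n / fact (count m n)) = interaction N M m"
    using False by (intro interaction_superset[symmetric]) auto
  finally show ?thesis using False by (simp add: trace_op_def del: of_nat_Suc)
qed

lemma interaction_add_mset:
  assumes M: "M \<in> carrier_mat N N" and "p > 0"
  shows "interaction N M (add_mset p m) =
    1 / (of_nat p * of_nat (Suc (count m p))) * (of_nat N * mat_trace (M ^\<^sub>m p) * interaction N M m)"
  using trace_op_interaction[OF M, of p m] assms(2)
  by (simp add: trace_op_def field_simps del: of_nat_Suc)

text \<open>Differentiating the exponential brings down the sum of \<open>N a_n M^(n-1)\<close>, and
  multiplication by \<open>a_n\<close> removes one \<open>n\<close> from the monomial at which the
  coefficient is taken.\<close>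

lemma entry_deriv_interaction:
  "0 \<notin># m \<Longrightarrow> entry_deriv N (\<lambda>M. interaction N M m)
    (\<lambda>i j M. \<Sum>n\<in>set_mset m. interaction N M (m - {#n#}) * (of_nat N * (M ^\<^sub>m (n - 1)) $$ (j, i)))"
proof (induction m)
  case empty
  show ?case using entry_deriv_const[of N 1] by (simp add: interaction_def)
next
  case (add p m)
  then have p: "p > 0" and m: "0 \<notin># m" by auto
  let ?c = "of_nat (Suc (count m p)) :: complex"
  show ?case
  proof (rule entry_deriv_cong[OF entry_deriv_cmult[OF entry_deriv_mult[OF entry_deriv_cmult[OF
      entry_deriv_trace_pow] add.IH[OF m]]]])
    fix M :: "complex mat" assume M: "M \<in> carrier_mat N N"
    show "interaction N M (add_mset p m)
        = 1 / (of_nat p * ?c) * (of_nat N * mat_trace (M ^\<^sub>m p) * interaction N M m)"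
      by (rule interaction_add_mset[OF M p])
    fix i j assume "i < N" "j < N"
    let ?e = "\<lambda>n. of_nat N * (M ^\<^sub>m (n - 1)) $$ (j, i)"
    let ?tp = "of_nat N * mat_trace (M ^\<^sub>m p) / (of_nat p * ?c)"
    have other: "interaction N M (add_mset p (m - {#n#})) = ?tp * interaction N M (m - {#n#})"
      if "n \<noteq> p" for n
      using interaction_add_mset[OF M p, of "m - {#n#}"] that by simp
    have same: "?tp * interaction N M (m - {#p#}) = of_nat (count m p) / ?c * interaction N M m"
        if "p \<in># m"
    proof -
      have "Suc (count (m - {#p#}) p) = count m p" "add_mset p (m - {#p#}) = m" using that by auto
      then have "interaction N M m = 1 / (of_nat p * of_nat (count m p)) * (of_nat N
          * mat_trace (M ^\<^sub>m p) * interaction N M (m - {#p#}))"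
        using interaction_add_mset[OF M p, of "m - {#p#}"] by (simp only:)
      moreover have "of_nat (count m p) \<noteq> (0 :: complex)" using that by simp
      ultimately show ?thesis using p by (simp add: mult_ac del: of_nat_Suc of_nat_eq_0_iff)
    qed
    have "(\<Sum>n\<in>set_mset (add_mset p m). interaction N M (add_mset p m - {#n#}) * ?e n) =
       interaction N M m * ?e p + (\<Sum>n\<in>set_mset m - {p}. ?tp * interaction N M (m - {#n#}) * ?e n)"
      by (subst sum.remove[of _ p]) (auto simp: other intro!: sum.cong simp del: diff_add_mset_swap
          add_mset_diff_bothsides of_nat_Suc)
    \<comment> \<open>The term for \<open>p\<close> has two sources: the newly added trace gives the
      fraction \<open>1 / ?c\<close> of it, the copies of \<open>p\<close> already in
      \<open>m\<close> give \<open>count m p / ?c\<close>.\<close>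
    also have "\<dots> = interaction N M m * ?e p / ?c + (\<Sum>n\<in>set_mset m. ?tp * interaction N M (m - {#n#})
        * ?e n)"
    proof (cases "p \<in># m")
      case True
      have "(\<Sum>n\<in>set_mset m. ?tp * interaction N M (m - {#n#}) * ?e n) =
          of_nat (count m p) / ?c * interaction N M m * ?e p + (\<Sum>n\<in>set_mset m - {p}. ?tp
              * interaction N M (m - {#n#}) * ?e n)"
        using True by (subst sum.remove[of _ p]) (simp_all only: same finite_set_mset)
      moreover have "interaction N M m * ?e p
          = interaction N M m * ?e p / ?c + of_nat (count m p) / ?c * interaction N M m * ?e p"
      proof -
        have "?c \<noteq> 0" by (rule of_nat_neq_0)
        then have s: "1 / ?c + of_nat (count m p) / ?c = 1" by (simp add: divide_simps)
        have "X = X / ?c + of_nat (count m p) / ?c * X" for X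
        proof -
          have "X / ?c + of_nat (count m p) / ?c * X = (1 / ?c + of_nat (count m p) / ?c) * X"
            by (simp add: distrib_right)
          then show ?thesis unfolding s by (simp only: mult_1)
        qed
        from this[of "interaction N M m * ?e p"] show ?thesis by (simp only: mult.assoc)
      qed
      ultimately show ?thesis by simp
    next
      case False
      then show ?thesis by (simp add: not_in_iff)
    qed
    also have "\<dots> = 1 / (of_nat p * ?c) * (of_nat N * (of_nat p * (M ^\<^sub>m (p - 1)) $$ (j, i))
        * interaction N M m +
        of_nat N * mat_trace (M ^\<^sub>m p) * (\<Sum>n\<in>set_mset m. interaction N M (m - {#n#}) * ?e n))"
      using p by (simp add: distrib_left sum_distrib_left mult.assoc mult.left_commute del:
          of_nat_Suc)
    finally show "(\<Sum>n\<in>set_mset (add_mset p m). interaction N M (add_mset p m - {#n#}) * ?e n) = \<dots>" .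
  qed
qed

lemma trace_op_expectation:
  assumes N: "N \<ge> 1"
  shows "trace_op N p (\<lambda>m. gaussian_expectation N (\<lambda>M. f M m)) m
      = gaussian_expectation N (\<lambda>M. trace_op N p (f M) m)"
  by (cases "p = 0") (simp_all only: trace_op_def if_True if_False gaussian_expectation_cmult[OF N]
      refl)

text \<open>The Schwinger--Dyson equation: integration by parts of \<open>\<Sum>\<^sub>i\<^sub>j M\<^sub>i\<^sub>j (M\<^sup>p\<^sup>-\<^sup>1)\<^sub>j\<^sub>i Q(M)\<close>.\<close>

theorem partition_function_loop:
  assumes N: "N \<ge> 1" and m: "0 \<notin># m" and p: "p \<ge> 1"
  defines "Z \<equiv> partition_function N"
  shows "trace_op N p Z m = (\<Sum>l<p - 1. trace_op N l (trace_op N (p - 2 - l) Z) m) / of_nat N ^ 2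
    + (\<Sum>n\<in>set_mset m. trace_op N (n + p - 2) Z (m - {#n#}))"
proof -
  let ?E = "gaussian_expectation N"
  let ?Q = "\<lambda>m M. interaction N M m"
  let ?T = "\<lambda>p M. of_nat N * mat_trace (M ^\<^sub>m p) :: complex"
  have Z: "Z = (\<lambda>m. ?E (?Q m))" by (simp add: Z_def partition_function_def fun_eq_iff)
  have T: "trace_op N q Z m' = ?E (\<lambda>M. ?T q M * ?Q m' M)" for q m'
    unfolding Z trace_op_expectation[OF N]
        by (intro gaussian_expectation_cong N trace_op_interaction)
  have TT: "trace_op N l (trace_op N q Z) m = ?E (\<lambda>M. ?T l M * (?T q M * ?Q m M))" for l q
  proof -
    have "trace_op N l (trace_op N q Z) m
        = trace_op N l (\<lambda>m. ?E (\<lambda>M. trace_op N q (interaction N M) m)) m"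
      unfolding Z by (rule arg_cong[of _ _ "\<lambda>f. trace_op N l f m"]) (rule ext,
          rule trace_op_expectation[OF N])
    also have "\<dots> = ?E (\<lambda>M. trace_op N l (trace_op N q (interaction N M)) m)"
        by (rule trace_op_expectation[OF N])
    also have "\<dots> = ?E (\<lambda>M. ?T l M * (?T q M * ?Q m M))"
    proof (intro gaussian_expectation_cong N)
      fix M :: "complex mat" assume M: "M \<in> carrier_mat N N"
      have "trace_op N q (interaction N M) = (\<lambda>m. ?T q M * interaction N M m)"
        using trace_op_interaction[OF M] by auto
      then have "trace_op N l (trace_op N q (interaction N M)) m
          = ?T q M * trace_op N l (interaction N M) m"
        by (simp add: trace_op_def)
      then show "trace_op N l (trace_op N q (interaction N M)) m = ?T l M * (?T q M * ?Q m M)"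
        using trace_op_interaction[OF M] by simp
    qed
    finally show ?thesis .
  qed
  obtain k where k: "p = Suc k" using p by (cases p) auto
  define D where "D = (\<lambda>i j i' j' M. (\<Sum>l<k. (M ^\<^sub>m l) $$ (j, i') * (M ^\<^sub>m (k - 1 - l)) $$ (j', i))
      * ?Q m M +
      (M ^\<^sub>m k) $$ (j, i) * (\<Sum>n\<in>set_mset m. ?Q (m - {#n#}) M * (of_nat N * (M ^\<^sub>m (n
          - 1)) $$ (j', i'))))"
  have D: "entry_deriv N (\<lambda>M. (M ^\<^sub>m k) $$ (j, i) * ?Q m M) (D i j)" if "i < N" "j < N" for i j
    unfolding D_def using that by (intro entry_deriv_mult entry_deriv_pow entry_deriv_interaction m)
  \<comment> \<open>Expectations are additive only for integrable, here polynomial, integrands;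
    every sum split below needs this.\<close>
  have poly: "\<exists>D. entry_deriv N (\<lambda>M. (M ^\<^sub>m a) $$ (i, j) * ((M ^\<^sub>m b) $$ (i', j') * ?Q m' M)) D"
    if "i < N" "j < N" "i' < N" "j' < N" "0 \<notin># m'" for a b i j i' j' m'
    using entry_deriv_mult[OF entry_deriv_pow[OF that(1,2),
        of a] entry_deriv_mult[OF entry_deriv_pow[OF that(3,4),
        of b] entry_deriv_interaction[OF that(5)]]] by blast
  have "trace_op N p Z m = ?E (\<lambda>M. of_nat N * (\<Sum>i<N. \<Sum>j<N. M $$ (i, j) * ((M ^\<^sub>m k) $$ (j, i)
      * ?Q m M)))"
    unfolding T
  proof (intro gaussian_expectation_cong N)
    fix M :: "complex mat" assume M: "M \<in> carrier_mat N N"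
    have "M ^\<^sub>m 1 = M" using M by simp
    then have "mat_trace (M ^\<^sub>m p) = (\<Sum>i<N. \<Sum>j<N. M $$ (i, j) * (M ^\<^sub>m k) $$ (j, i))"
      using trace_pow_mult[OF M, of 1 k] by (simp add: k)
    then show "?T p M * ?Q m M = of_nat N * (\<Sum>i<N. \<Sum>j<N. M $$ (i, j) * ((M ^\<^sub>m k) $$ (j, i)
        * ?Q m M))"
      by (simp add: sum_distrib_left sum_distrib_right mult.assoc)
  qed
  also have "\<dots> = of_nat N * (\<Sum>i<N. \<Sum>j<N. ?E (\<lambda>M. M $$ (i, j) * ((M ^\<^sub>m k) $$ (j, i) * ?Q m M)))"
  proof -
    have e: "entry_deriv N (\<lambda>M. M $$ (i, j) * ((M ^\<^sub>m k) $$ (j, i) * ?Q m M))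
      (\<lambda>a b M. (if a = i \<and> b = j then 1 else 0) * ((M ^\<^sub>m k) $$ (j, i) * ?Q m M) + M $$ (i, j)
          * D i j a b M)"
      if "i < N" "j < N" for i j
      using that by (intro entry_deriv_mult[OF entry_deriv_entry] D)
    show ?thesis
      by (subst gaussian_expectation_cmult[OF N], subst gaussian_expectation_sum[OF N],
          rule entry_deriv_sum, rule e)
         (auto intro!: sum.cong gaussian_expectation_sum[OF N] e)
  qed
  also have "\<dots> = of_nat N * (\<Sum>i<N. \<Sum>j<N. ?E (D i j j i) / of_nat N)"
    by (intro arg_cong[of _ _ "(*) _"] sum.cong refl gaussian_expectation_entry[OF N] D) auto
  also have "\<dots> = (\<Sum>i<N. \<Sum>j<N. ?E (D i j j i))"
    using N by (simp add: sum_distrib_left)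
  also have "\<dots> = (\<Sum>i<N. \<Sum>j<N. (\<Sum>l<k. ?E (\<lambda>M. (M ^\<^sub>m l) $$ (j, j) * ((M ^\<^sub>m (k - 1 - l)) $$ (i, i)
      * ?Q m M))) +
      (\<Sum>n\<in>set_mset m. of_nat N * ?E (\<lambda>M. (M ^\<^sub>m k) $$ (j, i) * ((M ^\<^sub>m (n - 1)) $$ (i, j) * ?Q (m
          - {#n#}) M))))"
  proof (intro sum.cong refl)
    fix i j assume ij: "i \<in> {..<N}" "j \<in> {..<N}"
    then have ij: "i < N" "j < N" by auto
    have m': "0 \<notin># m - {#n#}" for n using m by (meson in_diffD)
    have D1: "\<exists>D. entry_deriv N (\<lambda>M. (M ^\<^sub>m l) $$ (j, j) * ((M ^\<^sub>m (k - 1 - l)) $$ (i, i)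
        * ?Q m M)) D" for l
      by (rule poly) (use ij m in auto)
    have D2: "\<exists>D. entry_deriv N (\<lambda>M. of_nat N * ((M ^\<^sub>m k) $$ (j, i) * ((M ^\<^sub>m (n - 1)) $$ (i, j)
        * ?Q (m - {#n#}) M))) D" for n
    proof -
      obtain D where "entry_deriv N (\<lambda>M. (M ^\<^sub>m k) $$ (j, i) * ((M ^\<^sub>m (n - 1)) $$ (i, j) * ?Q (m
          - {#n#}) M)) D"
        using poly[OF ij(2,1) ij m', of k "n - 1" n] by blast
      from entry_deriv_cmult[OF this, of "of_nat N"] show ?thesis by blast
    qed
    have "\<exists>D. entry_deriv N (\<lambda>M. \<Sum>l<k. (M ^\<^sub>m l) $$ (j, j) * ((M ^\<^sub>m (k - 1 - l)) $$ (i, i)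
        * ?Q m M)) D"
      by (rule gaussian_expectation_sum_ex(2)[OF N D1])
    then obtain S1 where S1: "entry_deriv N (\<lambda>M. \<Sum>l<k. (M ^\<^sub>m l) $$ (j, j) * ((M ^\<^sub>m (k - 1
        - l)) $$ (i, i) * ?Q m M)) S1"
      by blast
    have "\<exists>D. entry_deriv N (\<lambda>M. \<Sum>n\<in>set_mset m. of_nat N * ((M ^\<^sub>m k) $$ (j, i) * ((M ^\<^sub>m (n
        - 1)) $$ (i, j) * ?Q (m - {#n#}) M))) D"
      by (rule gaussian_expectation_sum_ex(2)[OF N D2])
    then obtain S2 where S2: "entry_deriv N (\<lambda>M. \<Sum>n\<in>set_mset m. of_nat N * ((M ^\<^sub>m k) $$ (j, i)
        * ((M ^\<^sub>m (n - 1)) $$ (i, j) * ?Q (m - {#n#}) M))) S2"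
      by blast
    have "?E (D i j j i) = ?E (\<lambda>M. (\<Sum>l<k. (M ^\<^sub>m l) $$ (j, j) * ((M ^\<^sub>m (k - 1 - l)) $$ (i, i)
        * ?Q m M)) +
       (\<Sum>n\<in>set_mset m. of_nat N * ((M ^\<^sub>m k) $$ (j, i) * ((M ^\<^sub>m (n - 1)) $$ (i, j) * ?Q (m
           - {#n#}) M))))"
      by (intro gaussian_expectation_cong N) (simp add: D_def sum_distrib_left sum_distrib_right
          mult_ac)
    also have "\<dots> = (\<Sum>l<k. ?E (\<lambda>M. (M ^\<^sub>m l) $$ (j, j) * ((M ^\<^sub>m (k - 1 - l)) $$ (i, i) * ?Q m M))) +
       (\<Sum>n\<in>set_mset m. ?E (\<lambda>M. of_nat N * ((M ^\<^sub>m k) $$ (j, i) * ((M ^\<^sub>m (n - 1)) $$ (i, j) * ?Q (m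
           - {#n#}) M))))"
      by (simp only: gaussian_expectation_add[OF N S1 S2]
            gaussian_expectation_sum_ex(1)[OF N D1] gaussian_expectation_sum_ex(1)[OF N D2])
    finally show "?E (D i j j i) = (\<Sum>l<k. ?E (\<lambda>M. (M ^\<^sub>m l) $$ (j, j) * ((M ^\<^sub>m (k - 1 - l)) $$ (i, i)
        * ?Q m M))) +
      (\<Sum>n\<in>set_mset m. of_nat N * ?E (\<lambda>M. (M ^\<^sub>m k) $$ (j, i) * ((M ^\<^sub>m (n - 1)) $$ (i, j) * ?Q (m
          - {#n#}) M)))"
      by (simp only: gaussian_expectation_cmult[OF N])
  qed
  also have "\<dots> = (\<Sum>l<k. ?E (\<lambda>M. mat_trace (M ^\<^sub>m l) * (mat_trace (M ^\<^sub>m (k - 1 - l)) * ?Q m M))) +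
     (\<Sum>n\<in>set_mset m. ?E (\<lambda>M. of_nat N * mat_trace (M ^\<^sub>m (k + (n - 1))) * ?Q (m - {#n#}) M))"
  proof -
    have m': "0 \<notin># m - {#n#}" for n using m by (meson in_diffD)
    have E1: "(\<Sum>i<N. \<Sum>j<N. ?E (\<lambda>M. (M ^\<^sub>m l) $$ (j, j) * ((M ^\<^sub>m l') $$ (i, i) * ?Q m M))) =
      ?E (\<lambda>M. mat_trace (M ^\<^sub>m l) * (mat_trace (M ^\<^sub>m l') * ?Q m M))" for l l'
    proof -
      have D1: "\<exists>D. entry_deriv N (\<lambda>M. (M ^\<^sub>m l) $$ (j, j) * ((M ^\<^sub>m l') $$ (i, i) * ?Q m M)) D"
          if "i \<in> {..<N}" "j \<in> {..<N}" for i j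
        by (rule poly) (use that m in auto)
      have "?E (\<lambda>M. mat_trace (M ^\<^sub>m l) * (mat_trace (M ^\<^sub>m l') * ?Q m M)) =
        ?E (\<lambda>M. \<Sum>i<N. \<Sum>j<N. (M ^\<^sub>m l) $$ (j, j) * ((M ^\<^sub>m l') $$ (i, i) * ?Q m M))"
      proof (intro gaussian_expectation_cong N)
        fix M :: "complex mat" assume M: "M \<in> carrier_mat N N"
        have "M ^\<^sub>m l \<in> carrier_mat N N" "M ^\<^sub>m l' \<in> carrier_mat N N" using M by auto
        then have "mat_trace (M ^\<^sub>m l) = (\<Sum>j<N. (M ^\<^sub>m l) $$ (j, j))" "mat_trace (M ^\<^sub>m l')
            = (\<Sum>i<N. (M ^\<^sub>m l') $$ (i, i))"
          by (simp_all add: mat_trace_def del: pow_mat_dim)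
        then show "mat_trace (M ^\<^sub>m l) * (mat_trace (M ^\<^sub>m l') * ?Q m M) =
          (\<Sum>i<N. \<Sum>j<N. (M ^\<^sub>m l) $$ (j, j) * ((M ^\<^sub>m l') $$ (i, i) * ?Q m M))"
          by (simp add: sum_distrib_left sum_distrib_right)
      qed
      also have "\<dots> = (\<Sum>i<N. \<Sum>j<N. ?E (\<lambda>M. (M ^\<^sub>m l) $$ (j, j) * ((M ^\<^sub>m l') $$ (i, i) * ?Q m M)))"
        by (rule gaussian_expectation_sum2[OF N D1])
      finally show ?thesis by simp
    qed
    have E2: "(\<Sum>i<N. \<Sum>j<N. of_nat N * ?E (\<lambda>M. (M ^\<^sub>m k) $$ (j, i) * ((M ^\<^sub>m n') $$ (i, j) * ?Q (m
        - {#n#}) M))) =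
      ?E (\<lambda>M. of_nat N * mat_trace (M ^\<^sub>m (k + n')) * ?Q (m - {#n#}) M)" for n n'
    proof -
      have D1: "\<exists>D. entry_deriv N (\<lambda>M. (M ^\<^sub>m k) $$ (j, i) * ((M ^\<^sub>m n') $$ (i, j) * ?Q (m
          - {#n#}) M)) D" if "i \<in> {..<N}" "j \<in> {..<N}" for i j
        by (rule poly) (use that m' in auto)
      have "?E (\<lambda>M. of_nat N * mat_trace (M ^\<^sub>m (k + n')) * ?Q (m - {#n#}) M) =
        ?E (\<lambda>M. of_nat N * (\<Sum>i<N. \<Sum>j<N. (M ^\<^sub>m k) $$ (j, i) * ((M ^\<^sub>m n') $$ (i, j) * ?Q (m
            - {#n#}) M)))"
      proof (intro gaussian_expectation_cong N)
        fix M :: "complex mat" assume M: "M \<in> carrier_mat N N"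
        have "mat_trace (M ^\<^sub>m (k + n')) = (\<Sum>i<N. \<Sum>j<N. (M ^\<^sub>m k) $$ (j, i) * (M ^\<^sub>m n') $$ (i, j))"
          unfolding trace_pow_mult[OF M, symmetric] by (rule sum.swap)
        then show "of_nat N * mat_trace (M ^\<^sub>m (k + n')) * ?Q (m - {#n#}) M =
          of_nat N * (\<Sum>i<N. \<Sum>j<N. (M ^\<^sub>m k) $$ (j, i) * ((M ^\<^sub>m n') $$ (i, j) * ?Q (m - {#n#}) M))"
          by (simp add: sum_distrib_left sum_distrib_right mult.assoc)
      qed
      also have "\<dots> = of_nat N * (\<Sum>i<N. \<Sum>j<N. ?E (\<lambda>M. (M ^\<^sub>m k) $$ (j, i) * ((M ^\<^sub>m n') $$ (i, j)
          * ?Q (m - {#n#}) M)))"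
        by (simp only: gaussian_expectation_cmult[OF N] gaussian_expectation_sum2[OF N D1])
      finally show ?thesis by (simp add: sum_distrib_left)
    qed
    have swap3: "(\<Sum>i<N. \<Sum>j<N. \<Sum>c\<in>C. h i j c) = (\<Sum>c\<in>C. \<Sum>i<N. \<Sum>j<N. h i j c)"
      for C :: "nat set" and h :: "nat \<Rightarrow> nat \<Rightarrow> nat \<Rightarrow> complex"
      by (simp only: sum.swap[of _ C])
    show ?thesis
      unfolding sum.distrib E1[symmetric] E2[symmetric] 
      by (intro arg_cong2[of _ _ _ _ "(+)"] swap3)
  qed
  also have "\<dots> = (\<Sum>l<p - 1. trace_op N l (trace_op N (p - 2 - l) Z) m) / of_nat N ^ 2
    + (\<Sum>n\<in>set_mset m. trace_op N (n + p - 2) Z (m - {#n#}))"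
  proof -
    have "gaussian_expectation N (\<lambda>M. mat_trace (M ^\<^sub>m l) * (mat_trace (M ^\<^sub>m l') * ?Q m M))
        = trace_op N l (trace_op N l' Z) m / of_nat N ^ 2" for l l'
    proof -
      have "?E (\<lambda>M. ?T l M * (?T l' M * ?Q m M))
          = ?E (\<lambda>M. of_nat N ^ 2 * (mat_trace (M ^\<^sub>m l) * (mat_trace (M ^\<^sub>m l') * ?Q m M)))"
        by (intro gaussian_expectation_cong N) (simp add: power2_eq_square)
      then show ?thesis unfolding TT gaussian_expectation_cmult[OF N] using N by simp
    qed
    moreover have "?E (\<lambda>M. of_nat N * mat_trace (M ^\<^sub>m (k + (n - 1))) * ?Q (m - {#n#}) M)
        = trace_op N (n + p - 2) Z (m - {#n#})"
      if "n \<in># m" for n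
    proof -
      have "n \<noteq> 0" using that m by metis
      then have "n + p - 2 = k + (n - 1)" by (simp add: k)
      then show ?thesis by (simp only: T)
    qed
    ultimately show ?thesis by (simp add: k sum_divide_distrib)
  qed
  finally show ?thesis .
qed

section \<open>Series in infinitely many variables\<close>

lemma finite_submultisets [simp]: "finite {p. p \<subseteq># (m :: 'a multiset)}"
proof -
  have "{p. p \<subseteq># m} \<subseteq> mset ` {xs. set xs \<subseteq> set_mset m \<and> length xs \<le> size m}"
  proof
    fix p assume "p \<in> {p. p \<subseteq># m}"
    moreover obtain xs where "p = mset xs" using ex_mset by metis
    ultimately show "p \<in> mset ` {xs. set xs \<subseteq> set_mset m \<and> length xs \<le> size m}"
      by (auto dest: size_mset_mono mset_subset_eqD intro!: imageI)
  qed
  then show ?thesis by (rule finite_subset) (intro finite_imageI finite_lists_length_le, simp)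
qed

lemma double_diff_mset: "p \<subseteq># m \<Longrightarrow> m - (m - p) = p"
  by (simp add: multiset_eq_iff subseteq_mset_def)

lemma mps_times_commute: "mps_times F G = mps_times G F"
proof
  fix m
  show "mps_times F G m = mps_times G F m"
    unfolding mps_times_def
    by (rule sum.reindex_bij_witness[of _ "\<lambda>p. m - p" "\<lambda>p. m - p"])
       (auto simp: mult.commute double_diff_mset)
qed

lemma mps_times_assoc: "mps_times (mps_times F G) H = mps_times F (mps_times G H)"
proof
  fix m
  have "mps_times (mps_times F G) H m = (\<Sum>(p, q)\<in>(SIGMA p:{p. p \<subseteq># m}. {q. q \<subseteq># p}). F q * G (p - q)
      * H (m - p))"
    by (simp add: mps_times_def sum_distrib_right sum.Sigma)
  also have "\<dots> = (\<Sum>(q, r)\<in>(SIGMA q:{q. q \<subseteq># m}. {r. r \<subseteq># m - q}). F q * G r * H (m - q - r))"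
    by (rule sum.reindex_bij_witness[of _ "\<lambda>(q, r). (q + r, q)" "\<lambda>(p, q). (q, p - q)"])
       (auto simp: subseteq_mset_def multiset_eq_iff,
           (metis add_diff_inverse_nat diff_diff_add le_trans not_less add_le_cancel_left
           le_diff_conv2 add.commute diff_le_mono diff_add_inverse)+)
  also have "\<dots> = mps_times F (mps_times G H) m"
    by (simp add: mps_times_def sum_distrib_left sum.Sigma mult.assoc)
  finally show "mps_times (mps_times F G) H m = mps_times F (mps_times G H) m" .
qed

lemma mps_times_one: "mps_times mps_one F = F"
proof
  fix m
  have "mps_times mps_one F m = (\<Sum>p\<in>{p. p \<subseteq># m}. if p = {#} then F m else 0)"
    unfolding mps_times_def by (intro sum.cong) (auto simp: mps_one_def)
  then show "mps_times mps_one F m = F m" by simp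
qed

text \<open>A copy of \<open>'a mps\<close> on which the ring operations are available through the type classes.\<close>

typedef 'a mseries = "UNIV :: 'a mps set" morphisms coef Mseries ..

setup_lifting type_definition_mseries

instantiation mseries :: (comm_ring_1) comm_ring_1
begin

lift_definition zero_mseries :: "'a mseries" is "\<lambda>_. 0" .
lift_definition one_mseries :: "'a mseries" is mps_one .
lift_definition plus_mseries :: "'a mseries \<Rightarrow> 'a mseries \<Rightarrow> 'a mseries" is "\<lambda>F G m. F m + G m" .
lift_definition minus_mseries :: "'a mseries \<Rightarrow> 'a mseries \<Rightarrow> 'a mseries" is mps_minus .
lift_definition uminus_mseries :: "'a mseries \<Rightarrow> 'a mseries" is "\<lambda>F m. - F m" .
lift_definition times_mseries :: "'a mseries \<Rightarrow> 'a mseries \<Rightarrow> 'a mseries" is mps_times .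

instance
proof
  fix a b c :: "'a mseries"
  show "a + b + c = a + (b + c)" by transfer (simp add: add.assoc)
  show "a + b = b + a" by transfer (simp add: add.commute)
  show "0 + a = a" by transfer simp
  show "- a + a = 0" by transfer simp
  show "a - b = a + - b" by transfer (simp add: mps_minus_def fun_eq_iff)
  show "a * b * c = a * (b * c)" by transfer (rule mps_times_assoc)
  show "a * b = b * a" by transfer (rule mps_times_commute)
  show "1 * a = a" by transfer (rule mps_times_one)
  show "(a + b) * c = a * c + b * c"
    by transfer (simp add: mps_times_def fun_eq_iff distrib_right sum.distrib)
  show "(0 :: 'a mseries) \<noteq> 1" by transfer (auto simp: mps_one_def fun_eq_iff)
qed

end

lemma coef_eqI: "(\<And>m. coef F m = coef G m) \<Longrightarrow> F = G"
  by transfer auto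

lemma coef_0 [simp]: "coef 0 m = 0" by transfer simp
lemma coef_1: "coef 1 m = (if m = {#} then 1 else 0)" by transfer (simp add: mps_one_def)
lemma coef_add [simp]: "coef (F + G) m = coef F m + coef G m" by transfer simp
lemma coef_diff [simp]: "coef (F - G) m = coef F m - coef G m" by transfer (simp add: mps_minus_def)
lemma coef_uminus [simp]: "coef (- F) m = - coef F m" by transfer simp
lemma coef_mult: "coef (F * G) m = (\<Sum>p\<in>{p. p \<subseteq># m}. coef F p * coef G (m - p))"
  by transfer (simp add: mps_times_def)
lemma coef_sum [simp]: "coef (sum F A) m = (\<Sum>k\<in>A. coef (F k) m)"
  by (induction A rule: infinite_finite_induct) auto

lift_definition mconst :: "'a::comm_ring_1 \<Rightarrow> 'a mseries" is "\<lambda>c m. if m = {#} then c else 0" .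

lemma coef_mconst: "coef (mconst c) m = (if m = {#} then c else 0)" by transfer simp

lemma coef_mconst_mult [simp]: "coef (mconst c * F) m = c * coef F m"
proof -
  have "coef (mconst c * F) m = (\<Sum>p\<in>{p. p \<subseteq># m}. if p = {#} then c * coef F m else 0)"
    unfolding coef_mult by (intro sum.cong) (auto simp: coef_mconst)
  then show ?thesis by simp
qed

lift_definition mvar :: "nat \<Rightarrow> 'a::comm_ring_1 mseries" is "\<lambda>n m. if m = {#n#} then 1 else 0" .

lemma coef_mvar_mult: "coef (mvar n * F) m = (if n \<in># m then coef F (m - {#n#}) else 0)"
proof -
  have "coef (mvar n * F) m = (\<Sum>p\<in>{p. p \<subseteq># m}. if p = {#n#} then coef F (m - {#n#}) else 0)"
    unfolding coef_mult by (intro sum.cong) (auto simp: mvar.rep_eq)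
  then show ?thesis by simp
qed

text \<open>The partial derivative with respect to \<open>a_n\<close>.\<close>

lift_definition mderiv :: "nat \<Rightarrow> 'a::comm_ring_1 mseries \<Rightarrow> 'a mseries"
  is "\<lambda>n F m. of_nat (Suc (count m n)) * F (add_mset n m)" .

lemma coef_mderiv: "coef (mderiv n F) m = of_nat (Suc (count m n)) * coef F (add_mset n m)"
  by transfer simp

lemma mderiv_diff: "mderiv n (F - G) = mderiv n F - mderiv n G"
  by (intro coef_eqI) (simp add: coef_mderiv right_diff_distrib del: of_nat_Suc)

lemma mderiv_mconst [simp]: "mderiv n (mconst c) = 0"
  by (intro coef_eqI) (simp add: coef_mderiv coef_mconst)

lemma mconst_1 [simp]: "mconst 1 = 1"
  by (intro coef_eqI) (simp add: coef_1 coef_mconst)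

lemma mderiv_1 [simp]: "mderiv n 1 = 0"
  using mderiv_mconst[of n 1] by simp

lemma sum_submultisets_count:
  fixes f :: "nat multiset \<Rightarrow> 'a::comm_ring_1"
  shows "(\<Sum>p\<in>{p. p \<subseteq># add_mset n m}. of_nat (count p n) * f p) =
    (\<Sum>p\<in>{p. p \<subseteq># m}. of_nat (Suc (count p n)) * f (add_mset n p))"
proof -
  have "(\<Sum>p\<in>{p. p \<subseteq># add_mset n m}. of_nat (count p n) * f p) =
      (\<Sum>p\<in>{p. p \<subseteq># add_mset n m \<and> n \<in># p}. of_nat (count p n) * f p)"
    by (intro sum.mono_neutral_right) (auto simp: not_in_iff)
  also have "\<dots> = (\<Sum>p\<in>{p. p \<subseteq># m}. of_nat (Suc (count p n)) * f (add_mset n p))"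
    by (rule sum.reindex_bij_witness[of _ "add_mset n" "\<lambda>p. p - {#n#}"])
       (auto simp: subset_eq_diff_conv simp del: of_nat_Suc)
  finally show ?thesis .
qed

text \<open>The exponent of \<open>a_n\<close> in a monomial is the sum of its exponents in the two
  factors; in each half, removing one \<open>n\<close> from the submultiset produces the derivative
  of that factor.\<close>

lemma mderiv_mult: "mderiv n (F * G) = mderiv n F * G + F * mderiv n G"
proof (intro coef_eqI)
  fix m
  let ?m = "add_mset n m"
  have half: "(\<Sum>p\<in>{p. p \<subseteq># ?m}. of_nat (count p n) * (coef F p * coef G (?m - p)))
      = coef (mderiv n F * G) m"
    for F G :: "'a mseries"
    unfolding sum_submultisets_count by (simp add: coef_mult coef_mderiv mult.assoc del: of_nat_Suc)
  have "coef (mderiv n (F * G)) m = (\<Sum>p\<in>{p. p \<subseteq># ?m}. of_nat (count ?m n) * (coef F p * coef G (?m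
      - p)))"
    by (simp add: coef_mderiv coef_mult sum_distrib_left)
  also have "\<dots> = (\<Sum>p\<in>{p. p \<subseteq># ?m}. of_nat (count p n) * (coef F p * coef G (?m - p)) +
      of_nat (count (?m - p) n) * (coef F p * coef G (?m - p)))"
  proof (intro sum.cong refl)
    fix p assume "p \<in> {p. p \<subseteq># ?m}"
    then have "count p n + count (?m - p) n = count ?m n"
        by (simp add: subseteq_mset_def del: count_add_mset)
    then show "of_nat (count ?m n) * (coef F p * coef G (?m - p))
        = of_nat (count p n) * (coef F p * coef G (?m - p)) +
      of_nat (count (?m - p) n) * (coef F p * coef G (?m - p))"
      by (metis distrib_right of_nat_add)
  qed
  also have "\<dots> = coef (mderiv n F * G) m + (\<Sum>p\<in>{p. p \<subseteq># ?m}. of_nat (count (?m - p) n) * (coef F p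
      * coef G (?m - p)))"
    unfolding sum.distrib half ..
  also have "(\<Sum>p\<in>{p. p \<subseteq># ?m}. of_nat (count (?m - p) n) * (coef F p * coef G (?m - p))) =
      (\<Sum>p\<in>{p. p \<subseteq># ?m}. of_nat (count p n) * (coef G p * coef F (?m - p)))"
    by (rule sum.reindex_bij_witness[of _ "\<lambda>p. ?m - p" "\<lambda>p. ?m - p"])
       (simp_all add: mult.commute double_diff_mset)
  also have "\<dots> = coef (F * mderiv n G) m" unfolding half by (simp add: mult.commute)
  finally show "coef (mderiv n (F * G)) m = coef (mderiv n F * G + F * mderiv n G) m" by simp
qed

lemma mderiv_power: "mderiv n (F ^ Suc k) = of_nat (Suc k) * F ^ k * mderiv n F"
proof (induction k)
  case (Suc k)
  then show ?case by (subst power_Suc, subst mderiv_mult) (simp add: algebra_simps)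
qed simp

lemma coef_power_eq_0:
  assumes "coef Y {#} = 0" "size m < k"
  shows "coef (Y ^ k) m = 0"
  using assms(2)
proof (induction k arbitrary: m)
  case (Suc k)
  show ?case unfolding power_Suc coef_mult
  proof (intro sum.neutral ballI)
    fix p assume p: "p \<in> {p. p \<subseteq># m}"
    show "coef Y p * coef (Y ^ k) (m - p) = 0"
    proof (cases "p = {#}")
      case False
      then have "size (m - p) < k" using p Suc.prems
        by (metis (no_types, lifting) Suc_leI le_less_trans less_Suc_eq_le mem_Collect_eq
            nonempty_has_size size_Diff_submset size_mset_mono diff_less less_le_trans
            linorder_not_le order_less_le_trans)
      then show ?thesis by (simp add: Suc.IH)
    qed (simp add: assms)
  qed
qed simp

lemma coef_mult_cong:
  assumes "\<And>p. p \<subseteq># m \<Longrightarrow> coef G p = coef G' p"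
  shows "coef (F * G) m = coef (F * G') m"
  unfolding coef_mult by (intro sum.cong refl) (use assms in \<open>auto simp: diff_subset_eq_self\<close>)

lemma mconst_of_nat: "mconst (of_nat k) = (of_nat k :: 'a::comm_ring_1 mseries)"
proof (induction k)
  case 0
  show ?case by (intro coef_eqI) (simp add: coef_mconst)
next
  case (Suc k)
  have "mconst (of_nat (Suc k)) = 1 + (mconst (of_nat k) :: 'a mseries)"
    by (intro coef_eqI) (simp add: coef_mconst coef_1)
  with Suc show ?case by simp
qed

lemma mconst_power_minus: "mconst ((-1) ^ k) = ((-1) ^ k :: 'a::comm_ring_1 mseries)"
proof (induction k)
  case (Suc k)
  have "mconst ((-1) ^ Suc k) = - (mconst ((-1) ^ k) :: 'a mseries)"
      by (intro coef_eqI) (simp add: coef_mconst)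
  with Suc show ?case by (simp only: power_Suc mult_minus1)
qed simp

section \<open>The logarithm and its derivatives\<close>

lift_definition mlog :: "'a::field_char_0 mseries \<Rightarrow> 'a mseries" is mps_log .

lemma mps_power_conv: "mps_power (coef F) k = coef (F ^ k)"
  by (induction k) (simp_all add: one_mseries.rep_eq times_mseries.rep_eq)

text \<open>Higher powers do not reach the coefficient, so a single cut-off \<open>K\<close> serves
  all submonomials of a monomial at once.\<close>

lemma coef_mlog:
  assumes "coef F {#} = 1" "size m \<le> K"
  shows "coef (mlog F) m = (\<Sum>k=1..K. (-1) ^ (k + 1) / of_nat k * coef ((F - 1) ^ k) m)"
proof -
  have "coef (mlog F) m = (\<Sum>k=1..size m. (-1) ^ (k + 1) / of_nat k * coef ((F - 1) ^ k) m)"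
    by (simp add: mlog.rep_eq mps_log_def mps_power_conv flip: one_mseries.rep_eq
        minus_mseries.rep_eq)
  also have "\<dots> = (\<Sum>k=1..K. (-1) ^ (k + 1) / of_nat k * coef ((F - 1) ^ k) m)"
    using assms by (intro sum.mono_neutral_left) (auto simp: coef_power_eq_0 coef_1)
  finally show ?thesis .
qed

text \<open>Termwise differentiation of the logarithm gives the truncated geometric series of
  \<open>1 / F\<close> in \<open>Y = F - 1\<close>. Multiplied by \<open>F\<close> it telescopes,
  and the remainder with \<open>(- Y) ^ K\<close> has no term of degree below
  \<open>K\<close>.\<close>

lemma mderiv_mlog:
  fixes F :: "'a::field_char_0 mseries"
  assumes F: "coef F {#} = 1"
  shows "F * mderiv n (mlog F) = mderiv n F"
proof (intro coef_eqI)
  fix m :: "nat multiset"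
  define Y where "Y = F - 1"
  \<comment> \<open>One above the degree of \<open>m\<close>, since a derivative reads its argument
    one degree higher.\<close>
  define K where "K = Suc (size m)"
  have dY: "mderiv n Y = mderiv n F" by (simp add: Y_def mderiv_diff)
  have Y0: "coef Y {#} = 0" using F by (simp add: Y_def coef_1)
  have "coef (mderiv n (mlog F)) p = coef ((\<Sum>k<K. (- Y) ^ k) * mderiv n F) p" if pm: "p \<subseteq># m" for p
  proof -
    have "size (add_mset n p) \<le> K" using size_mset_mono[OF pm] by (simp add: K_def)
    then have "coef (mderiv n (mlog F)) p
        = (\<Sum>k=1..K. (-1) ^ (k + 1) / of_nat k * coef (mderiv n (Y ^ k)) p)"
      unfolding coef_mderiv coef_mlog[OF F \<open>size (add_mset n p) \<le> K\<close>]
      by (simp add: Y_def sum_distrib_left mult.left_commute del: of_nat_Suc)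
    also have "\<dots> = (\<Sum>k<K. (-1) ^ k / of_nat (Suc k) * coef (mderiv n (Y ^ Suc k)) p)"
      unfolding One_nat_def sum.atLeast1_atMost_eq
          by (simp del: power_Suc of_nat_Suc add: power_Suc[of "-1"])
    also have "\<dots> = (\<Sum>k<K. coef ((- Y) ^ k * mderiv n F) p)"
    proof (intro sum.cong refl)
      fix k
      have "of_nat (Suc k) * Y ^ k * mderiv n Y = mconst (of_nat (Suc k)) * (Y ^ k * mderiv n Y)"
        by (simp add: mconst_of_nat mult.assoc del: of_nat_Suc)
      moreover have "(- Y) ^ k * mderiv n F = mconst ((-1) ^ k) * (Y ^ k * mderiv n Y)"
        by (simp add: mconst_power_minus dY power_minus[of Y] mult.assoc)
      ultimately show "(-1) ^ k / of_nat (Suc k) * coef (mderiv n (Y ^ Suc k)) p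
          = coef ((- Y) ^ k * mderiv n F) p"
        by (simp only: mderiv_power coef_mconst_mult) (simp del: of_nat_Suc)
    qed
    finally show ?thesis by (simp add: sum_distrib_right)
  qed
  then have "coef (F * mderiv n (mlog F)) m = coef (F * ((\<Sum>k<K. (- Y) ^ k) * mderiv n F)) m"
    by (rule coef_mult_cong)
  also have "F * ((\<Sum>k<K. (- Y) ^ k) * mderiv n F) = (1 - (- Y)) * (\<Sum>k<K. (- Y) ^ k) * mderiv n F"
    by (simp add: Y_def algebra_simps)
  also have "\<dots> = mderiv n F - mderiv n F * (- Y) ^ K"
    unfolding one_diff_power_eq[of "- Y" K, symmetric] by (simp add: algebra_simps)
  also have "coef \<dots> m = coef (mderiv n F) m"
    using coef_mult_cong[of m "(- Y) ^ K" 0 "mderiv n F"] coef_power_eq_0[of "- Y" _ K] Y0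
    by (simp add: K_def less_Suc_eq_le size_mset_mono)
  finally show "coef (F * mderiv n (mlog F)) m = coef (mderiv n F) m" .
qed

section \<open>Loop equations and the genus expansion\<close>

text \<open>\<open>cumulant p F\<close> is the generating series of \<open>Tr(M\<^sup>p)\<close>, normalized so that \<open>Tr 1 = 1\<close>.\<close>

definition cumulant :: "nat \<Rightarrow> 'a::comm_ring_1 mseries \<Rightarrow> 'a mseries" where
  "cumulant p F = (if p = 0 then 1 else of_nat p * mderiv p F)"

text \<open>The connected correlator of two traces. It is 0 when \<open>l = 0\<close> or
  \<open>q = 0\<close>, as \<open>Tr 1\<close> does not fluctuate.\<close>

definition cumulant2 :: "nat \<Rightarrow> nat \<Rightarrow> 'a::comm_ring_1 mseries \<Rightarrow> 'a mseries" where
  "cumulant2 l q F = (if l = 0 then 0 else of_nat l * mderiv l (cumulant q F))"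

text \<open>The loop equations; \<open>h\<close> stands for \<open>1 / N\<^sup>2\<close> and \<open>F\<close> for \<open>(log Z) / N\<^sup>2\<close>.\<close>

definition loop_eq :: "'a::comm_ring_1 \<Rightarrow> 'a mseries \<Rightarrow> bool" where
  "loop_eq h F \<longleftrightarrow> (\<forall>p m. p \<ge> 1 \<longrightarrow> 0 \<notin># m \<longrightarrow>
     coef (cumulant p F) m =
       coef (\<Sum>l<p - 1. cumulant l F * cumulant (p - 2 - l) F + mconst h * cumulant2 l (p - 2
           - l) F) m
       + (\<Sum>n\<in>set_mset m. coef (cumulant (n + p - 2) F) (m - {#n#})))"

lemma coef_of_nat_mult [simp]: "coef (of_nat k * F) m = of_nat k * coef F m"
  by (simp flip: mconst_of_nat)

lemma mderiv_cmult: "mderiv n (mconst c * F) = mconst c * mderiv n F"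
  by (simp add: mderiv_mult)

text \<open>A series with constant term 1 is cancelled by induction on the degree. The loop
  equations are available only for monomials avoiding \<open>a_0\<close>; the restriction to
  \<open>A\<close> respects this, since submultisets of a multiset over \<open>A\<close> stay over
  \<open>A\<close>.\<close>

lemma coef_mult_eq_0_cancel:
  assumes Z: "coef Z {#} = 1"
    and 0: "\<And>m. set_mset m \<subseteq> A \<Longrightarrow> coef (Z * W) m = 0"
  shows "set_mset m \<subseteq> A \<Longrightarrow> coef W m = 0"
proof (induction "size m" arbitrary: m rule: less_induct)
  case less
  have "coef Z p * coef W (m - p) = (if p = {#} then coef W m else 0)" if "p \<subseteq># m" for p
  proof (cases "p = {#}")
    case False
    have "size (m - p) < size m"
      using False that by (metis nonempty_has_size size_Diff_submset size_mset_mono diff_less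
          le_trans less_le_trans)
    moreover have "set_mset (m - p) \<subseteq> A" using less.prems by (meson in_diffD subset_iff)
    ultimately show ?thesis using less.hyps False by simp
  qed (simp add: Z)
  then have "coef (Z * W) m = (\<Sum>p\<in>{p. p \<subseteq># m}. if p = {#} then coef W m else 0)"
    unfolding coef_mult by (intro sum.cong) auto
  then show ?case using 0[OF less.prems] by simp
qed

context
  fixes N :: nat
  assumes N: "N \<ge> 1"
begin

lemma coef_partition_function_empty: "coef (Mseries (partition_function N)) {#} = 1"
  using gaussian_expectation_one[OF N]
  by (simp add: Mseries_inverse partition_function_def interaction_def)

lemma trace_op_coef: "trace_op N p (coef F) = coef (if p
    = 0 then mconst (of_nat N ^ 2) * F else of_nat p * mderiv p F)"
  by (auto simp: trace_op_def fun_eq_iff coef_mderiv)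

text \<open>Formally \<open>Z = exp (N^2 F)\<close>: one trace insertion turns \<open>Z\<close> into
  \<open>N^2 Z\<close> times a cumulant, and a second one produces the product of two cumulants plus
  \<open>1 / N^2\<close> times their connected correlator. The common factor \<open>Z\<close> is
  cancelled at the end.\<close>

theorem loop_eq_log_partition_function:
  "loop_eq (1 / of_nat N ^ 2) (mconst (1 / of_nat N ^ 2) * mlog (Mseries (partition_function N)))"
  unfolding loop_eq_def
proof (intro allI impI)
  fix p m assume p: "p \<ge> (1::nat)" and m: "0 \<notin># (m :: nat multiset)"
  define Z where "Z = Mseries (partition_function N)"
  define c where "c = mconst (of_nat N ^ 2 :: complex)"
  define h where "h = (1 / of_nat N ^ 2 :: complex)"
  define F where "F = mconst h * mlog Z"
  have hN: "h * of_nat N ^ 2 = 1" using N by (simp add: h_def)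
  have ch: "c * mconst h = 1" "mconst h * c = 1"
    using N by (auto intro!: coef_eqI simp: c_def h_def coef_1 coef_mconst)
  have Z0: "coef Z {#} = 1" unfolding Z_def by (rule coef_partition_function_empty)
  have Zp: "partition_function N = coef Z" by (simp add: Z_def Mseries_inverse)
  have dZ: "mderiv n Z = c * Z * mderiv n F" for n
  proof -
    have "c * Z * mderiv n F = (c * mconst h) * (Z * mderiv n (mlog Z))"
      by (simp add: F_def mderiv_cmult mult_ac)
    then show ?thesis by (simp add: ch mderiv_mlog[OF Z0])
  qed
  have T: "trace_op N q (coef Z) = coef (c * (Z * cumulant q F))" for q
    by (simp add: trace_op_coef cumulant_def dZ c_def[symmetric] mult_ac)
  have TT: "trace_op N l (trace_op N q (coef Z)) =
     coef (c * (c * (Z * (cumulant l F * cumulant q F + mconst h * cumulant2 l q F))))" for l q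
  proof (cases "l = 0")
    case True
    then show ?thesis unfolding T unfolding trace_op_coef
        by (simp add: cumulant_def cumulant2_def c_def)
  next
    case False
    have "of_nat l * mderiv l (c * (Z * cumulant q F)) =
      c * (of_nat l * (c * Z * mderiv l F * cumulant q F + Z * mderiv l (cumulant q F)))"
      by (simp add: mderiv_mult c_def mderiv_cmult dZ[unfolded c_def] algebra_simps)
    also have "\<dots> = c * (c * (Z * (cumulant l F * cumulant q F))) + (c * mconst h) * (c * (Z
        * cumulant2 l q F))"
      using False by (simp add: ch cumulant_def cumulant2_def algebra_simps)
    moreover have "c * (c * (Z * (mconst h * X))) = (c * mconst h) * (c * (Z * X))" for X
      by (simp only: mult_ac)
    ultimately show ?thesis using False ch unfolding T unfolding trace_op_coef
        by (simp add: distrib_left)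
  qed
  let ?S = "\<Sum>l<p - 1. cumulant l F * cumulant (p - 2 - l) F + mconst h * cumulant2 l (p - 2 - l) F"
  \<comment> \<open>Only the variables of \<open>m\<close> are kept in the sum over
    \<open>a_n\<close>; on monomials built from these variables it has the same coefficients as the
    sum over all \<open>n\<close>.\<close>
  let ?W = "cumulant p F - ?S - (\<Sum>n\<in>set_mset m. mvar n * cumulant (n + p - 2) F)"
  have "coef (Z * ?W) m' = 0" if m': "set_mset m' \<subseteq> set_mset m" for m'
  proof -
    have m'0: "0 \<notin># m'" using m m' by auto
    have "coef (c * (Z * cumulant p F)) m' =
      (\<Sum>l<p - 1. coef (c * (c * (Z * (cumulant l F * cumulant (p - 2 - l) F + mconst h
          * cumulant2 l (p - 2 - l) F)))) m') / of_nat N ^ 2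
      + (\<Sum>n\<in>set_mset m'. coef (c * (Z * cumulant (n + p - 2) F)) (m' - {#n#}))"
      using partition_function_loop[OF N m'0 p] unfolding Zp T[symmetric] TT[symmetric] .
    then have "of_nat N ^ 2 * coef (Z * cumulant p F) m' =
      of_nat N ^ 2 * (\<Sum>l<p - 1. coef (Z * (cumulant l F * cumulant (p - 2 - l) F + mconst h
          * cumulant2 l (p - 2 - l) F)) m')
      + of_nat N ^ 2 * (\<Sum>n\<in>set_mset m'. coef (Z * cumulant (n + p - 2) F) (m' - {#n#}))"
      using N by (simp add: c_def sum_distrib_left sum_divide_distrib power2_eq_square)
    then have 1: "coef (Z * cumulant p F) m'
        = coef (Z * ?S) m' + (\<Sum>n\<in>set_mset m'. coef (Z * cumulant (n + p - 2) F) (m' - {#n#}))"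
    proof -
      have S: "coef (Z * ?S) m' = (\<Sum>l<p - 1. coef (Z * (cumulant l F * cumulant (p - 2 - l) F
          + mconst h * cumulant2 l (p - 2 - l) F)) m')"
        by (simp only: sum_distrib_left coef_sum)
      assume "of_nat N ^ 2 * coef (Z * cumulant p F) m' =
        of_nat N ^ 2 * (\<Sum>l<p - 1. coef (Z * (cumulant l F * cumulant (p - 2 - l) F + mconst h
            * cumulant2 l (p - 2 - l) F)) m')
        + of_nat N ^ 2 * (\<Sum>n\<in>set_mset m'. coef (Z * cumulant (n + p - 2) F) (m' - {#n#}))"
      then show ?thesis
        unfolding S distrib_left[symmetric] using N by (subst (asm) mult_left_cancel) auto
    qed
    have "(\<Sum>n\<in>set_mset m'. coef (Z * cumulant (n + p - 2) F) (m' - {#n#})) =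
       (\<Sum>n\<in>set_mset m. coef (mvar n * (Z * cumulant (n + p - 2) F)) m')"
      using m' by (simp add: coef_mvar_mult sum.If_cases Int_absorb1)
    also have "\<dots> = coef (Z * (\<Sum>n\<in>set_mset m. mvar n * cumulant (n + p - 2) F)) m'"
      by (simp add: sum_distrib_left mult.left_commute)
    finally show ?thesis using 1 by (simp add: right_diff_distrib)
  qed
  then have "coef ?W m = 0"
    by (rule coef_mult_eq_0_cancel[OF Z0 _ order_refl])
  then show "coef (cumulant p F) m = coef ?S m + (\<Sum>n\<in>set_mset m. coef (cumulant (n + p - 2) F) (m
      - {#n#}))"
    by (simp add: coef_mvar_mult algebra_simps)
qed

end

section \<open>Transport of the loop equations along ring homomorphisms\<close>

lift_definition mmap :: "('a \<Rightarrow> 'b) \<Rightarrow> 'a mseries \<Rightarrow> 'b mseries" is "\<lambda>f F m. f (F m)" .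

lemma coef_mmap [simp]: "coef (mmap f F) m = f (coef F m)" by transfer simp

context ring_map begin

lemma coef_mmap_mult: "f (coef (F * G) m) = coef (mmap f F * mmap f G) m"
  by (simp add: coef_mult map_sum map_mult)

lemma mmap_cumulant: "mmap f (cumulant p F) = cumulant p (mmap f F)"
  by (intro coef_eqI) (simp add: cumulant_def coef_mderiv coef_1 map_0 map_1 map_mult map_of_nat
      del: of_nat_Suc)

lemma mmap_cumulant2: "mmap f (cumulant2 l q F) = cumulant2 l q (mmap f F)"
proof (intro coef_eqI)
  fix m
  have "coef (mmap f (cumulant q F)) m' = coef (cumulant q (mmap f F)) m'" for m'
      by (simp only: mmap_cumulant)
  then show "coef (mmap f (cumulant2 l q F)) m = coef (cumulant2 l q (mmap f F)) m"
    by (simp add: cumulant2_def coef_mderiv map_0 map_mult map_of_nat del: of_nat_Suc)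
qed

text \<open>Both sides are ring expressions in the coefficients, so the equation can be moved
  between polynomials in \<open>1 / N^2\<close>, their values at each \<open>N\<close>, and their
  constant terms.\<close>

lemma map_loop_sides:
  "f (coef (cumulant p F) m) = coef (cumulant p (mmap f F)) m"
  "f (coef (\<Sum>l<p - 1. cumulant l F * cumulant (p - 2 - l) F + mconst h * cumulant2 l (p - 2
      - l) F) m
       + (\<Sum>n\<in>set_mset m. coef (cumulant (n + p - 2) F) (m - {#n#}))) =
   coef (\<Sum>l<p - 1. cumulant l (mmap f F) * cumulant (p - 2 - l) (mmap f F) + mconst (f h)
       * cumulant2 l (p - 2 - l) (mmap f F)) m
       + (\<Sum>n\<in>set_mset m. coef (cumulant (n + p - 2) (mmap f F)) (m - {#n#}))"
proof -
  have 1: "f (coef (cumulant p F) m) = coef (cumulant p (mmap f F)) m" for p m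
    by (metis coef_mmap mmap_cumulant)
  have 2: "f (coef (cumulant2 l q F) m) = coef (cumulant2 l q (mmap f F)) m" for l q m
    by (metis coef_mmap mmap_cumulant2)
  show "f (coef (cumulant p F) m) = coef (cumulant p (mmap f F)) m" by (rule 1)
  show "f (coef (\<Sum>l<p - 1. cumulant l F * cumulant (p - 2 - l) F + mconst h * cumulant2 l (p - 2
      - l) F) m
       + (\<Sum>n\<in>set_mset m. coef (cumulant (n + p - 2) F) (m - {#n#}))) =
   coef (\<Sum>l<p - 1. cumulant l (mmap f F) * cumulant (p - 2 - l) (mmap f F) + mconst (f h)
       * cumulant2 l (p - 2 - l) (mmap f F)) m
       + (\<Sum>n\<in>set_mset m. coef (cumulant (n + p - 2) (mmap f F)) (m - {#n#}))"
    by (simp only: map_add map_sum map_mult coef_mmap_mult mmap_cumulant coef_sum coef_add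
        coef_mconst_mult 1 2)
qed

end

definition eval_genus :: "nat \<Rightarrow> rat poly \<Rightarrow> complex" where
  "eval_genus N P = poly (map_poly of_rat P) (1 / of_nat N ^ 2)"

interpretation eval_genus: ring_map "eval_genus N" for N
proof
  fix P Q :: "rat poly"
  have "map_poly (of_rat :: rat \<Rightarrow> complex) (P + Q) = map_poly of_rat P + map_poly of_rat Q"
    "map_poly (of_rat :: rat \<Rightarrow> complex) (P * Q) = map_poly of_rat P * map_poly of_rat Q"
    by (auto intro!: poly_eqI simp: coeff_map_poly coeff_mult of_rat_add of_rat_mult of_rat_sum)
  then
  show "eval_genus N (P + Q) = eval_genus N P + eval_genus N Q"
    "eval_genus N (P * Q) = eval_genus N P * eval_genus N Q"
    "eval_genus N 1 = 1"
    by (simp_all add: eval_genus_def)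
qed

interpretation poly_0: ring_map "\<lambda>P. poly P (0 :: rat)"
  by standard simp_all

text \<open>The points \<open>1 / N^2\<close> for \<open>N >= 1\<close> are pairwise distinct, so
  such a polynomial would have infinitely many roots.\<close>

lemma eval_genus_eq_0D:
  assumes "\<And>N. N \<ge> 1 \<Longrightarrow> eval_genus N P = 0"
  shows "P = 0"
proof (rule ccontr)
  assume "P \<noteq> 0"
  then have "map_poly (of_rat :: rat \<Rightarrow> complex) P \<noteq> 0"
    by (simp add: poly_eq_iff coeff_map_poly)
  then have fin: "finite {x. poly (map_poly (of_rat :: rat \<Rightarrow> complex) P) x = 0}"
      by (rule poly_roots_finite)
  have "inj_on (\<lambda>N. 1 / (of_nat N :: complex) ^ 2) {1..}"
  proof (intro inj_onI)
    fix a b :: nat assume "1 / (of_nat a :: complex) ^ 2 = 1 / of_nat b ^ 2" "a \<in> {1..}" "b \<in> {1..}"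
    then have "(of_nat (a ^ 2) :: complex) = of_nat (b ^ 2)" by (simp add: field_simps)
    then have "a ^ 2 = b ^ 2" by (simp only: of_nat_eq_iff)
    then show "a = b" by (simp add: power2_eq_iff_nonneg)
  qed
  then have "infinite ((\<lambda>N. 1 / (of_nat N :: complex) ^ 2) ` {1..})"
    by (simp add: finite_image_iff infinite_Ici)
  moreover have "(\<lambda>N. 1 / (of_nat N :: complex) ^ 2) ` {1..} \<subseteq> {x. poly (map_poly (of_rat :: rat \<Rightarrow>
      complex) P) x = 0}"
    using assms by (auto simp: eval_genus_def)
  ultimately show False using fin finite_subset by blast
qed

section \<open>Existence and uniqueness of the genus expansion\<close>

definition genus_series :: "nat \<Rightarrow> complex mseries" where
  "genus_series N = mconst (1 / of_nat N ^ 2) * mlog (Mseries (partition_function N))"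

lemma coef_power_var_eq_0:
  assumes "\<And>m. 0 \<in># m \<Longrightarrow> coef Y m = 0" "0 \<in># m" "k \<ge> 1"
  shows "coef (Y ^ k) m = 0"
  using assms(3,2)
proof (induction k arbitrary: m rule: nat_induct_at_least)
  case base
  then show ?case by (simp add: assms(1))
next
  case (Suc k)
  have "coef Y p * coef (Y ^ k) (m - p) = 0" for p
  proof (cases "0 \<in># p")
    case False
    then have "0 \<in># m - p" using Suc.prems by (simp add: not_in_iff flip: count_greater_zero_iff)
    then show ?thesis by (simp add: Suc.IH)
  qed (simp add: assms(1))
  then show ?case unfolding power_Suc coef_mult by simp
qed

text \<open>Induction on the weight \<open>sum_mset m\<close>, the total power of \<open>M\<close>
  in the monomial. With one \<open>p\<close> split off, the loop equation expresses the coefficient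
  through coefficients of smaller weight, and \<open>N\<close> enters only as the factor
  \<open>1 / N^2\<close> of the correlator.\<close>

lemma genus_series_poly: "\<exists>P. \<forall>N\<ge>1. coef (genus_series N) m = eval_genus N P"
proof (induction "sum_mset m" arbitrary: m rule: less_induct)
  case less
  \<comment> \<open>The functions of \<open>N\<close> given by rational polynomials in
    \<open>1 / N^2\<close> form a ring, and the recursion stays inside it.\<close>
  define C where "C = {c. \<exists>P. \<forall>N\<ge>1. c N = eval_genus N P}"
  have IH: "(\<lambda>N. coef (genus_series N) m') \<in> C" if "sum_mset m' < sum_mset m" for m'
    using less[OF that] by (auto simp: C_def)
  have C_add: "(\<lambda>N. c N + d N) \<in> C" if "c \<in> C" "d \<in> C" for c d
  proof -
    from that obtain P Q where "\<forall>N\<ge>1. c N = eval_genus N P" "\<forall>N\<ge>1. d N = eval_genus N Q"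
        by (auto simp: C_def)
    then show ?thesis unfolding C_def by (auto intro!: exI[of _ "P + Q"] simp: eval_genus.map_add)
  qed
  have C_mult: "(\<lambda>N. c N * d N) \<in> C" if "c \<in> C" "d \<in> C" for c d
  proof -
    from that obtain P Q where "\<forall>N\<ge>1. c N = eval_genus N P" "\<forall>N\<ge>1. d N = eval_genus N Q"
        by (auto simp: C_def)
    then show ?thesis unfolding C_def by (auto intro!: exI[of _ "P * Q"] simp: eval_genus.map_mult)
  qed
  have C_rat: "(\<lambda>N. of_rat r) \<in> C" for r
    unfolding C_def by (auto intro!: exI[of _ "[:r:]"] simp: eval_genus_def map_poly_pCons)
  have C_nat: "(\<lambda>N. of_nat k) \<in> C" for k using C_rat[of "of_nat k"] by simp
  have C_h: "(\<lambda>N. 1 / of_nat N ^ 2) \<in> C"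
    unfolding C_def by (auto intro!: exI[of _ "[:0, 1:]"] simp: eval_genus_def map_poly_pCons)
  have C_sum: "(\<lambda>N. \<Sum>a\<in>A. c a N) \<in> C" if "\<And>a. a \<in> A \<Longrightarrow> c a \<in> C" for c and A :: "'z set"
    using that C_rat[of 0] by (induction A rule: infinite_finite_induct) (auto intro: C_add)
  consider "m = {#}" | "0 \<in># m" | p m' where "m = add_mset p m'" "p \<ge> 1" "0 \<notin># m'"
    proof (cases "m = {#} \<or> 0 \<in># m")
    case False
    then obtain p m' where "m = add_mset p m'" by (cases m) auto
    then show ?thesis using False that(3)[of p m'] by (cases p) auto
  qed (use that in auto)
  then have "(\<lambda>N. coef (genus_series N) m) \<in> C"
  proof cases
    case 1
    have "coef (genus_series N) m = of_rat 0" for N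
      by (simp add: 1 genus_series_def mlog.rep_eq mps_log_def)
    then show ?thesis using C_rat[of 0] by simp
  next
    case 2
    have "coef (genus_series N) m = 0" if "N \<ge> 1" for N
    proof -
      have "coef (Mseries (partition_function N) - 1) m = 0" if "0 \<in># m" for m
        using that gaussian_expectation_cmult[OF \<open>N \<ge> 1\<close>, of 0 "\<lambda>_. 0"]
        by (auto simp: Mseries_inverse coef_1 partition_function_def interaction_def)
      then have "coef ((Mseries (partition_function N) - 1) ^ k) m = 0" if "k \<ge> 1" for k
        using 2 that by (intro coef_power_var_eq_0)
      then show ?thesis
        unfolding genus_series_def coef_mconst_mult
          coef_mlog[OF coef_partition_function_empty[OF that] order_refl] by simp
    qed
    then show ?thesis unfolding C_def by (auto intro!: exI[of _ 0] simp: eval_genus.map_0)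
  next
    case 3
    have J: "(\<lambda>N. coef (cumulant q (genus_series N)) m0) \<in> C"
        if "sum_mset m0 + q < sum_mset m" for q m0
    proof (cases "q = 0")
      case True
      then show ?thesis using C_nat[of 0] C_nat[of 1] by (auto simp: cumulant_def coef_1)
    next
      case False
      have "(\<lambda>N. of_nat q * (of_nat (Suc (count m0 q))
          * coef (genus_series N) (add_mset q m0))) \<in> C"
        using that by (intro C_mult C_nat IH) simp
      then show ?thesis using False by (simp add: cumulant_def coef_mderiv)
    qed
    have J2: "(\<lambda>N. coef (cumulant2 l q (genus_series N)) m0) \<in> C"
        if "sum_mset m0 + l + q < sum_mset m" for l q m0
    proof (cases "l = 0")
      case True
      then show ?thesis using C_nat[of 0] by (simp add: cumulant2_def)
    next
      case False
      have "(\<lambda>N. of_nat l * (of_nat (Suc (count m0 l))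
          * coef (cumulant q (genus_series N)) (add_mset l m0))) \<in> C"
        using that by (intro C_mult C_nat J) simp
      then show ?thesis using False by (simp add: cumulant2_def coef_mderiv)
    qed
    have wt: "sum_mset p0 \<le> sum_mset m0" if "p0 \<subseteq># m0" for p0 m0 :: "nat multiset"
      using that by (metis le_add1 subset_mset.add_diff_inverse sum_mset.union)
    have "(\<lambda>N. (\<Sum>l<p - 1. (\<Sum>r\<in>{r. r \<subseteq># m'}. coef (cumulant l (genus_series N)) r * coef (cumulant (p
        - 2 - l) (genus_series N)) (m' - r))
        + 1 / of_nat N ^ 2 * coef (cumulant2 l (p - 2 - l) (genus_series N)) m')
       + (\<Sum>n\<in>set_mset m'. coef (cumulant (n + p - 2) (genus_series N)) (m' - {#n#}))) \<in> C"
    proof (intro C_add C_sum C_mult C_h J J2)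
      fix l r assume l: "l \<in> {..<p - 1}" and r: "r \<in> {r. r \<subseteq># m'}"
      then show "sum_mset r + l < sum_mset m" using wt[of r m'] by (simp add: 3)
      show "sum_mset (m' - r) + (p - 2 - l) < sum_mset m" using wt[of "m' - r" m'] l
          by (simp add: 3)
    next
      fix l assume l: "l \<in> {..<p - 1}"
      then show "sum_mset m' + l + (p - 2 - l) < sum_mset m" by (simp add: 3)
    next
      fix n assume n: "n \<in> set_mset m'"
      then have "n \<ge> 1" using 3 by (cases n) auto
      moreover have "sum_mset m' = n + sum_mset (m' - {#n#})"
        using n by (simp add: sum_mset.remove)
      ultimately show "sum_mset (m' - {#n#}) + (n + p - 2) < sum_mset m" using 3 by simp
    qed
    moreover have "coef (cumulant p (genus_series N)) m'
        = (\<Sum>l<p - 1. (\<Sum>r\<in>{r. r \<subseteq># m'}. coef (cumulant l (genus_series N)) r * coef (cumulant (p - 2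
        - l) (genus_series N)) (m' - r))
        + 1 / of_nat N ^ 2 * coef (cumulant2 l (p - 2 - l) (genus_series N)) m')
       + (\<Sum>n\<in>set_mset m'. coef (cumulant (n + p - 2) (genus_series N)) (m' - {#n#}))"
           if "N \<ge> 1" for N
      using loop_eq_log_partition_function[OF that] 3
      unfolding loop_eq_def genus_series_def[symmetric]
          by (simp add: coef_mult[of "cumulant a b" for a b])
    ultimately have "(\<lambda>N. coef (cumulant p (genus_series N)) m') \<in> C"
      unfolding C_def by (auto simp del: of_nat_Suc)
    then have "(\<lambda>N. of_rat (1 / (of_nat p * of_nat (Suc (count m' p))))
        * coef (cumulant p (genus_series N)) m') \<in> C"
      by (intro C_mult C_rat)
    moreover have "of_rat (1 / (of_nat p * of_nat (Suc (count m' p))))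
        * coef (cumulant p (genus_series N)) m' = coef (genus_series N) m" for N
      using 3 by (simp add: cumulant_def coef_mderiv of_rat_divide of_rat_mult del: of_nat_Suc)
    ultimately show ?thesis by simp
  qed
  then show ?case by (simp add: C_def)
qed

definition genus_poly :: "nat multiset \<Rightarrow> rat poly" where
  "genus_poly m = (SOME P. \<forall>N\<ge>1. coef (genus_series N) m = eval_genus N P)"

lemma genus_poly: "N \<ge> 1 \<Longrightarrow> coef (genus_series N) m = eval_genus N (genus_poly m)"
  using someI_ex[OF genus_series_poly[of m]] unfolding genus_poly_def by blast

lemma eval_genus_sum:
  assumes "finite A" "\<And>g. g \<notin> A \<Longrightarrow> coeff P g = 0"
  shows "eval_genus N P = (\<Sum>g\<in>A. of_rat (coeff P g) / of_nat N ^ (2 * g))"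
proof -
  have "eval_genus N P = (\<Sum>g\<le>degree P. of_rat (coeff P g) / of_nat N ^ (2 * g))"
  proof -
    have "degree (map_poly (of_rat :: rat \<Rightarrow> complex) P) = degree P"
      by (rule degree_map_poly) simp
    then show ?thesis
      by (simp add: eval_genus_def poly_altdef coeff_map_poly power_divide power_mult)
  qed
  also have "\<dots> = (\<Sum>g\<in>{..degree P} \<union> A. of_rat (coeff P g) / of_nat N ^ (2 * g))"
    using assms by (intro sum.mono_neutral_left) (auto simp: coeff_eq_0)
  also have "\<dots> = (\<Sum>g\<in>A. of_rat (coeff P g) / of_nat N ^ (2 * g))"
    using assms by (intro sum.mono_neutral_right) auto
  finally show ?thesis .
qed

lemma log_partition_function_eq:
  assumes "N \<ge> 1"
  shows "mps_log (partition_function N) m = of_nat N ^ 2 * eval_genus N (genus_poly m)"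
  using assms by (simp add: genus_poly[symmetric] genus_series_def mlog.rep_eq Mseries_inverse)

lemma powi_genus: "N \<ge> 1 \<Longrightarrow> (of_nat N :: complex) powi (2 - 2 * int g) * c
    = of_nat N ^ 2 * (c / of_nat N ^ (2 * g))"
  by (simp add: power_int_diff power_int_mult power_mult)

text \<open>A polynomial in \<open>1 / N^2\<close> is determined by its values at all
  \<open>N\<close>. The definite description behind \<open>genus_free_energy\<close> therefore
  denotes the coefficients of \<open>genus_poly\<close>.\<close>

lemma is_genus_expansion_iff: "is_genus_expansion F \<longleftrightarrow> F = (\<lambda>g m. coeff (genus_poly m) g)"
proof
  assume F: "is_genus_expansion F"
  show "F = (\<lambda>g m. coeff (genus_poly m) g)"
  proof (intro ext)
    fix g m
    have fin: "finite {g. F g m \<noteq> 0}" using F by (simp add: is_genus_expansion_def)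
    define Q where "Q = (\<Sum>g\<in>{g. F g m \<noteq> 0}. monom (F g m) g)"
    have cQ: "coeff Q g = F g m" for g
      using fin by (simp add: Q_def coeff_sum)
    have "eval_genus N (genus_poly m - Q) = 0" if N: "N \<ge> 1" for N
    proof -
      have "of_nat N ^ 2 * eval_genus N (genus_poly m)
          = (\<Sum>g\<in>{g. F g m \<noteq> 0}. of_nat N powi (2 - 2 * int g) * of_rat (F g m))"
        using F N by (simp add: is_genus_expansion_def log_partition_function_eq)
      also have "\<dots> = of_nat N ^ 2 * eval_genus N Q"
        using fin N by (subst eval_genus_sum[of "{g. F g m \<noteq> 0}"]) (auto simp: cQ powi_genus
            sum_distrib_left)
      finally show ?thesis using N by (simp add: eval_genus.map_diff)
    qed
    then have "genus_poly m = Q" using eval_genus_eq_0D by fastforce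
    then show "F g m = coeff (genus_poly m) g" by (simp add: cQ)
  qed
next
  assume F: "F = (\<lambda>g m. coeff (genus_poly m) g)"
  have fin: "finite {g. coeff P g \<noteq> 0}" for P :: "rat poly"
    by (rule finite_subset[of _ "{..degree P}"]) (auto simp: le_degree)
  show "is_genus_expansion F"
    unfolding is_genus_expansion_def F
  proof (intro allI impI conjI fin)
    fix m N assume N: "N \<ge> (1::nat)"
    show "mps_log (partition_function N) m
        = (\<Sum>g\<in>{g. coeff (genus_poly m) g \<noteq> 0}. of_nat N powi (2 - 2 * int g)
        * of_rat (coeff (genus_poly m) g))"
      unfolding log_partition_function_eq[OF N]
      by (subst eval_genus_sum[OF fin[of "genus_poly m"]]) (auto simp: powi_genus[OF N]
          sum_distrib_left)
  qed
qed

lemma planar_limit_eq: "planar_limit m = poly (genus_poly m) 0"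
proof -
  have "genus_free_energy = (\<lambda>g m. coeff (genus_poly m) g)"
    unfolding genus_free_energy_def is_genus_expansion_iff by simp
  then have "genus_free_energy 0 m = coeff (genus_poly m) 0" by (rule fun_cong[OF fun_cong])
  then show ?thesis by (simp only: planar_limit_def poly_0_coeff_0)
qed

lemma planar_limit_var_0:
  assumes "m = {#}"
  shows "planar_limit m = 0"
proof -
  have "genus_poly {#} = 0"
    by (rule eval_genus_eq_0D) (simp add: genus_poly[symmetric] genus_series_def mlog.rep_eq
        mps_log_def)
  then show ?thesis using assms by (simp add: planar_limit_eq)
qed

text \<open>The loop equation holds at \<open>h = 1 / N^2\<close> for every \<open>N\<close>, hence
  as an identity between polynomials in \<open>h\<close>, written \<open>[:0, 1:]\<close>. Its value
  at \<open>h = 0\<close> is the planar equation, so no limit in \<open>N\<close> is taken.\<close>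

theorem loop_eq_planar_limit: "loop_eq 0 (Mseries planar_limit)"
  unfolding loop_eq_def
proof (intro allI impI)
  fix p m assume p: "p \<ge> (1::nat)" and m: "0 \<notin># (m :: nat multiset)"
  define F where "F = Mseries genus_poly"
  let ?l = "\<lambda>F. coef (cumulant p F) m"
  let ?r = "\<lambda>h F. coef (\<Sum>l<p - 1. cumulant l F * cumulant (p - 2 - l) F + mconst h * cumulant2 l (p
      - 2 - l) F) m
       + (\<Sum>n\<in>set_mset m. coef (cumulant (n + p - 2) F) (m - {#n#}))"
  have "eval_genus N (?l F - ?r [:0, 1:] F) = 0" if N: "N \<ge> 1" for N
  proof -
    have "mmap (eval_genus N) F = genus_series N"
      using N by (intro coef_eqI) (simp add: F_def Mseries_inverse genus_poly)
    moreover have "eval_genus N [:0, 1:] = 1 / of_nat N ^ 2"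
        by (simp add: eval_genus_def map_poly_pCons)
    moreover have "?l (genus_series N) = ?r (1 / of_nat N ^ 2) (genus_series N)"
      by (rule loop_eq_log_partition_function[OF N, folded genus_series_def, unfolded loop_eq_def,
          rule_format, OF p m])
    ultimately show ?thesis by (simp only: eval_genus.map_diff eval_genus.map_loop_sides) simp
  qed
  then have "?l F - ?r [:0, 1:] F = 0" by (rule eval_genus_eq_0D)
  then have "poly (?l F) 0 = poly (?r [:0, 1:] F) 0" by simp
  moreover have "mmap (\<lambda>P. poly P 0) F = Mseries planar_limit"
    by (intro coef_eqI) (simp add: F_def Mseries_inverse planar_limit_eq)
  ultimately show "?l (Mseries planar_limit) = ?r 0 (Mseries planar_limit)"
    by (simp only: poly_0.map_loop_sides) simp
qed

section \<open>Specialization to one parameter\<close>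

text \<open>The power of \<open>s\<close> that the monomial receives from
  \<open>a_n = c_n s^(n-2)\<close>. The truncated difference matters only for \<open>n < 2\<close>,
  and such monomials are excluded from \<open>excess_msets\<close>.\<close>

definition excess :: "nat multiset \<Rightarrow> nat" where
  "excess m = (\<Sum>n\<in>#m. n - 2)"

lemma sum_count_mult:
  assumes "finite A"
  shows "set_mset m \<subseteq> A \<Longrightarrow> (\<Sum>n\<in>A. count m n * f n) = (\<Sum>n\<in>#m. f n :: nat)"
proof (induction m)
  case (add x m)
  have "(\<Sum>n\<in>A. count (add_mset x m) n * f n) = (\<Sum>n\<in>A. count m n * f n + (if n = x then f x else 0))"
    by (intro sum.cong) auto
  also have "\<dots> = (\<Sum>n\<in>A. count m n * f n) + f x"
    using assms add.prems by (simp add: sum.distrib)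
  finally show ?case using add by simp
qed simp

definition excess_msets :: "nat \<Rightarrow> nat multiset set" where
  "excess_msets j = {m. (\<forall>n\<in>#m. 3 \<le> n) \<and> excess m = j}"

definition monom_weight :: "(nat \<Rightarrow> rat) \<Rightarrow> nat multiset \<Rightarrow> rat" where
  "monom_weight c m = (\<Prod>n\<in>#m. c n)"

lemma excess_simps [simp]:
  "excess {#} = 0" "excess (add_mset n m) = n - 2 + excess m" "excess (m + m')
      = excess m + excess m'"
  by (simp_all add: excess_def)

lemma monom_weight_simps [simp]:
  "monom_weight c {#} = 1" "monom_weight c (add_mset n m) = c n * monom_weight c m"
  "monom_weight c (m + m') = monom_weight c m * monom_weight c m'"
  by (simp_all add: monom_weight_def)

text \<open>Every element \<open>n >= 3\<close> contributes at least 1, and exactly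
  \<open>n - 2\<close>, to the excess; this bounds both the number and the size of the
  elements.\<close>

lemma finite_excess_msets [simp]: "finite (excess_msets j)"
proof -
  have *: "size m \<le> excess m \<and> (\<forall>n\<in>#m. n \<le> excess m + 2)" if "\<forall>n\<in>#m. 3 \<le> n" for m
    using that by (induction m) fastforce+
  have "excess_msets j \<subseteq> mset ` {xs. set xs \<subseteq> {..j + 2} \<and> length xs \<le> j}"
  proof
    fix m assume m: "m \<in> excess_msets j"
    obtain xs where "m = mset xs" using ex_mset by metis
    with m *[of m] show "m \<in> mset ` {xs. set xs \<subseteq> {..j + 2} \<and> length xs \<le> j}"
      by (auto simp: excess_msets_def intro!: imageI)
  qed
  then show ?thesis by (rule finite_subset) (intro finite_imageI finite_lists_length_le, simp)
qed

text \<open>The substitution \<open>a\<^sub>n = c\<^sub>n s\<^sup>n\<^sup>-\<^sup>2\<close> for \<open>n \<ge> 3\<close> and \<open>a\<^sub>n = 0\<close> otherwise.\<close>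

definition specialize :: "(nat \<Rightarrow> rat) \<Rightarrow> rat mseries \<Rightarrow> rat fps" where
  "specialize c G = Abs_fps (\<lambda>j. \<Sum>m\<in>excess_msets j. coef G m * monom_weight c m)"

lemma specialize_nth: "fps_nth (specialize c G) j
    = (\<Sum>m\<in>excess_msets j. coef G m * monom_weight c m)"
  by (simp add: specialize_def)

lemma excess_msets_0 [simp]: "excess_msets 0 = {{#}}"
proof -
  have "m = {#}" if "\<forall>n\<in>#m. 3 \<le> n" "excess m = 0" for m :: "nat multiset"
    using that by (cases m) auto
  then show ?thesis by (auto simp: excess_msets_def)
qed

lemma specialize_1 [simp]: "specialize c 1 = 1"
proof (rule fps_ext)
  fix j
  show "fps_nth (specialize c 1) j = fps_nth 1 j"
  proof (cases "j = 0")
    case False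
    then have "coef 1 m * monom_weight c m = 0" if "m \<in> excess_msets j" for m
      using that by (auto simp: coef_1 excess_msets_def)
    then show ?thesis using False by (auto simp: specialize_nth intro!: sum.neutral)
  qed (simp add: specialize_nth coef_1)
qed

lemma excess_diff:
  assumes "p \<subseteq># m"
  shows "excess (m - p) = excess m - excess p" "excess p \<le> excess m"
proof -
  have "m = p + (m - p)" using assms by simp
  then have "excess m = excess p + excess (m - p)" by (metis excess_simps(3))
  then show "excess (m - p) = excess m - excess p" "excess p \<le> excess m" by simp_all
qed

text \<open>Excess is additive and weight multiplicative over the union of multisets, which makes
  the substitution compatible with products.\<close>

lemma specialize_mult: "specialize c (G * H) = specialize c G * specialize c H"
proof (rule fps_ext)
  fix j
  let ?G = "\<lambda>m. coef G m * monom_weight c m" and ?H = "\<lambda>m. coef H m * monom_weight c m"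
  have "fps_nth (specialize c (G * H)) j = (\<Sum>m\<in>excess_msets j. \<Sum>p\<in>{p. p \<subseteq># m}. ?G p * ?H (m - p))"
    unfolding specialize_nth coef_mult sum_distrib_right
  proof (intro sum.cong refl)
    fix m p :: "nat multiset" assume "p \<in> {p. p \<subseteq># m}"
    then have "p + (m - p) = m" by simp
    then have "monom_weight c m = monom_weight c p * monom_weight c (m - p)"
      using monom_weight_simps(3)[of c p "m - p"] by simp
    then show "coef G p * coef H (m - p) * monom_weight c m = ?G p * ?H (m - p)" by simp
  qed
  also have "\<dots> = (\<Sum>(m, p)\<in>(SIGMA m:excess_msets j. {p. p \<subseteq># m}). ?G p * ?H (m - p))"
    by (simp add: sum.Sigma)
  also have "\<dots> = (\<Sum>(i, p, q)\<in>(SIGMA i:{0..j}. excess_msets i \<times> excess_msets (j - i)). ?G p * ?H q)"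
    by (rule sum.reindex_bij_witness[of _ "\<lambda>(i, p, q). (p + q, p)" "\<lambda>(m, p). (excess p, p, m - p)"])
       (auto simp: excess_msets_def excess_diff dest: in_diffD mset_subset_eqD)
  also have "\<dots> = (\<Sum>i=0..j. \<Sum>p\<in>excess_msets i. \<Sum>q\<in>excess_msets (j - i). ?G p * ?H q)"
    by (simp add: sum.Sigma sum.cartesian_product)
  also have "\<dots> = fps_nth (specialize c G * specialize c H) j"
    by (simp add: fps_mult_nth specialize_nth sum_product)
  finally show "fps_nth (specialize c (G * H)) j = fps_nth (specialize c G * specialize c H) j" .
qed

text \<open>Multiplication by \<open>\<Sum>\<^sub>n b\<^sub>n a\<^sub>n\<close>, after the substitution.\<close>

lemma specialize_shift:
  "(\<Sum>m\<in>excess_msets j. (\<Sum>n\<in>set_mset m. b n * coef (G n) (m - {#n#})) * monom_weight c m) =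
   (\<Sum>n=3..j + 2. b n * c n * fps_nth (specialize c (G n)) (j - (n - 2)))"
proof -
  have "(\<Sum>m\<in>excess_msets j. (\<Sum>n\<in>set_mset m. b n * coef (G n) (m - {#n#})) * monom_weight c m) =
     (\<Sum>(m, n)\<in>(SIGMA m:excess_msets j. set_mset m). b n * coef (G n) (m - {#n#})
         * monom_weight c m)"
    by (simp add: sum.Sigma sum_distrib_right)
  also have "\<dots> = (\<Sum>(n, m)\<in>(SIGMA n:{3..j + 2}. excess_msets (j - (n - 2))). b n * coef (G n) m
      * (c n * monom_weight c m))"
  proof (rule sum.reindex_bij_witness[of _ "\<lambda>(n, m). (add_mset n m, n)" "\<lambda>(m, n). (n, m - {#n#})"])
    fix a :: "nat multiset \<times> nat" assume "a \<in> (SIGMA m:excess_msets j. set_mset m)"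
    then obtain m n where a: "a = (m, n)" "m \<in> excess_msets j" "n \<in># m" by auto
    then obtain m' where m: "m = add_mset n m'" by (auto dest: multi_member_split)
    show "(case case a of (m, n) \<Rightarrow> (n, m - {#n#}) of (n, m) \<Rightarrow> (add_mset n m, n)) = a"
      "(case a of (m, n) \<Rightarrow> (n, m - {#n#})) \<in> (SIGMA n:{3..j + 2}. excess_msets (j - (n - 2)))"
      "(case case a of (m, n) \<Rightarrow> (n, m - {#n#}) of (n, m) \<Rightarrow> b n * coef (G n) m * (c n
          * monom_weight c m)) =
       (case a of (m, n) \<Rightarrow> b n * coef (G n) (m - {#n#}) * monom_weight c m)"
      using a(2) unfolding a(1) m by (auto simp: excess_msets_def)
  qed (auto simp: excess_msets_def)
  also have "\<dots> = (\<Sum>n=3..j + 2. \<Sum>m\<in>excess_msets (j - (n - 2)). b n * coef (G n) m * (c n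
      * monom_weight c m))"
    by (subst sum.Sigma) simp_all
  finally show ?thesis by (simp add: specialize_nth sum_distrib_left mult_ac del: sum.cl_ivl_Suc)
qed

definition planar_series :: "(nat \<Rightarrow> rat) \<Rightarrow> rat fps" where
  "planar_series c = specialize c (Mseries planar_limit)"

definition planar_moment :: "(nat \<Rightarrow> rat) \<Rightarrow> nat \<Rightarrow> rat fps" where
  "planar_moment c p = specialize c (cumulant p (Mseries planar_limit))"

lemma specialize_sum: "specialize c (sum G A) = (\<Sum>k\<in>A. specialize c (G k))"
  by (rule fps_ext) (simp add: specialize_nth fps_sum_nth sum_distrib_right sum.swap[of _ A])

lemma planar_moment_0: "planar_moment c 0 = 1"
  by (simp add: planar_moment_def cumulant_def)

lemma planar_moment_loop:
  assumes "p \<ge> 1"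
  shows "fps_nth (planar_moment c p) j =
    fps_nth (\<Sum>l<p - 1. planar_moment c l * planar_moment c (p - 2 - l)) j
    + (\<Sum>n=3..j + 2. c n * fps_nth (planar_moment c (n + p - 2)) (j - (n - 2)))"
proof -
  let ?F = "Mseries planar_limit"
  have "fps_nth (planar_moment c p) j = (\<Sum>m\<in>excess_msets j. (coef (\<Sum>l<p - 1. cumulant l ?F
      * cumulant (p - 2 - l) ?F) m
      + (\<Sum>n\<in>set_mset m. 1 * coef (cumulant (n + p - 2) ?F) (m - {#n#}))) * monom_weight c m)"
    unfolding planar_moment_def specialize_nth
  proof (intro sum.cong refl)
    fix m assume "m \<in> excess_msets j"
    then have "0 \<notin># m" by (auto simp: excess_msets_def)
    then have "coef (cumulant p ?F) m = coef (\<Sum>l<p - 1. cumulant l ?F * cumulant (p - 2 - l) ?F) m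
      + (\<Sum>n\<in>set_mset m. 1 * coef (cumulant (n + p - 2) ?F) (m - {#n#}))"
      using loop_eq_planar_limit assms by (simp add: loop_eq_def)
    then show "coef (cumulant p ?F) m * monom_weight c m
        = (coef (\<Sum>l<p - 1. cumulant l ?F * cumulant (p - 2 - l) ?F) m
      + (\<Sum>n\<in>set_mset m. 1 * coef (cumulant (n + p - 2) ?F) (m - {#n#}))) * monom_weight c m"
          by (simp only:)
  qed
  also have "\<dots> = fps_nth (specialize c (\<Sum>l<p - 1. cumulant l ?F * cumulant (p - 2 - l) ?F)) j +
     (\<Sum>n=3..j + 2. c n * fps_nth (planar_moment c (n + p - 2)) (j - (n - 2)))"
    unfolding distrib_right sum.distrib specialize_shift specialize_nth[symmetric] planar_moment_def
        by simp
  finally show ?thesis by (simp add: specialize_sum specialize_mult planar_moment_def)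
qed

text \<open>Euler's identity: \<open>s d/ds\<close> multiplies a monomial by its excess, that is,
  acts as the sum of \<open>(n - 2) a_n d/da_n\<close>. Writing \<open>n - 2 = n (1 - 2/n)\<close>
  turns the derivatives into moments.\<close>

lemma planar_series_euler:
  "of_nat j * fps_nth (planar_series c) j =
    (\<Sum>n=3..j + 2. (1 - 2 / of_nat n) * c n * fps_nth (planar_moment c n) (j - (n - 2)))"
proof -
  let ?F = "Mseries planar_limit"
  have "of_nat j * fps_nth (planar_series c) j
      = (\<Sum>m\<in>excess_msets j. (\<Sum>n\<in>set_mset m. (1 - 2 / of_nat n) * coef (cumulant n ?F) (m - {#n#}))
      * monom_weight c m)"
    unfolding planar_series_def specialize_nth sum_distrib_left
  proof (intro sum.cong refl)
    fix m assume m: "m \<in> excess_msets j"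
    have "(1 - 2 / of_nat n) * coef (cumulant n ?F) (m - {#n#})
        = of_nat (n - 2) * of_nat (count m n) * coef ?F m" if nm: "n \<in># m" for n
    proof -
      obtain m' where m': "m = add_mset n m'" using multi_member_split[OF nm] by blast
      have "n \<ge> 3" using m nm by (auto simp: excess_msets_def)
      then show ?thesis by (simp add: m' cumulant_def coef_mderiv of_nat_diff field_simps del:
          of_nat_Suc)
    qed
    then have "(\<Sum>n\<in>set_mset m. (1 - 2 / of_nat n) * coef (cumulant n ?F) (m - {#n#}))
        = (\<Sum>n\<in>set_mset m. of_nat (n - 2) * of_nat (count m n)) * coef ?F m"
      by (simp add: sum_distrib_right)
    also have "(\<Sum>n\<in>set_mset m. of_nat (n - 2) * of_nat (count m n)) = (of_nat (excess m) :: rat)"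
      unfolding excess_def using sum_count_mult[of "set_mset m" m "\<lambda>n. n - 2"]
      by (simp add: mult.commute flip: of_nat_mult of_nat_sum)
    finally show "of_nat j * (coef ?F m * monom_weight c m)
        = (\<Sum>n\<in>set_mset m. (1 - 2 / of_nat n) * coef (cumulant n ?F) (m - {#n#})) * monom_weight c m"
      using m by (simp add: excess_msets_def)
  qed
  then show ?thesis by (simp add: specialize_shift planar_moment_def)
qed

section \<open>The two given substitutions as special cases\<close>

definition weights_full :: "nat \<Rightarrow> rat" where
  "weights_full n = (if 3 \<le> n then 1 else 0)"

definition weights_even :: "nat \<Rightarrow> rat" where
  "weights_even n = (if even n \<and> 4 \<le> n then 1 else 0)"

lemma monom_weight_eq_0:
  assumes "\<And>n. n < 3 \<Longrightarrow> c n = 0" "\<not> (\<forall>n\<in>#m. 3 \<le> n)"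
  shows "monom_weight c m = 0"
proof -
  obtain n where "n \<in># m" "c n = 0" using assms by (metis not_le)
  then show ?thesis by (auto simp: monom_weight_def intro!: bexI[of _ n])
qed

text \<open>The second assumption says that every monomial becomes its weight times one power of the
  new variable. Separate indices \<open>k\<close> and \<open>j\<close> allow for
  \<open>t = s^2\<close>, where \<open>j = 2 k\<close>.\<close>

lemma mps_subst_planar:
  assumes c: "\<And>n. n < 3 \<Longrightarrow> c n = 0"
    and a: "\<And>m. fps_nth (\<Prod>n\<in>#m. a n) k = (if excess m = j then monom_weight c m else 0)"
  shows "fps_nth (mps_subst planar_limit a) k = fps_nth (planar_series c) j"
proof -
  have "fps_nth (mps_subst planar_limit a) k = Sum_any (\<lambda>m. planar_limit m * (if excess m
      = j then monom_weight c m else 0))"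
    by (simp add: mps_subst_def a)
  also have "\<dots> = (\<Sum>m\<in>excess_msets j. planar_limit m * (if excess m
      = j then monom_weight c m else 0))"
  proof (rule Sum_any.expand_superset)
    show "{m. planar_limit m * (if excess m = j then monom_weight c m else 0) \<noteq> 0} \<subseteq> excess_msets j"
      using monom_weight_eq_0[of c, OF c] by (auto simp: excess_msets_def split: if_splits)
  qed simp
  also have "\<dots> = fps_nth (planar_series c) j"
    by (auto simp: planar_series_def specialize_nth Mseries_inverse excess_msets_def intro!:
        sum.cong)
  finally show ?thesis .
qed

lemma planar_full_sqrt_eq: "planar_full_sqrt = planar_series weights_full"
proof (rule fps_ext)
  fix k
  have "(\<Prod>n\<in>#m. coeffs_full n) = fps_const (monom_weight weights_full m) * fps_X ^ excess m" for m
    by (induction m) (auto simp: coeffs_full_def weights_full_def power_add)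
  then show "fps_nth planar_full_sqrt k = fps_nth (planar_series weights_full) k"
    unfolding planar_full_sqrt_def by (intro mps_subst_planar) (auto simp: weights_full_def)
qed

lemma planar_even_nth: "fps_nth planar_even k = fps_nth (planar_series weights_even) (2 * k)"
proof -
  have 1: "(\<Prod>n\<in>#m. coeffs_even n)
      = fps_const (monom_weight weights_even m) * fps_X ^ (excess m div 2) \<and>
     (monom_weight weights_even m \<noteq> 0 \<longrightarrow> even (excess m))" for m
  proof (induction m)
    case (add n m)
    show ?case
    proof (cases "even n \<and> 4 \<le> n")
      case True
      then obtain i where "n = 2 * i" "2 \<le> i" by auto
      then have "n - 2 = 2 * (i - 1)" "n div 2 - 1 = i - 1" by auto
      then show ?thesis using add True
        by (auto simp: coeffs_even_def weights_even_def power_add[symmetric] mult.left_commute)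
    qed (auto simp: coeffs_even_def weights_even_def)
  qed simp
  show ?thesis
    unfolding planar_even_def
  proof (rule mps_subst_planar)
    fix m
    show "fps_nth (\<Prod>n\<in>#m. coeffs_even n) k = (if excess m
        = 2 * k then monom_weight weights_even m else 0)"
    proof (cases "monom_weight weights_even m = 0")
      case False
      then have "even (excess m)" using 1[of m] by simp
      then have "k = excess m div 2 \<longleftrightarrow> excess m = 2 * k" by presburger
      then show ?thesis using 1[of m] by auto
    next
      case True
      then have "(\<Prod>n\<in>#m. coeffs_even n) = 0"
        using conjunct1[OF 1[of m]] by (simp only: fps_const_0_eq_0 mult_zero_left)
      then show ?thesis using True by (simp only: fps_zero_nth if_cancel)
    qed
  qed (simp add: weights_even_def)
qed

section \<open>The resolvent\<close>

no_notation index_mat (infixl "$$" 100)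
notation fls_nth (infixl "$$" 75)

interpretation fls_const: ring_map "fls_const :: rat \<Rightarrow> rat fls"
  by standard (simp_all add: fls_plus_const)

interpretation poly_const: ring_map "\<lambda>c :: rat. [:c:]"
  by standard simp_all

interpretation poly_at: ring_map "\<lambda>p. poly p (x :: rat)" for x
  by standard simp_all

definition poly_inv_y :: "rat poly \<Rightarrow> rat fls" where
  "poly_inv_y p = poly (map_poly fls_const p) fls_X_inv"

interpretation poly_inv_y: ring_map poly_inv_y
proof
  fix P Q :: "rat poly"
  have "map_poly (fls_const :: rat \<Rightarrow> rat fls) (P + Q) = map_poly fls_const P + map_poly fls_const Q"
    "map_poly (fls_const :: rat \<Rightarrow> rat fls) (P * Q) = map_poly fls_const P * map_poly fls_const Q"
    by (intro poly_eqI, simp only: coeff_map_poly coeff_add fls_const.map_add fls_const_0)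
       (intro poly_eqI, simp only: coeff_map_poly coeff_mult fls_const.map_mult fls_const.map_sum
           fls_const_0)
  then show "poly_inv_y (P + Q) = poly_inv_y P + poly_inv_y Q"
    "poly_inv_y (P * Q) = poly_inv_y P * poly_inv_y Q" "poly_inv_y 1 = 1"
    by (simp_all add: poly_inv_y_def)
qed

lemma poly_inv_y_nth: "poly_inv_y p $$ i = (if i \<le> 0 then coeff p (nat (- i)) else 0)"
proof -
  have deg: "degree (map_poly (fls_const :: rat \<Rightarrow> rat fls) p) = degree p"
    by (rule degree_map_poly) simp
  have "poly_inv_y p $$ i = (\<Sum>k\<le>degree p. if i = - int k then coeff p k else 0)"
    by (simp add: poly_inv_y_def poly_altdef deg coeff_map_poly fls_nth_sum if_distrib cong:
        if_cong)
  also have "\<dots> = (\<Sum>k\<le>degree p. if k = nat (- i) \<and> i \<le> 0 then coeff p (nat (- i)) else 0)"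
    by (intro sum.cong) auto
  also have "\<dots> = (if i \<le> 0 then coeff p (nat (- i)) else 0)"
    by (auto simp: coeff_eq_0)
  finally show ?thesis .
qed

text \<open>The ring \<open>\<rat>((y))[[s]]\<close>. Coefficients of powers of \<open>y\<close> are series in \<open>s\<close>.\<close>

type_synonym rser = "rat fls fps"

definition coeff_y :: "int \<Rightarrow> rser \<Rightarrow> rat fps" where
  "coeff_y i w = Abs_fps (\<lambda>j. fps_nth w j $$ i)"

lemma coeff_y_nth: "fps_nth (coeff_y i w) j = fps_nth w j $$ i"
  by (simp add: coeff_y_def)

abbreviation emb :: "rat fps \<Rightarrow> rser" where
  "emb \<equiv> fps_map fls_const"

lemma coeff_y_add: "coeff_y i (v + w) = coeff_y i v + coeff_y i w"
  by (rule fps_ext) (simp add: coeff_y_nth)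

lemma coeff_y_diff: "coeff_y i (v - w) = coeff_y i v - coeff_y i w"
  by (rule fps_ext) (simp add: coeff_y_nth)

lemma coeff_y_emb: "coeff_y i (emb A * w) = A * coeff_y i w"
  by (rule fps_ext) (simp add: coeff_y_nth fps_mult_nth fls_nth_sum)

lemma coeff_y_deriv: "coeff_y i (fps_deriv w) = fps_deriv (coeff_y i w)"
  by (rule fps_ext) (simp add: coeff_y_nth fls_of_nat)

text \<open>An order at infinity in \<open>y\<close>, uniform in the powers of \<open>s\<close>. A
  series that is both \<open>bounded_y (-1)\<close> and regular in the sense below is 0, so the two
  notions separate negative from nonnegative powers.\<close>

definition bounded_y :: "int \<Rightarrow> rser \<Rightarrow> bool" where
  "bounded_y k w \<longleftrightarrow> (\<forall>j i. i > k \<longrightarrow> fps_nth w j $$ i = 0)"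

definition regular_y :: "rser \<Rightarrow> bool" where
  "regular_y w \<longleftrightarrow> (\<forall>j i. i < 0 \<longrightarrow> fps_nth w j $$ i = 0)"

lemma bounded_yI: "(\<And>j i. i > k \<Longrightarrow> fps_nth w j $$ i = 0) \<Longrightarrow> bounded_y k w"
  by (simp add: bounded_y_def)

lemma bounded_yD: "bounded_y k w \<Longrightarrow> i > k \<Longrightarrow> fps_nth w j $$ i = 0"
  unfolding bounded_y_def by blast

lemma regular_yI: "(\<And>j i. i < 0 \<Longrightarrow> fps_nth w j $$ i = 0) \<Longrightarrow> regular_y w"
  by (simp add: regular_y_def)

lemma regular_yD: "regular_y w \<Longrightarrow> i < 0 \<Longrightarrow> fps_nth w j $$ i = 0"
  unfolding regular_y_def by blast

lemma bounded_y_mono: "bounded_y k w \<Longrightarrow> k \<le> l \<Longrightarrow> bounded_y l w"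
  by (rule bounded_yI) (simp add: bounded_yD)

lemma bounded_y_diff: "bounded_y k v \<Longrightarrow> bounded_y k w \<Longrightarrow> bounded_y k (v - w)"
  by (rule bounded_yI) (simp add: bounded_yD)

lemma bounded_y_emb: "bounded_y k w \<Longrightarrow> bounded_y k (emb A * w)"
  by (rule bounded_yI) (simp add: bounded_yD fps_mult_nth fls_nth_sum)

lemma bounded_y_deriv: "bounded_y k w \<Longrightarrow> bounded_y k (fps_deriv w)"
  by (rule bounded_yI) (simp add: bounded_yD fls_of_nat)

lemma fls_mult_nth_bounded:
  fixes f g :: "rat fls"
  assumes "\<And>i. i > a \<Longrightarrow> f $$ i = 0" "\<And>i. i > b \<Longrightarrow> g $$ i = 0" "i \<ge> a + b"
  shows "(f * g) $$ i = (if i = a + b then f $$ a * g $$ b else 0)"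
proof -
  have "(f * g) $$ i = (\<Sum>n=fls_subdegree f..i - fls_subdegree g. f $$ n * g $$ (i - n))"
    by (rule fls_times_nth(2))
  also have "\<dots> = (\<Sum>n=fls_subdegree f..i - fls_subdegree g.
      if n = a then (if i = a + b then f $$ a * g $$ b else 0) else 0)"
  proof (intro sum.cong refl)
    fix n
    show "f $$ n * g $$ (i - n) = (if n = a then (if i = a + b then f $$ a * g $$ b else 0) else 0)"
    proof (cases n a rule: linorder_cases)
      case less
      then have "i - n > b" using assms(3) by linarith
      then show ?thesis using assms(2) less by simp
    next
      case equal
      then show ?thesis using assms(2)[of "i - n"] assms(3) by auto
    next
      case greater
      then show ?thesis using assms(1) by simp
    qed
  qed
  also have "\<dots> = (if i = a + b then f $$ a * g $$ b else 0)"
  proof (cases "a \<in> {fls_subdegree f..i - fls_subdegree g}")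
    case False
    then have "f $$ a = 0 \<or> (i = a + b \<longrightarrow> g $$ b = 0)" by (cases "a < fls_subdegree f") auto
    then show ?thesis using False by auto
  qed simp
  finally show ?thesis .
qed

lemma
  assumes "bounded_y a v" "bounded_y b w"
  shows bounded_y_mult: "bounded_y (a + b) (v * w)"
    and coeff_y_mult_top: "coeff_y (a + b) (v * w) = coeff_y a v * coeff_y b w"
proof -
  have "(fps_nth v m * fps_nth w n) $$ i = (if i
      = a + b then fps_nth v m $$ a * fps_nth w n $$ b else 0)" if "i \<ge> a + b" for m n i
    using that by (intro fls_mult_nth_bounded bounded_yD[OF assms(1)] bounded_yD[OF assms(2)])
  then show "bounded_y (a + b) (v * w)" "coeff_y (a + b) (v * w) = coeff_y a v * coeff_y b w"
    by (auto simp: fps_mult_nth fls_nth_sum coeff_y_nth intro!: fps_ext bounded_yI)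
qed

lemma regular_y_diff: "regular_y v \<Longrightarrow> regular_y w \<Longrightarrow> regular_y (v - w)"
  by (rule regular_yI) (simp add: regular_yD)

lemma regular_y_deriv: "regular_y w \<Longrightarrow> regular_y (fps_deriv w)"
  by (rule regular_yI) (simp add: regular_yD fls_of_nat)

lemma regular_y_mult:
  assumes "regular_y v" "regular_y w"
  shows "regular_y (v * w)"
proof (rule regular_yI)
  fix j and i :: int assume i: "i < 0"
  have "(fps_nth v m * fps_nth w n) $$ i = 0" for m n
  proof (rule fls_times_nth_eq0)
    have "0 \<le> fls_subdegree (fps_nth v m)" "0 \<le> fls_subdegree (fps_nth w n)"
      by (rule fls_subdegree_ge0I, erule regular_yD[OF assms(1)]) (rule fls_subdegree_ge0I,
          erule regular_yD[OF assms(2)])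
    then show "i < fls_subdegree (fps_nth v m) + fls_subdegree (fps_nth w n)" using i by linarith
  qed
  then show "fps_nth (v * w) j $$ i = 0" by (simp add: fps_mult_nth fls_nth_sum)
qed

lemma regular_y_const: "regular_y (fps_const (fps_to_fls f))"
  by (rule regular_yI) simp

lemma regular_y_emb: "regular_y (emb A)"
  by (rule regular_yI) simp

text \<open>The linearized loop equation has only the trivial solution.\<close>

lemma loop_uniqueness:
  assumes d: "bounded_y (-2) d" and reg: "regular_y (A * d)"
    and A: "fls_subdegree (fps_nth A 0) = 1"
  shows "d = 0"
proof (rule ccontr)
  assume "d \<noteq> 0"
  \<comment> \<open>At the lowest power of \<open>s\<close> in \<open>d\<close> only the part of
    \<open>A\<close> of order \<open>s^0\<close> contributes. It raises the \<open>y\<close>-order,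
    which is at most -2, by exactly 1, so a negative power of \<open>y\<close> survives.\<close>
  define j where "j = subdegree d"
  have dj: "fps_nth d j \<noteq> 0"
    unfolding j_def by (rule nth_subdegree_nonzero[OF \<open>d \<noteq> 0\<close>])
  have A0: "fps_nth A 0 \<noteq> 0"
  proof
    assume "fps_nth A 0 = 0"
    with A show False by simp
  qed
  have "fps_nth (A * d) j = (\<Sum>i=0..j. if i = 0 then fps_nth A 0 * fps_nth d j else 0)"
    unfolding fps_mult_nth
  proof (intro sum.cong refl)
    fix i assume "i \<in> {0..j}"
    then show "fps_nth A i * fps_nth d (j - i) = (if i = 0 then fps_nth A 0 * fps_nth d j else 0)"
    proof (cases "i = 0")
      case False
      then have "j - i < subdegree d" using \<open>i \<in> {0..j}\<close> unfolding j_def by auto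
      then have "fps_nth d (j - i) = 0" by (rule nth_less_subdegree_zero)
      then show ?thesis using False by (simp only: mult_zero_right if_False)
    qed simp
  qed
  then have Ad: "fps_nth (A * d) j = fps_nth A 0 * fps_nth d j"
    by (simp only: sum.delta finite_atLeastAtMost) simp
  let ?k = "fls_subdegree (fps_nth A 0 * fps_nth d j)"
  have "fps_nth d j $$ fls_subdegree (fps_nth d j) \<noteq> 0"
    by (rule nth_fls_subdegree_nonzero[OF dj])
  then have "fls_subdegree (fps_nth d j) \<le> -2"
    using bounded_yD[OF d, of "fls_subdegree (fps_nth d j)" j]
        by (cases "fls_subdegree (fps_nth d j) > -2") simp_all
  then have "?k < 0" by (simp only: fls_subdegree_mult[OF A0 dj] A)
  from regular_yD[OF reg this, of j] have "(fps_nth A 0 * fps_nth d j) $$ ?k = 0" by (simp only: Ad)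
  moreover have "(fps_nth A 0 * fps_nth d j) $$ ?k \<noteq> 0"
    by (intro nth_fls_subdegree_nonzero no_zero_divisors A0 dj)
  ultimately show False by contradiction
qed

section \<open>Differentiation in \<open>y\<close> and residues\<close>

definition deriv_y :: "rser \<Rightarrow> rser" where
  "deriv_y w = fps_map fls_deriv w"

lemma deriv_y_mult: "deriv_y (v * w) = deriv_y v * w + v * deriv_y w"
proof (rule fps_ext)
  fix n
  have *: "fls_deriv (sum f A) = (\<Sum>x\<in>A. fls_deriv (f x))" for f :: "nat \<Rightarrow> rat fls" and A
    by (induction A rule: infinite_finite_induct) simp_all
  have "fps_nth (deriv_y (v * w)) n = (\<Sum>i=0..n. fls_deriv (fps_nth v i * fps_nth w (n - i)))"
    by (simp only: deriv_y_def fps_mult_nth fps_map_nth *)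
  also have "\<dots> = (\<Sum>i=0..n. fls_deriv (fps_nth v i) * fps_nth w (n - i)) + (\<Sum>i=0..n. fps_nth v i
      * fls_deriv (fps_nth w (n - i)))"
    by (simp only: fls_deriv_mult sum.distrib add.commute)
  also have "\<dots> = fps_nth (deriv_y v * w + v * deriv_y w) n"
    by (simp only: deriv_y_def fps_mult_nth fps_map_nth fps_add_nth)
  finally show "fps_nth (deriv_y (v * w)) n = fps_nth (deriv_y v * w + v * deriv_y w) n" .
qed

lemma deriv_y_emb [simp]: "deriv_y (emb A) = 0"
  by (rule fps_ext) (simp add: deriv_y_def)

lemma deriv_y_diff: "deriv_y (v - w) = deriv_y v - deriv_y w"
  by (rule fps_ext) (simp add: deriv_y_def)

lemma deriv_y_const: "deriv_y (fps_const (fps_to_fls f)) = fps_const (fps_to_fls (fps_deriv f))"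
  by (rule fps_ext) (simp add: deriv_y_def fls_deriv_fps_to_fls)

lemma residue_deriv_y [simp]: "coeff_y (-1) (deriv_y w) = 0"
  by (rule fps_ext) (simp add: coeff_y_nth deriv_y_def)

lemma coeff_y_1: "coeff_y i 1 = (if i = 0 then 1 else 0)"
  by (rule fps_ext) (simp add: coeff_y_nth)

lemma coeff_y_numeral: "coeff_y i (numeral k * w) = numeral k * coeff_y i w"
  using coeff_y_emb[of i "numeral k" w] by (simp add: fls_const.fps_map_numeral)

lemma regular_y_add: "regular_y v \<Longrightarrow> regular_y w \<Longrightarrow> regular_y (v + w)"
  by (rule regular_yI) (simp add: regular_yD)

lemma regular_y_half:
  assumes "regular_y (2 * w)"
  shows "regular_y w"
proof -
  have "emb (fps_const (1 / 2)) * (emb 2 * w) = emb (fps_const (1 / 2) * 2) * w"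
    by (simp only: fls_const.fps_map_mult mult.assoc)
  also have "fps_const (1 / 2) * 2 = (1 :: rat fps)" by (simp add: numeral_fps_const)
  finally have eq: "emb (fps_const (1 / 2)) * (emb 2 * w) = w" by (simp add: fls_const.fps_map_1)
  have "regular_y (emb (fps_const (1 / 2)) * (emb 2 * w))"
    by (rule regular_y_mult[OF regular_y_emb]) (use assms in \<open>simp add: fls_const.fps_map_numeral\<close>)
  then show ?thesis by (simp only: eq)
qed

section \<open>Potential and resolvent as series in \<open>y\<close> and \<open>s\<close>\<close>

definition yvar :: rser where "yvar = fps_const fls_X"

definition y_inv_power :: "nat \<Rightarrow> rser" where "y_inv_power n = fps_const (fls_X_inv ^ n)"

definition potential_fps :: "(nat \<Rightarrow> rat) \<Rightarrow> rat fps" where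
  "potential_fps c = fps_X - Abs_fps (\<lambda>k. c (k + 1))"

text \<open>\<open>s V'(y/s)\<close>, which does not depend on \<open>s\<close>.\<close>

definition dpotential :: "(nat \<Rightarrow> rat) \<Rightarrow> rser" where
  "dpotential c = fps_const (fps_to_fls (potential_fps c))"

text \<open>The resolvent \<open>s W(y/s)\<close>.\<close>

definition resolvent :: "(nat \<Rightarrow> rat fps) \<Rightarrow> rser" where
  "resolvent T = Abs_fps (\<lambda>j. \<Sum>n<j - 1. fls_const (fps_nth (T n) (j - n - 2)) * fls_X_inv ^ (n
      + 1))"

lemma resolvent_nth: "fps_nth (resolvent T) j $$ i =
    (if i < 0 \<and> nat (- i) < j then fps_nth (T (nat (- i) - 1)) (j - nat (- i) - 1) else 0)"
proof -
  have "fps_nth (resolvent T) j $$ i = (\<Sum>n<j - 1.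
      if i = - int (n + 1) then fps_nth (T n) (j - n - 2) else 0)"
    by (auto simp: resolvent_def fls_nth_sum simp del: power_Suc intro!: sum.cong)
  also have "\<dots> = (\<Sum>n<j - 1.
      if n = nat (- i) - 1 then (if i < 0 then fps_nth (T n) (j - n - 2) else 0) else 0)"
    by (intro sum.cong) auto
  also have "\<dots> = (if i < 0 \<and> nat (- i)
      < j then fps_nth (T (nat (- i) - 1)) (j - nat (- i) - 1) else 0)"
    by auto
  finally show ?thesis .
qed

lemma coeff_y_resolvent: "coeff_y i (resolvent T) = (if i
    < 0 then fps_X ^ (nat (- i) + 1) * T (nat (- i) - 1) else 0)"
  by (rule fps_ext) (auto simp: coeff_y_nth resolvent_nth fps_X_power_mult_nth simp del: power_Suc)

lemma bounded_y_resolvent: "bounded_y (-1) (resolvent T)"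
  by (rule bounded_yI) (simp add: resolvent_nth)

lemma coeff_y_mult_negative:
  assumes v: "bounded_y (-1) v" and w: "bounded_y (-1) w"
  shows "coeff_y (- int p) (v * w) = (\<Sum>l<p - 1. coeff_y (- int (l + 1)) v * coeff_y (- int (p - 1
      - l)) w)"
proof (rule fps_ext)
  fix j
  have *: "(fps_nth v a * fps_nth w b) $$ (- int p) =
      (\<Sum>l<p - 1. fps_nth v a $$ (- int (l + 1)) * fps_nth w b $$ (- int (p - 1 - l)))" for a b
  proof -
    let ?f = "fps_nth v a" and ?g = "fps_nth w b"
    have z: "?f $$ i = 0" if "i > -1" for i using bounded_yD[OF v that] .
    have z': "?g $$ i = 0" if "i > -1" for i using bounded_yD[OF w that] .
    let ?A = "{fls_subdegree ?f..- int p - fls_subdegree ?g}" and ?B = "{1 - int p..-1}"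
    have "(?f * ?g) $$ (- int p) = (\<Sum>i\<in>?A. ?f $$ i * ?g $$ (- int p - i))"
      by (rule fls_times_nth(2))
    also have "\<dots> = (\<Sum>i\<in>?A \<union> ?B. ?f $$ i * ?g $$ (- int p - i))"
    proof (rule sum.mono_neutral_left)
      show "\<forall>i\<in>?A \<union> ?B - ?A. ?f $$ i * ?g $$ (- int p - i) = 0"
      proof
        fix i assume "i \<in> ?A \<union> ?B - ?A"
        then have "i < fls_subdegree ?f \<or> - int p - i < fls_subdegree ?g" by auto
        then show "?f $$ i * ?g $$ (- int p - i) = 0" by (elim disjE) simp_all
      qed
    qed auto
    also have "\<dots> = (\<Sum>i\<in>?B. ?f $$ i * ?g $$ (- int p - i))"
    proof (rule sum.mono_neutral_right)
      show "\<forall>i\<in>?A \<union> ?B - ?B. ?f $$ i * ?g $$ (- int p - i) = 0"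
      proof
        fix i assume "i \<in> ?A \<union> ?B - ?B"
        then have "i > -1 \<or> - int p - i > -1" by auto
        then show "?f $$ i * ?g $$ (- int p - i) = 0" using z z' by (elim disjE) simp_all
      qed
    qed auto
    also have "\<dots> = (\<Sum>l<p - 1. ?f $$ (- int (l + 1)) * ?g $$ (- int (p - 1 - l)))"
      by (rule sum.reindex_bij_witness[of _ "\<lambda>l. - int (l + 1)" "\<lambda>i. nat (- i) - 1"])
         (auto simp: of_nat_diff intro!: arg_cong2[of _ _ _ _ "\<lambda>a b. ?f $$ a * ?g $$ b"])
    finally show ?thesis .
  qed
  show "fps_nth (coeff_y (- int p) (v * w)) j
      = fps_nth (\<Sum>l<p - 1. coeff_y (- int (l + 1)) v * coeff_y (- int (p - 1 - l)) w) j"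
    by (simp only: coeff_y_nth fps_mult_nth fls_nth_sum * fps_sum_nth) (rule sum.swap)
qed

lemma coeff_y_resolvent_sq:
  assumes "p \<ge> 1"
  shows "coeff_y (- int p) (resolvent T * resolvent T)
      = fps_X ^ (p + 2) * (\<Sum>l<p - 1. T l * T (p - 2 - l))"
  unfolding coeff_y_mult_negative[OF bounded_y_resolvent bounded_y_resolvent] sum_distrib_left
proof (intro sum.cong refl)
  fix l assume l: "l \<in> {..<p - 1}"
  have a: "coeff_y (- int (l + 1)) (resolvent T) = fps_X ^ (l + 2) * T l"
    using coeff_y_resolvent[of "- int (l + 1)" T] by (simp add: nat_add_distrib)
  have b: "coeff_y (- int (p - 1 - l)) (resolvent T) = fps_X ^ (p - l) * T (p - 2 - l)"
  proof -
    have "p - 1 - l + 1 = p - l" "p - 1 - l - 1 = p - 2 - l" "- int (p - 1 - l) < 0" using l by auto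
    then show ?thesis using coeff_y_resolvent[of "- int (p - 1 - l)" T]
        by (simp only: minus_minus nat_int if_True)
  qed
  have "l + 2 + (p - l) = p + 2" using l by auto
  then show "coeff_y (- int (l + 1)) (resolvent T) * coeff_y (- int (p - 1 - l)) (resolvent T)
      = fps_X ^ (p + 2) * (T l * T (p - 2 - l))"
    unfolding a b by (metis (no_types, lifting) mult.assoc mult.left_commute power_add)
qed

text \<open>Shifted by \<open>p + 2\<close> powers of \<open>s\<close>, these are the linear terms
  of the loop equation for the moment \<open>T p\<close>: the monomial \<open>y\<close> of the
  potential contributes \<open>T p\<close> itself, the rest the terms with
  \<open>c n\<close>.\<close>

lemma coeff_y_dpotential_resolvent:
  assumes p: "p \<ge> 1" and c: "\<And>n. n < 3 \<Longrightarrow> c n = 0"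
  shows "fps_nth (coeff_y (- int p) (dpotential c * resolvent T)) j =
    (if j < p + 2 then 0 else fps_nth (T p) (j - (p + 2)) - (\<Sum>n=3..j - p. c n * fps_nth (T (n + p
        - 2)) (j - (p + n))))"
proof -
  let ?G = "fps_to_fls (potential_fps c)"
  have mono: "(?G * (fls_const a * fls_X_inv ^ (n + 1))) $$ (- int p)
      = a * ?G $$ (int n + 1 - int p)" for a n
  proof -
    have "?G * (fls_const a * fls_X_inv ^ (n + 1)) = fls_const a * (fls_X_inv ^ (n + 1) * ?G)"
        by (simp only: mult_ac)
    also have "fls_X_inv ^ (n + 1) * ?G = fls_shift (int (n + 1)) ?G"
        by (rule fls_X_inv_power_times_conv_shift)
    finally have e: "?G * (fls_const a * fls_X_inv ^ (n + 1))
        = fls_const a * fls_shift (int (n + 1)) ?G" .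
    show ?thesis unfolding e by (simp add: algebra_simps)
  qed
  have "fps_nth (coeff_y (- int p) (dpotential c * resolvent T)) j
      = (\<Sum>n<j - 1. fps_nth (T n) (j - n - 2) * ?G $$ (int n + 1 - int p))"
    by (simp only: coeff_y_nth dpotential_def resolvent_def fps_mult_left_const_nth fps_nth_Abs_fps
        sum_distrib_left fls_nth_sum mono)
  also have "\<dots> = (\<Sum>n<j - 1. (if n = p then fps_nth (T n) (j - n - 2) else 0) -
      (if n \<in> {p + 1..j - 2} then c (n + 2 - p) * fps_nth (T n) (j - n - 2) else 0))"
  proof (intro sum.cong refl)
    fix n assume n: "n \<in> {..<j - 1}"
    consider "n + 1 < p" | "n + 1 = p" | "n = p" | "n \<ge> p + 1" by linarith
    then show "fps_nth (T n) (j - n - 2) * ?G $$ (int n + 1 - int p) = (if n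
        = p then fps_nth (T n) (j - n - 2) else 0) -
      (if n \<in> {p + 1..j - 2} then c (n + 2 - p) * fps_nth (T n) (j - n - 2) else 0)"
    proof cases
      case 4
      then have "nat (int n + 1 - int p) = n + 1 - p" "n \<le> j - 2" using n by auto
      then show ?thesis using 4 by (simp add: potential_fps_def fps_X_def Suc_diff_le)
    qed (use c[of 1] c[of 2] in \<open>auto simp: potential_fps_def numeral_2_eq_2\<close>)
  qed
  also have "\<dots> = (if p < j - 1 then fps_nth (T p) (j - p - 2) else 0) - (\<Sum>n\<in>{p + 1..j - 2}. c (n + 2
      - p) * fps_nth (T n) (j - n - 2))"
  proof -
    have "(\<Sum>n<j - 1. if n \<in> {p + 1..j - 2} then c (n + 2 - p) * fps_nth (T n) (j - n - 2) else 0) =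
      (\<Sum>n\<in>{..<j - 1} \<inter> {p + 1..j - 2}. c (n + 2 - p) * fps_nth (T n) (j - n - 2))"
      by (rule sum.inter_restrict[symmetric]) simp
    also have "{..<j - 1} \<inter> {p + 1..j - 2} = {p + 1..j - 2}" using p by auto
    finally show ?thesis by (simp add: sum_subtractf)
  qed
  also have "(\<Sum>n\<in>{p + 1..j - 2}. c (n + 2 - p) * fps_nth (T n) (j - n - 2)) = (if j
      < p + 2 then 0 else \<Sum>n=3..j - p. c n * fps_nth (T (n + p - 2)) (j - (p + n)))"
  proof (cases "j < p + 2")
    case False
    then have "(\<Sum>n\<in>{p + 1..j - 2}. c (n + 2 - p) * fps_nth (T n) (j - n - 2))
        = (\<Sum>n=3..j - p. c n * fps_nth (T (n + p - 2)) (j - (p + n)))"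
      by (intro sum.reindex_bij_witness[of _ "\<lambda>n. n + p - 2" "\<lambda>n. n + 2
          - p"]) (auto intro!: arg_cong2[of _ _ _ _ "\<lambda>a b. c a * fps_nth (T _) b"])
    then show ?thesis using False by simp
  qed simp
  finally show ?thesis by (simp add: less_diff_conv)
qed

text \<open>The polynomial \<open>(y - P)^2 - 4 Q\<close> vanishes at the rescaled endpoints of the
  cut, and \<open>\<Omega>\<close> is the branch of its inverse square root that behaves like
  \<open>1/y\<close>. The two string conditions say that the one-cut ansatz for the resolvent starts
  with \<open>s^2 / y\<close>.\<close>

locale one_cut =
  fixes c :: "nat \<Rightarrow> rat" and T :: "nat \<Rightarrow> rat fps" and P Q R :: "rat fps" and \<Omega> :: rser
  assumes c: "\<And>n. n < 3 \<Longrightarrow> c n = 0"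
    and T0: "T 0 = 1"
    and loop: "\<And>p j. p \<ge> 1 \<Longrightarrow> fps_nth (T p) j = fps_nth (\<Sum>l<p - 1. T l * T (p - 2 - l)) j
      + (\<Sum>n=3..j + 2. c n * fps_nth (T (n + p - 2)) (j - (n - 2)))"
    and Q: "Q = fps_X ^ 2 * R"
    and \<Omega>: "((yvar - emb P) ^ 2 - 4 * emb Q) * \<Omega> ^ 2 = 1" "bounded_y (-1) \<Omega>" "coeff_y (-1) \<Omega> = 1"
      "fps_nth \<Omega> 0 = fls_X_inv"
    and string: "coeff_y (-1) (dpotential c * \<Omega>) = 0" "coeff_y (-2) (dpotential c * \<Omega>)
        = 2 * fps_X ^ 2"
begin

abbreviation "g \<equiv> dpotential c"
abbreviation "\<omega> \<equiv> resolvent T"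

text \<open>The square root itself, obtained from \<open>\<Omega>\<close> so that no second choice
  of a sign arises.\<close>

definition \<Sigma> :: rser where "\<Sigma> = ((yvar - emb P) ^ 2 - 4 * emb Q) * \<Omega>"

lemma \<Sigma>\<Omega>: "\<Sigma> * \<Omega> = 1" "\<Sigma> ^ 2 = (yvar - emb P) ^ 2 - 4 * emb Q"
proof -
  show 1: "\<Sigma> * \<Omega> = 1" using \<Omega>(1) by (simp add: \<Sigma>_def power2_eq_square mult.assoc)
  have "\<Sigma> ^ 2 = ((yvar - emb P) ^ 2 - 4 * emb Q) * (\<Sigma> * \<Omega>)"
    unfolding power2_eq_square[of \<Sigma>] by (subst (2) \<Sigma>_def) (simp only: mult_ac)
  then show "\<Sigma> ^ 2 = (yvar - emb P) ^ 2 - 4 * emb Q" using 1 by simp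
qed

lemma regular_y_\<Sigma>2: "regular_y (\<Sigma> ^ 2)"
proof -
  have "regular_y (emb (4 * Q))" by (rule regular_y_emb)
  then have "regular_y (4 * emb Q)" by (simp add: fls_const.fps_map_mult fls_const.fps_map_numeral)
  moreover have "regular_y yvar" by (rule regular_yI) (simp add: yvar_def)
  ultimately show ?thesis
    unfolding \<Sigma>\<Omega>(2) unfolding power2_eq_square
        by (intro regular_y_diff[OF regular_y_mult] regular_y_diff regular_y_emb)
qed

lemma bounded_y_\<Sigma>: "bounded_y 1 \<Sigma>" and coeff_y_\<Sigma>: "coeff_y 1 \<Sigma> = 1"
proof -
  have y: "bounded_y 1 yvar" "coeff_y 1 yvar = 1"
    by (auto intro!: bounded_yI fps_ext simp: yvar_def coeff_y_nth)
  have e: "bounded_y 0 (emb A)" for A by (rule bounded_yI) simp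
  have yP: "bounded_y 1 (yvar - emb P)" "coeff_y 1 (yvar - emb P) = 1"
    using y bounded_y_mono[OF e] coeff_y_emb[of 1 P 1] coeff_y_1
    by (auto intro!: bounded_y_diff simp: coeff_y_diff)
  have q: "bounded_y 0 (4 * emb Q)"
    using e[of "4 * Q"] by (simp add: fls_const.fps_map_mult fls_const.fps_map_numeral)
  have q2: "coeff_y 2 (4 * emb Q) = 0" using q by (intro fps_ext) (simp add: coeff_y_nth bounded_yD)
  have s2: "bounded_y 2 ((yvar - emb P) ^ 2 - 4 * emb Q)" "coeff_y 2 ((yvar - emb P) ^ 2 - 4
      * emb Q) = 1"
    using bounded_y_mult[OF yP(1) yP(1)] coeff_y_mult_top[OF yP(1) yP(1)] bounded_y_mono[OF q,
        of 2] q2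
    by (auto simp: power2_eq_square yP(2) coeff_y_diff[of 2] intro!: bounded_y_diff)
  show "bounded_y 1 \<Sigma>" "coeff_y 1 \<Sigma> = 1"
    using bounded_y_mult[OF s2(1) \<Omega>(2)] coeff_y_mult_top[OF s2(1) \<Omega>(2)]
        by (simp_all add: \<Sigma>_def s2 \<Omega>(3))
qed

text \<open>For \<open>p >= 1\<close>, vanishing of the coefficient of \<open>y^(-p)\<close> is the
  loop equation for the moment \<open>T p\<close>.\<close>

lemma loop_resolvent: "regular_y (\<omega> * \<omega> - g * \<omega>)"
proof (rule regular_yI)
  fix j and i :: int assume i: "i < 0"
  define p where "p = nat (- i)"
  have p: "p \<ge> 1" "i = - int p" using i by (auto simp: p_def)
  have "coeff_y (- int p) (\<omega> * \<omega>) = coeff_y (- int p) (g * \<omega>)"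
  proof (rule fps_ext)
    fix j
    show "fps_nth (coeff_y (- int p) (\<omega> * \<omega>)) j = fps_nth (coeff_y (- int p) (g * \<omega>)) j"
    proof -
      have 1: "fps_nth (coeff_y (- int p) (\<omega> * \<omega>)) j = (if j
          < p + 2 then 0 else fps_nth (\<Sum>l<p - 1. T l * T (p - 2 - l)) (j - (p + 2)))"
        by (simp only: coeff_y_resolvent_sq[OF p(1)] fps_X_power_mult_nth)
      have 2: "fps_nth (coeff_y (- int p) (g * \<omega>)) j = (if j < p + 2 then 0 else
          fps_nth (T p) (j - (p + 2)) - (\<Sum>n=3..j - p. c n * fps_nth (T (n + p - 2)) (j - (p + n))))"
        by (rule coeff_y_dpotential_resolvent[OF p(1)]) (rule c)
      show ?thesis
      proof (cases "j < p + 2")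
        case False
        define i where "i = j - (p + 2)"
        have ji: "j = i + (p + 2)" using False by (simp add: i_def)
        show ?thesis
          unfolding 1 2 using loop[OF p(1), of i]
          unfolding ji by (simp add: add.commute[of _ p] del: sum.cl_ivl_Suc)
      qed (simp add: 1 2)
    qed
  qed
  then have "coeff_y (- int p) (\<omega> * \<omega> - g * \<omega>) = 0" by (simp add: coeff_y_diff)
  then have "fps_nth (coeff_y (- int p) (\<omega> * \<omega> - g * \<omega>)) j = 0" by simp
  then show "fps_nth (\<omega> * \<omega> - g * \<omega>) j $$ i = 0" by (simp only: coeff_y_nth p(2))
qed

definition g\<Omega>_neg :: rser where
  "g\<Omega>_neg = fps_map (\<lambda>f. f - fps_to_fls (fls_regpart f)) (g * \<Omega>)"

lemma g\<Omega>_neg_nth: "fps_nth g\<Omega>_neg j $$ i = (if i < 0 then fps_nth (g * \<Omega>) j $$ i else 0)"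
  by (simp add: g\<Omega>_neg_def)

lemma regular_y_g\<Omega>: "regular_y (g * \<Omega> - g\<Omega>_neg)"
  by (rule regular_yI) (simp add: g\<Omega>_neg_nth)

lemma bounded_y_g\<Omega>_neg: "bounded_y (-2) g\<Omega>_neg"
proof (rule bounded_yI)
  fix j and i :: int assume "i > -2"
  then consider "i = -1" | "i \<ge> 0" by linarith
  then show "fps_nth g\<Omega>_neg j $$ i = 0"
  proof cases
    case 1
    then show ?thesis using string(1) coeff_y_nth[of "-1" "g * \<Omega>" j] by (simp add: g\<Omega>_neg_nth)
  qed (simp add: g\<Omega>_neg_nth)
qed

lemma subdegree_g: "fls_subdegree (fps_nth g 0) = 1"
proof -
  have "subdegree (potential_fps c) = 1"
    by (rule subdegreeI) (auto simp: potential_fps_def c less_Suc_eq)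
  then show ?thesis by (simp add: dpotential_def fls_subdegree_fls_to_fps)
qed

text \<open>The one-cut candidate \<open>e\<close> is half of the right-hand side. As
  \<open>2 e = g - \<Sigma> (g \<Omega> - g\<Omega>_neg)\<close>, the square
  \<open>(2 e - g)^2\<close> is regular, so \<open>e\<close> satisfies the same quadratic equation
  as \<open>\<omega>\<close>, with the same leading term. The difference of the two quadratic
  equations factors, and \<open>loop_uniqueness\<close> applies to
  \<open>\<omega> - e\<close>.\<close>

lemma resolvent_eq: "2 * \<omega> = \<Sigma> * g\<Omega>_neg"
proof -
  define e where "e = emb (fps_const (1 / 2)) * (\<Sigma> * g\<Omega>_neg)"
  have "emb (2 * fps_const (1 / 2)) = 1" by (simp add: numeral_fps_const fls_const.fps_map_1)
  then have half: "2 * emb (fps_const (1 / 2)) = 1"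
    by (simp only: fls_const.fps_map_mult fls_const.fps_map_numeral)
  have e2: "2 * e = \<Sigma> * g\<Omega>_neg"
    unfolding e_def mult.assoc[symmetric] half by simp
  have "2 * e = \<Sigma> * (g * \<Omega>) - \<Sigma> * (g * \<Omega> - g\<Omega>_neg)" unfolding e2 by (simp add: algebra_simps)
  also have "\<Sigma> * (g * \<Omega>) = g * (\<Sigma> * \<Omega>)" by (simp only: mult_ac)
  finally have e3: "2 * e = g - \<Sigma> * (g * \<Omega> - g\<Omega>_neg)" by (simp add: \<Sigma>\<Omega>)
  have e_bound: "bounded_y (-1) e"
    unfolding e_def using bounded_y_mult[OF bounded_y_\<Sigma> bounded_y_g\<Omega>_neg]
        by (intro bounded_y_emb) simp
  have "coeff_y (-2) g\<Omega>_neg = 2 * fps_X ^ 2"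
    unfolding string(2)[symmetric] by (rule fps_ext) (simp add: coeff_y_nth g\<Omega>_neg_nth)
  then have "coeff_y (-1) (\<Sigma> * g\<Omega>_neg) = 2 * fps_X ^ 2"
    using coeff_y_mult_top[OF bounded_y_\<Sigma> bounded_y_g\<Omega>_neg] by (simp add: coeff_y_\<Sigma>)
  then have e_top: "coeff_y (-1) e = fps_X ^ 2"
    unfolding e_def coeff_y_emb by (simp add: mult.assoc[symmetric] numeral_fps_const)
  have "4 * (e * e - g * e) = (2 * e - g) ^ 2 - g ^ 2" by (simp add: power2_eq_square algebra_simps)
  also have "\<dots> = \<Sigma> ^ 2 * ((g * \<Omega> - g\<Omega>_neg) * (g * \<Omega> - g\<Omega>_neg)) - g * g"
    unfolding e3 by (simp add: power2_eq_square algebra_simps)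
  finally have "4 * (e * e - g * e) = \<dots>" .
  moreover have "regular_y g" unfolding dpotential_def by (rule regular_y_const)
  ultimately have "regular_y (4 * (e * e - g * e))"
    by (simp only:) (intro regular_y_diff regular_y_mult regular_y_\<Sigma>2 regular_y_g\<Omega>)
  then have reg_e: "regular_y (e * e - g * e)"
    using regular_y_half[of "2 * (e * e - g * e)"] regular_y_half[of "e * e - g * e"]
        by (simp add: mult.assoc[symmetric])
  have \<omega>0: "fps_nth \<omega> 0 = 0" by (simp add: resolvent_def)
  have "fps_nth g\<Omega>_neg 0 = 0"
  proof (rule fls_eqI)
    fix i
    have "fps_nth (g * \<Omega>) 0 $$ i = fps_to_fls (potential_fps c) $$ (i + 1)"
      by (simp add: dpotential_def \<Omega>(4) fls_X_inv_times_conv_shift)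
    then show "fps_nth g\<Omega>_neg 0 $$ i = 0 $$ i"
      using c[of 1] by (simp add: g\<Omega>_neg_nth potential_fps_def)
  qed
  then have e0: "fps_nth e 0 = 0" by (simp add: e_def)
  have "\<omega> - e = 0"
  proof (rule loop_uniqueness)
    show "bounded_y (-2) (\<omega> - e)"
    proof (rule bounded_yI)
      fix j and i :: int assume "i > -2"
      then consider "i = -1" | "i > -1" by linarith
      then show "fps_nth (\<omega> - e) j $$ i = 0"
      proof cases
        case 1
        have "coeff_y (-1) (\<omega> - e) = 0"
            by (simp add: coeff_y_diff e_top coeff_y_resolvent T0 numeral_2_eq_2)
        then have "fps_nth (coeff_y (-1) (\<omega> - e)) j = 0" by simp
        then show ?thesis by (simp only: 1 coeff_y_nth)
      next
        case 2
        then show ?thesis by (simp add: bounded_yD[OF bounded_y_resolvent] bounded_yD[OF e_bound])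
      qed
    qed
    have "(\<omega> + e - g) * (\<omega> - e) = (\<omega> * \<omega> - g * \<omega>) - (e * e - g * e)" by (simp add: algebra_simps)
    then show "regular_y ((\<omega> + e - g) * (\<omega> - e))"
      using regular_y_diff[OF loop_resolvent reg_e] by (simp only:)
    show "fls_subdegree (fps_nth (\<omega> + e - g) 0) = 1" using subdegree_g by (simp add: \<omega>0 e0)
  qed
  then show ?thesis using e2 by simp
qed

text \<open>At fixed \<open>y\<close> the potential does not depend on \<open>s\<close>, so the
  differentiated loop equation is linear in \<open>fps_deriv \<omega>\<close>. The candidate
  \<open>2 s \<Omega>\<close> solves it because \<open>(g - 2 \<omega>) \<Omega>\<close> is the
  regular part of \<open>g \<Omega>\<close>, and both start with \<open>2 s / y\<close>.\<close>

theorem deriv_resolvent: "fps_deriv \<omega> = 2 * fps_X * \<Omega>"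
proof -
  have "g - 2 * \<omega> = g * (\<Sigma> * \<Omega>) - \<Sigma> * g\<Omega>_neg" unfolding resolvent_eq \<Sigma>\<Omega>(1) by simp
  also have "\<dots> = \<Sigma> * (g * \<Omega> - g\<Omega>_neg)" by (simp add: algebra_simps)
  finally have "(g - 2 * \<omega>) * \<Omega> = (\<Sigma> * \<Omega>) * (g * \<Omega> - g\<Omega>_neg)" by (simp only: mult_ac)
  then have reg1: "regular_y ((g - 2 * \<omega>) * \<Omega>)" by (simp add: \<Sigma>\<Omega>(1) regular_y_g\<Omega>)
  have emb2X: "emb (2 * fps_X) = 2 * fps_X" by (simp add: fls_const.fps_map_simps)
  have dg: "fps_deriv g = 0" by (simp add: dpotential_def)
  have "fps_deriv \<omega> - 2 * fps_X * \<Omega> = 0"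
  proof (rule loop_uniqueness[of _ "2 * \<omega> - g"])
    show "fls_subdegree (fps_nth (2 * \<omega> - g) 0) = 1" using subdegree_g by (simp add: resolvent_def)
    have "bounded_y (-1) (emb (2 * fps_X) * \<Omega>)" by (rule bounded_y_emb[OF \<Omega>(2)])
    then have b: "bounded_y (-1) (fps_deriv \<omega> - 2 * fps_X * \<Omega>)"
      unfolding emb2X by (intro bounded_y_diff bounded_y_deriv bounded_y_resolvent)
    have "coeff_y (-1) (fps_deriv \<omega> - emb (2 * fps_X) * \<Omega>) = 0"
      unfolding coeff_y_diff coeff_y_deriv coeff_y_emb \<Omega>(3)
      by (simp add: coeff_y_resolvent T0 numeral_2_eq_2)
    then have t: "coeff_y (-1) (fps_deriv \<omega> - 2 * fps_X * \<Omega>) = 0" by (simp only: emb2X)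
    show "bounded_y (-2) (fps_deriv \<omega> - 2 * fps_X * \<Omega>)"
    proof (rule bounded_yI)
      fix j and i :: int assume "i > -2"
      then consider "i = -1" | "i > -1" by linarith
      then show "fps_nth (fps_deriv \<omega> - 2 * fps_X * \<Omega>) j $$ i = 0"
      proof cases
        case 1
        have "fps_nth (coeff_y (-1) (fps_deriv \<omega> - 2 * fps_X * \<Omega>)) j = 0"
            by (simp only: t fps_zero_nth)
        then show ?thesis by (simp only: 1 coeff_y_nth)
      qed (rule bounded_yD[OF b])
    qed
    have "(2 * \<omega> - g) * (fps_deriv \<omega> - 2 * fps_X * \<Omega>) =
        fps_deriv (\<omega> * \<omega> - g * \<omega>) + emb (2 * fps_X) * ((g - 2 * \<omega>) * \<Omega>)"
      unfolding emb2X by (simp add: dg algebra_simps)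
    then show "regular_y ((2 * \<omega> - g) * (fps_deriv \<omega> - 2 * fps_X * \<Omega>))"
      by (simp only:) (intro regular_y_add regular_y_deriv loop_resolvent regular_y_mult
          regular_y_emb reg1)
  qed
  then show ?thesis by simp
qed

end

section \<open>From the resolvent to the free energy\<close>

lemma residue_const_resolvent:
  "fps_nth (coeff_y (-1) (fps_const (fps_to_fls a) * resolvent T)) j
      = (\<Sum>n<j - 1. fps_nth (T n) (j - n - 2) * fps_nth a n)"
proof -
  have mono: "(fps_to_fls a * (fls_const x * fls_X_inv ^ (n + 1))) $$ (- 1)
      = x * fps_nth a n" for x n
  proof -
    have "fps_to_fls a * (fls_const x * fls_X_inv ^ (n + 1))
        = fls_const x * (fls_X_inv ^ (n + 1) * fps_to_fls a)" by (simp only: mult_ac)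
    also have "fls_X_inv ^ (n + 1) * fps_to_fls a = fls_shift (int (n + 1)) (fps_to_fls a)"
        by (rule fls_X_inv_power_times_conv_shift)
    finally have e: "fps_to_fls a * (fls_const x * fls_X_inv ^ (n + 1))
        = fls_const x * fls_shift (int (n + 1)) (fps_to_fls a)" .
    show ?thesis unfolding e by simp
  qed
  show ?thesis
    by (simp only: coeff_y_nth resolvent_def fps_mult_left_const_nth fps_nth_Abs_fps
        sum_distrib_left fls_nth_sum mono)
qed

lemma coeff_y_yvar: "coeff_y i (yvar * w) = coeff_y (i - 1) w"
  by (rule fps_ext) (simp add: coeff_y_nth yvar_def fls_X_times_conv_shift)

lemma residue_by_parts: "coeff_y (-1) (v * deriv_y w) = - coeff_y (-1) (deriv_y v * w)"
proof -
  have "coeff_y (-1) (deriv_y v * w) + coeff_y (-1) (v * deriv_y w) = 0"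
    by (simp only: deriv_y_mult[symmetric] coeff_y_add[symmetric] residue_deriv_y)
  then show ?thesis by (simp add: add_eq_0_iff)
qed

context one_cut begin

text \<open>By Euler's identity the residue of \<open>h \<omega>\<close> is \<open>s^5\<close> times
  the \<open>s\<close>-derivative of the planar series. \<open>G\<close> is the primitive of
  \<open>g\<close> in \<open>y\<close>.\<close>

definition "hf = Abs_fps (\<lambda>n. (1 - 2 / of_nat n) * c n)"
definition "Gf = Abs_fps (\<lambda>n. if n = 0 then 0 else fps_nth (potential_fps c) (n - 1) / of_nat n)"
definition "h = (fps_const (fps_to_fls hf) :: rser)"
definition "G = (fps_const (fps_to_fls Gf) :: rser)"

lemma hf_eq: "hf = 2 * Gf - fps_X * potential_fps c"
proof (rule fps_ext)
  fix n :: nat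
  consider "n = 0" | "n = 2" | "n \<noteq> 0" "n \<noteq> 2" by blast
  then show "fps_nth hf n = fps_nth (2 * Gf - fps_X * potential_fps c) n"
  proof cases
    case 3
    then have "fps_nth (potential_fps c) (n - 1) = - c n"
      by (simp add: potential_fps_def fps_X_def)
    then show ?thesis using 3 by (simp add: hf_def Gf_def numeral_fps_const field_simps)
  qed (use c in \<open>simp_all add: hf_def Gf_def numeral_fps_const potential_fps_def\<close>)
qed

lemma h_eq: "h = 2 * G - yvar * g"
proof -
  have "fps_to_fls hf = 2 * fps_to_fls Gf - fls_X * fps_to_fls (potential_fps c)"
    unfolding hf_eq by (simp only: fps_to_fls_minus fls_times_fps_to_fls fps_to_fls_numeral
        fps_X_to_fls)
  then show ?thesis
    by (simp add: h_def G_def yvar_def dpotential_def numeral_fps_const)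
qed

lemma deriv_y_G: "deriv_y G = g"
proof -
  have "fps_deriv Gf = potential_fps c" by (rule fps_ext) (simp add: Gf_def)
  then show ?thesis by (simp add: G_def deriv_y_const dpotential_def)
qed

lemma deriv_y_yvar: "deriv_y yvar = 1"
  by (rule fps_ext) (simp add: deriv_y_def yvar_def)

text \<open>With \<open>S = (y - P)^2 - 4 Q\<close> and \<open>\<Omega> = S^(-1/2)\<close>, all
  three derivatives are multiples of \<open>\<Omega>^3\<close>. Trading the
  \<open>s\<close>-derivative for \<open>y\<close>-derivatives prepares an integration by parts
  under the residue.\<close>

lemma deriv_\<Omega>:
  "emb Q * (2 * fps_deriv \<Omega>) = - 2 * emb Q * emb (fps_deriv P) * deriv_y \<Omega> - emb (fps_deriv Q)
      * deriv_y ((yvar - emb P) * \<Omega>)"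
proof -
  define z where "z = yvar - emb P"
  define S where "S = z * z - 4 * emb Q"
  have S: "S * \<Omega> ^ 2 = 1" using \<Omega>(1) by (simp add: S_def z_def power2_eq_square)
  have de: "fps_deriv (emb A) = emb (fps_deriv A)" for A
      by (rule fls_const.fps_map_deriv[symmetric])
  have d4: "fps_deriv (4 :: rser) = 0" by (simp add: numeral_fps_const)
  have dz: "fps_deriv z = - emb (fps_deriv P)" by (simp add: z_def yvar_def de)
  have dyz: "deriv_y z = 1" by (simp add: z_def deriv_y_diff deriv_y_yvar)
  have dy4: "deriv_y (4 * emb Q) = 0"
    using deriv_y_emb[of "4 * Q"] by (simp add: fls_const.fps_map_mult fls_const.fps_map_numeral)
  have dS: "fps_deriv S = - 2 * z * emb (fps_deriv P) - 4 * emb (fps_deriv Q)"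
    by (simp add: S_def de dz d4 algebra_simps)
  have dSy: "deriv_y S = 2 * z"
    by (simp only: S_def deriv_y_diff deriv_y_mult[of z] dyz dy4) simp
  have 1: "fps_deriv (S * \<Omega> ^ 2) = 0" "deriv_y (S * \<Omega> ^ 2) = 0"
    using deriv_y_emb[of 1] unfolding S by (simp_all add: fls_const.fps_map_1)
  have "0 = \<Omega> * fps_deriv (S * \<Omega> ^ 2)" by (simp only: 1 mult_zero_right)
  also have "\<dots> = fps_deriv S * \<Omega> ^ 3 + (S * \<Omega> ^ 2) * (2 * fps_deriv \<Omega>)"
    by (simp add: power2_eq_square power3_eq_cube algebra_simps)
  finally have s: "2 * fps_deriv \<Omega> = (2 * z * emb (fps_deriv P) + 4 * emb (fps_deriv Q)) * \<Omega> ^ 3"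
    unfolding S dS by (simp add: algebra_simps)
  have "0 = \<Omega> * deriv_y (S * \<Omega> ^ 2)" by (simp only: 1 mult_zero_right)
  also have "\<dots> = deriv_y S * \<Omega> ^ 3 + (S * \<Omega> ^ 2) * (2 * deriv_y \<Omega>)"
    by (simp only: deriv_y_mult power2_eq_square[of \<Omega>] power3_eq_cube) (simp add: algebra_simps)
  finally have "2 * deriv_y \<Omega> = 2 * (- (z * \<Omega> ^ 3))"
    unfolding S dSy by (simp add: algebra_simps eq_neg_iff_add_eq_0)
  then have y1: "deriv_y \<Omega> = - (z * \<Omega> ^ 3)" by (subst (asm) mult_left_cancel) simp_all
  have "deriv_y (z * \<Omega>) = \<Omega> - z * z * \<Omega> ^ 3"
    by (simp add: deriv_y_mult dyz y1)
  also have "\<dots> = \<Omega> - (S * \<Omega> ^ 2) * \<Omega> - 4 * emb Q * \<Omega> ^ 3"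
    by (simp add: S_def power2_eq_square power3_eq_cube algebra_simps)
  finally have zz: "deriv_y (z * \<Omega>) = - 4 * emb Q * \<Omega> ^ 3" unfolding S by simp
  show ?thesis unfolding z_def[symmetric] s zz y1 by (simp add: algebra_simps)
qed

definition "y1 = coeff_y (-1) (h * \<Omega>)"

text \<open>Integration by parts moves the \<open>y\<close>-derivatives from \<open>\<Omega>\<close>
  to \<open>G\<close> and leaves coefficients of \<open>g \<Omega>\<close>, which the string
  equations evaluate.\<close>

lemma deriv_y1: "Q * (fps_deriv y1 + 4 * fps_X) = 2 * fps_X ^ 2 * fps_deriv Q"
proof -
  \<comment> \<open>The subtracted coefficient is \<open>2 s^2\<close> by the second string
    equation; its derivative is the term \<open>4 * fps_X\<close>.\<close>
  have "y1 = 2 * coeff_y (-1) (G * \<Omega>) - coeff_y (-2) (g * \<Omega>)"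
    by (simp add: y1_def h_eq left_diff_distrib coeff_y_diff mult.assoc coeff_y_numeral
        coeff_y_yvar)
  then have "fps_deriv y1 + 4 * fps_X = 2 * coeff_y (-1) (G * fps_deriv \<Omega>)"
    by (simp add: string(2) G_def coeff_y_deriv[symmetric] power2_eq_square numeral_fps_const)
  then have "Q * (fps_deriv y1 + 4 * fps_X) = coeff_y (-1) (G * (emb Q * (2 * fps_deriv \<Omega>)))"
    by (simp add: mult.left_commute[of G] coeff_y_emb coeff_y_numeral)
  also have "\<dots> = coeff_y (-1) (emb (- 2 * Q * fps_deriv P) * (G * deriv_y \<Omega>) - emb (fps_deriv Q)
      * (G * deriv_y ((yvar - emb P) * \<Omega>)))"
    unfolding deriv_\<Omega> by (simp add: fls_const.fps_map_simps algebra_simps)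
  also have "\<dots> = 2 * Q * fps_deriv P * coeff_y (-1) (g * \<Omega>) + fps_deriv Q * coeff_y (-1) (g * ((yvar
      - emb P) * \<Omega>))"
    by (simp only: coeff_y_diff coeff_y_emb residue_by_parts deriv_y_G) simp
  also have "g * ((yvar - emb P) * \<Omega>) = yvar * (g * \<Omega>) - emb P * (g * \<Omega>)"
      by (simp add: algebra_simps)
  finally have "Q * (fps_deriv y1 + 4 * fps_X) = 2 * Q * fps_deriv P * coeff_y (-1) (g * \<Omega>) +
      fps_deriv Q * (coeff_y (-1 - 1) (g * \<Omega>) - P * coeff_y (-1) (g * \<Omega>))"
    by (simp only: coeff_y_diff coeff_y_yvar coeff_y_emb)
  then show ?thesis by (simp add: string)
qed

text \<open>Three differentiations in \<open>s\<close> produce the three factors: \<open>j\<close>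
  from the planar series itself, \<open>j + 4\<close> from \<open>fps_X ^ 5 * fps_deriv F\<close>,
  which is the residue of \<open>h \<omega>\<close>, and \<open>j + 2\<close> from
  \<open>y1\<close>, whose derivative is known by \<open>deriv_y1\<close>.\<close>

theorem planar_log_R:
  assumes euler: "\<And>j. of_nat j * fps_nth F j
      = (\<Sum>n=3..j + 2. (1 - 2 / of_nat n) * c n * fps_nth (T n) (j - (n - 2)))"
  shows "R * Abs_fps (\<lambda>j. of_nat (j * (j + 2) * (j + 4)) * fps_nth F j) = 4 * fps_X * fps_deriv R"
proof -
  have hw: "coeff_y (-1) (h * \<omega>) = fps_X ^ 5 * fps_deriv F"
  proof (rule fps_ext)
    fix j
    have "fps_nth (coeff_y (-1) (h * \<omega>)) j
        = (\<Sum>n<j - 1. fps_nth (T n) (j - n - 2) * ((1 - 2 / of_nat n) * c n))"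
      unfolding h_def residue_const_resolvent by (simp add: hf_def)
    also have "\<dots> = (\<Sum>n\<in>{3..<j - 1}. fps_nth (T n) (j - n - 2) * ((1 - 2 / of_nat n) * c n))"
      by (intro sum.mono_neutral_right) (auto simp: c)
    also have "\<dots> = fps_nth (fps_X ^ 5 * fps_deriv F) j"
    proof (cases "j < 5")
      case False
      define i where "i = j - 4"
      have j: "j = i + 4" "i \<ge> 1" using False by (auto simp: i_def)
      have "(\<Sum>n\<in>{3..<j - 1}. fps_nth (T n) (j - n - 2) * ((1 - 2 / of_nat n) * c n))
          = of_nat i * fps_nth F i"
        unfolding euler
      proof (intro sum.cong)
        show "{3..<j - 1} = {3..i + 2}" using j by auto
        fix n assume n: "n \<in> {3..i + 2}"
        then have "j - n - 2 = i - (n - 2)" using j by auto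
        then show "fps_nth (T n) (j - n - 2) * ((1 - 2 / of_nat n) * c n)
            = (1 - 2 / of_nat n) * c n * fps_nth (T n) (i - (n - 2))"
          by (simp only: mult_ac)
      qed
      then show ?thesis using j by (simp add: fps_X_power_mult_nth Suc_diff_le)
    qed (simp add: fps_X_power_mult_nth)
    finally show "fps_nth (coeff_y (-1) (h * \<omega>)) j = fps_nth (fps_X ^ 5 * fps_deriv F) j" .
  qed
  have "fps_deriv (h * \<omega>) = emb (2 * fps_X) * (h * \<Omega>)"
    by (simp add: h_def deriv_resolvent fls_const.fps_map_simps mult_ac)
  then have A: "fps_deriv (fps_X ^ 5 * fps_deriv F) = 2 * fps_X * y1"
    by (simp add: hw[symmetric] coeff_y_deriv[symmetric] coeff_y_emb y1_def)
  define D where "D = Abs_fps (\<lambda>j. of_nat (j * (j + 2) * (j + 4)) * fps_nth F j)"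
  have "2 * fps_X * fps_deriv y1 = fps_X ^ 2 * D"
  proof (rule fps_ext)
    fix k
    have "fps_nth (fps_deriv W) (k + 1) = of_nat (k + 2) * fps_nth W (k + 2)" for W :: "rat fps"
        by simp
    from this[of "fps_X ^ 5 * fps_deriv F"] have A': "of_nat (k + 2) * fps_nth (fps_X ^ 5
        * fps_deriv F) (k + 2) = 2 * fps_nth y1 k"
      unfolding A by (simp add: numeral_fps_const mult.assoc)
    have "fps_nth (2 * fps_X * fps_deriv y1) k = of_nat k * (2 * fps_nth y1 k)"
      by (cases k) (simp_all add: numeral_fps_const mult.assoc)
    also have "\<dots> = of_nat k * (of_nat (k + 2) * fps_nth (fps_X ^ 5 * fps_deriv F) (k + 2))"
        by (simp only: A')
    also have "\<dots> = fps_nth (fps_X ^ 2 * D) k"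
    proof (cases "k < 3")
      case True
      then have "k = 0 \<or> k = 1 \<or> k = 2" by auto
      then show ?thesis by (auto simp: fps_X_power_mult_nth D_def)
    next
      case False
      define i where "i = k - 3"
      have "k = i + 3" using False by (simp add: i_def)
      then show ?thesis by (simp add: fps_X_power_mult_nth D_def algebra_simps numeral_eq_Suc)
    qed
    finally show "fps_nth (2 * fps_X * fps_deriv y1) k = fps_nth (fps_X ^ 2 * D) k" .
  qed
  moreover have "R * fps_deriv y1 = 2 * fps_X ^ 2 * fps_deriv R"
  proof -
    have "fps_X ^ 2 * (R * (fps_deriv y1 + 4 * fps_X))
        = fps_X ^ 2 * (2 * fps_X ^ 2 * fps_deriv R + R * (4 * fps_X))"
      using deriv_y1 unfolding Q by (simp add: power2_eq_square algebra_simps)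
    then have "R * (fps_deriv y1 + 4 * fps_X) = 2 * fps_X ^ 2 * fps_deriv R + R * (4 * fps_X)"
      by (subst (asm) mult_left_cancel) simp_all
    then show ?thesis by (simp add: distrib_left)
  qed
  moreover have "fps_X ^ 2 * (R * D) = R * (fps_X ^ 2 * D)" "R * (2 * fps_X * fps_deriv y1)
      = 2 * fps_X * (R * fps_deriv y1)"
    by (simp_all only: mult_ac)
  ultimately have "fps_X ^ 2 * (R * D) = 2 * fps_X * (2 * fps_X ^ 2 * fps_deriv R)" by (simp only:)
  then have "fps_X ^ 2 * (R * D) = fps_X ^ 2 * (4 * fps_X * fps_deriv R)" by (simp add: mult_ac)
  then have "R * D = 4 * fps_X * fps_deriv R"
    by (subst (asm) mult_left_cancel) simp_all
  then show ?thesis by (simp only: D_def)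
qed

end

section \<open>The inverse square root of the cut polynomial\<close>

lemma coeff_fps_map_mult:
  "fps_map (\<lambda>p. coeff p k) (F * G)
      = (\<Sum>i\<le>k. fps_map (\<lambda>p. coeff p i) F * fps_map (\<lambda>p. coeff p (k - i)) (G :: rat poly fps))"
proof (rule fps_ext)
  fix n
  have "fps_nth (fps_map (\<lambda>p. coeff p k) (F * G)) n
      = (\<Sum>a=0..n. \<Sum>i\<le>k. coeff (fps_nth F a) i * coeff (fps_nth G (n - a)) (k - i))"
    by (simp add: fps_mult_nth coeff_sum coeff_mult)
  then show "fps_nth (fps_map (\<lambda>p. coeff p k) (F * G)) n
      = fps_nth (\<Sum>i\<le>k. fps_map (\<lambda>p. coeff p i) F * fps_map (\<lambda>p. coeff p (k - i)) G) n"
    by (simp add: fps_sum_nth fps_mult_nth sum.swap[of _ "{0..n}"])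
qed

definition geometric :: "rat \<Rightarrow> rat fps" where
  "geometric x = Abs_fps (\<lambda>k. x ^ k)"

lemma residue_poly_inv_y:
  "(fps_to_fls a * (fls_X_inv * poly_inv_y p)) $$ (- 1) = (\<Sum>k\<le>degree p. fps_nth a k * coeff p k)"
proof -
  have deg: "degree (map_poly (fls_const :: rat \<Rightarrow> rat fls) p) = degree p"
    by (rule degree_map_poly) simp
  have "fps_to_fls a * (fls_X_inv * poly_inv_y p)
      = (\<Sum>k\<le>degree p. fls_const (coeff p k) * (fls_X_inv ^ (k + 1) * fps_to_fls a))"
    by (simp add: poly_inv_y_def poly_altdef deg coeff_map_poly sum_distrib_left mult_ac)
  also have "\<dots> = (\<Sum>k\<le>degree p. fls_const (coeff p k) * fls_shift (int (k + 1)) (fps_to_fls a))"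
    by (simp only: fls_X_inv_power_times_conv_shift)
  finally have e: "fps_to_fls a * (fls_X_inv * poly_inv_y p)
      = (\<Sum>k\<le>degree p. fls_const (coeff p k) * fls_shift (int (k + 1)) (fps_to_fls a))" .
  show ?thesis unfolding e by (simp add: fls_nth_sum mult.commute)
qed

text \<open>The inverse square root of \<open>(y - P)\<^sup>2 - 4 Q\<close> is \<open>1/y\<close> times a series in \<open>s\<close> whose
  coefficients are polynomials in \<open>1/y\<close>; the latter can be evaluated.\<close>

lemma inverse_sqrt_exists:
  fixes P Q :: "rat fps"
  assumes P0: "fps_nth P 0 = 0" and Q0: "fps_nth Q 0 = 0"
  obtains \<Omega> e where
    "((yvar - emb P) ^ 2 - 4 * emb Q) * \<Omega> ^ 2 = 1" "bounded_y (-1) \<Omega>" "fps_nth \<Omega> 0 = fls_X_inv"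
    "coeff_y (-1) \<Omega> = 1" "coeff_y (-2) \<Omega> = P" "coeff_y (-3) \<Omega> = P ^ 2 + 2 * Q"
    "\<And>x. coeff_y (-1) (fps_const (fps_to_fls (geometric x)) * \<Omega>) = e x"
    "\<And>x. e x ^ 2 * ((1 - fps_const x * P) ^ 2 - 4 * fps_const (x ^ 2) * Q) = 1"
    "\<And>x. fps_nth (e x) 0 = 1"
proof -
  define lc where "lc = fps_map (\<lambda>c :: rat. [:c:])"
  \<comment> \<open>\<open>Z\<close> stands for \<open>1/y\<close>. A single series over the
    polynomials in \<open>Z\<close> then yields both the Laurent series \<open>\<Omega>\<close>,
    through \<open>poly_inv_y\<close>, and the values \<open>e x\<close>, through evaluation at
    \<open>x\<close>.\<close>
  define Z :: "rat poly fps" where "Z = fps_const [:0, 1:]"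
  define M where "M = (1 - lc P * Z) ^ 2 - 4 * lc Q * Z ^ 2"
  have lc_nth: "fps_nth (lc A) n = [:fps_nth A n:]" for A n by (simp add: lc_def)
  have M0: "fps_nth (M - 1) 0 = 0" using P0 Q0 by (simp add: M_def lc_nth fps_power_zeroth)
  \<comment> \<open>The binomial series of exponent \<open>-1/2\<close>, composed with a series
    without constant term, so that \<open>U ^ 2 * M = 1\<close>.\<close>
  define U where "U = lc (fps_binomial (- 1 / 2)) oo (M - 1)"
  have "fps_binomial (- 1 / 2) * fps_binomial (- 1 / 2) * (1 + fps_X) = (1 :: rat fps)"
    by (simp add: fps_binomial_add_mult[symmetric] fps_binomial_minus_one inverse_mult_eq_1)
  then have "lc (fps_binomial (- 1 / 2) * fps_binomial (- 1 / 2) * (1 + fps_X)) = lc 1" by simp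
  then have "lc (fps_binomial (- 1 / 2)) * lc (fps_binomial (- 1 / 2)) * (1 + fps_X) = 1"
    by (simp add: lc_def poly_const.fps_map_simps)
  then have "(lc (fps_binomial (- 1 / 2)) * lc (fps_binomial (- 1 / 2)) * (1 + fps_X)) oo (M - 1)
      = 1 oo (M - 1)" by simp
  then have UM: "U ^ 2 * M = 1"
    using M0 by (simp add: U_def fps_compose_mult_distrib fps_compose_add_distrib power2_eq_square)
  have U0: "fps_nth U 0 = 1" by (simp add: U_def lc_nth)
  define \<Omega> where "\<Omega> = fps_const fls_X_inv * fps_map poly_inv_y U"
  define e where "e = (\<lambda>x. fps_map (\<lambda>p. poly p x) U)"
  have lcE: "fps_map poly_inv_y (lc A) = emb A" for A
    by (rule fps_ext) (simp add: lc_nth poly_inv_y_def map_poly_pCons)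
  have ZE: "fps_map poly_inv_y Z = fps_const fls_X_inv"
    by (simp add: Z_def poly_inv_y.fps_map_const) (simp add: poly_inv_y_def map_poly_pCons)
  have yi: "yvar * fps_const fls_X_inv = 1"
    by (simp add: yvar_def fls_X_times_conv_shift)
  have ysq: "(yvar - emb P) ^ 2 - 4 * emb Q = yvar ^ 2 * fps_map poly_inv_y M"
  proof -
    have "yvar ^ 2 * fps_map poly_inv_y M
        = (yvar - (yvar * fps_const fls_X_inv) * emb P) ^ 2 - 4 * emb Q * (yvar
        * fps_const fls_X_inv) ^ 2"
      unfolding M_def
      by (simp add: poly_inv_y.fps_map_simps lcE ZE power2_eq_square algebra_simps)
    then show ?thesis by (simp add: yi)
  qed
  have \<Omega>_nth: "fps_nth \<Omega> j $$ i = (if i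
      < 0 then coeff (fps_nth U j) (nat (- i - 1)) else 0)" for i j
    by (simp add: \<Omega>_def fls_X_inv_times_conv_shift poly_inv_y_nth)
  have cy: "coeff_y (- 1 - int k) \<Omega> = fps_map (\<lambda>p. coeff p k) U" for k
    by (rule fps_ext) (simp add: coeff_y_nth \<Omega>_nth)
  \<comment> \<open>The first three coefficients of \<open>U\<close> in \<open>Z\<close> follow from
    comparing powers of \<open>Z\<close> in \<open>U ^ 2 * M = 1\<close>; the sign of
    \<open>a 0\<close> is fixed by its value at \<open>s = 0\<close>.\<close>
  define a where "a = (\<lambda>k. fps_map (\<lambda>p. coeff p k) U)"
  define b where "b = (\<lambda>k. fps_map (\<lambda>p. coeff p k) M)"
  define s where "s = (\<lambda>k. fps_map (\<lambda>p. coeff p k) (U ^ 2))"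
  have s: "s 0 = a 0 * a 0" "s 1 = 2 * a 0 * a 1" "s 2 = 2 * a 0 * a 2 + a 1 * a 1"
    unfolding s_def power2_eq_square coeff_fps_map_mult a_def
        by (simp_all add: numeral_2_eq_2 algebra_simps)
  have bM: "M = 1 + Z * lc (- 2 * P) + Z * Z * lc (P * P - 4 * Q)"
    unfolding M_def by (simp add: lc_def poly_const.fps_map_simps power2_eq_square algebra_simps)
  have Z_nth: "fps_nth (Z * G) n = pCons 0 (fps_nth G n)" for G n by (simp add: Z_def)
  have b: "b 0 = 1" "b 1 = - 2 * P" "b 2 = P * P - 4 * Q"
    unfolding b_def bM by (auto intro!: fps_ext simp: Z_nth lc_nth mult.assoc numeral_2_eq_2
        coeff_pCons split: nat.splits)
  have sb: "(\<Sum>i\<le>k. s i * b (k - i)) = (if k = 0 then 1 else 0)" for k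
    unfolding s_def b_def coeff_fps_map_mult[symmetric] UM by (rule fps_ext) simp
  have a00: "fps_nth (a 0) 0 = 1" by (simp add: a_def U0)
  have "a 0 * a 0 = 1" using sb[of 0] by (simp add: s b)
  then have "(a 0 - 1) * (a 0 + 1) = 0" by (simp add: algebra_simps)
  moreover have "fps_nth (a 0 + 1) 0 \<noteq> 0" using a00 by simp
  then have "a 0 + 1 \<noteq> 0" by (metis fps_zero_nth)
  ultimately have a0: "a 0 = 1" by simp
  have "s 0 * b 1 + s 1 * b 0 = 0" using sb[of "Suc 0"] by simp
  then have "2 * a 1 - 2 * P = 0" unfolding s b a0 by simp
  then have "2 * a 1 = 2 * P" by simp
  then have a1: "a 1 = P" by (subst (asm) mult_left_cancel) simp_all
  have "2 * a 2 + P * P - 4 * (P * P) + (P * P - 4 * Q) = 0"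
  proof -
    have "s 0 * b 2 + s 1 * b 1 + s 2 * b 0 = 0" using sb[of "Suc (Suc 0)"]
        by (simp add: numeral_2_eq_2)
    then show ?thesis unfolding s b a0 a1 by (simp add: algebra_simps)
  qed
  then have "2 * a 2 = 2 * (P ^ 2 + 2 * Q)" by (simp add: power2_eq_square algebra_simps)
  then have a2: "a 2 = P ^ 2 + 2 * Q" by (subst (asm) mult_left_cancel) simp_all
  show thesis
  proof
    have "((yvar - emb P) ^ 2 - 4 * emb Q) * \<Omega> ^ 2
        = (yvar * fps_const fls_X_inv) ^ 2 * (fps_map poly_inv_y (U ^ 2 * M))"
      unfolding ysq \<Omega>_def by (simp only: poly_inv_y.fps_map_mult poly_inv_y.fps_map_power
          power_mult_distrib mult_ac)
    then show "((yvar - emb P) ^ 2 - 4 * emb Q) * \<Omega> ^ 2 = 1"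
      by (simp only: yi UM poly_inv_y.fps_map_1 power_one mult_1)
    show "bounded_y (-1) \<Omega>" by (rule bounded_yI) (simp add: \<Omega>_nth)
    show "fps_nth \<Omega> 0 = fls_X_inv" by (simp add: \<Omega>_def U0 poly_inv_y.map_1)
    show "coeff_y (-1) \<Omega> = 1" using cy[of 0] a0 by (simp add: a_def)
    show "coeff_y (-2) \<Omega> = P" using cy[of 1] a1 by (simp add: a_def)
    show "coeff_y (-3) \<Omega> = P ^ 2 + 2 * Q" using cy[of 2] a2 by (simp add: a_def)
    fix x
    show "coeff_y (-1) (fps_const (fps_to_fls (geometric x)) * \<Omega>) = e x"
    proof (rule fps_ext)
      fix j
      have "fps_nth (coeff_y (-1) (fps_const (fps_to_fls (geometric x)) * \<Omega>)) j
          = (\<Sum>k\<le>degree (fps_nth U j). x ^ k * coeff (fps_nth U j) k)"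
        by (simp only: coeff_y_nth \<Omega>_def fps_mult_left_const_nth fps_map_nth residue_poly_inv_y)
            (simp add: geometric_def)
      then show "fps_nth (coeff_y (-1) (fps_const (fps_to_fls (geometric x)) * \<Omega>)) j
          = fps_nth (e x) j"
        by (simp add: e_def poly_altdef mult.commute)
    qed
    have lcP: "fps_map (\<lambda>p. poly p x) (lc A) = A" for A by (rule fps_ext) (simp add: lc_nth)
    have lcZ: "fps_map (\<lambda>p. poly p x) Z = fps_const x" by (simp add: Z_def poly_at.fps_map_const)
    have "fps_map (\<lambda>p. poly p x) (U ^ 2 * M) = 1" unfolding UM by (rule poly_at.fps_map_1)
    then show "e x ^ 2 * ((1 - fps_const x * P) ^ 2 - 4 * fps_const (x ^ 2) * Q) = 1"
      unfolding M_def e_def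
      by (simp add: poly_at.fps_map_simps lcP lcZ mult_ac fps_const_power)
    show "fps_nth (e x) 0 = 1" by (simp add: e_def U0)
  qed
qed

section \<open>Lagrange inversion\<close>

lemma fps_sqrt_unique:
  fixes e e' D :: "rat fps"
  assumes "e ^ 2 * D = 1" "e' ^ 2 * D = 1" "fps_nth e 0 = 1" "fps_nth e' 0 = 1"
  shows "e = e'"
proof -
  have "(e - e') * (e + e') * D = 0" using assms(1,2) by (simp add: power2_eq_square algebra_simps)
  moreover have "D \<noteq> 0" using assms(1) by auto
  moreover have "fps_nth (e + e') 0 \<noteq> 0" using assms(3,4) by simp
  then have "e + e' \<noteq> 0" by (metis fps_zero_nth)
  ultimately show ?thesis by simp
qed

text \<open>Invariance of the residue under \<open>t = \<Phi>(z)\<close> with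
  \<open>\<Phi> = z \<Psi>\<close>. For \<open>D = t^k\<close> the claim is that the residue of
  \<open>\<Phi>^(k-n) \<Phi>'\<close> is 1 if \<open>k = n - 1\<close> and 0 otherwise, where the
  form has a primitive.\<close>

lemma fps_lagrange:
  fixes D \<Psi> :: "'a::field_char_0 fps"
  assumes \<Psi>0: "fps_nth \<Psi> 0 \<noteq> 0" and n: "n \<ge> 1"
  shows "fps_nth ((D oo (fps_X * \<Psi>)) * fps_deriv (fps_X * \<Psi>) * inverse \<Psi> ^ n) (n - 1)
      = fps_nth D (n - 1)"
proof -
  define \<Phi> where "\<Phi> = fps_X * \<Psi>"
  define i\<Psi> where "i\<Psi> = inverse \<Psi>"
  have inv: "\<Psi> * i\<Psi> = 1" using \<Psi>0 by (simp add: i\<Psi>_def inverse_mult_eq_1')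
  have d\<Phi>: "fps_deriv \<Phi> = \<Psi> + fps_X * fps_deriv \<Psi>" by (simp add: \<Phi>_def)
  have di: "fps_deriv (i\<Psi> ^ j) = - of_nat j * fps_deriv \<Psi> * i\<Psi> ^ Suc j" for j
  proof -
    have "fps_deriv i\<Psi> = - fps_deriv \<Psi> * i\<Psi> ^ 2"
      unfolding i\<Psi>_def by (rule fps_inverse_deriv[OF \<Psi>0])
    then show ?thesis
      by (induction j) (simp_all add: power2_eq_square algebra_simps)
  qed
  have mono: "fps_nth (\<Phi> ^ k * fps_deriv \<Phi> * i\<Psi> ^ n) (n - 1) = (if k = n - 1 then 1 else 0)"
      if "k \<le> n - 1" for k
  proof -
    define j where "j = n - 1 - k"
    have nj: "n = k + j + 1" using that n by (simp add: j_def)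
    have "\<Phi> ^ k * fps_deriv \<Phi> * i\<Psi> ^ n = fps_X ^ k * (fps_deriv \<Phi> * ((\<Psi> * i\<Psi>) ^ k * i\<Psi> ^ (j + 1)))"
      by (simp add: \<Phi>_def nj power_add power_mult_distrib mult_ac)
    also have "\<dots> = fps_X ^ k * ((\<Psi> * i\<Psi>) * i\<Psi> ^ j + fps_X * (fps_deriv \<Psi> * i\<Psi> ^ Suc j))"
      by (simp add: inv d\<Phi> algebra_simps)
    finally have e: "\<Phi> ^ k * fps_deriv \<Phi> * i\<Psi> ^ n
        = fps_X ^ k * (i\<Psi> ^ j + fps_X * (fps_deriv \<Psi> * i\<Psi> ^ Suc j))" by (simp add: inv)
    have "fps_nth (\<Phi> ^ k * fps_deriv \<Phi> * i\<Psi> ^ n) (n - 1)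
        = fps_nth (i\<Psi> ^ j + fps_X * (fps_deriv \<Psi> * i\<Psi> ^ Suc j)) j"
      unfolding e by (simp add: fps_X_power_mult_nth nj)
    also have "\<dots> = (if j = 0 then 1 else 0)"
    proof (cases j)
      case (Suc m)
      have "of_nat j * fps_nth (fps_deriv \<Psi> * i\<Psi> ^ Suc j) m = - fps_nth (fps_deriv (i\<Psi> ^ j)) m"
        by (simp add: di fps_of_nat mult.assoc flip: fps_of_nat)
      also have "fps_nth (fps_deriv W) m = of_nat j * fps_nth W j" for W :: "'a fps" using Suc
          by simp
      then have "- fps_nth (fps_deriv (i\<Psi> ^ j)) m = of_nat j * (- fps_nth (i\<Psi> ^ j) j)" by simp
      finally have "fps_nth (fps_deriv \<Psi> * i\<Psi> ^ Suc j) m = - fps_nth (i\<Psi> ^ j) j"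
        using Suc by (subst (asm) mult_left_cancel) (simp_all del: of_nat_Suc power_Suc)
      then show ?thesis using Suc by simp
    qed simp
    finally show ?thesis using nj by auto
  qed
  let ?W = "fps_deriv \<Phi> * i\<Psi> ^ n"
  have \<Phi>0: "fps_nth (\<Phi> ^ k) i = 0" if "i < k" for i k
    using that by (simp add: \<Phi>_def power_mult_distrib fps_X_power_mult_nth)
  have comp: "fps_nth (D oo \<Phi>) i = (\<Sum>k<n. fps_nth D k * fps_nth (\<Phi> ^ k) i)" if "i \<le> n - 1" for i
    unfolding fps_compose_nth using that n by (intro sum.mono_neutral_left) (auto simp: \<Phi>0)
  have "fps_nth ((D oo \<Phi>) * ?W) (n - 1)
      = (\<Sum>i=0..n - 1. \<Sum>k<n. fps_nth D k * (fps_nth (\<Phi> ^ k) i * fps_nth ?W (n - 1 - i)))"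
    unfolding fps_mult_nth[of "D oo \<Phi>"]
        by (intro sum.cong refl) (simp add: comp sum_distrib_right mult.assoc)
  also have "\<dots> = (\<Sum>k<n. fps_nth D k * fps_nth (\<Phi> ^ k * ?W) (n - 1))"
    unfolding fps_mult_nth[of "\<Phi> ^ k" for k] by (subst sum.swap) (simp add: sum_distrib_left)
  also have "\<dots> = (\<Sum>k<n. if k = n - 1 then fps_nth D k else 0)"
    by (intro sum.cong refl) (use mono in \<open>auto simp: mult.assoc\<close>)
  also have "\<dots> = fps_nth D (n - 1)" using n by simp
  finally show ?thesis by (simp only: \<Phi>_def i\<Psi>_def mult.assoc)
qed

text \<open>The conclusion of the formal part, for a string equation whose solution is parametrized
  by \<open>z\<close> with \<open>t = s\<^sup>2 = z \<Psi>(z)\<close> and \<open>R = \<rho>(z)\<close>.\<close>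

locale planar_solution =
  fixes c :: "nat \<Rightarrow> rat" and \<Psi> \<rho> :: "rat fps"
  assumes c: "\<And>n. n < 3 \<Longrightarrow> c n = 0"
    and \<Psi>0: "fps_nth \<Psi> 0 \<noteq> 0" and \<rho>0: "fps_nth \<rho> 0 = 1"
begin

definition "branch = fps_inv (fps_X * \<Psi>)"
definition "z = branch oo fps_X ^ 2"
definition "r = \<rho> oo branch"

lemma branch_0: "fps_nth branch 0 = 0"
  by (simp add: branch_def fps_inv_def)

lemma branch_right: "(fps_X * \<Psi>) oo branch = fps_X"
  unfolding branch_def using \<Psi>0 by (intro fps_inv_right) simp_all

lemma branch_left: "branch oo (fps_X * \<Psi>) = fps_X"
  unfolding branch_def using \<Psi>0 by (intro fps_inv) simp_all

lemma z0: "fps_nth z 0 = 0"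
  by (simp add: z_def branch_0)

lemma compose_z: "F oo z = (F oo branch) oo fps_X ^ 2"
  unfolding z_def using branch_0 by (intro fps_compose_assoc) simp_all

lemma compose_z_eq: "(fps_X * \<Psi>) oo z = fps_X ^ 2"
  unfolding compose_z branch_right by simp

text \<open>The centre and the width of the cut are \<open>\<pi>\<close> and \<open>\<rho>\<close>
  in the parameter \<open>z\<close>. As \<open>z\<close> is a series in \<open>s^2\<close>, so is
  \<open>R\<close>, and this is what kills the odd coefficients.\<close>

lemma coeff_formula:
  assumes string: "\<And>P Q. P = \<pi> oo z \<Longrightarrow> Q = fps_X ^ 2 * (\<rho> oo z) \<Longrightarrow>
    \<exists>\<Omega>. ((yvar - emb P) ^ 2 - 4 * emb Q) * \<Omega> ^ 2 = 1 \<and> bounded_y (-1) \<Omega> \<and> coeff_y (-1) \<Omega> = 1 \<and>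
      fps_nth \<Omega> 0 = fls_X_inv \<and> coeff_y (-1) (dpotential c * \<Omega>) = 0
          \<and> coeff_y (-2) (dpotential c * \<Omega>) = 2 * fps_X ^ 2"
  shows "odd j \<Longrightarrow> fps_nth (planar_series c) j = 0"
    and "n \<ge> 1 \<Longrightarrow> of_nat (n * (n + 1) * (n + 2)) * fps_nth (planar_series c) (2 * n) =
      fps_nth (fps_deriv \<rho> * inverse \<rho> * inverse \<Psi> ^ n) (n - 1)"
proof -
  define F where "F = planar_series c"
  define D where "D = Abs_fps (\<lambda>j. of_nat (j * (j + 2) * (j + 4)) * fps_nth F j)"
  define R where "R = \<rho> oo z"
  from string[OF refl refl] obtain \<Omega> where \<Omega>: "((yvar - emb (\<pi> oo z)) ^ 2 - 4 * emb (fps_X ^ 2 * R))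
      * \<Omega> ^ 2 = 1"
    "bounded_y (-1) \<Omega>" "coeff_y (-1) \<Omega> = 1" "fps_nth \<Omega> 0 = fls_X_inv"
    "coeff_y (-1) (dpotential c * \<Omega>) = 0" "coeff_y (-2) (dpotential c * \<Omega>) = 2 * fps_X ^ 2"
    unfolding R_def by blast
  interpret one_cut c "planar_moment c" "\<pi> oo z" "fps_X ^ 2 * R" R \<Omega>
    by standard (use c \<Omega> planar_moment_0 planar_moment_loop in auto)
  have RD: "R * D = 4 * fps_X * fps_deriv R"
    unfolding D_def F_def by (rule planar_log_R) (rule planar_series_euler)
  have r0: "fps_nth r 0 = 1" using \<rho>0 by (simp add: r_def)
  define G where "G = fps_deriv r * inverse r"
  have rG: "r * G = fps_deriv r" using r0 by (simp add: G_def inverse_mult_eq_1' mult.left_commute)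
  have R: "R = r oo fps_X ^ 2" by (simp add: R_def r_def compose_z)
  have "fps_deriv R = (fps_deriv r oo fps_X ^ 2) * (2 * fps_X)"
    unfolding R by (subst fps_compose_deriv) (simp_all add: power2_eq_square numeral_fps_const
        algebra_simps)
  also have "fps_deriv r oo fps_X ^ 2 = R * (G oo fps_X ^ 2)"
    unfolding rG[symmetric] R by (rule fps_compose_mult_distrib) simp
  finally have "R * D = R * (8 * fps_X ^ 2 * (G oo fps_X ^ 2))"
    unfolding RD by (simp add: power2_eq_square mult_ac)
  moreover have "R \<noteq> 0"
  proof
    assume "R = 0"
    then have "fps_nth R 0 = 0" by simp
    then show False using r0 by (simp add: R)
  qed
  ultimately have D: "D = 8 * fps_X ^ 2 * (G oo fps_X ^ 2)"
      by (subst (asm) mult_left_cancel) simp_all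
  have Gnth: "fps_nth (G oo fps_X ^ 2) k = (if even k then fps_nth G (k div 2) else 0)" for k
  proof -
    have "fps_nth (G oo fps_X ^ 2) k = (\<Sum>i=0..k.
        if i = k div 2 then (if even k then fps_nth G i else 0) else 0)"
      unfolding fps_compose_nth by (intro sum.cong refl) (auto simp: power_mult[symmetric])
    then show ?thesis by simp
  qed
  have Dnth: "of_nat (j * (j + 2) * (j + 4)) * fps_nth F j = (if even j
      \<and> j \<noteq> 0 then 8 * fps_nth G (j div 2 - 1) else 0)" for j
  proof -
    have "of_nat (j * (j + 2) * (j + 4)) * fps_nth F j
        = fps_nth (8 * fps_X ^ 2 * (G oo fps_X ^ 2)) j"
      unfolding D[symmetric] by (simp add: D_def)
    also have "\<dots> = (if j < 2 then 0 else 8 * fps_nth (G oo fps_X ^ 2) (j - 2))"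
      by (simp add: mult.assoc numeral_fps_const fps_X_power_mult_nth)
    also have "\<dots> = (if even j \<and> j \<noteq> 0 then 8 * fps_nth G (j div 2 - 1) else 0)"
    proof (cases "j < 2")
      case True
      then have "j = 0 \<or> j = 1" by auto
      then show ?thesis by auto
    next
      case False
      then have "even (j - 2) = even j" "(j - 2) div 2 = j div 2 - 1" by auto
      then show ?thesis using False by (simp add: Gnth)
    qed
    finally show ?thesis .
  qed
  show "fps_nth (planar_series c) j = 0" if "odd j"
  proof -
    have "of_nat (j * (j + 2) * (j + 4)) \<noteq> (0 :: rat)" using odd_pos[OF that]
        by (simp only: of_nat_eq_0_iff) simp
    moreover have "of_nat (j * (j + 2) * (j + 4)) * fps_nth F j = 0" using Dnth[of j] that by simp
    ultimately show ?thesis by (simp only: F_def mult_eq_0_iff) simp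
  qed
  show "of_nat (n * (n + 1) * (n + 2)) * fps_nth (planar_series c) (2 * n) =
      fps_nth (fps_deriv \<rho> * inverse \<rho> * inverse \<Psi> ^ n) (n - 1)" if n: "n \<ge> 1"
  proof -
    have "8 * (of_nat (n * (n + 1) * (n + 2)) * fps_nth F (2 * n)) = 8 * fps_nth G (n - 1)"
      using Dnth[of "2 * n"] n by (simp add: algebra_simps)
    then have "of_nat (n * (n + 1) * (n + 2)) * fps_nth F (2 * n) = fps_nth G (n - 1)" by simp
    also have "\<dots> = fps_nth ((G oo (fps_X * \<Psi>)) * fps_deriv (fps_X * \<Psi>) * inverse \<Psi> ^ n) (n - 1)"
      by (rule fps_lagrange[OF \<Psi>0 n, symmetric])
    \<comment> \<open>By the chain rule this is the logarithmic derivative of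
      \<open>r oo (fps_X * \<Psi>) = \<rho>\<close>.\<close>
    also have "(G oo (fps_X * \<Psi>)) * fps_deriv (fps_X * \<Psi>) = fps_deriv \<rho> * inverse \<rho>"
    proof -
      have r\<Phi>: "r oo (fps_X * \<Psi>) = \<rho>"
        unfolding r_def by (subst fps_compose_assoc[symmetric]) (simp_all add: branch_0 branch_left)
      have "\<rho> * ((G oo (fps_X * \<Psi>)) * fps_deriv (fps_X * \<Psi>))
          = ((r * G) oo (fps_X * \<Psi>)) * fps_deriv (fps_X * \<Psi>)"
        by (simp add: fps_compose_mult_distrib r\<Phi> mult.assoc)
      also have "\<dots> = fps_deriv (r oo (fps_X * \<Psi>))" unfolding rG
          by (subst fps_compose_deriv) simp_all
      also have "\<dots> = \<rho> * (fps_deriv \<rho> * inverse \<rho>)" unfolding r\<Phi> using \<rho>0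
          by (simp add: inverse_mult_eq_1' mult.left_commute)
      finally show ?thesis using \<rho>0 by (subst (asm) mult_left_cancel) auto
    qed
    finally show ?thesis by (simp add: F_def)
  qed
qed

end

text \<open>With \<open>P = 0\<close> and \<open>z = 1 - sqrt (1 - 4 Q)\<close> the second string
  equation becomes \<open>2 (1 - z) t = z (1 - 3 z + z^2)\<close>, that is
  \<open>t = z \<Psi>(z)\<close>; then \<open>\<rho>\<close> is \<open>Q / t\<close>.\<close>

definition \<Psi>_even :: "'a::field_char_0 fps" where
  "\<Psi>_even = (1 - 3 * fps_X + fps_X ^ 2) * inverse (2 * (1 - fps_X))"

definition \<rho>_even :: "'a::field_char_0 fps" where
  "\<rho>_even = (1 - fps_X) * (2 - fps_X) * inverse (2 * (1 - 3 * fps_X + fps_X ^ 2))"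

text \<open>Here \<open>z = 2 P\<close>. The first string equation reads
  \<open>(1 + z)^2 ((1 - P)^2 - 4 Q) = 1\<close> and gives \<open>Q\<close>; the second,
  \<open>2 P^2 + 4 Q - P = 2 t\<close>, gives \<open>t = z \<Psi>(z)\<close>, and
  \<open>\<rho>\<close> is again \<open>Q / t\<close>.\<close>

definition \<Psi>_full :: "'a::field_char_0 fps" where
  "\<Psi>_full = (fps_X - 1) * (3 * fps_X ^ 2 + 3 * fps_X - 2) * inverse (8 * (1 + fps_X) ^ 2)"

definition \<rho>_full :: "'a::field_char_0 fps" where
  "\<rho>_full = (fps_X ^ 2 - fps_X - 4) * inverse (2 * (3 * fps_X ^ 2 + 3 * fps_X - 2))"


interpretation even: planar_solution weights_even \<Psi>_even \<rho>_even
  by standard (simp_all add: weights_even_def \<Psi>_even_def \<rho>_even_def power2_eq_square)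

interpretation full: planar_solution weights_full \<Psi>_full \<rho>_full
  by standard (simp_all add: weights_full_def \<Psi>_full_def \<rho>_full_def power2_eq_square)

lemmas fps_compose_simps = fps_compose_add_distrib fps_compose_sub_distrib fps_compose_mult_distrib
  fps_compose_power[symmetric]

lemma fps_compose_quotient:
  fixes a b :: "'a::field fps"
  assumes "fps_nth b 0 \<noteq> 0" "fps_nth w 0 = 0"
  shows "(b oo w) * ((a * inverse b) oo w) = a oo w"
proof -
  have "b * (a * inverse b) = a" using assms(1) by (simp add: mult.left_commute inverse_mult_eq_1')
  then show ?thesis by (simp only: fps_compose_mult_distrib[OF assms(2), symmetric])
qed

text \<open>A polynomial of degree one plus a geometric series, whose residue against
  \<open>\<Omega>\<close> is the value \<open>e 1\<close>. For the even potential
  \<open>e (- 1)\<close> occurs as well.\<close>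

lemma potential_full: "potential_fps weights_full = 2 * fps_X + 1 - geometric 1"
  by (rule fps_ext) (auto simp: potential_fps_def weights_full_def geometric_def fps_X_def
      numeral_fps_const)

lemma potential_even: "potential_fps weights_even
    = 2 * fps_X - fps_const (1 / 2) * (geometric 1 - geometric (- 1))"
proof (rule fps_ext)
  fix n
  show "fps_nth (potential_fps weights_even) n
      = fps_nth (2 * fps_X - fps_const (1 / 2) * (geometric 1 - geometric (- 1))) n"
    by (cases "even n") (auto simp: potential_fps_def weights_even_def geometric_def fps_X_def
        numeral_fps_const elim!: oddE)
qed

lemma X_geometric: "fps_X * (fps_const x * geometric x) = geometric x - 1"
proof (rule fps_ext)
  fix n
  show "fps_nth (fps_X * (fps_const x * geometric x)) n = fps_nth (geometric x - 1) n"
    by (cases n) (simp_all add: geometric_def)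
qed

definition dres :: "rser \<Rightarrow> rat fps \<Rightarrow> rat fps" where
  "dres \<Omega> a = coeff_y (-1) (fps_const (fps_to_fls a) * \<Omega>)"

lemma dres_add: "dres \<Omega> (a + b) = dres \<Omega> a + dres \<Omega> b"
  by (simp add: dres_def distrib_right coeff_y_add flip: fps_const_add)

lemma dres_diff: "dres \<Omega> (a - b) = dres \<Omega> a - dres \<Omega> b"
  by (simp add: dres_def left_diff_distrib coeff_y_diff flip: fps_const_sub)

lemma dres_const: "dres \<Omega> (fps_const x * a) = fps_const x * dres \<Omega> a"
proof -
  have "fps_const (fps_to_fls (fps_const x * a)) = emb (fps_const x) * fps_const (fps_to_fls a)"
    by (simp add: fls_times_fps_to_fls fls_const.fps_map_const)
  then show ?thesis by (simp add: dres_def mult.assoc coeff_y_emb)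
qed

lemma dres_X: "dres \<Omega> (fps_X ^ k) = coeff_y (- 1 - int k) \<Omega>"
proof -
  have "coeff_y i (fps_const (fls_X ^ k) * \<Omega>) = coeff_y (i - int k) \<Omega>" for i
    by (rule fps_ext) (simp add: coeff_y_nth fls_X_power_times_conv_shift)
  then show ?thesis by (simp add: dres_def fps_to_fls_power)
qed

lemma coeff_y_2_dpotential: "coeff_y (-2) (dpotential c * \<Omega>) = dres \<Omega> (fps_X * potential_fps c)"
proof -
  have "fps_const (fps_to_fls (fps_X * potential_fps c)) = yvar * dpotential c"
    by (simp add: dpotential_def yvar_def fls_times_fps_to_fls)
  then show ?thesis by (simp add: dres_def mult.assoc coeff_y_yvar)
qed

lemma even_string:
  assumes "P = 0 oo even.z" "Q = fps_X ^ 2 * (\<rho>_even oo even.z)"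
  shows "\<exists>\<Omega>. ((yvar - emb P) ^ 2 - 4 * emb Q) * \<Omega> ^ 2 = 1 \<and> bounded_y (-1) \<Omega> \<and> coeff_y (-1) \<Omega> = 1 \<and>
      fps_nth \<Omega> 0 = fls_X_inv \<and> coeff_y (-1) (dpotential weights_even * \<Omega>) = 0 \<and>
      coeff_y (-2) (dpotential weights_even * \<Omega>) = 2 * fps_X ^ 2"
proof -
  let ?z = even.z
  have z0: "fps_nth ?z 0 = 0" by (rule even.z0)
  have P: "P = 0" using assms(1) by simp
  have "fps_nth P 0 = 0" "fps_nth Q 0 = 0" by (simp_all add: assms P power2_eq_square)
  then obtain \<Omega> e where \<Omega>: "((yvar - emb P) ^ 2 - 4 * emb Q) * \<Omega> ^ 2
      = 1" "bounded_y (-1) \<Omega>" "fps_nth \<Omega> 0 = fls_X_inv"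
    "coeff_y (-1) \<Omega> = 1" "coeff_y (-2) \<Omega> = P" "coeff_y (-3) \<Omega> = P ^ 2 + 2 * Q"
    "\<And>x. coeff_y (-1) (fps_const (fps_to_fls (geometric x)) * \<Omega>) = e x"
    "\<And>x. e x ^ 2 * ((1 - fps_const x * P) ^ 2 - 4 * fps_const (x ^ 2) * Q) = 1"
    "\<And>x. fps_nth (e x) 0 = 1"
    using inverse_sqrt_exists by metis
  have "(2 * (1 - ?z)) * (\<Psi>_even oo ?z) = 1 - 3 * ?z + ?z ^ 2"
    using fps_compose_quotient[of "2 * (1 - fps_X)" ?z "1 - 3 * fps_X + fps_X ^ 2"] z0
    by (simp add: \<Psi>_even_def fps_compose_simps)
  then have "?z * ((2 * (1 - ?z)) * (\<Psi>_even oo ?z)) = ?z * (1 - 3 * ?z + ?z ^ 2)" by (simp only:)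
  moreover have "?z * (\<Psi>_even oo ?z) = fps_X ^ 2"
    using even.compose_z_eq z0 by (simp add: fps_compose_mult_distrib)
  moreover have "?z * ((2 * (1 - ?z)) * (\<Psi>_even oo ?z)) = 2 * (1 - ?z) * (?z * (\<Psi>_even oo ?z))"
      by (simp only: mult_ac)
  ultimately have t: "2 * (1 - ?z) * fps_X ^ 2 = ?z * (1 - 3 * ?z + ?z ^ 2)" by (simp only:)
  have \<rho>: "2 * (1 - 3 * ?z + ?z ^ 2) * (\<rho>_even oo ?z) = (1 - ?z) * (2 - ?z)"
    using fps_compose_quotient[of "2 * (1 - 3 * fps_X + fps_X ^ 2)" ?z "(1 - fps_X) * (2
        - fps_X)"] z0
    by (simp add: \<rho>_even_def fps_compose_simps fps_power_zeroth)
  let ?d = "1 - 3 * ?z + ?z ^ 2"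
  have "fps_nth ?d 0 \<noteq> 0" using z0 by (simp add: power2_eq_square)
  then have d: "?d \<noteq> 0" by (metis fps_zero_nth)
  have "?d * (4 * Q) = 2 * fps_X ^ 2 * (2 * ?d * (\<rho>_even oo ?z))" by (simp add: assms(2) mult_ac)
  also have "\<dots> = (2 * (1 - ?z) * fps_X ^ 2) * (2 - ?z)" unfolding \<rho> by (simp add: mult_ac)
  also have "\<dots> = ?d * (?z * (2 - ?z))" unfolding t by (simp add: mult_ac)
  \<comment> \<open>This makes \<open>1 - 4 Q\<close> the square of \<open>1 - z\<close>, so that
    \<open>e 1\<close> and \<open>e (- 1)\<close> are rational in \<open>z\<close>.\<close>
  finally have Q: "4 * Q = ?z * (2 - ?z)" using d by simp
  have u0: "fps_nth (1 - ?z) 0 = 1" using z0 by simp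
  have e: "e x = inverse (1 - ?z)" if "x ^ 2 = 1" for x
  proof (rule fps_sqrt_unique)
    show "e x ^ 2 * (1 - ?z) ^ 2 = 1"
    proof -
      have "(1 - ?z) ^ 2 = 1 - 4 * Q" unfolding Q by (simp add: power2_eq_square algebra_simps)
      then show ?thesis using \<Omega>(8)[of x] that by (simp add: P)
    qed
    show "(inverse (1 - ?z)) ^ 2 * (1 - ?z) ^ 2 = 1"
      using u0 by (simp add: power_mult_distrib[symmetric] inverse_mult_eq_1)
  qed (use u0 \<Omega>(9) in simp_all)
  have ge: "dres \<Omega> (geometric x) = e x" for x using \<Omega>(7) by (simp add: dres_def)
  have s1: "coeff_y (-1) (dpotential weights_even * \<Omega>) = 0"
  proof -
    have "coeff_y (-1) (dpotential weights_even * \<Omega>)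
        = dres \<Omega> (fps_const 2 * fps_X ^ 1 - fps_const (1 / 2) * (geometric 1 - geometric (- 1)))"
      by (simp add: dpotential_def dres_def potential_even numeral_fps_const)
    also have "\<dots> = 0"
      unfolding dres_diff dres_const dres_X ge by (simp add: e \<Omega>(5) P)
    finally show ?thesis .
  qed
  have s2: "coeff_y (-2) (dpotential weights_even * \<Omega>) = 2 * fps_X ^ 2"
  proof -
    have "fps_X * potential_fps weights_even
        = fps_const 2 * fps_X ^ 2 + fps_X ^ 0 - fps_const (1 / 2) * (geometric 1 + geometric (- 1))"
    proof -
      have "fps_X * geometric 1 = geometric 1 - 1" using X_geometric[of 1] by simp
      moreover have "fps_X * geometric (- 1) = 1 - geometric (- 1)"
        using X_geometric[of "- 1"] by (simp add: fps_const_neg[symmetric] minus_equation_iff[of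
            "fps_X * _"] del: fps_const_neg)
      moreover have h2: "fps_const (1 / 2) * 2 = (1 :: rat fps)" by (simp add: numeral_fps_const)
      moreover have "fps_X * potential_fps weights_even
          = 2 * fps_X ^ 2 - fps_const (1 / 2) * (fps_X * geometric 1 - fps_X * geometric (- 1))"
        unfolding potential_even by (simp add: power2_eq_square algebra_simps)
      ultimately have "fps_X * potential_fps weights_even
          = 2 * fps_X ^ 2 - fps_const (1 / 2) * (geometric 1 - 1 - (1 - geometric (- 1)))"
        by (simp only:)
      also have "\<dots> = 2 * fps_X ^ 2 + fps_const (1 / 2) * 2 - fps_const (1 / 2) * (geometric 1
          + geometric (- 1))"
        by (simp only: algebra_simps) (simp add: algebra_simps)
      finally show ?thesis by (simp only: h2 numeral_fps_const[of "num.Bit0 num.One",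
          symmetric] power_0)
    qed
    then have "coeff_y (-2) (dpotential weights_even * \<Omega>)
        = fps_const 2 * (2 * Q) + 1 - fps_const (1 / 2) * (2 * inverse (1 - ?z))"
      unfolding coeff_y_2_dpotential by (simp add: dres_diff dres_add dres_const dres_X ge e \<Omega>(4,6)
          P del: power_0)
    also have "\<dots> = 4 * Q + 1 - inverse (1 - ?z)"
      by (simp add: numeral_fps_const mult.assoc[symmetric])
    finally have "coeff_y (-2) (dpotential weights_even * \<Omega>) * (1 - ?z)
        = (4 * Q + 1) * (1 - ?z) - inverse (1 - ?z) * (1 - ?z)"
      by (simp add: left_diff_distrib)
    also have "\<dots> = 2 * fps_X ^ 2 * (1 - ?z)"
    proof -
      have "inverse (1 - ?z) * (1 - ?z) = 1" using u0 by (intro inverse_mult_eq_1) simp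
      then show ?thesis using t unfolding Q by (simp add: power2_eq_square algebra_simps)
    qed
    finally show ?thesis using u0 by (subst (asm) mult_right_cancel) (auto simp: fps_eq_iff intro!:
        exI[of _ 0])
  qed
  show ?thesis using \<Omega>(1-4) s1 s2 by blast
qed

lemma full_string:
  assumes "P = fps_const (1 / 2) * fps_X oo full.z" "Q = fps_X ^ 2 * (\<rho>_full oo full.z)"
  shows "\<exists>\<Omega>. ((yvar - emb P) ^ 2 - 4 * emb Q) * \<Omega> ^ 2 = 1 \<and> bounded_y (-1) \<Omega> \<and> coeff_y (-1) \<Omega> = 1 \<and>
      fps_nth \<Omega> 0 = fls_X_inv \<and> coeff_y (-1) (dpotential weights_full * \<Omega>) = 0 \<and>
      coeff_y (-2) (dpotential weights_full * \<Omega>) = 2 * fps_X ^ 2"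
proof -
  let ?z = full.z
  have z0: "fps_nth ?z 0 = 0" by (rule full.z0)
  have P: "P = fps_const (1 / 2) * ?z" using z0 by (simp add: assms(1) fps_compose_mult_distrib)
  have P2: "2 * P = ?z" by (simp add: P numeral_fps_const mult.assoc[symmetric])
  have "fps_nth P 0 = 0" "fps_nth Q 0 = 0" by (simp_all add: assms P z0 power2_eq_square)
  then obtain \<Omega> e where \<Omega>: "((yvar - emb P) ^ 2 - 4 * emb Q) * \<Omega> ^ 2
      = 1" "bounded_y (-1) \<Omega>" "fps_nth \<Omega> 0 = fls_X_inv"
    "coeff_y (-1) \<Omega> = 1" "coeff_y (-2) \<Omega> = P" "coeff_y (-3) \<Omega> = P ^ 2 + 2 * Q"
    "\<And>x. coeff_y (-1) (fps_const (fps_to_fls (geometric x)) * \<Omega>) = e x"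
    "\<And>x. e x ^ 2 * ((1 - fps_const x * P) ^ 2 - 4 * fps_const (x ^ 2) * Q) = 1"
    "\<And>x. fps_nth (e x) 0 = 1"
    using inverse_sqrt_exists by metis
  have "(8 * (1 + ?z) ^ 2) * (\<Psi>_full oo ?z) = (?z - 1) * (3 * ?z ^ 2 + 3 * ?z - 2)"
    using fps_compose_quotient[of "8 * (1 + fps_X) ^ 2" ?z "(fps_X - 1) * (3 * fps_X ^ 2 + 3 * fps_X
        - 2)"] z0
    by (simp add: \<Psi>_full_def fps_compose_simps fps_power_zeroth)
  then have "?z * ((8 * (1 + ?z) ^ 2) * (\<Psi>_full oo ?z))
      = ?z * ((?z - 1) * (3 * ?z ^ 2 + 3 * ?z - 2))" by (simp only:)
  moreover have "?z * (\<Psi>_full oo ?z) = fps_X ^ 2"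
    using full.compose_z_eq z0 by (simp add: fps_compose_mult_distrib)
  moreover have "?z * ((8 * (1 + ?z) ^ 2) * (\<Psi>_full oo ?z))
      = 8 * (1 + ?z) ^ 2 * (?z * (\<Psi>_full oo ?z))" by (simp only: mult_ac)
  ultimately have t: "8 * (1 + ?z) ^ 2 * fps_X ^ 2 = ?z * ((?z - 1) * (3 * ?z ^ 2 + 3 * ?z - 2))"
      by (simp only:)
  have \<rho>: "2 * (3 * ?z ^ 2 + 3 * ?z - 2) * (\<rho>_full oo ?z) = ?z ^ 2 - ?z - 4"
    using fps_compose_quotient[of "2 * (3 * fps_X ^ 2 + 3 * fps_X - 2)" ?z "fps_X ^ 2 - fps_X
        - 4"] z0
    by (simp add: \<rho>_full_def fps_compose_simps fps_power_zeroth)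
  let ?d = "3 * ?z ^ 2 + 3 * ?z - 2"
  have "fps_nth ?d 0 \<noteq> 0" using z0 by (simp add: power2_eq_square)
  then have d: "?d \<noteq> 0" by (metis fps_zero_nth)
  have "?d * (16 * Q * (1 + ?z) ^ 2) = (8 * (1 + ?z) ^ 2 * fps_X ^ 2) * (2 * ?d * (\<rho>_full oo ?z))"
      by (simp add: assms(2) mult_ac)
  also have "\<dots> = ?d * (?z * (?z - 1) * (?z ^ 2 - ?z - 4))" unfolding \<rho> t by (simp add: mult_ac)
  finally have Q: "16 * Q * (1 + ?z) ^ 2 = ?z * (?z - 1) * (?z ^ 2 - ?z - 4)" using d by simp
  have e: "e 1 = 1 + ?z"
  proof (rule fps_sqrt_unique)
    show "e 1 ^ 2 * ((1 - P) ^ 2 - 4 * Q) = 1" using \<Omega>(8)[of 1] by simp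
    have "4 * ((1 + ?z) ^ 2 * ((1 - P) ^ 2 - 4 * Q))
        = ((1 + ?z) * (2 - 2 * P)) ^ 2 - 16 * Q * (1 + ?z) ^ 2"
      by (simp add: power2_eq_square algebra_simps)
    also have "\<dots> = 4 * 1" unfolding P2 Q by (simp add: power2_eq_square algebra_simps)
    finally show "(1 + ?z) ^ 2 * ((1 - P) ^ 2 - 4 * Q) = 1"
        by (subst (asm) mult_left_cancel) simp_all
  qed (use z0 \<Omega>(9) in simp_all)
  have ge: "dres \<Omega> (geometric x) = e x" for x using \<Omega>(7) by (simp add: dres_def)
  have s1: "coeff_y (-1) (dpotential weights_full * \<Omega>) = 0"
  proof -
    have "coeff_y (-1) (dpotential weights_full * \<Omega>)
        = dres \<Omega> (fps_const 2 * fps_X ^ 1 + fps_X ^ 0 - geometric 1)"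
      by (simp add: dpotential_def dres_def potential_full numeral_fps_const)
    also have "\<dots> = 0"
      unfolding dres_diff dres_add dres_const dres_X ge e
          by (simp add: \<Omega>(4,5) P2[symmetric] numeral_fps_const)
    finally show ?thesis .
  qed
  have s2: "coeff_y (-2) (dpotential weights_full * \<Omega>) = 2 * fps_X ^ 2"
  proof -
    have "fps_X * potential_fps weights_full = fps_const 2 * fps_X ^ 2 + fps_X + 1 - geometric 1"
      using X_geometric[of 1] by (simp add: potential_full numeral_fps_const power2_eq_square
          algebra_simps)
    moreover have d1: "dres \<Omega> 1 = 1" and dX: "dres \<Omega> fps_X = P"
      using dres_X[of \<Omega> 0] dres_X[of \<Omega> 1] by (simp_all add: \<Omega>(4,5))
    ultimately have "coeff_y (-2) (dpotential weights_full * \<Omega>)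
        = fps_const 2 * (P ^ 2 + 2 * Q) + P + 1 - (1 + ?z)"
      unfolding coeff_y_2_dpotential by (simp add: dres_diff dres_add dres_const dres_X d1 dX ge e
          \<Omega>(6))
    then have eq: "coeff_y (-2) (dpotential weights_full * \<Omega>) = 2 * P ^ 2 + 4 * Q - P"
      by (simp add: P2[symmetric] numeral_fps_const[of "num.Bit0 num.One", symmetric] algebra_simps)
    have "(4 * (1 + ?z) ^ 2) * (2 * P ^ 2 + 4 * Q - P)
        = (1 + ?z) ^ 2 * (2 * (2 * P) ^ 2 - 2 * (2 * P)) + 16 * Q * (1 + ?z) ^ 2"
      by (simp add: power2_eq_square algebra_simps)
    also have "\<dots> = 8 * (1 + ?z) ^ 2 * fps_X ^ 2" unfolding Q P2 t
        by (simp add: power2_eq_square algebra_simps)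
    also have "\<dots> = (4 * (1 + ?z) ^ 2) * (2 * fps_X ^ 2)" by simp
    finally have "2 * P ^ 2 + 4 * Q - P = 2 * fps_X ^ 2"
      using z0 by (subst (asm) mult_left_cancel) (auto simp: fps_eq_iff intro!: exI[of _ 0])
    then show ?thesis by (simp add: eq)
  qed
  show ?thesis using \<Omega>(1-4) s1 s2 by blast
qed

lemma planar_series_0: "fps_nth (planar_series c) 0 = 0"
  by (simp add: planar_series_def specialize_nth Mseries_inverse planar_limit_var_0)

theorem planar_even_coeffs:
  "fps_nth planar_even 0 = 0"
  "n \<ge> 1 \<Longrightarrow> of_nat (n * (n + 1) * (n + 2)) * fps_nth planar_even n =
     fps_nth (fps_deriv \<rho>_even * inverse \<rho>_even * inverse \<Psi>_even ^ n) (n - 1)"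
proof -
  show "fps_nth planar_even 0 = 0" by (simp add: planar_even_nth planar_series_0)
  show "of_nat (n * (n + 1) * (n + 2)) * fps_nth planar_even n =
     fps_nth (fps_deriv \<rho>_even * inverse \<rho>_even * inverse \<Psi>_even ^ n) (n - 1)" if "n \<ge> 1"
    unfolding planar_even_nth
    by (rule even.coeff_formula(2)[where \<pi> = 0, OF _ that]) (erule (1) even_string)
qed

theorem planar_full_coeffs:
  "fps_nth planar_full 0 = 0"
  "n \<ge> 1 \<Longrightarrow> of_nat (n * (n + 1) * (n + 2)) * fps_nth planar_full n =
     fps_nth (fps_deriv \<rho>_full * inverse \<rho>_full * inverse \<Psi>_full ^ n) (n - 1)"
proof -
  show "fps_nth planar_full 0 = 0" by (simp add: planar_full_def planar_full_sqrt_eq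
      planar_series_0)
  show "of_nat (n * (n + 1) * (n + 2)) * fps_nth planar_full n =
     fps_nth (fps_deriv \<rho>_full * inverse \<rho>_full * inverse \<Psi>_full ^ n) (n - 1)" if "n \<ge> 1"
    unfolding planar_full_def planar_full_sqrt_eq fps_nth_Abs_fps
    by (rule full.coeff_formula(2)[where \<pi>
        = "fps_const (1 / 2) * fps_X", OF _ that]) (erule (1) full_string)
qed

theorem planar_full_sqrt_compose: "planar_full_sqrt = planar_full oo fps_X ^ 2"
proof (rule fps_ext)
  fix k
  have "fps_nth (planar_series weights_full) k = 0" if "odd k"
    by (rule full.coeff_formula(1)[where \<pi>
        = "fps_const (1 / 2) * fps_X", OF _ that]) (erule (1) full_string)
  moreover have "fps_nth (planar_full oo fps_X ^ 2) k = (\<Sum>i=0..k.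
      if i = k div 2 then (if even k then fps_nth planar_full i else 0) else 0)"
    unfolding fps_compose_nth by (intro sum.cong refl) (auto simp: power_mult[symmetric])
  ultimately show "fps_nth planar_full_sqrt k = fps_nth (planar_full oo fps_X ^ 2) k"
    by (cases "even k") (simp_all add: planar_full_def planar_full_sqrt_eq)
qed

section \<open>Taylor coefficients\<close>

definition fps_prefix :: "'a::zero fps \<Rightarrow> 'a list \<Rightarrow> bool" where
  "fps_prefix F xs \<longleftrightarrow> (\<forall>i<length xs. fps_nth F i = xs ! i)"

lemma fps_prefix_Nil [simp]: "fps_prefix F []"
  by (simp add: fps_prefix_def)

lemma fps_prefix_Cons: "fps_prefix F (x # xs) \<longleftrightarrow> fps_nth F 0 = x \<and> fps_prefix (fps_shift 1 F) xs"
  by (auto simp: fps_prefix_def nth_Cons less_Suc_eq_0_disj split: nat.splits)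

lemma fps_prefix_nth: "fps_prefix F xs \<Longrightarrow> i < length xs \<Longrightarrow> fps_nth F i = xs ! i"
  by (simp add: fps_prefix_def)

text \<open>A product cut to the length of the shorter list, as only these coefficients are
  determined by both prefixes.\<close>

fun conv :: "'a::comm_ring_1 list \<Rightarrow> 'a list \<Rightarrow> 'a list" where
  "conv [] ys = []"
| "conv (x # xs) ys = map2 (+) (map ((*) x) ys) (0 # conv xs ys)"

lemma length_conv: "length (conv xs ys) = min (length xs) (length ys)"
  by (induction xs) auto

lemma fps_prefix_add: "fps_prefix F xs \<Longrightarrow> fps_prefix G ys \<Longrightarrow> fps_prefix (F + G) (map2 (+) xs ys)"
  by (simp add: fps_prefix_def)

lemma fps_prefix_diff: "fps_prefix F xs \<Longrightarrow> fps_prefix G ys \<Longrightarrow> fps_prefix (F - G) (map2 (-) xs ys)"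
  by (simp add: fps_prefix_def)

lemma fps_prefix_mult: "fps_prefix F xs \<Longrightarrow> fps_prefix G ys \<Longrightarrow> fps_prefix (F * G) (conv xs ys)"
proof (induction xs arbitrary: F)
  case (Cons x xs)
  have F: "F = fps_const x + fps_X * fps_shift 1 F"
    using Cons.prems(1) by (intro fps_ext) (auto simp: fps_prefix_Cons)
  have "fps_prefix (fps_shift 1 F * G) (conv xs ys)"
    using Cons by (simp add: fps_prefix_Cons)
  then have "fps_prefix (fps_X * (fps_shift 1 F * G)) (0 # conv xs ys)"
    by (auto simp: fps_prefix_def nth_Cons split: nat.splits)
  moreover have "fps_prefix (fps_const x * G) (map ((*) x) ys)"
    using Cons.prems(2) by (simp add: fps_prefix_def)
  ultimately have "fps_prefix (fps_const x * G + fps_X * (fps_shift 1 F * G)) (conv (x # xs) ys)"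
    unfolding conv.simps by (intro fps_prefix_add)
  also have "fps_const x * G + fps_X * (fps_shift 1 F * G) = F * G"
    by (subst (2) F) (simp add: algebra_simps)
  finally show ?case .
qed simp

text \<open>A claimed quotient is certified by multiplying back; it is the only one because the
  constant term of \<open>F\<close> is invertible.\<close>

lemma fps_prefix_quotient:
  fixes F H :: "'a::field fps"
  assumes "F * H = N" "fps_prefix F xs" "fps_prefix N (conv xs ys)" "fps_nth F 0 \<noteq> 0" "length xs
      = length ys"
  shows "fps_prefix H ys"
proof -
  define Y where "Y = Abs_fps (\<lambda>i. if i < length ys then ys ! i else 0)"
  have Y: "fps_prefix Y ys" by (simp add: fps_prefix_def Y_def)
  have 0: "fps_nth (F * (H - Y)) i = 0" if "i < length ys" for i
  proof -
    have "fps_nth N i = conv xs ys ! i" "fps_nth (F * Y) i = conv xs ys ! i"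
      using assms(3) fps_prefix_mult[OF assms(2) Y] that assms(5)
          by (auto simp: fps_prefix_def length_conv)
    then show ?thesis by (simp add: right_diff_distrib assms(1))
  qed
  have e: "H - Y = inverse F * (F * (H - Y))"
    unfolding mult.assoc[symmetric] inverse_mult_eq_1[OF assms(4)] by simp
  then have "fps_nth (H - Y) i = 0" if "i < length ys" for i
  proof -
    have "fps_nth (inverse F * (F * (H - Y))) i = 0"
      unfolding fps_mult_nth[of "inverse F"] by (rule sum.neutral) (use 0 that in auto)
    then show ?thesis using e by simp
  qed
  then show ?thesis using Y by (simp add: fps_prefix_def)
qed

lemma fps_prefix_X: "fps_prefix (fps_X :: 'a::comm_ring_1 fps) (0 # 1 # replicate k 0)"
  by (auto simp: fps_prefix_def nth_Cons split: nat.splits)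

lemma fps_prefix_numeral: "fps_prefix (numeral c :: 'a::comm_ring_1 fps) (numeral c # replicate k
    0)"
  by (auto simp: fps_prefix_def nth_Cons numeral_fps_const split: nat.splits)

lemma fps_prefix_power2: "fps_prefix F xs \<Longrightarrow> fps_prefix (F ^ 2) (conv xs xs)"
  by (simp add: power2_eq_square fps_prefix_mult)

lemma fps_prefix_mult_power:
  "fps_prefix (A * F ^ k) xs \<Longrightarrow> fps_prefix F ys \<Longrightarrow> fps_prefix (A * F ^ Suc k) (conv xs ys)"
  unfolding power_Suc2 mult.assoc[symmetric] by (rule fps_prefix_mult)

lemma fps_prefix_eqI: "fps_prefix F xs \<Longrightarrow> xs = ys \<Longrightarrow> fps_prefix F ys"
  by simp

lemma fps_prefix_1: "fps_prefix (1 :: 'a::comm_ring_1 fps) (1 # replicate k 0)"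
  by (auto simp: fps_prefix_def nth_Cons split: nat.splits)

section \<open>The coefficients of the two expansions\<close>

lemma fps_logderiv_quotient:
  fixes a b :: "'a::field_char_0 fps"
  assumes a0: "fps_nth a 0 \<noteq> 0" and b0: "fps_nth b 0 \<noteq> 0"
  shows "fps_deriv (a * inverse b) * inverse (a * inverse b) * (a * b)
      = fps_deriv a * b - a * fps_deriv b"
proof -
  define q where "q = a * inverse b"
  have "q * b = a" using inverse_mult_eq_1[OF b0] by (simp add: q_def mult.assoc)
  then have "fps_deriv a = fps_deriv q * b + q * fps_deriv b" by (metis fps_deriv_mult add.commute)
  then have "(fps_deriv q * b) * b = fps_deriv a * b - (q * b) * fps_deriv b"
    by (simp add: algebra_simps)
  then have dq: "fps_deriv q * b * b = fps_deriv a * b - a * fps_deriv b"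
    unfolding \<open>q * b = a\<close> .
  have "fps_nth q 0 \<noteq> 0" using a0 b0 by (simp add: q_def)
  from inverse_mult_eq_1[OF this] have "inverse q * a = b"
    unfolding \<open>q * b = a\<close>[symmetric] mult.assoc[symmetric] by simp
  then have "fps_deriv q * inverse q * (a * b) = fps_deriv q * b * b"
    by (metis mult.assoc)
  then show ?thesis unfolding dq q_def[symmetric] .
qed

lemma fps_double_cancel: "2 * x = 2 * y \<Longrightarrow> x = y" for x y :: "'a::field_char_0 fps"
  by (simp add: numeral_fps_const)

lemma mult_inverse_quotient:
  fixes a b :: "'a::field fps"
  assumes "fps_nth a 0 \<noteq> 0" "fps_nth b 0 \<noteq> 0"
  shows "a * inverse (a * inverse b) = b"
proof -
  have "inverse (a * inverse b) = inverse a * b" using assms by (simp add: fps_inverse_mult)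
  then show ?thesis using inverse_mult_eq_1[OF assms(1)] by (metis mult.assoc mult.commute mult_1)
qed

lemma logderiv_even_eq:
  "((1 - fps_X) * (2 - fps_X) * (1 - 3 * fps_X + fps_X ^ 2)) * (fps_deriv \<rho>_even * inverse \<rho>_even)
      = (3 - 2 * fps_X :: 'a::field_char_0 fps)"
proof -
  let ?a = "(1 - fps_X) * (2 - fps_X) :: 'a fps" and ?b
      = "2 * (1 - 3 * fps_X + fps_X ^ 2) :: 'a fps"
  have "2 * (((1 - fps_X) * (2 - fps_X) * (1 - 3 * fps_X + fps_X ^ 2)) * (fps_deriv \<rho>_even
      * inverse \<rho>_even))
      = fps_deriv (?a * inverse ?b) * inverse (?a * inverse ?b) * (?a * ?b)"
    unfolding \<rho>_even_def by (simp only: mult_ac)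
  also have "\<dots> = fps_deriv ?a * ?b - ?a * fps_deriv ?b"
    by (rule fps_logderiv_quotient) (simp_all add: numeral_fps_const)
  also have "\<dots> = 2 * (3 - 2 * fps_X)"
    by (simp add: numeral_fps_const power2_eq_square algebra_simps)
  finally show ?thesis by (rule fps_double_cancel)
qed

lemma logderiv_full_eq:
  "((fps_X ^ 2 - fps_X - 4) * (3 * fps_X ^ 2 + 3 * fps_X - 2)) * (fps_deriv \<rho>_full * inverse \<rho>_full)
      = (2 * (1 + fps_X) * (7 + 3 * fps_X) :: 'a::field_char_0 fps)"
proof -
  let ?a = "fps_X ^ 2 - fps_X - 4 :: 'a fps" and ?b
      = "2 * (3 * fps_X ^ 2 + 3 * fps_X - 2) :: 'a fps"
  have "2 * (((fps_X ^ 2 - fps_X - 4) * (3 * fps_X ^ 2 + 3 * fps_X - 2)) * (fps_deriv \<rho>_full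
      * inverse \<rho>_full))
      = fps_deriv (?a * inverse ?b) * inverse (?a * inverse ?b) * (?a * ?b)"
    unfolding \<rho>_full_def by (simp only: mult_ac)
  also have "\<dots> = fps_deriv ?a * ?b - ?a * fps_deriv ?b"
    by (rule fps_logderiv_quotient) (simp_all add: numeral_fps_const power2_eq_square)
  also have "\<dots> = 2 * (2 * (1 + fps_X) * (7 + 3 * fps_X))"
    by (simp add: numeral_fps_const power2_eq_square algebra_simps)
  finally show ?thesis by (rule fps_double_cancel)
qed

lemma inverse_\<Psi>_even_eq: "(1 - 3 * fps_X + fps_X ^ 2) * inverse \<Psi>_even
    = (2 * (1 - fps_X) :: 'a::field_char_0 fps)"
  unfolding \<Psi>_even_def by (rule mult_inverse_quotient) (simp_all add: numeral_fps_const
      power2_eq_square)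

lemma inverse_\<Psi>_full_eq:
  "((fps_X - 1) * (3 * fps_X ^ 2 + 3 * fps_X - 2)) * inverse \<Psi>_full
      = (8 * (1 + fps_X) ^ 2 :: 'a::field_char_0 fps)"
  unfolding \<Psi>_full_def by (rule mult_inverse_quotient) (simp_all add: numeral_fps_const
      power2_eq_square)

lemma logderiv_even_prefix:
  "fps_prefix (fps_deriv \<rho>_even * inverse \<rho>_even :: rat fps) [3 / 2, 23 / 4, 135 / 8, 735 / 16, 3903
      / 32, 20543 / 64, 107775 / 128, 564735 / 256, 2957823 / 512, 15489023 / 1024]"
proof (rule fps_prefix_quotient[OF logderiv_even_eq, of "[2, - 9, 12, - 6, 1, 0, 0, 0, 0, 0]"])
  note pre = fps_prefix_mult fps_prefix_add fps_prefix_diff fps_prefix_power2 fps_prefix_X[of 8]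
      fps_prefix_1[of 9] fps_prefix_numeral[where k = 9]
  show "fps_prefix ((1 - fps_X) * (2 - fps_X) * (1 - 3 * fps_X + fps_X ^ 2) :: rat fps) [2, - 9, 12,
      - 6, 1, 0, 0, 0, 0, 0]"
    by (rule fps_prefix_eqI, (rule pre)+) (simp add: numeral_eq_Suc)
  show "fps_prefix (3 - 2 * fps_X :: rat fps) (conv [2, - 9, 12, - 6, 1, 0, 0, 0, 0, 0] [3 / 2, 23
      / 4, 135 / 8, 735 / 16, 3903 / 32, 20543 / 64, 107775 / 128, 564735 / 256, 2957823
      / 512, 15489023 / 1024])"
    by (rule fps_prefix_eqI, (rule pre)+) (simp add: numeral_eq_Suc)
qed simp_all

lemma inverse_\<Psi>_even_prefix:
  "fps_prefix (inverse \<Psi>_even :: rat fps) [2, 4, 10, 26, 68, 178, 466, 1220, 3194, 8362]"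
proof (rule fps_prefix_quotient[OF inverse_\<Psi>_even_eq, of "[1, - 3, 1, 0, 0, 0, 0, 0, 0, 0]"])
  note pre = fps_prefix_mult fps_prefix_add fps_prefix_diff fps_prefix_power2 fps_prefix_X[of 8]
      fps_prefix_1[of 9] fps_prefix_numeral[where k = 9]
  show "fps_prefix (1 - 3 * fps_X + fps_X ^ 2 :: rat fps) [1, - 3, 1, 0, 0, 0, 0, 0, 0, 0]"
    by (rule fps_prefix_eqI, (rule pre)+) (simp add: numeral_eq_Suc)
  show "fps_prefix (2 * (1 - fps_X) :: rat fps) (conv [1,
      - 3, 1, 0, 0, 0, 0, 0, 0, 0] [2, 4, 10, 26, 68, 178, 466, 1220, 3194, 8362])"
    by (rule fps_prefix_eqI, (rule pre)+) (simp add: numeral_eq_Suc)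
qed simp_all

lemma planar_even_taylor:
  "fps_nth planar_even 1 = 1 / 2"
  "fps_nth planar_even 2 = 47 / 24"
  "fps_nth planar_even 3 = 49 / 4"
  "fps_nth planar_even 4 = 11839 / 120"
  "fps_nth planar_even 5 = 9283 / 10"
  "fps_nth planar_even 6 = 3260543 / 336"
  "fps_nth planar_even 7 = 18387797 / 168"
  "fps_nth planar_even 8 = 941448191 / 720"
  "fps_nth planar_even 9 = 490223647 / 30"
  "fps_nth planar_even 10 = 93171535189 / 440"
proof -
  define A I :: "rat fps" where "A = fps_deriv \<rho>_even * inverse \<rho>_even" and "I = inverse \<Psi>_even"
  have I: "fps_prefix I [2, 4, 10, 26, 68, 178, 466, 1220, 3194, 8362]"
    unfolding I_def by (rule inverse_\<Psi>_even_prefix)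
  \<comment> \<open>Ten coefficients of each \<open>A * I ^ k\<close> are computed in turn. Entry
    \<open>k - 1\<close>, divided by \<open>k (k + 1) (k + 2)\<close>, is the Taylor coefficient of
    index \<open>k\<close>.\<close>
  have p0: "fps_prefix (A * I ^ 0) [3 / 2, 23 / 4, 135 / 8, 735 / 16, 3903 / 32, 20543 / 64, 107775
      / 128, 564735 / 256, 2957823 / 512, 15489023 / 1024]"
    using logderiv_even_prefix by (simp add: A_def)
  have p1: "fps_prefix (A * I ^ 1) [3, 35 / 2, 287 / 4, 2047 / 8, 13567 / 16, 85951 / 32, 528127
      / 64, 3174143 / 128, 18760703 / 256, 109441023 / 512]"
    using fps_prefix_mult_power[OF p0 I] by simp
  have p2: "fps_prefix (A * I ^ 2) [6, 47, 487 / 2, 4207 / 4, 32767 / 8, 238591 / 16, 1656703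
      / 32, 11103743 / 64, 72408063 / 128, 461953023 / 256]"
    using fps_prefix_mult_power[OF p1 I] by (simp add: power2_eq_square)
  have p3: "fps_prefix (A * I ^ 3) [12, 118, 735, 7407 / 2, 65855 / 4, 538559 / 8, 4147455
      / 16, 30520831 / 32, 216735743 / 64, 1495468031 / 128]"
    using fps_prefix_mult_power[OF p2 I] by simp
  have p4: "fps_prefix (A * I ^ 4) [24, 284, 2062, 11839, 117951 / 2, 1067199 / 4, 9001727
      / 8, 71967487 / 16, 551492095 / 32, 4083079167 / 64]"
    using fps_prefix_mult_power[OF p3 I] by simp
  have p5: "fps_prefix (A * I ^ 5) [48, 664, 5500, 35390, 194943, 1930175 / 2, 17668607
      / 4, 152254975 / 8, 1250412543 / 16, 9873550335 / 32]"
    using fps_prefix_mult_power[OF p4 I] by simp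
  have p6: "fps_prefix (A * I ^ 6) [96, 1520, 14136, 100668, 606974, 3260543, 32157567
      / 2, 296820991 / 4, 2598198271 / 8, 21774630911 / 16]"
    using fps_prefix_mult_power[OF p5 I] by simp
  have p7: "fps_prefix (A * I ^ 7) [192, 3424, 35312, 275576, 1804028, 10443646, 55163391, 542598911
      / 2, 5039496191 / 4, 44644815871 / 8]"
    using fps_prefix_mult_power[OF p6 I] by simp
  have p8: "fps_prefix (A * I ^ 8) [384, 7616, 86240, 731632, 5165560, 32044284, 180406782,
      941448191, 9242173951 / 2, 86253074431 / 4]"
    using fps_prefix_mult_power[OF p7 I] by simp
  have p9: "fps_prefix (A * I ^ 9) [768, 16768, 206784, 1894368, 14344176, 94895608, 567067644,
      3128390142, 16177380351, 158576228351 / 2]"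
    using fps_prefix_mult_power[OF p8 I] by simp
  have p10: "fps_prefix (A * I ^ 10) [1536, 36608, 488320, 4803520, 38821856, 272764912, 1723816952,
      10021330940, 54438156286, 279514605567]"
    using fps_prefix_mult_power[OF p9 I] by simp
  note coeffs = planar_even_coeffs(2)[folded A_def I_def]
  show "fps_nth planar_even 1 = 1 / 2"
    using coeffs[of 1] fps_prefix_nth[OF p1, of 0] by simp
  show "fps_nth planar_even 2 = 47 / 24"
    using coeffs[of 2] fps_prefix_nth[OF p2, of 1] by simp
  show "fps_nth planar_even 3 = 49 / 4"
    using coeffs[of 3] fps_prefix_nth[OF p3, of 2] by simp
  show "fps_nth planar_even 4 = 11839 / 120"
    using coeffs[of 4] fps_prefix_nth[OF p4, of 3] by simp
  show "fps_nth planar_even 5 = 9283 / 10"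
    using coeffs[of 5] fps_prefix_nth[OF p5, of 4] by simp
  show "fps_nth planar_even 6 = 3260543 / 336"
    using coeffs[of 6] fps_prefix_nth[OF p6, of 5] by simp
  show "fps_nth planar_even 7 = 18387797 / 168"
    using coeffs[of 7] fps_prefix_nth[OF p7, of 6] by simp
  show "fps_nth planar_even 8 = 941448191 / 720"
    using coeffs[of 8] fps_prefix_nth[OF p8, of 7] by simp
  show "fps_nth planar_even 9 = 490223647 / 30"
    using coeffs[of 9] fps_prefix_nth[OF p9, of 8] by simp
  show "fps_nth planar_even 10 = 93171535189 / 440"
    using coeffs[of 10] fps_prefix_nth[OF p10, of 9] by simp
qed

lemma logderiv_full_prefix:
  "fps_prefix (fps_deriv \<rho>_full * inverse \<rho>_full :: rat fps) [7 / 4, 75 / 16, 661 / 64, 5855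
      / 256, 51077 / 1024, 447255 / 4096]"
proof (rule fps_prefix_quotient[OF logderiv_full_eq, of "[8, - 10, - 17, 0, 3, 0]"])
  note pre = fps_prefix_mult fps_prefix_add fps_prefix_diff fps_prefix_power2 fps_prefix_X[of 4]
      fps_prefix_1[of 5] fps_prefix_numeral[where k = 5]
  show "fps_prefix ((fps_X ^ 2 - fps_X - 4) * (3 * fps_X ^ 2 + 3 * fps_X - 2) :: rat fps) [8, - 10,
      - 17, 0, 3, 0]"
    by (rule fps_prefix_eqI, (rule pre)+) (simp add: numeral_eq_Suc)
  show "fps_prefix (2 * (1 + fps_X) * (7 + 3 * fps_X) :: rat fps) (conv [8, - 10, - 17, 0, 3, 0] [7
      / 4, 75 / 16, 661 / 64, 5855 / 256, 51077 / 1024, 447255 / 4096])"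
    by (rule fps_prefix_eqI, (rule pre)+) (simp add: numeral_eq_Suc)
qed simp_all

lemma inverse_\<Psi>_full_prefix:
  "fps_prefix (inverse \<Psi>_full :: rat fps) [4, 18, 49, 233 / 2, 1057 / 4, 4697 / 8]"
proof (rule fps_prefix_quotient[OF inverse_\<Psi>_full_eq, of "[2, - 5, 0, 3, 0, 0]"])
  note pre = fps_prefix_mult fps_prefix_add fps_prefix_diff fps_prefix_power2 fps_prefix_X[of 4]
      fps_prefix_1[of 5] fps_prefix_numeral[where k = 5]
  show "fps_prefix ((fps_X - 1) * (3 * fps_X ^ 2 + 3 * fps_X - 2) :: rat fps) [2, - 5, 0, 3, 0, 0]"
    by (rule fps_prefix_eqI, (rule pre)+) (simp add: numeral_eq_Suc)
  show "fps_prefix (8 * (1 + fps_X) ^ 2 :: rat fps) (conv [2, - 5, 0, 3, 0, 0] [4, 18, 49, 233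
      / 2, 1057 / 4, 4697 / 8])"
    by (rule fps_prefix_eqI, (rule pre)+) (simp add: numeral_eq_Suc)
qed simp_all

lemma planar_full_taylor:
  "fps_nth planar_full 1 = 7 / 6"
  "fps_nth planar_full 2 = 109 / 8"
  "fps_nth planar_full 3 = 15631 / 60"
  "fps_nth planar_full 4 = 256629 / 40"
  "fps_nth planar_full 5 = 38720767 / 210"
  "fps_nth planar_full 6 = 658811733 / 112"
proof -
  define A I :: "rat fps" where "A = fps_deriv \<rho>_full * inverse \<rho>_full" and "I = inverse \<Psi>_full"
  have I: "fps_prefix I [4, 18, 49, 233 / 2, 1057 / 4, 4697 / 8]"
    unfolding I_def by (rule inverse_\<Psi>_full_prefix)
  have p0: "fps_prefix (A * I ^ 0) [7 / 4, 75 / 16, 661 / 64, 5855 / 256, 51077 / 1024, 447255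
      / 4096]"
    using logderiv_full_prefix by (simp add: A_def)
  have p1: "fps_prefix (A * I ^ 1) [7, 201 / 4, 3383 / 16, 45501 / 64, 544207 / 256, 6066853
      / 1024]"
    using fps_prefix_mult_power[OF p0 I] by simp
  have p2: "fps_prefix (A * I ^ 2) [28, 327, 8373 / 4, 158839 / 16, 2519341 / 64, 35538127 / 256]"
    using fps_prefix_mult_power[OF p1 I] by (simp add: power2_eq_square)
  have p3: "fps_prefix (A * I ^ 3) [112, 1812, 15631, 386693 / 4, 7747463 / 16, 134208333 / 64]"
    using fps_prefix_mult_power[OF p2 I] by simp
  have p4: "fps_prefix (A * I ^ 4) [448, 9264, 100628, 769887, 18734389 / 4, 387303943 / 16]"
    using fps_prefix_mult_power[OF p3 I] by simp
  have p5: "fps_prefix (A * I ^ 5) [1792, 45120, 591216, 5396980, 38720767, 933157621 / 4]"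
    using fps_prefix_mult_power[OF p4 I] by simp
  have p6: "fps_prefix (A * I ^ 6) [7168, 212736, 3264832, 34649456, 286728308, 1976435199]"
    using fps_prefix_mult_power[OF p5 I] by simp
  note coeffs = planar_full_coeffs(2)[folded A_def I_def]
  show "fps_nth planar_full 1 = 7 / 6"
    using coeffs[of 1] fps_prefix_nth[OF p1, of 0] by simp
  show "fps_nth planar_full 2 = 109 / 8"
    using coeffs[of 2] fps_prefix_nth[OF p2, of 1] by simp
  show "fps_nth planar_full 3 = 15631 / 60"
    using coeffs[of 3] fps_prefix_nth[OF p3, of 2] by simp
  show "fps_nth planar_full 4 = 256629 / 40"
    using coeffs[of 4] fps_prefix_nth[OF p4, of 3] by simp
  show "fps_nth planar_full 5 = 38720767 / 210"
    using coeffs[of 5] fps_prefix_nth[OF p5, of 4] by simp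
  show "fps_nth planar_full 6 = 658811733 / 112"
    using coeffs[of 6] fps_prefix_nth[OF p6, of 5] by simp
qed

section \<open>Saddle point asymptotics\<close>

lemma power_quotient_cancel:
  fixes q N :: complex
  assumes "q \<noteq> 0"
  shows "q ^ m * N / (q ^ Suc m * q ^ Suc m) = N / q ^ (Suc m + 1)"
  using assms by (simp add: field_simps)

lemma central_binomial_Suc:
  "Suc n * ((2 * Suc n) choose Suc n) = 2 * (2 * n + 1) * ((2 * n) choose n)"
proof -
  have "Suc n * ((2 * Suc n) choose Suc n) = Suc (Suc (2 * n)) * (Suc (2 * n) choose n)"
    using Suc_times_binomial[of n "Suc (2 * n)"] by simp
  also have "Suc (2 * n) choose n = Suc (2 * n) choose Suc n"
    using binomial_symmetric[of n "Suc (2 * n)"] by (simp add: Suc_diff_le)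
  also have "Suc (Suc (2 * n)) * (Suc (2 * n) choose Suc n)
      = 2 * (Suc n * (Suc (2 * n) choose Suc n))"
    by simp
  also have "\<dots> = 2 * (Suc (2 * n) * ((2 * n) choose n))"
    by (simp only: Suc_times_binomial)
  finally show ?thesis by simp
qed

lemma norm_odd_product:
  assumes "n \<ge> 5"
  shows "(real n / 5) ^ 3 \<le> norm ((2 * of_nat n - 3) * (2 * of_nat n - 5) * (2 * of_nat n
      - 7) :: complex)"
proof -
  have n: "real n \<ge> 5" using assms by simp
  have "(real n / 5) ^ 3 = (real n / 5) * (real n / 5) * (real n / 5)" by (rule power3_eq_cube)
  also have "\<dots> \<le> (2 * real n - 3) * (2 * real n - 5) * (2 * real n - 7)"
    using n by (intro mult_mono) auto
  also have "\<dots> \<le> \<bar>(2 * real n - 3) * (2 * real n - 5) * (2 * real n - 7)\<bar>" by (rule abs_ge_self)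
  also have "\<dots> = norm (complex_of_real ((2 * real n - 3) * (2 * real n - 5) * (2 * real n - 7)))"
    by (rule norm_of_real[symmetric])
  finally show ?thesis by simp
qed

lemma norm_odd_product_pos:
  assumes "n \<ge> 5"
  shows "0 < norm ((2 * of_nat n - 3) * (2 * of_nat n - 5) * (2 * of_nat n - 7) :: complex)"
  by (rule less_le_trans[OF _ norm_odd_product[OF assms]]) (use assms in simp)

text \<open>
  \<open>z \<psi>(z) = t\<^sub>0 (1 - w(z)\<^sup>2)\<close> has its critical point nearest to \<open>0\<close> at the zero \<open>z0\<close> of \<open>w\<close>. On the
  circle through it the integrands below are of size \<open>(1 + \<kappa> \<bar>w\<bar>\<^sup>2)\<^sup>-\<^sup>n\<close>, so that a factor \<open>w\<^sup>8\<close> gains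
  \<open>n\<^sup>-\<^sup>4\<close> without any further localization.
\<close>

locale saddle =
  fixes r t0 z0 \<kappa> :: real and \<psi> \<alpha> w :: "complex \<Rightarrow> complex"
  assumes z0: "0 < z0" "z0 < r" and t0: "t0 > 0" and \<kappa>: "\<kappa> > 0"
    and holo: "\<psi> holomorphic_on ball 0 r" "\<alpha> holomorphic_on ball 0 r" "w holomorphic_on ball 0 r"
    and \<psi>_nz: "\<And>z :: complex. z \<in> ball 0 r \<Longrightarrow> \<psi> z \<noteq> 0"
    and \<phi>: "\<And>z :: complex. z \<in> ball 0 r \<Longrightarrow> z * \<psi> z = t0 * (1 - w z ^ 2)"
    and w_0: "w 0 = 1"
    and w_eq_0: "\<And>z :: complex. z \<in> ball 0 r \<Longrightarrow> w z = 0 \<longleftrightarrow> z = complex_of_real z0"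
    and dw: "deriv w z0 \<noteq> 0"
    and circle: "\<And>z :: complex. norm z = z0 \<Longrightarrow> 1 + \<kappa> * norm (w z) ^ 2 \<le> norm (1 - w z ^ 2)"
begin

abbreviation "B \<equiv> ball (0 :: complex) r"
abbreviation "\<gamma> \<equiv> circlepath 0 z0"

lemma circle_subset: "path_image \<gamma> \<subseteq> B - {0}"
  using z0 by auto

lemma circleD: "z \<in> path_image \<gamma> \<Longrightarrow> z \<in> B - {0}"
  using circle_subset by blast

lemma z0_in: "complex_of_real z0 \<in> B" "0 \<in> B"
  using z0 by auto

lemma one_minus_w2_nz: "z \<in> B - {0} \<Longrightarrow> 1 - w z ^ 2 \<noteq> 0"
  using \<phi>[of z] \<psi>_nz[of z] by auto

lemma holo_dw: "deriv w holomorphic_on B"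
  by (intro holomorphic_deriv holo) auto

lemma holo_quotient: "f holomorphic_on B \<Longrightarrow> (\<lambda>z. f z / (1 - w z ^ 2) ^ n) holomorphic_on B - {0}"
  using one_minus_w2_nz by (intro holomorphic_intros holomorphic_on_subset[OF holo(3)]) (auto intro:
      holomorphic_on_subset)

lemma integrable_quotient:
  assumes "f holomorphic_on B"
  shows "(\<lambda>z. f z / (1 - w z ^ 2) ^ n) contour_integrable_on \<gamma>"
  using holo_quotient[OF assms] circle_subset
  by (intro contour_integrable_holomorphic_simple[of _ "B - {0}"]) (auto intro!: open_Diff)

definition J :: "nat \<Rightarrow> (complex \<Rightarrow> complex) \<Rightarrow> complex" where
  "J n f = contour_integral \<gamma> (\<lambda>z. f z / (1 - w z ^ 2) ^ n) / (2 * of_real pi * \<i>)"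

lemma J_add: "f holomorphic_on B \<Longrightarrow> g holomorphic_on B \<Longrightarrow> J n (\<lambda>z. f z + g z) = J n f + J n g"
  using integrable_quotient[of f n] integrable_quotient[of g n]
  by (simp add: J_def add_divide_distrib contour_integral_add)

lemma J_cmult: "f holomorphic_on B \<Longrightarrow> J n (\<lambda>z. c * f z) = c * J n f"
  using integrable_quotient[of f n] contour_integral_lmul[of "\<lambda>z. f z / (1 - w z ^ 2) ^ n" \<gamma> c]
  by (simp add: J_def)

lemma J_sum:
  assumes "\<And>k. k \<in> A \<Longrightarrow> f k holomorphic_on B"
  shows "J n (\<lambda>z. \<Sum>k\<in>A. f k z) = (\<Sum>k\<in>A. J n (f k))"
  using assms
proof (induction A rule: infinite_finite_induct)
  case (insert k A)
  then show ?case using J_add[of "f k" "\<lambda>z. \<Sum>k\<in>A. f k z" n] by (simp add: holomorphic_on_sum)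
qed (simp_all add: J_def)

lemma J_cong: "(\<And>z. z \<in> B \<Longrightarrow> f z = g z) \<Longrightarrow> J n f = J n g"
  unfolding J_def using circle_subset by (intro arg_cong2[of _ _ _ _ "(/)"] contour_integral_cong)
      auto

lemma J_eqI:
  assumes "\<And>z. z \<in> path_image \<gamma> \<Longrightarrow> f z / (1 - w z ^ 2) ^ n = g z / (1 - w z ^ 2) ^ m"
  shows "J n f = J m g"
  unfolding J_def by (rule arg_cong2[of _ _ _ _ "(/)"],
      rule contour_integral_cong) (use assms in auto)

text \<open>On the circle \<open>1 - w^2\<close> equals \<open>z \<psi>(z) / t0\<close>, so this is
  Cauchy's formula for the coefficient of \<open>z^(n-1)\<close> that Lagrange inversion asks
  for.\<close>

lemma J_eq_coeff:
  assumes f: "f holomorphic_on B" and n: "n \<ge> 1"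
  shows "J n f = t0 ^ n * ((deriv ^^ (n - 1)) (\<lambda>z. f z / \<psi> z ^ n) 0 / fact (n - 1))"
proof -
  have h: "(\<lambda>z. f z / \<psi> z ^ n) holomorphic_on B"
    using f holo(1) \<psi>_nz by (intro holomorphic_intros) auto
  have "contour_integral \<gamma> (\<lambda>z. f z / (1 - w z ^ 2) ^ n)
      = contour_integral \<gamma> (\<lambda>z. t0 ^ n * (f z / \<psi> z ^ n / (z - 0) ^ Suc (n - 1)))"
  proof (rule contour_integral_cong[OF refl])
    fix z assume "z \<in> path_image \<gamma>"
    then have z: "z \<in> B" "z \<noteq> 0" using circle_subset by auto
    have "1 - w z ^ 2 = z * \<psi> z / t0" using \<phi>[OF z(1)] t0 by simp
    then show "f z / (1 - w z ^ 2) ^ n = t0 ^ n * (f z / \<psi> z ^ n / (z - 0) ^ Suc (n - 1))"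
      using n by (simp add: power_divide power_mult_distrib mult_ac flip: power_Suc)
  qed
  also have "\<dots> = t0 ^ n * contour_integral \<gamma> (\<lambda>z. f z / \<psi> z ^ n / (z - 0) ^ Suc (n - 1))"
  proof (rule contour_integral_lmul)
    have "(\<lambda>z. f z / \<psi> z ^ n / (z - 0) ^ Suc (n - 1)) holomorphic_on B - {0}"
      by (rule holomorphic_on_divide[OF holomorphic_on_subset[OF h]]) (auto intro!:
          holomorphic_intros)
    then show "(\<lambda>z. f z / \<psi> z ^ n / (z - 0) ^ Suc (n - 1)) contour_integrable_on \<gamma>"
      using circle_subset by (intro contour_integrable_holomorphic_simple[of _ "B
          - {0}"]) (auto intro!: open_Diff)
  qed
  also have "contour_integral \<gamma> (\<lambda>z. f z / \<psi> z ^ n / (z - 0) ^ Suc (n - 1)) =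
      (2 * of_real pi * \<i> / fact (n - 1)) * (deriv ^^ (n - 1)) (\<lambda>z. f z / \<psi> z ^ n) 0"
    using z0 Cauchy_contour_integral_circlepath[of 0 z0 "\<lambda>z. f z / \<psi> z ^ n" 0 "n - 1"]
      holomorphic_on_imp_continuous_on[OF holomorphic_on_subset[OF h,
          of "cball 0 z0"]] holomorphic_on_subset[OF h, of "ball 0 z0"]
    by (auto simp: subset_iff)
  finally show ?thesis by (simp add: J_def)
qed

lemma J_deriv_eq_0:
  assumes "\<And>z. z \<in> B - {0} \<Longrightarrow> (F has_field_derivative f z / (1 - w z ^ 2) ^ n) (at z)"
  shows "J n f = 0"
proof -
  have "((\<lambda>z. f z / (1 - w z ^ 2) ^ n) has_contour_integral 0) \<gamma>"
    by (rule Cauchy_theorem_primitive[of "B - {0}" F])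
      (rule has_field_derivative_at_within, rule assms, assumption, simp, rule circle_subset, simp)
  then show ?thesis by (simp add: J_def contour_integral_unique)
qed

definition M :: "nat \<Rightarrow> nat \<Rightarrow> complex" where "M n i = J n (\<lambda>z. w z ^ i * deriv w z)"

lemma w_has_deriv: "z \<in> B \<Longrightarrow> (w has_field_derivative deriv w z) (at z)"
  using holo(3) by (intro holomorphic_derivI[of _ B]) auto

lemma holo_M: "(\<lambda>z. w z ^ i * deriv w z) holomorphic_on B"
  by (intro holomorphic_intros holo holo_dw)

text \<open>The derivative of \<open>w^(i+1) / (1 - w^2)^n\<close> integrates to 0 over the
  circle.\<close>

lemma M_rec:
  assumes n: "n \<ge> 1"
  shows "M (n + 1) (i + 2) = - (of_nat (i + 1) / of_nat (2 * n)) * M n i"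
proof -
  let ?f = "\<lambda>z. of_nat (i + 1) * (w z ^ i * deriv w z * (1 - w z ^ 2)) + of_nat (2 * n) * (w z ^ (i
      + 2) * deriv w z)"
  have "J (n + 1) ?f = 0"
  proof (rule J_deriv_eq_0[of "\<lambda>z. w z ^ (i + 1) / (1 - w z ^ 2) ^ n"])
    fix z assume z: "z \<in> B - {0}"
    note nz = one_minus_w2_nz[OF z]
    obtain m where m: "n = Suc m" using n by (cases n) auto
    let ?q = "1 - w z ^ 2"
    have 1: "((\<lambda>z. w z ^ (i + 1)) has_field_derivative of_nat (i + 1) * w z ^ i * deriv w z) (at z)"
      using z by (intro DERIV_cong[OF DERIV_power[OF w_has_deriv]]) auto
    have 2: "((\<lambda>z. (1 - w z ^ 2) ^ n) has_field_derivative of_nat n * ?q ^ m * (- (2 * w z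
        * deriv w z))) (at z)"
    proof (rule DERIV_cong[OF DERIV_power])
      show "((\<lambda>z. 1 - w z ^ 2) has_field_derivative - (2 * w z * deriv w z)) (at z)"
        using w_has_deriv[of z] z by (auto intro!: derivative_eq_intros)
    qed (simp add: m)
    have e: "?q ^ m * N / (?q ^ n * ?q ^ n) = N / ?q ^ (n + 1)" for N
      unfolding m by (rule power_quotient_cancel[OF nz])
    have num: "of_nat (i + 1) * w z ^ i * deriv w z * ?q ^ n - w z ^ (i + 1) * (of_nat n * ?q ^ m
        * (- (2 * w z * deriv w z))) = ?q ^ m * ?f z"
      unfolding m power_Suc[of ?q] power_add by (simp add: power2_eq_square algebra_simps)
    show "((\<lambda>z. w z ^ (i + 1) / (1 - w z ^ 2) ^ n) has_field_derivative ?f z / (1 - w z ^ 2) ^ (n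
        + 1)) (at z)"
      using DERIV_divide[OF 1 2] nz unfolding num e by simp
  qed
  moreover have "J (n + 1) ?f = of_nat (i + 1) * J (n + 1) (\<lambda>z. w z ^ i * deriv w z * (1 - w z ^ 2))
      + of_nat (2 * n) * M (n + 1) (i + 2)"
    unfolding M_def by (subst J_add) (auto intro!: holomorphic_intros holo holo_dw J_cmult
        arg_cong2[of _ _ _ _ "(+)"])
  moreover have "J (n + 1) (\<lambda>z. w z ^ i * deriv w z * (1 - w z ^ 2)) = M n i"
    unfolding M_def
  proof (rule J_eqI)
    fix z assume "z \<in> path_image \<gamma>"
    from one_minus_w2_nz[OF circleD[OF this]]
    show "w z ^ i * deriv w z * (1 - w z ^ 2) / (1 - w z ^ 2) ^ (n + 1)
        = w z ^ i * deriv w z / (1 - w z ^ 2) ^ n" by simp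
  qed
  ultimately have "of_nat (2 * n) * M (n + 1) (i + 2) = - (of_nat (i + 1) * M n i)"
      by (simp add: add_eq_0_iff)
  then show ?thesis using n by (simp add: field_simps)
qed

lemma M_diff: "M (n + 1) i - M (n + 1) (i + 2) = M n i"
proof -
  have "M (n + 1) i + (- 1) * M (n + 1) (i + 2)
      = J (n + 1) (\<lambda>z. w z ^ i * deriv w z + (- 1) * (w z ^ (i + 2) * deriv w z))"
    unfolding M_def by (simp only: J_add[OF holo_M holomorphic_on_mult[OF holomorphic_on_const
        holo_M]] J_cmult[OF holo_M])
  also have "\<dots> = M n i"
    unfolding M_def
  proof (rule J_eqI)
    fix z assume "z \<in> path_image \<gamma>"
    note nz = one_minus_w2_nz[OF circleD[OF this]]
    have "w z ^ i * deriv w z + (- 1) * (w z ^ (i + 2) * deriv w z)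
        = w z ^ i * deriv w z * (1 - w z ^ 2)"
      by (simp add: power_add power2_eq_square algebra_simps)
    then show "(w z ^ i * deriv w z + (- 1) * (w z ^ (i + 2) * deriv w z)) / (1 - w z ^ 2) ^ (n + 1)
        = w z ^ i * deriv w z / (1 - w z ^ 2) ^ n"
      using nz by simp
  qed
  finally show ?thesis by simp
qed

text \<open>A residue at 0: since \<open>w 0 = 1\<close>, the denominator \<open>1 - w^2\<close> has
  a simple zero there with derivative \<open>- 2 w'\<close>.\<close>

lemma M_1_0: "M 1 0 = - 1 / 2"
proof -
  have h: "(\<lambda>z. deriv w z / \<psi> z ^ 1) holomorphic_on B"
    using holo(1,3) holo_dw \<psi>_nz by (intro holomorphic_intros) auto
  have "M 1 0 = t0 * (deriv w 0 / \<psi> 0)"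
    unfolding M_def using J_eq_coeff[of "\<lambda>z. w z ^ 0 * deriv w z" 1] holo_dw by simp
  moreover have "\<psi> 0 = - 2 * t0 * deriv w 0"
  proof -
    have "((\<lambda>z. z * \<psi> z) has_field_derivative \<psi> 0) (at 0)"
      using holomorphic_derivI[OF holo(1) _ z0_in(2)] by (auto intro!: derivative_eq_intros)
    moreover have "((\<lambda>z. t0 * (1 - w z ^ 2)) has_field_derivative - 2 * t0 * deriv w 0) (at 0)"
      using w_has_deriv[OF z0_in(2)] by (auto intro!: derivative_eq_intros simp: w_0)
    then have "((\<lambda>z. z * \<psi> z) has_field_derivative - 2 * t0 * deriv w 0) (at 0)"
      by (rule has_field_derivative_transform_within_open[of _ _ _ B]) (use z0_in \<phi> in auto)
    ultimately show ?thesis by (rule DERIV_unique)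
  qed
  ultimately show ?thesis using \<psi>_nz[OF z0_in(2)] t0 by (auto simp: field_simps)
qed

text \<open>\<open>M_diff\<close> and \<open>M_rec\<close> together give the quotient
  \<open>1 - 1 / (2 (n + 1))\<close> of consecutive values, which is also the quotient of
  consecutive central binomial coefficients divided by powers of 4.\<close>

lemma M_0: "M (n + 1) 0 = - 1 / 2 * of_nat ((2 * n) choose n) / 4 ^ n"
proof (induction n)
  case 0
  show ?case using M_1_0 by simp
next
  case (Suc n)
  have "M (Suc n + 1) 0 = M (n + 1) 0 + M (n + 1 + 1) (0 + 2)" using M_diff[of "n + 1" 0]
      by (simp add: algebra_simps)
  also have "\<dots> = M (n + 1) 0 * (1 - 1 / of_nat (2 * (n + 1)))"
    using M_rec[of "n + 1" 0] by (simp add: algebra_simps)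
  also have "\<dots> = - 1 / 2 * of_nat ((2 * Suc n) choose Suc n) / 4 ^ Suc n"
  proof -
    from central_binomial_Suc[of n] have "of_nat (Suc n) * of_nat ((2 * Suc n) choose Suc n)
        = (2 * (2 * of_nat n + 1) * of_nat ((2 * n) choose n) :: complex)"
      by (metis (no_types, lifting) of_nat_1 of_nat_add of_nat_mult of_nat_numeral)
    then have e: "of_nat ((2 * Suc n) choose Suc n)
        = (2 * (2 * of_nat n + 1) * of_nat ((2 * n) choose n) / of_nat (Suc n) :: complex)"
      by (simp add: field_simps del: of_nat_Suc)
    have f: "(1 - 1 / of_nat (2 * (n + 1)))
        = ((2 * of_nat n + 1) / (2 * of_nat (Suc n)) :: complex)"
      by (simp add: field_simps del: of_nat_Suc) (simp add: algebra_simps)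
    show ?thesis unfolding Suc e f by (simp add: field_simps del: of_nat_Suc)
  qed
  finally show ?case .
qed

text \<open>The integrand has a single-valued primitive, a rational function of \<open>w^2\<close>.
  The bound on \<open>n\<close> excludes a logarithm of \<open>1 - w^2\<close>.\<close>

lemma M_odd: "n \<ge> m + 2 \<Longrightarrow> M n (2 * m + 1) = 0"
proof (induction m arbitrary: n)
  case 0
  then have "n = Suc (Suc (n - 2))" by simp
  then obtain k where k: "n = Suc (Suc k)" by blast
  have "J n (\<lambda>z. 2 * of_nat (Suc k) * (w z ^ 1 * deriv w z)) = 0"
  proof (rule J_deriv_eq_0[of "\<lambda>z. 1 / (1 - w z ^ 2) ^ Suc k"])
    fix z assume z: "z \<in> B - {0}"
    note nz = one_minus_w2_nz[OF z]
    have "((\<lambda>z. (1 - w z ^ 2) ^ Suc k) has_field_derivative of_nat (Suc k) * (1 - w z ^ 2) ^ k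
        * (- (2 * w z * deriv w z))) (at z)"
    proof (rule DERIV_cong[OF DERIV_power])
      show "((\<lambda>z. 1 - w z ^ 2) has_field_derivative - (2 * w z * deriv w z)) (at z)"
        using w_has_deriv[of z] z by (auto intro!: derivative_eq_intros)
    qed simp
    from DERIV_divide[OF DERIV_const[of 1] this]
    have "((\<lambda>z. 1 / (1 - w z ^ 2) ^ Suc k) has_field_derivative
        (1 - w z ^ 2) ^ k * (2 * of_nat (Suc k) * (w z ^ 1 * deriv w z)) / ((1 - w z ^ 2) ^ Suc k
            * (1 - w z ^ 2) ^ Suc k)) (at z)"
      using nz by (simp add: mult_ac)
    then show "((\<lambda>z. 1 / (1 - w z ^ 2) ^ Suc k) has_field_derivative 2 * of_nat (Suc k) * (w z ^ 1
        * deriv w z) / (1 - w z ^ 2) ^ n) (at z)"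
      unfolding power_quotient_cancel[OF nz] by (simp add: k)
  qed
  then have "2 * of_nat (Suc k) * J n (\<lambda>z. w z ^ 1 * deriv w z) = 0"
    by (subst (asm) J_cmult) (auto intro!: holomorphic_intros holo holo_dw)
  then show ?case by (simp add: M_def del: of_nat_Suc)
next
  case (Suc m)
  then obtain k where k: "n = k + 1" "k \<ge> m + 2" by (cases n) auto
  then show ?case using M_rec[of k "2 * m + 1"] Suc.IH[of k] by simp
qed

text \<open>Eliminating \<open>M n i\<close> between \<open>M_rec\<close> and \<open>M_diff\<close>
  relates integrals with the same power of \<open>1 - w^2\<close>, so that \<open>M n 0\<close>
  factors out of the expansion.\<close>

lemma M_shift:
  assumes n: "n \<ge> 1"
  shows "(2 * of_nat n - of_nat (i + 1)) * M (n + 1) (i + 2) = - of_nat (i + 1) * M (n + 1) i"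
proof -
  have "of_nat (2 * n) * M (n + 1) (i + 2) = - of_nat (i + 1) * M n i"
    using n unfolding M_rec[OF n] by simp (simp add: algebra_simps)
  then show ?thesis unfolding M_diff[of n i, symmetric] by (simp add: algebra_simps)
qed

lemma M_even:
  assumes "n \<ge> 5"
  shows "M n 2 = - M n 0 / (2 * of_nat n - 3)"
    "M n 4 = 3 * M n 0 / ((2 * of_nat n - 3) * (2 * of_nat n - 5))"
    "M n 6 = - 15 * M n 0 / ((2 * of_nat n - 3) * (2 * of_nat n - 5) * (2 * of_nat n - 7))"
proof -
  define k where "k = n - 1"
  have k: "n = k + 1" "k \<ge> 1" using assms by (auto simp: k_def)
  have "real n \<ge> 5" using assms by simp
  then have "Re (2 * of_nat n - 3) > 0" "Re (2 * of_nat n - 5) > 0" "Re (2 * of_nat n - 7) > 0"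
      by auto
  then have nz: "2 * of_nat n - 3 \<noteq> (0 :: complex)" "2 * of_nat n - 5 \<noteq> (0 :: complex)" "2
      * of_nat n - 7 \<noteq> (0 :: complex)"
    by (metis less_irrefl zero_complex.simps(1))+
  have 1: "(2 * of_nat n - 3) * M n 2 = - M n 0" using M_shift[OF k(2), of 0]
      by (simp add: k(1) flip: numeral_2_eq_2)
  have 2: "(2 * of_nat n - 5) * M n 4 = - 3 * M n 2" using M_shift[OF k(2), of 2]
      by (simp add: k(1))
  have 3: "(2 * of_nat n - 7) * M n 6 = - 5 * M n 4" using M_shift[OF k(2), of 4]
      by (simp add: k(1))
  from 1 nz show e2: "M n 2 = - M n 0 / (2 * of_nat n - 3)" by (metis nonzero_mult_div_cancel_left)
  from 2 nz have "M n 4 = - 3 * M n 2 / (2 * of_nat n - 5)" by (metis nonzero_mult_div_cancel_left)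
  then show e4: "M n 4 = 3 * M n 0 / ((2 * of_nat n - 3) * (2 * of_nat n - 5))" by (simp add: e2)
  from 3 nz have "M n 6 = - 5 * M n 4 / (2 * of_nat n - 7)" by (metis nonzero_mult_div_cancel_left)
  then show "M n 6 = - 15 * M n 0 / ((2 * of_nat n - 3) * (2 * of_nat n - 5) * (2 * of_nat n - 7))"
      by (simp add: e4)
qed

text \<open>Dividing by the simple zero of \<open>w\<close> expands \<open>\<alpha>\<close> in the forms \<open>w\<^sup>k w'\<close>.\<close>

lemma division_step:
  assumes f: "f holomorphic_on B"
  shows "\<exists>b g. g holomorphic_on B \<and> (\<forall>z\<in>B. f z = b * deriv w z + w z * g z)"
proof -
  define b where "b = f (of_real z0) / deriv w (of_real z0)"
  define h where "h = (\<lambda>z. f z - b * deriv w z)"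
  have h: "h holomorphic_on B" unfolding h_def by (intro holomorphic_intros f holo_dw)
  have h0: "h (of_real z0) = 0" using dw by (simp add: h_def b_def)
  define H where "H = (\<lambda>z :: complex.
      if z = of_real z0 then deriv h (of_real z0) else (h z - h (of_real z0)) / (z - of_real z0))"
  define W where "W = (\<lambda>z :: complex.
      if z = of_real z0 then deriv w (of_real z0) else (w z - w (of_real z0)) / (z - of_real z0))"
  have HW: "H holomorphic_on B" "W holomorphic_on B"
    unfolding H_def W_def using z0 by (auto intro!: pole_lemma h holo)
  have W_nz: "W z \<noteq> 0" if "z \<in> B" for z
    using w_eq_0[OF that] w_eq_0[OF z0_in(1)] dw by (auto simp: W_def)
  have "f z = b * deriv w z + w z * (H z / W z)" if "z \<in> B" for z
  proof (cases "z = of_real z0")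
    case True
    then show ?thesis using h0 w_eq_0[OF z0_in(1)] by (simp add: h_def)
  next
    case False
    then have "H z / W z = h z / w z" using h0 w_eq_0[OF z0_in(1)] by (simp add: H_def W_def)
    then show ?thesis using False w_eq_0[OF that] by (simp add: h_def)
  qed
  moreover have "(\<lambda>z. H z / W z) holomorphic_on B" using HW W_nz by (intro holomorphic_intros) auto
  ultimately show ?thesis by blast
qed

lemma division:
  "\<exists>b g. g holomorphic_on B \<and> (\<forall>z\<in>B. \<alpha> z = (\<Sum>k<m. b k * (w z ^ k * deriv w z)) + w z ^ m * g z)"
proof (induction m)
  case 0
  show ?case using holo(2) by (intro exI[of _ \<alpha>] exI[of _ "\<lambda>_. 0"]) auto
next
  case (Suc m)
  then obtain b g where g: "g holomorphic_on B" "\<forall>z\<in>B. \<alpha> z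
      = (\<Sum>k<m. b k * (w z ^ k * deriv w z)) + w z ^ m * g z" by blast
  obtain c h where h: "h holomorphic_on B" "\<forall>z\<in>B. g z = c * deriv w z + w z * h z"
      using division_step[OF g(1)] by blast
  have "\<alpha> z = (\<Sum>k<Suc m. (b(m := c)) k * (w z ^ k * deriv w z)) + w z ^ Suc m * h z"
      if "z \<in> B" for z
    using g(2) h(2) that by (simp add: algebra_simps)
  then show ?case using h(1) by blast
qed

lemma J_bound:
  assumes g: "g holomorphic_on B"
  shows "\<exists>K. \<forall>n\<ge>4. norm (J n (\<lambda>z. w z ^ 8 * g z)) \<le> K / real n ^ 4"
proof -
  have "compact (sphere (0 :: complex) z0)" by simp
  moreover have "continuous_on (sphere 0 z0) g"
    using z0 by (intro holomorphic_on_imp_continuous_on holomorphic_on_subset[OF g]) auto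
  ultimately have "bounded (g ` sphere 0 z0)"
      by (intro compact_imp_bounded compact_continuous_image)
  then obtain G where G: "\<And>z. z \<in> sphere 0 z0 \<Longrightarrow> norm (g z) \<le> G" by (metis bounded_iff imageI)
  have "G \<ge> 0" using order_trans[OF norm_ge_zero G[of "of_real z0"]] z0 by simp
  have "norm (J n (\<lambda>z. w z ^ 8 * g z)) \<le> z0 * G * (256 / \<kappa> ^ 4) / real n ^ 4" if n: "n \<ge> 4" for n
  proof -
    have bd: "norm (w z ^ 8 * g z / (1 - w z ^ 2) ^ n) \<le> G * (256 / \<kappa> ^ 4) / real n ^ 4"
        if z: "norm z = z0" for z
    proof -
      define x where "x = norm (w z) ^ 2"
      have x: "x \<ge> 0" by (simp add: x_def)
      \<comment> \<open>One term of the binomial expansion of \<open>(1 + \<kappa> x)^n\<close>, the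
        one of degree 4, already bounds a multiple of \<open>n^4 x^4\<close>, and \<open>x^4\<close>
        is the size of \<open>w^8\<close>.\<close>
      have "(real n / 4) ^ 4 \<le> real (n choose 4)"
          using binomial_ge_n_over_k_pow_k[OF n, where 'a = real] by simp
      then have "(real n / 4) ^ 4 * (\<kappa> * x) ^ 4 \<le> real (n choose 4) * (\<kappa> * x) ^ 4"
          by (intro mult_right_mono) simp_all
      also have "\<dots> \<le> (\<Sum>k\<le>n. real (n choose k) * (\<kappa> * x) ^ k)"
        using n x \<kappa> by (intro member_le_sum) auto
      also have "\<dots> = (\<kappa> * x + 1) ^ n" by (simp add: binomial_ring)
      also have "\<dots> \<le> norm (1 - w z ^ 2) ^ n"
        using circle[OF z] x \<kappa> by (intro power_mono) (auto simp: x_def add.commute)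
      finally have "(real n / 4) ^ 4 * (\<kappa> * x) ^ 4 \<le> norm (1 - w z ^ 2) ^ n" .
      then have "x ^ 4 * (real n ^ 4 * \<kappa> ^ 4) \<le> 256 * norm (1 - w z ^ 2) ^ n"
        by (simp add: power_divide power_mult_distrib mult_ac)
      moreover have "norm (1 - w z ^ 2) > 0" using circle[OF z] \<kappa> x
          by (smt (verit) x_def mult_nonneg_nonneg)
      ultimately have "x ^ 4 / norm (1 - w z ^ 2) ^ n \<le> 256 / \<kappa> ^ 4 / real n ^ 4"
        using \<kappa> n by (simp add: field_simps)
      moreover have "norm (w z ^ 8 * g z / (1 - w z ^ 2) ^ n)
          = norm (g z) * (x ^ 4 / norm (1 - w z ^ 2) ^ n)"
        by (simp add: norm_mult norm_divide norm_power x_def flip: power_mult)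
      moreover have "norm (g z) \<le> G" using G z by simp
      ultimately show ?thesis
        using \<open>G \<ge> 0\<close> by (metis (no_types,
            lifting) mult_mono norm_ge_zero times_divide_eq_right zero_le_divide_iff zero_le_power
            x)
    qed
    have "norm (contour_integral \<gamma> (\<lambda>z. w z ^ 8 * g z / (1 - w z ^ 2) ^ n))
        \<le> (G * (256 / \<kappa> ^ 4) / real n ^ 4) * (2 * pi * z0)"
    proof (rule has_contour_integral_bound_circlepath)
      show "((\<lambda>z. w z ^ 8 * g z / (1 - w z ^ 2) ^ n) has_contour_integral
          contour_integral \<gamma> (\<lambda>z. w z ^ 8 * g z / (1 - w z ^ 2) ^ n)) \<gamma>"
        by (intro has_contour_integral_integral integrable_quotient holomorphic_intros holo g)
      show "0 \<le> G * (256 / \<kappa> ^ 4) / real n ^ 4" using \<kappa> \<open>G \<ge> 0\<close> by simp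
      show "norm (w z ^ 8 * g z / (1 - w z ^ 2) ^ n) \<le> G * (256 / \<kappa> ^ 4) / real n ^ 4"
          if "norm (z - 0) = z0" for z
        using bd that by simp
    qed (rule z0)
    then show ?thesis by (simp add: J_def norm_divide norm_mult field_simps)
  qed
  then show ?thesis by (intro exI[of _ "z0 * G * (256 / \<kappa> ^ 4)"]) blast
qed

lemma has_fps_expansion_at_z0:
  assumes "f holomorphic_on B"
  shows "(\<lambda>x. f (of_real z0 + x)) has_fps_expansion fps_expansion f (of_real z0)"
  by (intro analytic_at_imp_has_fps_expansion analytic_on_subset[OF
      holomorphic_on_imp_analytic_at[OF assms]]) (use z0_in in auto)

text \<open>With \<open>W = X K\<close> the series of \<open>w\<close> at \<open>z0\<close>, the
  expansion modulo \<open>w^8\<close> reads \<open>A = (D oo W) W'\<close>, and Lagrange inversion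
  extracts the coefficients of \<open>D\<close>.\<close>

lemma division_coeffs:
  fixes A K :: "complex fps"
  defines "b \<equiv> \<lambda>k. fps_nth (A * inverse K ^ Suc k) k"
  assumes A: "(\<lambda>x. \<alpha> (of_real z0 + x)) has_fps_expansion A"
    and K: "(\<lambda>x. w (of_real z0 + x)) has_fps_expansion (fps_X * K)"
  shows "\<exists>g. g holomorphic_on B \<and> (\<forall>z\<in>B. \<alpha> z = (\<Sum>k<8. b k * (w z ^ k * deriv w z)) + w z ^ 8 * g z)"
proof -
  obtain c g where g: "g holomorphic_on B" "\<forall>z\<in>B. \<alpha> z
      = (\<Sum>k<8. c k * (w z ^ k * deriv w z)) + w z ^ 8 * g z"
    using division[of 8] by blast
  define D where "D = Abs_fps (\<lambda>k. if k < 8 then c k else 0)"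
  have near: "eventually (\<lambda>x. of_real z0 + x \<in> B) (nhds 0)"
  proof -
    have "((\<lambda>x. of_real z0 + x) \<longlongrightarrow> of_real z0 + 0) (nhds (0 :: complex))"
        by (intro tendsto_intros filterlim_ident)
    then show ?thesis using z0_in(1) by (intro topological_tendstoD) auto
  qed
  have deriv_shift: "deriv (\<lambda>x. w (of_real z0 + x)) x = deriv w (of_real z0 + x)"
      if "of_real z0 + x \<in> B" for x
  proof (rule DERIV_imp_deriv)
    show "((\<lambda>x. w (of_real z0 + x)) has_field_derivative deriv w (of_real z0 + x)) (at x)"
    proof -
      have "((\<lambda>x. of_real z0 + x) has_field_derivative 1) (at x)"
          by (auto intro!: derivative_eq_intros)
      then show ?thesis
        using DERIV_chain2[of w "deriv w (of_real z0 + x)" "\<lambda>x. of_real z0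
            + x" x 1 UNIV] w_has_deriv[OF that] by simp
    qed
  qed
  have dw_exp: "(\<lambda>x. deriv w (of_real z0 + x)) has_fps_expansion fps_deriv (fps_X * K)"
    using has_fps_expansion_deriv[OF K]
    by (rule has_fps_expansion_cong[THEN iffD1, rotated
        -1]) (auto intro: eventually_mono[OF near] deriv_shift)
  then have K0: "fps_nth K 0 \<noteq> 0"
    using has_fps_expansion_imp_0_eq_fps_nth_0[OF dw_exp] dw by simp
  let ?W = "fps_X * K"
  have D_eq: "D oo ?W = (\<Sum>k<8. fps_const (c k) * ?W ^ k)"
  proof -
    have "D = (\<Sum>k<8. fps_const (c k) * fps_X ^ k)"
      by (rule fps_ext) (simp add: D_def fps_sum_nth fps_X_power_nth if_distrib cong: if_cong)
    then show ?thesis by (simp add: fps_compose_sum_distrib fps_compose_mult_distrib flip: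
        fps_compose_power)
  qed
  have "(\<lambda>x. \<Sum>k<8. c k * (w (of_real z0 + x) ^ k * deriv w (of_real z0 + x))) has_fps_expansion
      (\<Sum>k<8. fps_const (c k) * (?W ^ k * fps_deriv ?W))"
    by (intro fps_expansion_intros K dw_exp)
  moreover have "(\<lambda>x. w (of_real z0 + x) ^ 8 * g (of_real z0 + x)) has_fps_expansion
      ?W ^ 8 * fps_expansion g (of_real z0)"
    by (intro fps_expansion_intros K has_fps_expansion_at_z0 g)
  ultimately have "(\<lambda>x. (\<Sum>k<8. c k * (w (of_real z0 + x) ^ k * deriv w (of_real z0 + x)))
      + w (of_real z0 + x) ^ 8 * g (of_real z0 + x)) has_fps_expansion
      (\<Sum>k<8. fps_const (c k) * (?W ^ k * fps_deriv ?W)) + ?W ^ 8 * fps_expansion g (of_real z0)"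
    by (rule has_fps_expansion_add)
  then have "(\<lambda>x. \<alpha> (of_real z0 + x)) has_fps_expansion
      (\<Sum>k<8. fps_const (c k) * (?W ^ k * fps_deriv ?W)) + ?W ^ 8 * fps_expansion g (of_real z0)"
    by (rule has_fps_expansion_cong[THEN iffD1, rotated
        -1]) (auto intro: eventually_mono[OF near] simp: g(2))
  from fps_expansion_unique_complex[OF A this]
  have A_eq: "A = (D oo ?W) * fps_deriv ?W + ?W ^ 8 * fps_expansion g (of_real z0)"
    unfolding D_eq by (simp add: sum_distrib_right mult.assoc)
  have "b k = c k" if k: "k < 8" for k
  proof -
    have "A * inverse K ^ Suc k = (D oo ?W) * fps_deriv ?W * inverse K ^ Suc k
        + fps_X ^ 8 * (K ^ 8 * fps_expansion g (of_real z0) * inverse K ^ Suc k)"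
      unfolding A_eq by (simp only: power_mult_distrib algebra_simps)
    then have "b k = fps_nth ((D oo ?W) * fps_deriv ?W * inverse K ^ Suc k) k"
      unfolding b_def using k by (simp only: fps_add_nth fps_X_power_mult_nth if_True add_0_right)
    also have "\<dots> = c k" using fps_lagrange[OF K0, of "Suc k" D] k by (simp add: D_def)
    finally show ?thesis .
  qed
  then show ?thesis using g by (intro exI[of _ g]) (auto intro!: sum.cong)
qed

text \<open>A crude bound, but it turns the remainder of order \<open>n^(-4)\<close> into a relative
  error of order \<open>n^(-3)\<close>.\<close>

lemma norm_M_0_ge: "n \<ge> 5 \<Longrightarrow> 1 / (4 * real n) \<le> norm (M n 0)"
proof -
  assume n: "n \<ge> 5"
  define m where "m = n - 1"
  have m: "n = m + 1" "m > 0" using n by (auto simp: m_def)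
  have "1 / (4 * real n) \<le> 1 / (4 * real m)" using m by (simp add: field_simps)
  also have "\<dots> = 4 ^ m / (2 * real m) / (2 * 4 ^ m)" by simp
  also have "\<dots> \<le> real ((2 * m) choose m) / (2 * 4 ^ m)"
    by (rule divide_right_mono[OF central_binomial_lower_bound[OF m(2)]]) simp
  also have "\<dots> = norm (M n 0)"
    unfolding m(1) M_0 by (simp add: norm_mult norm_divide norm_power)
  finally show ?thesis .
qed

text \<open>The term with \<open>b 6\<close> already has relative order \<open>n^(-3)\<close>, yet
  it must be split off: a remainder with \<open>w^6\<close> would only be bounded by
  \<open>n^(-3)\<close>, which is of order \<open>n^(-5/2)\<close> relative to
  \<open>M n 0\<close>.\<close>

theorem J_expansion:
  fixes A K :: "complex fps"
  defines "b \<equiv> \<lambda>k. fps_nth (A * inverse K ^ Suc k) k"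
  assumes A: "(\<lambda>x. \<alpha> (of_real z0 + x)) has_fps_expansion A"
    and K: "(\<lambda>x. w (of_real z0 + x)) has_fps_expansion (fps_X * K)"
  shows "\<exists>C. \<forall>n\<ge>5. norm (J n \<alpha> - M n 0 * (b 0 - b 2 / (2 * of_nat n - 3)
      + 3 * b 4 / ((2 * of_nat n - 3) * (2 * of_nat n - 5)))) \<le> C * norm (M n 0) / real n ^ 3"
proof -
  have over_power4: "x / y ^ 4 = 4 * x / y ^ 3 * (1 / (4 * y))" for x y :: real
    by (simp add: eval_nat_numeral)
  have norm_15: "norm (- 15 * m / P) = 15 * norm m / norm P" for m P :: complex
    by (simp add: norm_divide norm_mult)
  have move_factor: "x * (15 * 125 * m / y) = 15 * 125 * x * m / y" for x y m :: real
    by simp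
  have combine: "b0 * m + b2 * (- m / d) + b4 * (3 * m / e) + X + R - m * (b0 - b2 / d + 3 * b4 / e)
      = X + R"
    for b0 b2 b4 m d e X R :: complex
    by (simp add: ring_distribs mult_ac)
  have "\<exists>g. g holomorphic_on B \<and> (\<forall>z\<in>B. \<alpha> z = (\<Sum>k<8. b k * (w z ^ k * deriv w z)) + w z ^ 8 * g z)"
    unfolding b_def by (rule division_coeffs[OF A K])
  then obtain g where g: "g holomorphic_on B"
    and \<alpha>_eq: "\<And>z. z \<in> B \<Longrightarrow> \<alpha> z = (\<Sum>k<8. b k * (w z ^ k * deriv w z)) + w z ^ 8 * g z"
    by blast
  obtain C where C: "\<And>n. n \<ge> 4 \<Longrightarrow> norm (J n (\<lambda>z. w z ^ 8 * g z)) \<le> C / real n ^ 4"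
    using J_bound[OF g] by blast
  have "norm (J n \<alpha> - M n 0 * (b 0 - b 2 / (2 * of_nat n - 3)
      + 3 * b 4 / ((2 * of_nat n - 3) * (2 * of_nat n - 5))))
          \<le> (15 * 125 * norm (b 6) + 4 * \<bar>C\<bar>) * norm (M n 0) / real n ^ 3"
    if n: "n \<ge> 5" for n
  proof -
    define R where "R = J n (\<lambda>z. w z ^ 8 * g z)"
    have holo_term: "(\<lambda>z. b k * (w z ^ k * deriv w z)) holomorphic_on B" for k
      by (intro holomorphic_intros holo holo_dw)
    have "J n \<alpha> = J n (\<lambda>z. (\<Sum>k<8. b k * (w z ^ k * deriv w z)) + w z ^ 8 * g z)"
      by (rule J_cong) (rule \<alpha>_eq)
    also have "\<dots> = (\<Sum>k<8. b k * M n k) + R"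
      unfolding R_def M_def
      by (subst J_add) (auto intro!: holomorphic_intros holo holo_dw g simp: J_sum[OF holo_term]
          J_cmult[OF holo_M])
    also have "(\<Sum>k<8. b k * M n k) = b 0 * M n 0 + b 2 * M n 2 + b 4 * M n 4 + b 6 * M n 6"
      using M_odd[of 0 n] M_odd[of 1 n] M_odd[of 2 n] M_odd[of 3 n] n
      by (simp add: eval_nat_numeral lessThan_Suc)
    finally have J_eq: "J n \<alpha> = b 0 * M n 0 + b 2 * M n 2 + b 4 * M n 4 + b 6 * M n 6 + R" .
    have n': "real n \<ge> 5" using n by simp
    have "norm (b 6 * M n 6) \<le> 15 * 125 * norm (b 6) * norm (M n 0) / real n ^ 3"
    proof -
      have "norm (M n 6) = 15 * norm (M n 0) / norm ((2 * of_nat n - 3) * (2 * of_nat n - 5) * (2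
          * of_nat n - 7) :: complex)"
        unfolding M_even(3)[OF n] by (rule norm_15)
      also have "\<dots> \<le> 15 * norm (M n 0) / (real n / 5) ^ 3"
        by (intro divide_left_mono norm_odd_product[OF n] mult_pos_pos norm_odd_product_pos[OF n])
            (use n' in simp_all)
      also have "\<dots> = 15 * 125 * norm (M n 0) / real n ^ 3" by (simp only: power_divide, simp)
      finally have "norm (b 6) * norm (M n 6) \<le> norm (b 6) * (15 * 125 * norm (M n 0) / real n ^ 3)"
        by (rule mult_left_mono) (rule norm_ge_zero)
      then show ?thesis unfolding norm_mult[of "b 6"]
          by (rule order_trans) (rule eq_refl[OF move_factor])
    qed
    moreover have "norm R \<le> 4 * \<bar>C\<bar> * norm (M n 0) / real n ^ 3"
    proof -
      have "norm R \<le> \<bar>C\<bar> / real n ^ 4"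
        unfolding R_def by (rule order_trans[OF C divide_right_mono[OF abs_ge_self]]) (use n in
            simp_all)
      also have "\<dots> = 4 * \<bar>C\<bar> / real n ^ 3 * (1 / (4 * real n))" by (rule over_power4)
      also have "\<dots> \<le> 4 * \<bar>C\<bar> / real n ^ 3 * norm (M n 0)"
          by (rule mult_left_mono[OF norm_M_0_ge]) (use n in simp_all)
      finally show ?thesis by (simp only: times_divide_eq_left)
    qed
    moreover have "J n \<alpha> - M n 0 * (b 0 - b 2 / (2 * of_nat n - 3)
      + 3 * b 4 / ((2 * of_nat n - 3) * (2 * of_nat n - 5))) = b 6 * M n 6 + R"
      unfolding J_eq M_even(1,2)[OF n] by (rule combine)
    moreover have "norm (b 6 * M n 6 + R) \<le> norm (b 6 * M n 6) + norm R"
        by (rule norm_triangle_ineq)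
    ultimately show ?thesis by (simp only: add_divide_distrib distrib_right)
  qed
  then show ?thesis by (intro exI allI impI)
qed

end

section \<open>Asymptotics of the central binomial coefficient\<close>

definition cbin :: "nat \<Rightarrow> real" where
  "cbin n = real ((2 * n) choose n) / 4 ^ n"

lemma cbin_pos: "cbin n > 0"
  by (simp add: cbin_def)

lemma cbin_Suc: "cbin (Suc n) = cbin n * ((2 * real n + 1) / (2 * real n + 2))"
proof -
  have "real (Suc n) * real ((2 * Suc n) choose Suc n)
      = 2 * (2 * real n + 1) * real ((2 * n) choose n)"
    using arg_cong[OF central_binomial_Suc[of n], of real]
        by (simp only: of_nat_mult of_nat_add of_nat_numeral of_nat_1)
  then have e: "real ((2 * Suc n) choose Suc n)
      = 2 * (2 * real n + 1) * real ((2 * n) choose n) / real (Suc n)"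
    by (simp add: field_simps del: of_nat_Suc binomial_Suc_Suc)
  have "2 * real n + 2 = 2 * real (Suc n)" by simp
  moreover have "2 * x * c / y / (4 * p) = c / p * (x / (2 * y))" for x c y p :: real by simp
  ultimately show ?thesis unfolding cbin_def e power_Suc by (simp only:)
qed

text \<open>These are the partial products of Wallis' formula for \<open>pi / 2\<close>.\<close>

lemma cbin_wallis: "1 / (cbin n ^ 2 * (2 * real n + 1))
    = (\<Prod>k=1..n. (4 * real k ^ 2) / (4 * real k ^ 2 - 1))"
proof (induction n)
  case 0
  show ?case by (simp add: cbin_def)
next
  case (Suc n)
  have 1: "4 * real (Suc n) ^ 2 - 1 = (2 * real n + 1) * (2 * real n + 3)"
      by (simp add: power2_eq_square algebra_simps)
  have 2: "4 * real (Suc n) ^ 2 = (2 * real n + 2) ^ 2"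
      by (simp add: power2_eq_square algebra_simps)
  have 3: "2 * real (Suc n) + 1 = 2 * real n + 3" by simp
  have "(\<Prod>k=1..Suc n. (4 * real k ^ 2) / (4 * real k ^ 2 - 1))
      = 1 / (cbin n ^ 2 * (2 * real n + 1)) * ((2 * real n + 2) ^ 2 / ((2 * real n + 1) * (2
          * real n + 3)))"
    unfolding Suc.IH 1[symmetric] 2[symmetric]
        by (subst prod.nat_ivl_Suc') (simp, rule mult.commute)
  also have "\<dots> = 1 / (cbin (Suc n) ^ 2 * (2 * real (Suc n) + 1))"
    unfolding cbin_Suc 3 by (simp add: power_mult_distrib power_divide power2_eq_square)
  finally show ?case by simp
qed

lemma cbin_limit: "(\<lambda>n. cbin n * sqrt (real n)) \<longlonglongrightarrow> 1 / sqrt pi"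
proof -
  have "(\<lambda>n. 1 / (cbin n ^ 2 * (2 * real n + 1))) \<longlonglongrightarrow> pi / 2"
    unfolding cbin_wallis by (rule wallis)
  then have "(\<lambda>n. inverse (1 / (cbin n ^ 2 * (2 * real n + 1))) * (real n / (2 * real n
      + 1))) \<longlonglongrightarrow> inverse (pi / 2) * (1 / 2)"
    by (intro tendsto_mult tendsto_inverse) (assumption, simp, real_asymp)
  moreover have "inverse (1 / (cbin n ^ 2 * (2 * real n + 1))) * (real n / (2 * real n + 1))
      = cbin n ^ 2 * real n" for n
    using add_nonneg_pos[of "2 * real n" 1] by (simp add: field_simps)
  ultimately have "(\<lambda>n. sqrt (cbin n ^ 2 * real n)) \<longlonglongrightarrow> sqrt (1 / pi)"
    by (intro tendsto_real_sqrt) simp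
  then show ?thesis using cbin_pos by (simp add: real_sqrt_mult real_sqrt_divide less_imp_le)
qed

lemma eventually_le_limit:
  fixes x :: "nat \<Rightarrow> real"
  assumes "x \<longlonglongrightarrow> L" "eventually (\<lambda>n. x n \<le> x (Suc n)) sequentially"
  shows "eventually (\<lambda>n. x n \<le> L) sequentially"
proof -
  from assms(2) obtain N where N: "\<And>n. n \<ge> N \<Longrightarrow> x n \<le> x (Suc n)"
      by (auto simp: eventually_sequentially)
  have "x n \<le> L" if "n \<ge> N" for n
  proof -
    have "incseq (\<lambda>k. x (n + k))" using N that by (intro incseq_SucI) simp
    moreover have "(\<lambda>k. x (n + k)) \<longlonglongrightarrow> L" using LIMSEQ_ignore_initial_segment[OF assms(1), of n]
        by (simp add: add.commute)
    ultimately show ?thesis using incseq_le[of "\<lambda>k. x (n + k)" L 0] by simp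
  qed
  then show ?thesis by (auto simp: eventually_sequentially)
qed

text \<open>
  With an error term \<open>\<plusminus> 1/n\<^sup>3\<close> added, the quotient of \<open>cbin n\<close> by the expansion is monotone with
  limit \<open>1 / sqrt \<pi>\<close>, hence on one side of it.
\<close>

lemma cbin_expansion:
  "(\<lambda>n. cbin n * sqrt (pi * real n) - (1 - 1 / (8 * real n) + 1 / (128 * real n ^ 2)))
      \<in> O(\<lambda>n. 1 / real n ^ 3)"
proof -
  define p where "p = (\<lambda>C n. (1 - 1 / (8 * real n) + 1 / (128 * real n ^ 2) + C / real n ^ 3)
      / sqrt (real n))"
  have lim: "(\<lambda>n. cbin n / p C n) \<longlonglongrightarrow> 1 / sqrt pi" for C :: real
  proof -
    have "(\<lambda>n. 1 - 1 / (8 * real n) + 1 / (128 * real n ^ 2) + C / real n ^ 3) \<longlonglongrightarrow> 1" by real_asymp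
    from tendsto_divide[OF cbin_limit this] show ?thesis by (simp add: p_def)
  qed
  have p_pos_Suc: "eventually (\<lambda>n. p C (Suc n) > 0) sequentially" for C :: real
    unfolding p_def by real_asymp
  have p_pos: "eventually (\<lambda>n. p C n > 0) sequentially" for C :: real
    unfolding p_def by real_asymp
  \<comment> \<open>The true coefficient of \<open>1 / n^3\<close> is \<open>5 / 1024\<close>. It
    lies strictly between the trial values \<open>-1\<close> and \<open>1\<close>, which decides the
    direction of monotonicity in either case.\<close>
  have "eventually (\<lambda>n. p 1 (Suc n) \<le> p 1 n * ((2 * real n + 1) / (2 * real n + 2))) sequentially"
    unfolding p_def by real_asymp
  then have "eventually (\<lambda>n. cbin n / p 1 n \<le> cbin (Suc n) / p 1 (Suc n)) sequentially"
    using p_pos[of 1] p_pos_Suc[of 1]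
  proof eventually_elim
    case (elim n)
    have "cbin n * p 1 (Suc n) \<le> cbin n * (p 1 n * ((2 * real n + 1) / (2 * real n + 2)))"
      by (rule mult_left_mono[OF elim(1) less_imp_le[OF cbin_pos]])
    then show ?case using elim(2,3) unfolding cbin_Suc
        by (simp add: divide_le_eq le_divide_eq mult_ac)
  qed
  from eventually_le_limit[OF lim this]
  have upper: "eventually (\<lambda>n. cbin n / p 1 n \<le> 1 / sqrt pi) sequentially" .
  have "eventually (\<lambda>n. p (-1) (Suc n) \<ge> p (-1) n * ((2 * real n + 1) / (2 * real n
      + 2))) sequentially"
    unfolding p_def by real_asymp
  then have "eventually (\<lambda>n. - (cbin n / p (-1) n)
      \<le> - (cbin (Suc n) / p (-1) (Suc n))) sequentially"
    using p_pos[of "-1"] p_pos_Suc[of "-1"]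
  proof eventually_elim
    case (elim n)
    have "cbin n * (p (-1) n * ((2 * real n + 1) / (2 * real n + 2))) \<le> cbin n * p (-1) (Suc n)"
      by (rule mult_left_mono[OF elim(1) less_imp_le[OF cbin_pos]])
    then show ?case using elim(2,3) unfolding cbin_Suc
        by (simp add: divide_le_eq le_divide_eq mult_ac)
  qed
  from eventually_le_limit[OF tendsto_minus[OF lim] this]
  have lower: "eventually (\<lambda>n. cbin n / p (-1) n \<ge> 1 / sqrt pi) sequentially" by simp
  show ?thesis
  proof (rule bigoI[of _ 1])
    show "eventually (\<lambda>n. norm (cbin n * sqrt (pi * real n) - (1 - 1 / (8 * real n) + 1 / (128
        * real n ^ 2)))
        \<le> 1 * norm (1 / real n ^ 3)) sequentially"
      using upper lower p_pos[of 1] p_pos[of "-1"] eventually_gt_at_top[of 0]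
    proof eventually_elim
      case (elim n)
      have s: "sqrt (pi * real n) = sqrt pi * sqrt (real n)" by (simp add: real_sqrt_mult)
      have "cbin n * sqrt pi \<le> p 1 n" using elim(1,3) by (simp add: field_simps)
      then have 1: "cbin n * sqrt (pi * real n) \<le> p 1 n * sqrt (real n)"
        unfolding s using mult_right_mono[of "cbin n * sqrt pi" "p 1 n" "sqrt (real n)"]
            by (simp add: mult.assoc)
      have "cbin n * sqrt pi \<ge> p (-1) n" using elim(2,4) by (simp add: field_simps)
      then have 2: "cbin n * sqrt (pi * real n) \<ge> p (-1) n * sqrt (real n)"
        unfolding s using mult_right_mono[of "p (-1) n" "cbin n * sqrt pi" "sqrt (real n)"]
            by (simp add: mult.assoc)
      have "p C n * sqrt (real n) = 1 - 1 / (8 * real n) + 1 / (128 * real n ^ 2) + C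
          / real n ^ 3" for C
        using elim(5) by (simp add: p_def)
      with 1 2 have "\<bar>cbin n * sqrt (pi * real n) - (1 - 1 / (8 * real n) + 1 / (128 * real n ^ 2))\<bar>
          \<le> 1 / real n ^ 3"
        by (simp add: abs_le_iff)
      then show ?case by simp
    qed
  qed
qed

section \<open>From the integrals to the coefficients\<close>

lemma bigo_cmult: "f \<in> O(g) \<Longrightarrow> (\<lambda>n. c * f n) \<in> O(g)" for c :: real and f g :: "nat \<Rightarrow> real"
  by (cases "c = 0") simp_all

lemma bigo_mult_expansions:
  fixes f g :: "nat \<Rightarrow> real"
  assumes "(\<lambda>n. f n - (1 + a1 / real n + a2 / real n ^ 2)) \<in> O(\<lambda>n. 1 / real n ^ 3)"
    and "(\<lambda>n. g n - (1 + b1 / real n + b2 / real n ^ 2)) \<in> O(\<lambda>n. 1 / real n ^ 3)"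
  shows "(\<lambda>n. f n * g n - (1 + (a1 + b1) / real n + (a2 + a1 * b1 + b2) / real n ^ 2))
      \<in> O(\<lambda>n. 1 / real n ^ 3)"
proof -
  define F where "F = (\<lambda>n. 1 + a1 / real n + a2 / real n ^ 2)"
  define G where "G = (\<lambda>n. 1 + b1 / real n + b2 / real n ^ 2)"
  have inv1: "(\<lambda>n. c / real n) \<in> O(\<lambda>_. 1)" for c :: real
  proof -
    have "(\<lambda>n. 1 / real n) \<in> O(\<lambda>_. 1 :: real)" by real_asymp
    from bigo_cmult[OF this, of c] show ?thesis by simp
  qed
  have inv2: "(\<lambda>n. c / real n ^ 2) \<in> O(\<lambda>_. 1)" for c :: real
  proof -
    have "(\<lambda>n. 1 / real n ^ 2) \<in> O(\<lambda>_. 1 :: real)" by real_asymp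
    from bigo_cmult[OF this, of c] show ?thesis by simp
  qed
  have one: "(\<lambda>_::nat. 1) \<in> O(\<lambda>_. 1 :: real)" by simp
  have bounded: "F \<in> O(\<lambda>_. 1)" "G \<in> O(\<lambda>_. 1)"
    unfolding F_def G_def by (rule sum_in_bigo(1)[OF sum_in_bigo(1)[OF one inv1] inv2])+
  have small: "(\<lambda>n. 1 / real n ^ 3) \<in> O(\<lambda>_. 1 :: real)" by real_asymp
  have "g \<in> O(\<lambda>_. 1)"
    using sum_in_bigo(1)[OF bounded(2) landau_o.big_trans[OF assms(2) small]] by (simp add: G_def)
  then have "(\<lambda>n. (f n - F n) * g n) \<in> O(\<lambda>n. 1 / real n ^ 3)"
    using landau_o.big.mult[OF assms(1), of g "\<lambda>_. 1"] by (simp add: F_def)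
  moreover have "(\<lambda>n. F n * (g n - G n)) \<in> O(\<lambda>n. 1 / real n ^ 3)"
    using landau_o.big.mult[OF bounded(1) assms(2)] by (simp add: G_def)
  moreover have "(\<lambda>n. F n * G n - (1 + (a1 + b1) / real n + (a2 + a1 * b1 + b2) / real n ^ 2))
      \<in> O(\<lambda>n. 1 / real n ^ 3)"
  proof -
    have e: "F n * G n - (1 + (a1 + b1) / real n + (a2 + a1 * b1 + b2) / real n ^ 2)
        = (a1 * b2 + a2 * b1) * (1 / real n ^ 3) + a2 * b2 / real n * (1 / real n ^ 3)" for n
      by (simp add: F_def G_def eval_nat_numeral ring_distribs add_divide_distrib)
    have "(\<lambda>n. a2 * b2 / real n * (1 / real n ^ 3)) \<in> O(\<lambda>n. 1 * (1 / real n ^ 3))"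
      by (intro landau_o.big.mult inv1) simp_all
    then have 2: "(\<lambda>n. a2 * b2 / real n * (1 / real n ^ 3)) \<in> O(\<lambda>n. 1 / real n ^ 3)" by simp
    show ?thesis unfolding e by (rule sum_in_bigo(1)[OF bigo_cmult 2]) simp
  qed
  ultimately have "(\<lambda>n. (f n - F n) * g n + F n * (g n - G n)
      + (F n * G n - (1 + (a1 + b1) / real n + (a2 + a1 * b1 + b2) / real n ^ 2)))
          \<in> O(\<lambda>n. 1 / real n ^ 3)"
    by (rule sum_in_bigo(1)[OF sum_in_bigo(1)])
  then show ?thesis by (simp add: algebra_simps)
qed

text \<open>Three expansions are multiplied: \<open>P\<close> collects
  \<open>n^3 / (n (n + 1) (n + 2))\<close> and the passage from \<open>cbin (n - 1)\<close> to
  \<open>cbin n\<close>, \<open>S\<close> is the central binomial coefficient, and \<open>T\<close>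
  comes from the saddle point. The numbers \<open>- 21 / 8\<close> and \<open>777 / 128\<close> are
  the coefficients of \<open>P * S\<close>.\<close>

lemma coefficient_asymptotics:
  fixes a f :: "nat \<Rightarrow> real" and t0 b0 b2 b4 C :: real
  assumes t0: "t0 > 0" and b0: "b0 < 0"
    and f: "\<And>n. n \<ge> 1 \<Longrightarrow> real (n * (n + 1) * (n + 2)) * f n = a n"
    and a: "\<And>n. n \<ge> 5 \<Longrightarrow> \<bar>t0 ^ n * a n - (- cbin (n - 1) / 2) * (b0 - b2 / (2 * real n - 3)
      + 3 * b4 / ((2 * real n - 3) * (2 * real n - 5)))\<bar> \<le> C * cbin (n - 1) / real n ^ 3"
  defines "c \<equiv> - b0 / (2 * sqrt pi)" and "d1 \<equiv> - 21 / 8 - b2 / b0 / 2"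
    and "d2 \<equiv> 777 / 128 + 9 / 16 * (b2 / b0) + 3 / 4 * (b4 / b0)"
  shows "\<exists>E. E \<in> O(\<lambda>n. 1 / real n ^ 3) \<and> (\<forall>n\<ge>1. f n
      = c * ((1 / t0) ^ n / real n powr (7 / 2)) * (1 + d1 / real n + d2 / real n ^ 2 + E n))"
proof -
  define T where "T = (\<lambda>n. t0 ^ n * a n / (- cbin (n - 1) / 2 * b0))"
  define P where "P = (\<lambda>n. real n ^ 3 / (real n * (real n + 1) * (real n + 2)) * (2 * real n / (2
      * real n - 1)))"
  define S where "S = (\<lambda>n. cbin n * sqrt (pi * real n))"
  have c: "c > 0" using b0 by (simp add: c_def divide_less_0_iff)
  have S: "(\<lambda>n. S n - (1 + (- 1 / 8) / real n + (1 / 128) / real n ^ 2)) \<in> O(\<lambda>n. 1 / real n ^ 3)"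
    using cbin_expansion by (simp add: S_def)
  have P: "(\<lambda>n. P n - (1 + (- 5 / 2) / real n + (23 / 4) / real n ^ 2)) \<in> O(\<lambda>n. 1 / real n ^ 3)"
    unfolding P_def by real_asymp
  have T: "(\<lambda>n. T n - (1 + (- (b2 / b0) / 2) / real n + (3 / 4 * (b4 / b0) - 3 / 4 * (b2 / b0))
      / real n ^ 2)) \<in> O(\<lambda>n. 1 / real n ^ 3)"
  proof -
    have "(\<lambda>n. T n - (1 - b2 / b0 * (1 / (2 * real n - 3)) + b4 / b0 * (3 / ((2 * real n - 3) * (2
        * real n - 5))))) \<in> O(\<lambda>n. 1 / real n ^ 3)"
    proof (rule bigoI[of _ "2 * C / \<bar>b0\<bar>"], rule eventually_mono[OF eventually_ge_at_top[of 5]])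
      fix n :: nat assume n: "n \<ge> 5"
      show "norm (T n - (1 - b2 / b0 * (1 / (2 * real n - 3)) + b4 / b0 * (3 / ((2 * real n - 3)
          * (2 * real n - 5)))))
          \<le> 2 * C / \<bar>b0\<bar> * norm (1 / real n ^ 3)"
      proof -
        define V where "V = 1 - b2 / b0 * (1 / (2 * real n - 3)) + b4 / b0 * (3 / ((2 * real n - 3)
            * (2 * real n - 5)))"
        define m where "m = - cbin (n - 1) / 2"
        have m: "m \<noteq> 0" "\<bar>m\<bar> = cbin (n - 1) / 2" using cbin_pos[of "n - 1"] by (auto simp: m_def)
        have V: "b0 - b2 / (2 * real n - 3) + 3 * b4 / ((2 * real n - 3) * (2 * real n - 5))
            = b0 * V"
        proof -
          have "b0 - b2 / u + 3 * b4 / v = b0 * (1 - b2 / b0 * (1 / u) + b4 / b0 * (3 / v))" for u v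
            using b0 by (simp only: distrib_left right_diff_distrib) simp
          then show ?thesis unfolding V_def .
        qed
        have "\<bar>m * b0\<bar> * \<bar>T n - V\<bar> = \<bar>t0 ^ n * a n - m * (b0 * V)\<bar>"
          using m(1) b0 unfolding abs_mult[symmetric] T_def m_def[symmetric]
              by (simp add: right_diff_distrib mult.assoc)
        also have "\<dots> \<le> C * cbin (n - 1) / real n ^ 3" using a[OF n] unfolding V m_def .
        finally have "\<bar>m\<bar> * (\<bar>b0\<bar> * \<bar>T n - V\<bar>) \<le> \<bar>m\<bar> * (2 * C / real n ^ 3)"
          unfolding abs_mult m(2) by (simp add: mult_ac)
        then have "\<bar>b0\<bar> * \<bar>T n - V\<bar> \<le> 2 * C / real n ^ 3"
          by (rule mult_left_le_imp_le) (use m(1) in simp)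
        then have "\<bar>T n - V\<bar> \<le> 2 * C / real n ^ 3 / \<bar>b0\<bar>" using b0
            by (subst pos_le_divide_eq) (auto simp: mult.commute)
        then show ?thesis by (simp add: V_def mult.commute)
      qed
    qed
    moreover have "(\<lambda>n. 1 / (2 * real n - 3) - (1 / 2 / real n + 3 / 4 / real n ^ 2))
        \<in> O(\<lambda>n. 1 / real n ^ 3)"
      by real_asymp
    then have "(\<lambda>n. b2 / b0 * (1 / (2 * real n - 3) - (1 / 2 / real n + 3 / 4 / real n ^ 2)))
        \<in> O(\<lambda>n. 1 / real n ^ 3)"
      by (rule bigo_cmult)
    moreover have "(\<lambda>n. 3 / ((2 * real n - 3) * (2 * real n - 5)) - 3 / 4 / real n ^ 2)
        \<in> O(\<lambda>n. 1 / real n ^ 3)"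
      by real_asymp
    then have "(\<lambda>n. b4 / b0 * (3 / ((2 * real n - 3) * (2 * real n - 5)) - 3 / 4 / real n ^ 2))
        \<in> O(\<lambda>n. 1 / real n ^ 3)"
      by (rule bigo_cmult)
    ultimately have "(\<lambda>n. T n - (1 - b2 / b0 * (1 / (2 * real n - 3)) + b4 / b0 * (3 / ((2 * real n
        - 3) * (2 * real n - 5))))
        - b2 / b0 * (1 / (2 * real n - 3) - (1 / 2 / real n + 3 / 4 / real n ^ 2))
        + b4 / b0 * (3 / ((2 * real n - 3) * (2 * real n - 5)) - 3 / 4 / real n ^ 2))
            \<in> O(\<lambda>n. 1 / real n ^ 3)"
      by (rule sum_in_bigo(1)[OF sum_in_bigo(2)])
    moreover have "x - (1 - p * y + q * z) - p * (y - (1 / 2 / u + 3 / 4 / v)) + q * (z - 3 / 4 / v)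
        = x - (1 + (- p / 2) / u + (3 / 4 * q - 3 / 4 * p) / v)" for x y z p q u v :: real
      by (simp add: algebra_simps diff_divide_distrib add_divide_distrib)
    ultimately show ?thesis by (simp only:)
  qed
  have PST: "(\<lambda>n. P n * S n * T n - (1 + d1 / real n + d2 / real n ^ 2)) \<in> O(\<lambda>n. 1 / real n ^ 3)"
    using bigo_mult_expansions[OF bigo_mult_expansions[OF P S] T]
    by (simp add: d1_def d2_def algebra_simps add_divide_distrib diff_divide_distrib)
  have f_eq: "f n = c * ((1 / t0) ^ n / real n powr (7 / 2)) * (P n * S n * T n)"
      if n: "n \<ge> 1" for n
  proof -
    define x where "x = real n"
    have x: "x \<ge> 1" using n by (simp add: x_def)
    define m where "m = cbin (n - 1)"
    have m: "m > 0" unfolding m_def by (rule cbin_pos)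
    have cb: "cbin n = m * ((2 * x - 1) / (2 * x))"
      using cbin_Suc[of "n - 1"] n by (simp add: m_def x_def of_nat_diff)
    have pw: "x powr (7 / 2) = x ^ 3 * sqrt x"
    proof -
      have "x powr (7 / 2) = x powr (3 + 1 / 2)" by simp
      also have "\<dots> = x powr 3 * x powr (1 / 2)" by (rule powr_add)
      finally show ?thesis using x by (simp add: powr_half_sqrt)
    qed
    have fn: "f n = a n / (x * (x + 1) * (x + 2))" proof -
      have "x * (x + 1) * (x + 2) * f n = a n" using f[OF n]
          by (simp only: of_nat_mult of_nat_add of_nat_1 of_nat_numeral x_def)
      then show ?thesis using x by (subst nonzero_eq_divide_eq) (auto simp: mult_ac)
    qed
    have "c * ((1 / t0) ^ n / (x ^ 3 * sqrt x)) * (x ^ 3 / (x * (x + 1) * (x + 2)) * (2 * x / (2 * x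
        - 1)) *
        (m * ((2 * x - 1) / (2 * x)) * (sqrt pi * sqrt x)) * (t0 ^ n * a n / (- m / 2 * b0)))
      = (c * sqrt pi * 2 / - b0) * ((1 / t0) ^ n * t0 ^ n) * (x ^ 3 / x ^ 3) * (sqrt x / sqrt x)
          * (m / m)
        * ((2 * x - 1) / (2 * x - 1)) * ((2 * x) / (2 * x)) * (a n / (x * (x + 1) * (x + 2)))"
      by (simp add: mult_ac)
    also have "\<dots> = f n"
      using x m t0 b0 unfolding fn c_def by (simp add: power_divide)
    finally show ?thesis
      unfolding P_def S_def T_def x_def[symmetric] m_def[symmetric] cb pw real_sqrt_mult by simp
  qed
  show ?thesis
    using PST f_eq by (intro exI[of _ "\<lambda>n. P n * S n * T n - (1 + d1 / real n + d2
        / real n ^ 2)"]) simp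
qed

text \<open>The ratio test: in the quotient of consecutive coefficients every factor except
  \<open>t0\<close> tends to 1.\<close>

lemma conv_radius_from_asymptotics:
  fixes F :: "real fps"
  assumes c: "c > 0" and t0: "t0 > 0" and E: "E \<in> O(\<lambda>n. 1 / real n ^ 3)"
    and F: "\<And>n. n \<ge> 1 \<Longrightarrow> fps_nth F n
        = c * ((1 / t0) ^ n / real n powr (7 / 2)) * (1 + d1 / real n + d2 / real n ^ 2 + E n)"
  shows "fps_conv_radius F = ereal t0"
proof -
  define g where "g = (\<lambda>n. 1 + d1 / real n + d2 / real n ^ 2 + E n)"
  have F': "fps_nth F n = c * ((1 / t0) ^ n / real n powr (7 / 2)) * g n" if "n \<ge> 1" for n
    unfolding g_def by (rule F[OF that])
  obtain K where K: "eventually (\<lambda>n. norm (E n) \<le> K * norm (1 / real n ^ 3)) sequentially"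
    using E by (elim landau_o.bigE)
  have "(\<lambda>n. 1 / real n ^ 3) \<longlonglongrightarrow> 0" by real_asymp
  then have "(\<lambda>n. K * norm (1 / real n ^ 3)) \<longlonglongrightarrow> K * norm (0 :: real)"
    by (intro tendsto_mult_left tendsto_norm)
  then have E0: "E \<longlonglongrightarrow> 0" using Lim_null_comparison[OF K] by simp
  have "(\<lambda>n. d1 * (1 / real n)) \<longlonglongrightarrow> d1 * 0" "(\<lambda>n. d2 * (1 / real n ^ 2)) \<longlonglongrightarrow> d2 * 0"
    by (intro tendsto_mult_left; real_asymp)+
  from tendsto_add[OF tendsto_add[OF tendsto_add[OF tendsto_const[of 1] this(1)] this(2)] E0]
  have g: "g \<longlonglongrightarrow> 1" by (simp add: g_def)
  then have g_pos: "eventually (\<lambda>n. g n > 0) sequentially" by (rule order_tendstoD) simp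
  have "(\<lambda>n. t0 * ((real (Suc n) / real n) powr (7 / 2)) * (g n / g (Suc n))) \<longlonglongrightarrow> t0 * 1 * (1 / 1)"
    by (intro tendsto_mult tendsto_const tendsto_divide g LIMSEQ_Suc[OF g]) (real_asymp, simp)
  moreover have "eventually (\<lambda>n. t0 * ((real (Suc n) / real n) powr (7 / 2)) * (g n / g (Suc n))
      = norm (fps_nth F n) / norm (fps_nth F (Suc n))) sequentially"
    using g_pos eventually_all_ge_at_top[OF g_pos] eventually_ge_at_top[of 1]
  proof eventually_elim
    case (elim n)
    have "g (Suc n) > 0" using elim(2) by simp
    then show ?case
      using elim(1,3) c t0 by (simp add: F' powr_divide abs_mult power_one_over del: of_nat_Suc)
  qed
  ultimately have lim: "(\<lambda>n. norm (fps_nth F n) / norm (fps_nth F (Suc n))) \<longlonglongrightarrow> t0"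
    using Lim_transform_eventually by fastforce
  with t0 show ?thesis
    unfolding fps_conv_radius_def by (intro conv_radius_ratio_limit_nonzero) auto
qed

lemma of_real_of_rat: "of_real (of_rat q) = (of_rat q :: 'a::{real_normed_field})"
  by (induction q) (simp add: of_rat_rat)

lemma fps_map_of_rat_inverse:
  fixes \<Psi> :: "rat fps"
  assumes "fps_nth \<Psi> 0 \<noteq> 0"
  shows "fps_map of_rat (inverse \<Psi>) = (inverse (fps_map of_rat \<Psi>) :: 'a::field_char_0 fps)"
proof -
  interpret rat: ring_map "of_rat :: rat \<Rightarrow> 'a" by standard (simp_all add: of_rat_add of_rat_mult)
  have "fps_map of_rat (inverse \<Psi>) * fps_map of_rat \<Psi> = (1 :: 'a fps)"
    unfolding rat.fps_map_mult[symmetric] inverse_mult_eq_1[OF assms] by (rule rat.fps_map_1)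
  then show ?thesis by (metis fps_inverse_unique mult.commute)
qed

text \<open>Data that produce a \<open>saddle\<close>: the double zero at \<open>z0\<close> is split
  off from \<open>1 - z \<psi>(z) / t0\<close>, and the remaining factor \<open>k\<close> maps into
  the right half plane, so its principal square root is holomorphic and
  \<open>w = (z0 - z) sqrt k\<close>. The circle condition is stated for squares of moduli, free of
  roots.\<close>

locale sqrt_saddle =
  fixes r t0 z0 \<eta> :: real and \<psi> \<alpha> k :: "complex \<Rightarrow> complex"
  assumes z0: "0 < z0" "z0 < r" and t0: "t0 > 0" and \<eta>: "\<eta> > 0"
    and holo: "\<psi> holomorphic_on ball 0 r" "\<alpha> holomorphic_on ball 0 r" "k holomorphic_on ball 0 r"
    and \<psi>_nz: "\<And>z :: complex. z \<in> ball 0 r \<Longrightarrow> \<psi> z \<noteq> 0"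
    and Re_k: "\<And>z :: complex. z \<in> ball 0 r \<Longrightarrow> Re (k z) > 0"
    and \<phi>: "\<And>z :: complex. z \<in> ball 0 r \<Longrightarrow> z * \<psi> z = of_real t0 * (1 - (of_real z0 - z) ^ 2 * k z)"
    and k_0: "k 0 = of_real (1 / z0 ^ 2)"
    and circle: "\<And>z :: complex. norm z = z0 \<Longrightarrow> t0 ^ 2 * (1 + \<eta> * norm (z - of_real z0) ^ 2)
        \<le> norm (z * \<psi> z) ^ 2"
begin

definition w :: "complex \<Rightarrow> complex" where "w z = (of_real z0 - z) * csqrt (k z)"

lemma k_not_nonpos: "z \<in> ball 0 r \<Longrightarrow> k z \<notin> \<real>\<^sub>\<le>\<^sub>0"
  using Re_k[of z] by (auto simp: complex_nonpos_Reals_iff)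

lemma holo_csqrt: "(\<lambda>z. csqrt (k z)) holomorphic_on ball 0 r"
  by (intro holomorphic_on_csqrt' holo k_not_nonpos)

lemma holo_w: "w holomorphic_on ball 0 r"
  unfolding w_def by (intro holomorphic_intros holo_csqrt)

lemma w_sq: "w z ^ 2 = (of_real z0 - z) ^ 2 * k z"
  by (simp add: w_def power_mult_distrib)

lemma z0_ball: "complex_of_real z0 \<in> ball 0 r" "0 \<in> ball (0 :: complex) r"
  using z0 by auto

lemma circle_ex: "\<exists>\<kappa>>0. \<forall>z. norm z = z0 \<longrightarrow> 1 + \<kappa> * norm (w z) ^ 2 \<le> norm (1 - w z ^ 2)"
proof -
  have "bounded (k ` sphere 0 z0)"
    using z0 by (intro compact_imp_bounded compact_continuous_image holomorphic_on_imp_continuous_on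
        holomorphic_on_subset[OF holo(3)]) auto
  then obtain L where L: "L > 0" "\<And>z. norm z = z0 \<Longrightarrow> norm (k z) \<le> L"
    by (metis bounded_pos dist_0_norm imageI mem_sphere)
  \<comment> \<open>Chosen to give \<open>(1 + \<kappa> x)^2 <= 1 + \<eta> d\<close> whenever
    \<open>x <= L d\<close> and \<open>d <= 4 z0^2\<close>, where \<open>L\<close> bounds
    \<open>k\<close> on the circle and \<open>d\<close> is the squared distance to
    \<open>z0\<close>.\<close>
  define \<kappa> where "\<kappa> = min 1 (\<eta> / (L * (2 + 4 * z0 ^ 2 * L)))"
  have pos: "L * (2 + 4 * z0 ^ 2 * L) > 0" using L(1) by (intro mult_pos_pos add_pos_nonneg) auto
  have \<kappa>: "\<kappa> > 0" "\<kappa> \<le> 1" "\<kappa> * (L * (2 + 4 * z0 ^ 2 * L)) \<le> \<eta>"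
    using \<eta> pos by (auto simp: \<kappa>_def min_def divide_simps split: if_splits)
  have "1 + \<kappa> * norm (w z) ^ 2 \<le> norm (1 - w z ^ 2)" if z: "norm z = z0" for z
  proof -
    define d where "d = norm (z - of_real z0) ^ 2"
    have d: "0 \<le> d" "d \<le> 4 * z0 ^ 2"
    proof -
      have "norm (z - of_real z0) \<le> 2 * z0" using norm_triangle_ineq4[of z "of_real z0"] z z0
          by simp
      from power_mono[OF this, of 2] show "d \<le> 4 * z0 ^ 2" by (simp add: d_def power_mult_distrib)
    qed (simp add: d_def)
    have wd: "norm (w z) ^ 2 \<le> L * d"
    proof -
      have "norm (w z) ^ 2 = norm (w z ^ 2)" by (simp only: norm_power)
      also have "\<dots> = norm (k z) * d"
        by (simp add: w_sq d_def norm_mult norm_power norm_minus_commute mult.commute)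
      finally show ?thesis using mult_right_mono[OF L(2)[OF z] d(1)] by simp
    qed
    define x where "x = norm (w z) ^ 2"
    have x: "0 \<le> x" "x \<le> L * d" "x \<le> L * (4 * z0 ^ 2)"
      using wd order_trans[OF wd mult_left_mono[OF d(2), of L]] L(1) by (auto simp: x_def)
    have "(1 + \<kappa> * x) ^ 2 = 1 + \<kappa> * (2 + \<kappa> * x) * x" by (simp add: power2_eq_square algebra_simps)
    also have "\<dots> \<le> 1 + \<kappa> * (2 + 1 * (L * (4 * z0 ^ 2))) * (L * d)"
      using \<kappa> x L(1) by (intro add_left_mono mult_mono mult_nonneg_nonneg add_nonneg_nonneg) auto
    also have "\<dots> = 1 + \<kappa> * (L * (2 + 4 * z0 ^ 2 * L)) * d" by (simp add: algebra_simps)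
    also have "\<dots> \<le> 1 + \<eta> * d" using mult_right_mono[OF \<kappa>(3) d(1)] by simp
    also have "\<dots> \<le> norm (1 - w z ^ 2) ^ 2"
    proof -
      have "z * \<psi> z = of_real t0 * (1 - w z ^ 2)" using \<phi>[of z] z z0 by (simp add: w_sq)
      then have "t0 ^ 2 * (1 + \<eta> * d) \<le> t0 ^ 2 * norm (1 - w z ^ 2) ^ 2"
        using circle[OF z] by (simp add: d_def norm_mult power_mult_distrib)
      then show ?thesis using t0 by simp
    qed
    finally have "1 + \<kappa> * x \<le> norm (1 - w z ^ 2)" by (rule power2_le_imp_le) simp
    then show ?thesis by (simp add: x_def)
  qed
  with \<kappa>(1) show ?thesis by blast
qed

lemma saddle_ex: "\<exists>\<kappa>. saddle r t0 z0 \<kappa> \<psi> \<alpha> w"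
proof -
  obtain \<kappa> where \<kappa>: "\<kappa> > 0" "\<And>z. norm z = z0 \<Longrightarrow> 1 + \<kappa> * norm (w z) ^ 2 \<le> norm (1 - w z ^ 2)"
    using circle_ex by blast
  have k_nz: "k z \<noteq> 0" if "z \<in> ball 0 r" for z using Re_k[OF that] by auto
  have "saddle r t0 z0 \<kappa> \<psi> \<alpha> w"
  proof
    show "z * \<psi> z = t0 * (1 - w z ^ 2)" if "z \<in> ball 0 r" for z using \<phi>[OF that] by (simp add: w_sq)
    have "csqrt (k 0) = of_real (1 / z0)" using z0
        by (simp add: k_0 real_sqrt_divide csqrt_of_real_nonneg del: of_real_divide)
    then show "w 0 = 1" using z0 by (simp add: w_def)
    show "w z = 0 \<longleftrightarrow> z = complex_of_real z0" if "z \<in> ball 0 r" for z using k_nz[OF that]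
        by (auto simp: w_def)
    have d: "((\<lambda>z. csqrt (k z)) has_field_derivative deriv (\<lambda>z. csqrt (k z)) (of_real z0)) (at
        (of_real z0))"
      by (rule holomorphic_derivI[OF holo_csqrt _ z0_ball(1)]) simp
    have "(w has_field_derivative - csqrt (k (of_real z0))) (at (of_real z0))"
      unfolding w_def by (rule derivative_eq_intros d | simp)+
    then have "deriv w (of_real z0) = - csqrt (k (of_real z0))" by (rule DERIV_imp_deriv)
    then show "deriv w (of_real z0) \<noteq> 0" using k_nz[OF z0_ball(1)] by simp
  qed (use z0 t0 \<kappa> holo \<psi>_nz holo_w in auto)
  then show ?thesis ..
qed

text \<open>
  \<open>r2\<close> and \<open>r4\<close> determine the coefficients of \<open>w\<^sup>2 w'\<close> and \<open>w\<^sup>4 w'\<close> in the expansion of \<open>\<alpha>\<close>. They are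
  rational in the saddle point although \<open>K\<close>, the series of \<open>w / (z - z0)\<close>, is not.
\<close>

theorem asymptotics:
  fixes \<Psi> A F :: "rat fps" and A1 G :: "complex fps" and a0 g0 r2 r4 :: real
  assumes \<Psi>: "\<psi> has_fps_expansion fps_map of_rat \<Psi>" and A: "\<alpha> has_fps_expansion fps_map of_rat A"
    and F: "\<And>n. n \<ge> 1 \<Longrightarrow> of_nat (n * (n + 1) * (n + 2)) * fps_nth F n
        = fps_nth (A * inverse \<Psi> ^ n) (n - 1)"
    and A1: "(\<lambda>x. \<alpha> (of_real z0 + x)) has_fps_expansion A1" and G: "(\<lambda>x. k (of_real z0
        + x)) has_fps_expansion G"
    and a0: "\<alpha> (of_real z0) = of_real a0" "a0 > 0" and g0: "k (of_real z0) = of_real g0"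
    and r2: "\<And>K. K ^ 2 = G \<Longrightarrow> fps_nth (A1 * inverse K ^ 3) 2
        = of_real r2 * fps_nth (A1 * inverse K ^ 3) 0"
    and r4: "\<And>K. K ^ 2 = G \<Longrightarrow> fps_nth (A1 * inverse K ^ 5) 4
        = of_real r4 * fps_nth (A1 * inverse K ^ 5) 0"
  defines "c \<equiv> a0 / (2 * sqrt (pi * g0))" and "d1 \<equiv> - 21 / 8 - r2 / g0 / 2"
    and "d2 \<equiv> 777 / 128 + 9 / 16 * (r2 / g0) + 3 / 4 * (r4 / g0 ^ 2)"
  shows "\<exists>E. E \<in> O(\<lambda>n. 1 / real n ^ 3) \<and> (\<forall>n\<ge>1. fps_nth (real_fps F) n
     = c * ((1 / t0) ^ n / real n powr (7 / 2)) * (1 + d1 / real n + d2 / real n ^ 2 + E n))"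
    and "fps_conv_radius (real_fps F) = ereal t0"
proof -
  interpret rat: ring_map "of_rat :: rat \<Rightarrow> complex"
      by standard (simp_all add: of_rat_add of_rat_mult)
  obtain \<kappa> where \<kappa>: "saddle r t0 z0 \<kappa> \<psi> \<alpha> w" using saddle_ex by blast
  then interpret saddle r t0 z0 \<kappa> \<psi> \<alpha> w .
  have g0_pos: "g0 > 0" using Re_k[OF z0_ball(1)] g0 by simp
  define S where "S = fps_expansion (\<lambda>z. csqrt (k z)) (of_real z0)"
  have S: "(\<lambda>x. csqrt (k (of_real z0 + x))) has_fps_expansion S"
    unfolding S_def by (rule has_fps_expansion_at_z0[OF holo_csqrt])
  \<comment> \<open>The minus sign turns \<open>z0 - z\<close> into the local variable
    \<open>z - z0\<close>. It makes \<open>b0\<close> negative, in accordance with the negative sign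
    of \<open>M n 0\<close>.\<close>
  define K where "K = - S"
  have K: "(\<lambda>x. w (of_real z0 + x)) has_fps_expansion (fps_X * K)"
  proof -
    have "(\<lambda>x. x * - csqrt (k (of_real z0 + x))) has_fps_expansion (fps_X * K)"
      unfolding K_def by (intro fps_expansion_intros S)
    then show ?thesis by (simp add: w_def)
  qed
  have K2: "K ^ 2 = G"
  proof (rule fps_expansion_unique_complex[OF _ G])
    have "(\<lambda>x. csqrt (k (of_real z0 + x)) ^ 2) has_fps_expansion S ^ 2"
        by (intro fps_expansion_intros S)
    then show "(\<lambda>x. k (of_real z0 + x)) has_fps_expansion K ^ 2" by (simp add: K_def)
  qed
  have K0: "fps_nth K 0 = - of_real (sqrt g0)"
    using has_fps_expansion_imp_0_eq_fps_nth_0[OF S] g0 g0_pos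
        by (simp add: K_def csqrt_of_real_nonneg)
  have A10: "fps_nth A1 0 = of_real a0"
    using has_fps_expansion_imp_0_eq_fps_nth_0[OF A1] a0(1) by simp
  define b0 where "b0 = - a0 / sqrt g0"
  \<comment> \<open>\<open>K ^ 2\<close> has constant term \<open>g0\<close>, so passing from
    \<open>1 / K\<close> to its third or fifth power divides the constant term by \<open>g0\<close>
    or \<open>g0^2\<close>.\<close>
  define b2 where "b2 = r2 / g0 * b0"
  define b4 where "b4 = r4 / g0 ^ 2 * b0"
  define b where "b = (\<lambda>i. fps_nth (A1 * inverse K ^ Suc i) i)"
  have iK0: "inverse (fps_nth K 0) = of_real (- 1 / sqrt g0)" using K0 by (simp add: divide_simps)
  have sq: "sqrt g0 * sqrt g0 = g0" using g0_pos by simp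
  have b0: "b 0 = of_real b0" by (simp add: b_def A10 iK0 b0_def)
  have b2: "b 2 = of_real b2"
  proof -
    have "fps_nth (A1 * inverse K ^ 3) 0 = of_real (a0 * (- 1 / sqrt g0) ^ 3)"
      by (simp add: A10 iK0 fps_nth_power_0)
    also have "a0 * (- 1 / sqrt g0) ^ 3 = b0 / g0"
      using g0_pos by (simp add: b0_def power3_eq_cube sq)
    finally show ?thesis using r2[OF K2] by (simp add: b_def b2_def eval_nat_numeral)
  qed
  have b4: "b 4 = of_real b4"
  proof -
    have "fps_nth (A1 * inverse K ^ 5) 0 = of_real (a0 * (- 1 / sqrt g0) ^ 5)"
      by (simp add: A10 iK0 fps_nth_power_0)
    also have "a0 * (- 1 / sqrt g0) ^ 5 = b0 / g0 ^ 2"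
      using g0_pos by (simp add: b0_def eval_nat_numeral sq)
    finally show ?thesis using r4[OF K2] by (simp add: b_def b4_def eval_nat_numeral)
  qed
  obtain C where C: "\<And>n. n \<ge> 5 \<Longrightarrow> norm (J n \<alpha> - M n 0 * (b 0 - b 2 / (2 * of_nat n - 3)
      + 3 * b 4 / ((2 * of_nat n - 3) * (2 * of_nat n - 5)))) \<le> C * norm (M n 0) / real n ^ 3"
    using J_expansion[OF A1 K] unfolding b_def by blast
  define a where "a = (\<lambda>n. of_rat (fps_nth (A * inverse \<Psi> ^ n) (n - 1)) :: real)"
  have \<Psi>0: "fps_nth \<Psi> 0 \<noteq> 0"
    using has_fps_expansion_imp_0_eq_fps_nth_0[OF \<Psi>] \<psi>_nz[OF z0_ball(2)] by auto
  have J_eq: "J n \<alpha> = of_real (t0 ^ n * a n)" if n: "n \<ge> 1" for n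
  proof -
    have "(\<lambda>z. \<alpha> z * inverse (\<psi> z) ^ n) has_fps_expansion fps_map of_rat A
        * inverse (fps_map of_rat \<Psi>) ^ n"
      by (intro fps_expansion_intros A \<Psi>) (simp add: \<Psi>0)
    also have "(\<lambda>z. \<alpha> z * inverse (\<psi> z) ^ n) = (\<lambda>z. \<alpha> z / \<psi> z ^ n)"
      by (simp add: divide_inverse power_inverse)
    also have "fps_map of_rat A * inverse (fps_map of_rat \<Psi>) ^ n
        = (fps_map of_rat (A * inverse \<Psi> ^ n) :: complex fps)"
      unfolding rat.fps_map_mult rat.fps_map_power fps_map_of_rat_inverse[OF \<Psi>0] ..
    finally have "(deriv ^^ (n - 1)) (\<lambda>z. \<alpha> z / \<psi> z ^ n) 0 / fact (n - 1)
        = of_rat (fps_nth (A * inverse \<Psi> ^ n) (n - 1))"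
      by (simp add: fps_nth_fps_expansion[symmetric])
    then show ?thesis using J_eq_coeff[OF holo(2) n] by (simp add: a_def of_real_of_rat)
  qed
  have M_eq: "M n 0 = of_real (- cbin (n - 1) / 2)" if n: "n \<ge> 1" for n
    using M_0[of "n - 1"] n by (simp add: cbin_def)
  have f: "real (n * (n + 1) * (n + 2)) * fps_nth (real_fps F) n = a n" if n: "n \<ge> 1" for n
    unfolding real_fps_def a_def F[OF n, symmetric]
        by (simp only: fps_nth_Abs_fps of_rat_mult of_rat_of_nat_eq)
  have bound: "\<bar>t0 ^ n * a n - (- cbin (n - 1) / 2) * (b0 - b2 / (2 * real n - 3)
      + 3 * b4 / ((2 * real n - 3) * (2 * real n - 5)))\<bar> \<le> C / 2 * cbin (n - 1) / real n ^ 3"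
          if n: "n \<ge> 5" for n
  proof -
    have n1: "n \<ge> 1" using n by simp
    have "J n \<alpha> - M n 0 * (b 0 - b 2 / (2 * of_nat n - 3) + 3 * b 4 / ((2 * of_nat n - 3) * (2
        * of_nat n - 5)))
      = of_real (t0 ^ n * a n - (- cbin (n - 1) / 2) * (b0 - b2 / (2 * real n - 3) + 3 * b4 / ((2
          * real n - 3) * (2 * real n - 5))))"
      unfolding J_eq[OF n1] M_eq[OF n1] b0 b2 b4 by simp
    moreover have "norm (M n 0) = cbin (n - 1) / 2"
      unfolding M_eq[OF n1] norm_of_real using cbin_pos[of "n - 1"] by simp
    ultimately show ?thesis using C[OF n]
        by (simp only: norm_of_real times_divide_eq_right times_divide_eq_left mult_1)
  qed
  have b0_neg: "b0 < 0" using a0(2) g0_pos by (simp add: b0_def)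
  have "- b0 / (2 * sqrt pi) = c" using g0_pos by (simp add: b0_def c_def real_sqrt_mult)
  moreover have "b2 / b0 = r2 / g0" "b4 / b0 = r4 / g0 ^ 2" using b0_neg
      by (simp_all add: b2_def b4_def)
  ultimately show E: "\<exists>E. E \<in> O(\<lambda>n. 1 / real n ^ 3) \<and> (\<forall>n\<ge>1. fps_nth (real_fps F) n
     = c * ((1 / t0) ^ n / real n powr (7 / 2)) * (1 + d1 / real n + d2 / real n ^ 2 + E n))"
    using coefficient_asymptotics[OF t0 b0_neg f bound] by (simp only: d1_def d2_def)
  then obtain E where "E \<in> O(\<lambda>n. 1 / real n ^ 3)" "\<And>n. n \<ge> 1 \<Longrightarrow> fps_nth (real_fps F) n
     = c * ((1 / t0) ^ n / real n powr (7 / 2)) * (1 + d1 / real n + d2 / real n ^ 2 + E n)"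
         by blast
  moreover have "c > 0" using a0(2) g0_pos by (simp add: c_def)
  ultimately show "fps_conv_radius (real_fps F) = ereal t0"
    using conv_radius_from_asymptotics t0 by blast
qed

end

section \<open>Local expansions at a saddle point\<close>

fun deriv_coeffs :: "nat \<Rightarrow> 'a::semiring_1 list \<Rightarrow> 'a list" where
  "deriv_coeffs k [] = []"
| "deriv_coeffs k (x # xs) = of_nat k * x # deriv_coeffs (Suc k) xs"

lemma length_deriv_coeffs [simp]: "length (deriv_coeffs k xs) = length xs"
  by (induction xs arbitrary: k) auto

lemma deriv_coeffs_nth: "i < length xs \<Longrightarrow> deriv_coeffs k xs ! i = of_nat (k + i) * xs ! i"
  by (induction xs arbitrary: k i) (auto simp: nth_Cons algebra_simps split: nat.splits)

text \<open>A linear first-order equation with invertible \<open>U\<close> determines a series up to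
  its constant term, which stays symbolic here. The list \<open>ps\<close> is certified by checking
  the equation on it.\<close>

lemma fps_prefix_ode:
  fixes P U V :: "'a::field_char_0 fps"
  assumes ode: "fps_deriv P * U = V * P"
    and U: "fps_prefix U us" "fps_nth U 0 \<noteq> 0" and V: "fps_prefix V vs"
    and len: "length us = n" "length vs = n" "length ps = n"
    and eq: "conv (deriv_coeffs 1 ps) us = conv vs (butlast (1 # ps))"
  shows "fps_prefix P (map ((*) (fps_nth P 0)) (1 # ps))"
proof -
  define Y where "Y = Abs_fps (\<lambda>i. if i \<le> n then (1 # ps) ! i else 0)"
  have Y: "fps_prefix Y (butlast (1 # ps))" "fps_prefix (fps_deriv Y) (deriv_coeffs 1 ps)"
    using len by (auto simp: fps_prefix_def Y_def nth_butlast deriv_coeffs_nth simp del: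
        butlast.simps)
  define E where "E = P - fps_const (fps_nth P 0) * Y"
  have Yeq: "fps_nth (fps_deriv Y * U) i = fps_nth (V * Y) i" if "i < n" for i
    using fps_prefix_nth[OF fps_prefix_mult[OF Y(2) U(1)],
        of i] fps_prefix_nth[OF fps_prefix_mult[OF V Y(1)], of i] that len
    unfolding eq by (simp add: length_conv del: butlast.simps)
  have 1: "fps_deriv E * U = V * P - fps_const (fps_nth P 0) * (fps_deriv Y * U)"
    unfolding E_def fps_deriv_sub fps_deriv_mult_const_left left_diff_distrib ode mult.assoc ..
  have 2: "V * E = V * P - fps_const (fps_nth P 0) * (V * Y)"
    unfolding E_def right_diff_distrib mult.left_commute[of V] ..
  have E_ode: "fps_nth (fps_deriv E * U) i = fps_nth (V * E) i" if "i < n" for i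
    unfolding 1 2 fps_sub_nth fps_mult_left_const_nth Yeq[OF that] ..
  have E0: "fps_nth E i = 0" if "i \<le> n" for i
    using that
  proof (induction i rule: less_induct)
    case (less i)
    show ?case
    proof (cases i)
      case 0
      then show ?thesis by (simp add: E_def Y_def)
    next
      case (Suc j)
      have "(\<Sum>l=0..j. fps_nth (fps_deriv E) l * fps_nth U (j - l))
          = (\<Sum>l=0..j. fps_nth V l * fps_nth E (j - l))"
        using E_ode[of j] less.prems Suc by (simp add: fps_mult_nth)
      also have "\<dots> = 0" using less Suc by (intro sum.neutral) auto
      also have "(\<Sum>l=0..j. fps_nth (fps_deriv E) l * fps_nth U (j - l))
          = (\<Sum>l\<in>{j}. fps_nth (fps_deriv E) l * fps_nth U (j - l))"
        using less Suc by (intro sum.mono_neutral_right) auto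
      finally show ?thesis using U(2) Suc by (simp del: of_nat_Suc)
    qed
  qed
  show ?thesis
    unfolding fps_prefix_def
  proof (intro allI impI)
    fix i assume "i < length (map ((*) (fps_nth P 0)) (1 # ps))"
    then have i: "i \<le> n" using len by simp
    have "fps_nth P i = fps_nth P 0 * (1 # ps) ! i"
      using E0[OF i] i unfolding E_def by (simp add: Y_def)
    also have "\<dots> = map ((*) (fps_nth P 0)) (1 # ps) ! i"
      by (rule nth_map[symmetric]) (use i len in simp)
    finally show "fps_nth P i = map ((*) (fps_nth P 0)) (1 # ps) ! i" .
  qed
qed

text \<open>The logarithmic derivative of \<open>K^2 = g N / D\<close> is rational, hence powers of
  \<open>1 / K\<close> satisfy a linear equation in which no square root occurs.\<close>

lemma inverse_sqrt_power_ode: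
  fixes K N D :: "'a::field_char_0 fps"
  assumes K2: "K ^ 2 * D = fps_const g * N" and K0: "fps_nth K 0 \<noteq> 0" and g: "g \<noteq> 0"
  shows "fps_deriv (inverse K ^ m) * (2 * N * D)
      = of_nat m * (N * fps_deriv D - fps_deriv N * D) * inverse K ^ m"
proof -
  define I where "I = inverse K"
  have KI: "K * I = 1" using inverse_mult_eq_1[OF K0] by (simp add: I_def mult.commute)
  have dI: "fps_deriv I = - (fps_deriv K * I ^ 2)"
  proof -
    have "fps_deriv (K * I) = 0" unfolding KI by simp
    then have "K * fps_deriv I = - (fps_deriv K * I)" by (simp add: add_eq_0_iff mult.commute)
    then have "(K * I) * fps_deriv I = - (fps_deriv K * I ^ 2)"
        by (simp add: power2_eq_square algebra_simps)
    then show ?thesis unfolding KI by simp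
  qed
  have dK: "fps_deriv K * (2 * N * D) = K * (fps_deriv N * D - N * fps_deriv D)"
  proof -
    have "fps_deriv (K ^ 2 * D) = fps_deriv (fps_const g * N)" by (simp only: K2)
    then have "2 * (K * fps_deriv K * D) + K ^ 2 * fps_deriv D = fps_const g * fps_deriv N"
      by (simp add: power2_eq_square algebra_simps)
    then have 1: "2 * (K * fps_deriv K * D) = fps_const g * fps_deriv N - K ^ 2 * fps_deriv D"
      by (simp add: eq_diff_eq)
    have "fps_const g * (fps_deriv K * (2 * N * D)) = 2 * fps_deriv K * D * (K ^ 2 * D)"
        unfolding K2 by (simp add: mult_ac)
    also have "\<dots> = K * D * (2 * (K * fps_deriv K * D))" by (simp add: power2_eq_square mult_ac)
    also have "\<dots> = K * D * (fps_const g * fps_deriv N) - K * fps_deriv D * (K ^ 2 * D)"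
      unfolding 1 by (simp add: right_diff_distrib mult_ac)
    also have "\<dots> = fps_const g * (K * (fps_deriv N * D - N * fps_deriv D))"
      unfolding K2 by (simp add: right_diff_distrib mult_ac)
    finally show ?thesis using g by simp
  qed
  have aux1: "- a * (b * c * 1 * (x - y)) = a * (y - x) * (c * b)"
    and aux2: "a * (b * - (p * q)) * x = - a * (b * q * (p * x))" for a b c p q x y :: "'a fps"
    by (simp_all add: algebra_simps)
  show ?thesis
  proof (cases m)
    case (Suc k)
    have "fps_deriv (I ^ m) = of_nat m * (I ^ k * fps_deriv I)"
      unfolding Suc fps_deriv_power' diff_Suc_1 mult.assoc by (simp only: mult.commute)
    then have "fps_deriv (I ^ m) * (2 * N * D)
        = of_nat m * (I ^ k * - (fps_deriv K * I ^ 2)) * (2 * N * D)"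
      by (simp only: dI)
    also have "\<dots> = - of_nat m * (I ^ k * I ^ 2 * (fps_deriv K * (2 * N * D)))"
      by (rule aux2)
    also have "\<dots> = - of_nat m * (I ^ k * I * (K * I) * (fps_deriv N * D - N * fps_deriv D))"
      unfolding dK power2_eq_square by (simp only: mult_ac)
    also have "\<dots> = of_nat m * (N * fps_deriv D - fps_deriv N * D) * I ^ m"
      unfolding KI Suc power_Suc by (rule aux1)
    finally show ?thesis by (simp add: I_def)
  qed simp
qed

section \<open>The even potential\<close>

text \<open>
  The saddle point is at \<open>1 - z = c\<^sup>2/2\<close> with \<open>c = 2\<^sup>1\<^sup>/\<^sup>3\<close>. All series are in \<open>X = z - z0\<close>, with
  coefficients reduced modulo \<open>c\<^sup>3 = 2\<close>.
\<close>

lemma cube_root_2_rules: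
  fixes c :: complex
  assumes "c ^ 3 = 2"
  shows "c * (c * c) = 2" "c * (c * (c * x)) = 2 * x"
proof -
  show 1: "c * (c * c) = 2" using assms by (simp add: power3_eq_cube mult.assoc)
  show "c * (c * (c * x)) = 2 * x" unfolding 1[symmetric] by (simp only: mult.assoc)
qed

text \<open>Numerator and, below, denominator of \<open>\<alpha>_even\<close> in terms of
  \<open>U = 1 - z\<close>.\<close>

definition even_num :: "complex \<Rightarrow> complex fps" where
  "even_num c = 2 * (fps_const (c ^ 2 / 2) - fps_X) + 1"

definition even_den :: "complex \<Rightarrow> complex fps" where
  "even_den c = (let U = fps_const (c ^ 2 / 2) - fps_X in (U ^ 2 + U) * (U ^ 2 + U - 1))"

lemma fps_prefix_linear: "fps_prefix (fps_const c - fps_X :: 'a::comm_ring_1 fps) [c, - 1, 0, 0, 0]"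
  by (simp add: fps_prefix_Cons fps_X_def)

lemma fps_prefix_linear4: "fps_prefix (fps_const c - fps_X :: 'a::comm_ring_1 fps) [c, - 1, 0, 0]"
  by (simp add: fps_prefix_Cons fps_X_def)

lemma even_den_prefix:
  assumes c: "c ^ 3 = (2 :: complex)"
  shows "fps_prefix (even_den c) [1 - 1 / 4 * c ^ 2, - 1 - 3 * c, 3 * c + 3 * c ^ 2, - 2 - 2
      * c ^ 2, 1]"
proof -
  note pre = fps_prefix_linear fps_prefix_mult fps_prefix_add fps_prefix_diff fps_prefix_power2
      fps_prefix_X[of 3] fps_prefix_1[of 4] fps_prefix_numeral[where k = 4]
  show ?thesis
    unfolding even_den_def Let_def
  proof (rule fps_prefix_eqI, (rule pre)+)
  qed (simp add: numeral_eq_Suc field_simps cube_root_2_rules[OF c])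
qed

lemma even_den_nz:
  assumes c: "c ^ 3 = (2 :: complex)"
  shows "fps_nth (even_den c) 0 \<noteq> 0"
proof
  assume "fps_nth (even_den c) 0 = 0"
  then have "c * c = 4" using fps_prefix_nth[OF even_den_prefix[OF c], of 0]
      by (simp add: power2_eq_square)
  then have "2 * c = 1" using cube_root_2_rules(1)[OF c] by simp
  then have "(2 * c) * (2 * c) = 1" by (simp only: mult_1)
  then show False using \<open>c * c = 4\<close> by simp
qed

lemma even_amplitude_prefix:
  assumes c: "c ^ 3 = (2 :: complex)"
  shows "fps_prefix (even_num c * inverse (even_den c)) [4 / 3 + 2 / 3 * c + 4 / 3 * c ^ 2, 56 / 5
      + 116 / 15 * c + 92 / 15 * c ^ 2, 904 / 15 + 728 / 15 * c + 192 / 5 * c ^ 2, 78896 / 225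
      + 62032 / 225 * c + 49544 / 225 * c ^ 2, 89696 / 45 + 71192 / 45 * c + 18788 / 15 * c ^ 2]"
proof (rule fps_prefix_quotient)
  note pre = fps_prefix_linear fps_prefix_mult fps_prefix_add fps_prefix_diff fps_prefix_power2
      fps_prefix_X[of 3] fps_prefix_1[of 4] fps_prefix_numeral[where k = 4]
  show "fps_prefix (even_den c) [1 - 1 / 4 * c ^ 2, - 1 - 3 * c, 3 * c + 3 * c ^ 2, - 2 - 2
      * c ^ 2, 1]" by (rule even_den_prefix[OF c])
  show "fps_prefix (even_num c) (conv [1 - 1 / 4 * c ^ 2, - 1 - 3 * c, 3 * c + 3 * c ^ 2, - 2 - 2
      * c ^ 2, 1] [4 / 3 + 2 / 3 * c + 4 / 3 * c ^ 2, 56 / 5 + 116 / 15 * c + 92 / 15 * c ^ 2, 904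
      / 15 + 728 / 15 * c + 192 / 5 * c ^ 2, 78896 / 225 + 62032 / 225 * c + 49544 / 225
      * c ^ 2, 89696 / 45 + 71192 / 45 * c + 18788 / 15 * c ^ 2])"
    unfolding even_num_def
  proof (rule fps_prefix_eqI, (rule pre)+)
  qed (simp add: numeral_eq_Suc field_simps cube_root_2_rules[OF c])
  show nz: "fps_nth (even_den c) 0 \<noteq> 0" by (rule even_den_nz[OF c])
  have "even_den c * (even_num c * inverse (even_den c))
      = even_num c * (inverse (even_den c) * even_den c)"
    by (simp only: mult_ac)
  then show "even_den c * (even_num c * inverse (even_den c)) = even_num c"
    by (simp only: inverse_mult_eq_1[OF nz] mult_1_right)
qed simp

text \<open>\<open>K ^ 2\<close> is the local series of \<open>k_even\<close>, with its scalar
  factor called \<open>g\<close>. The square root survives only in the constant terms of the powers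
  of \<open>1 / K\<close>, which are factored out.\<close>

lemma even_saddle_prefix:
  fixes K :: "complex fps"
  assumes c: "c ^ 3 = 2" and K: "K ^ 2 * (fps_const (c ^ 2 / 2) - fps_X)
      = fps_const g * (fps_const (3 * c ^ 2 / 2) - fps_X)"
    and g: "g \<noteq> 0" and K0: "fps_nth K 0 \<noteq> 0"
  shows "fps_prefix (inverse K ^ 3) (map ((*) (fps_nth (inverse K ^ 3) 0)) [1, - c, - 1 / 6
      * c ^ 2, 1 / 27, 1 / 12 * c])"
    and "fps_prefix (inverse K ^ 5) (map ((*) (fps_nth (inverse K ^ 5) 0)) [1, - 5 / 3 * c, 5 / 18
        * c ^ 2, 5 / 9, 25 / 108 * c])"
proof -
  define N D :: "complex fps" where "N = fps_const (3 * c ^ 2 / 2) - fps_X" and "D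
      = fps_const (c ^ 2 / 2) - fps_X"
  have c0: "c \<noteq> 0" using c by auto
  have U0: "fps_nth (2 * N * D) 0 \<noteq> 0" using c0 by (simp add: N_def D_def)
  have ode: "fps_deriv (inverse K ^ numeral m) * (2 * N * D)
      = (numeral m * (D - N)) * inverse K ^ numeral m" for m
    using inverse_sqrt_power_ode[OF K K0 g, of "numeral m"] by (simp add: N_def D_def)
  note pre = fps_prefix_linear4 fps_prefix_mult fps_prefix_add fps_prefix_diff
      fps_prefix_numeral[where k = 3]
  have U: "fps_prefix (2 * N * D) [3 * c, - 4 * c ^ 2, 2, 0]"
    unfolding N_def D_def
  proof (rule fps_prefix_eqI, (rule pre)+)
  qed (simp add: numeral_eq_Suc field_simps cube_root_2_rules[OF c])
  have V: "fps_prefix (numeral m * (D - N)) [- numeral m * c ^ 2, 0, 0, 0]" for m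
    unfolding N_def D_def
  proof (rule fps_prefix_eqI, (rule pre)+)
  qed (simp add: numeral_eq_Suc field_simps)
  show "fps_prefix (inverse K ^ 3) (map ((*) (fps_nth (inverse K ^ 3) 0)) [1, - c, - 1 / 6
      * c ^ 2, 1 / 27, 1 / 12 * c])"
    by (rule fps_prefix_ode[OF ode U U0 V]) (simp_all add: power2_eq_square field_simps
        cube_root_2_rules[OF c])
  show "fps_prefix (inverse K ^ 5) (map ((*) (fps_nth (inverse K ^ 5) 0)) [1, - 5 / 3 * c, 5 / 18
      * c ^ 2, 5 / 9, 25 / 108 * c])"
    by (rule fps_prefix_ode[OF ode U U0 V]) (simp_all add: power2_eq_square field_simps
        cube_root_2_rules[OF c])
qed

lemma even_amplitude_0:
  "c ^ 3 = 2 \<Longrightarrow> fps_nth (even_num c * inverse (even_den c)) 0 = 4 / 3 + 2 / 3 * c + 4 / 3 * c ^ 2"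
  using fps_prefix_nth[OF even_amplitude_prefix, of c 0] by simp

lemma even_ratios:
  fixes K :: "complex fps"
  assumes c: "c ^ 3 = 2" and K: "K ^ 2 * (fps_const (c ^ 2 / 2) - fps_X)
      = fps_const g * (fps_const (3 * c ^ 2 / 2) - fps_X)"
    and g: "g \<noteq> 0" and K0: "fps_nth K 0 \<noteq> 0"
  defines "A \<equiv> even_num c * inverse (even_den c)"
  shows "fps_nth (A * inverse K ^ 3) 2
      = (12 + 26 / 3 * c + 13 / 2 * c ^ 2) * fps_nth (A * inverse K ^ 3) 0"
    and "fps_nth (A * inverse K ^ 5) 4 = (2714 / 9 + 8635 / 36 * c + 5090 / 27 * c ^ 2) * fps_nth (A
        * inverse K ^ 5) 0"
proof -
  note A = even_amplitude_prefix[OF c, folded A_def]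
  note P = even_saddle_prefix[OF c K g K0]
  show "fps_nth (A * inverse K ^ 3) 2 = (12 + 26 / 3 * c + 13 / 2 * c ^ 2) * fps_nth (A
      * inverse K ^ 3) 0"
  proof -
    define Q where "Q = A * inverse K ^ 3"
    define p where "p = fps_nth (inverse K ^ 3) 0"
    note Q = fps_prefix_mult[OF A P(1), folded Q_def p_def]
    have "fps_nth Q 0 = (4 / 3 + 2 / 3 * c + 4 / 3 * c ^ 2) * p" using fps_prefix_nth[OF Q, of 0]
        by (simp add: mult.commute)
    moreover have "fps_nth Q 2 = (12 + 26 / 3 * c + 13 / 2 * c ^ 2) * ((4 / 3 + 2 / 3 * c + 4 / 3
        * c ^ 2) * p)"
      by (subst fps_prefix_nth[OF Q]) (simp_all add: power2_eq_square field_simps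
          cube_root_2_rules[OF c])
    ultimately show ?thesis unfolding Q_def[symmetric] by (simp only:)
  qed
  show "fps_nth (A * inverse K ^ 5) 4 = (2714 / 9 + 8635 / 36 * c + 5090 / 27 * c ^ 2) * fps_nth (A
      * inverse K ^ 5) 0"
  proof -
    define Q where "Q = A * inverse K ^ 5"
    define p where "p = fps_nth (inverse K ^ 5) 0"
    note Q = fps_prefix_mult[OF A P(2), folded Q_def p_def]
    have "fps_nth Q 0 = (4 / 3 + 2 / 3 * c + 4 / 3 * c ^ 2) * p" using fps_prefix_nth[OF Q, of 0]
        by (simp add: mult.commute)
    moreover have "fps_nth Q 4 = (2714 / 9 + 8635 / 36 * c + 5090 / 27 * c ^ 2) * ((4 / 3 + 2 / 3
        * c + 4 / 3 * c ^ 2) * p)"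
      by (subst fps_prefix_nth[OF Q]) (simp_all add: power2_eq_square field_simps
          cube_root_2_rules[OF c])
    ultimately show ?thesis unfolding Q_def[symmetric] by (simp only:)
  qed
qed

lemma has_fps_expansion_quotient:
  fixes f g :: "complex \<Rightarrow> complex" and F G H :: "complex fps"
  assumes "f has_fps_expansion F" "g has_fps_expansion G" "fps_nth G 0 \<noteq> 0" "G * H = F"
  shows "(\<lambda>z. f z / g z) has_fps_expansion H"
proof -
  have "H = F * inverse G"
    using inverse_mult_eq_1[OF assms(3)] assms(4) by (metis mult.assoc mult.commute mult_1)
  then show ?thesis
    unfolding divide_inverse using assms by (auto intro!: fps_expansion_intros)
qed

section \<open>The saddle point of the even potential\<close>

definition \<theta> :: real where "\<theta> = root 3 2"

lemma \<theta>_cube: "\<theta> ^ 3 = 2" by (simp add: \<theta>_def)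

lemma \<theta>_cube': "\<theta> * (\<theta> * \<theta>) = 2" "\<theta> * (\<theta> * (\<theta> * x)) = 2 * x"
proof -
  show 1: "\<theta> * (\<theta> * \<theta>) = 2" using \<theta>_cube by (simp add: power3_eq_cube mult.assoc)
  show "\<theta> * (\<theta> * (\<theta> * x)) = 2 * x" unfolding 1[symmetric] by (simp only: mult.assoc)
qed

lemma \<theta>_bounds: "1.259 < \<theta>" "\<theta> < 1.26"
proof -
  have "\<theta> \<ge> 0" by (simp add: \<theta>_def)
  have a: "1.259 ^ 3 < \<theta> ^ 3" "\<theta> ^ 3 < 1.26 ^ 3" unfolding \<theta>_cube by (simp_all add: power3_eq_cube)
  show "1.259 < \<theta>" by (rule power_less_imp_less_base[OF a(1) \<open>\<theta> \<ge> 0\<close>])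
  show "\<theta> < 1.26" by (rule power_less_imp_less_base[OF a(2)]) simp
qed

definition t0_even :: real where "t0_even = (4 - 3 * \<theta>) / 4"
text \<open>In \<open>u = 1 - z\<close> the function \<open>z \<psi>_even(z)\<close> is
  \<open>1 - 1 / (2 u) - u^2 / 2\<close>. It is critical where \<open>u^3 = 1 / 2\<close>, and its
  value there is \<open>t0_even\<close>.\<close>

definition u_even :: real where "u_even = \<theta> ^ 2 / 2"

lemma u_even_bounds: "0.79 < u_even" "u_even < 0.8"
  using mult_strict_mono[OF \<theta>_bounds(1) \<theta>_bounds(1)] mult_strict_mono[OF \<theta>_bounds(2) \<theta>_bounds(2)]
      \<theta>_bounds
  by (simp_all add: u_even_def power2_eq_square)

lemma u_even_cube: "u_even ^ 3 = 1 / 2"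
  by (simp add: u_even_def eval_nat_numeral \<theta>_cube')

lemma t0_even_eq: "2 * t0_even = 2 - 3 * u_even ^ 2"
  by (simp add: u_even_def t0_even_def eval_nat_numeral \<theta>_cube')

lemma t0_even_pos: "t0_even > 0" using \<theta>_bounds by (simp add: t0_even_def)

definition \<psi>_even :: "complex \<Rightarrow> complex" where "\<psi>_even z = (1 - 3 * z + z ^ 2) / (2 * (1 - z))"
definition \<alpha>_even :: "complex \<Rightarrow> complex" where "\<alpha>_even z
    = (3 - 2 * z) / ((1 - z) * (2 - z) * (1 - 3 * z + z ^ 2))"
text \<open>With \<open>U = 1 - z\<close> and \<open>u = u_even\<close>, the relation
  \<open>u^3 = 1 / 2\<close> gives \<open>2 U (t0_even - z \<psi>_even(z)) = U^3 - 3 u^2 U + 1 = (U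
  - u)^2 (U + 2 u)\<close>; the double zero is removed.\<close>

definition k_even :: "complex \<Rightarrow> complex" where
  "k_even z = (1 - z + 2 * of_real u_even) / (2 * of_real t0_even * (1 - z))"

lemma even_nonzero:
  assumes "norm (z :: complex) < 1 / 4"
  shows "1 - z \<noteq> 0" "2 - z \<noteq> 0" "1 - 3 * z + z ^ 2 \<noteq> 0" "Re (1 - z) > 0"
proof -
  have "\<bar>Re z\<bar> < 1 / 4" using assms abs_Re_le_cmod[of z] by linarith
  then show "Re (1 - z) > 0" by simp
  from \<open>\<bar>Re z\<bar> < 1 / 4\<close> show "1 - z \<noteq> 0" "2 - z \<noteq> 0" by (auto simp: complex_eq_iff)
  show "1 - 3 * z + z ^ 2 \<noteq> 0"
  proof
    assume "1 - 3 * z + z ^ 2 = 0"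
    then have "1 = z * (3 - z)" by (simp add: algebra_simps power2_eq_square)
    then have "1 = norm z * norm (3 - z)" by (metis norm_mult norm_one)
    also have "\<dots> \<le> (1 / 4) * (3 + 1 / 4)"
      using assms norm_triangle_ineq4[of 3 z] by (intro mult_mono) auto
    finally show False by simp
  qed
qed

text \<open>On the circle all squared moduli are polynomials in \<open>s = z0 - x\<close>, which
  ranges over \<open>[0, 2 z0]\<close>. Both sides agree at \<open>s = 0\<close>, and coarse bounds
  suffice for what multiplies \<open>s\<close>.\<close>

lemma even_circle:
  fixes x y z0 u :: real
  assumes xy: "x ^ 2 + y ^ 2 = z0 ^ 2" and z0: "z0 = 1 - u" and u: "0.79 < u" "u < 0.8"
  shows "(1 - 3 * z0 + z0 ^ 2) ^ 2 * ((1 - x) ^ 2 + y ^ 2) * (1 + ((x - z0) ^ 2 + y ^ 2))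
    \<le> u ^ 2 * ((1 - 3 * x + x ^ 2 - y ^ 2) ^ 2 + (2 * x * y - 3 * y) ^ 2)"
proof -
  define s where "s = z0 - x"
  have "\<bar>x\<bar> \<le> \<bar>z0\<bar>" using xy by (metis abs_le_square_iff le_add_same_cancel1 zero_le_power2)
  then have s: "0 \<le> s" "s \<le> 2 * z0" using z0 u by (auto simp: s_def)
  have y2: "y ^ 2 = z0 ^ 2 - x ^ 2" using xy by simp
  have 1: "(1 - x) ^ 2 + y ^ 2 = u ^ 2 + 2 * s"
    unfolding y2 s_def z0 by (simp add: power2_eq_square algebra_simps)
  have 2: "(x - z0) ^ 2 + y ^ 2 = 2 * z0 * s"
    unfolding y2 s_def by (simp add: power2_eq_square algebra_simps)
  define P where "P = 1 - 3 * z0 + z0 ^ 2"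
  have 3: "(1 - 3 * x + x ^ 2 - y ^ 2) ^ 2 + (2 * x * y - 3 * y) ^ 2
      = P ^ 2 + s * (6 * z0 ^ 2 + 6 - 4 * (x + z0))"
  proof -
    have "(2 * x * y - 3 * y) ^ 2 = (2 * x - 3) ^ 2 * y ^ 2"
        by (simp add: power2_eq_square algebra_simps)
    then show ?thesis unfolding y2 P_def s_def by (simp add: power2_eq_square algebra_simps)
  qed
  have z0b: "1 / 5 < z0" "z0 < 21 / 100" using z0 u by auto
  have P: "0 \<le> P" "P \<le> 0.45"
  proof -
    have "z0 ^ 2 \<le> (21 / 100) ^ 2" using z0b by (intro power_mono) auto
    then show "0 \<le> P" "P \<le> 0.45" using z0b zero_le_power2[of z0]
        by (auto simp: P_def power2_eq_square)
  qed
  have u2: "0.62 \<le> u ^ 2" "u ^ 2 \<le> 0.64"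
    using power_mono[of "0.79" u 2] power_mono[of u "0.8" 2] u by (auto simp: power2_eq_square)
  have "P ^ 2 * (u ^ 2 + 2 * s) * (1 + 2 * z0 * s)
      = P ^ 2 * u ^ 2 + s * (P ^ 2 * (2 + 2 * z0 * (u ^ 2 + 2 * s)))"
    by (simp add: power2_eq_square algebra_simps)
  also have "\<dots> \<le> P ^ 2 * u ^ 2 + s * (u ^ 2 * 4)"
  proof -
    have "P ^ 2 * (2 + 2 * z0 * (u ^ 2 + 2 * s))
        \<le> 0.45 ^ 2 * (2 + 2 * 0.21 * (0.64 + 2 * (2 * 0.21)))"
      using P z0b s u2 by (intro mult_mono add_mono power_mono mult_nonneg_nonneg add_nonneg_nonneg)
          auto
    also have "\<dots> \<le> u ^ 2 * 4" using u2 by (simp add: power2_eq_square)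
    finally show ?thesis using s by (simp add: mult_left_mono)
  qed
  also have "\<dots> \<le> u ^ 2 * (P ^ 2 + s * (6 * z0 ^ 2 + 6 - 4 * (x + z0)))"
  proof -
    have "x \<le> z0" using s by (simp add: s_def)
    moreover have "0 \<le> 6 * z0 ^ 2" by simp
    ultimately have "4 \<le> 6 * z0 ^ 2 + 6 - 4 * (x + z0)" using z0b(2) by argo
    then have "s * (u ^ 2 * 4) \<le> s * (u ^ 2 * (6 * z0 ^ 2 + 6 - 4 * (x + z0)))"
      using s by (intro mult_left_mono) auto
    then show ?thesis by (simp add: algebra_simps)
  qed
  finally show ?thesis unfolding 1 2 3 P_def[symmetric] .
qed

text \<open>\<open>k_even\<close> is a positive combination of 1 and \<open>1 / (1 - z)\<close>, and
  inversion preserves the right half plane.\<close>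

lemma Re_k_even:
  assumes "norm (z :: complex) < 1 / 4"
  shows "Re (k_even z) > 0"
proof -
  note nz = even_nonzero[OF assms]
  have "k_even z = of_real (1 / (2 * t0_even)) * (1 + of_real (2 * u_even) * inverse (1 - z))"
    using nz(1) t0_even_pos by (simp add: k_even_def field_simps)
  then have "Re (k_even z) = 1 / (2 * t0_even) * (1 + 2 * u_even * Re (inverse (1 - z)))"
    by simp
  also have "Re (inverse (1 - z)) > 0"
    using nz(1,4) by (auto simp: complex_eq_iff intro!: divide_pos_pos sum_power2_gt_zero_iff[THEN
        iffD2])
  then have "1 / (2 * t0_even) * (1 + 2 * u_even * Re (inverse (1 - z))) > 0"
    using t0_even_pos u_even_bounds by (intro mult_pos_pos add_pos_pos divide_pos_pos) auto
  finally show ?thesis .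
qed

interpretation even_saddle: sqrt_saddle "1 / 4" t0_even "1 - u_even" 1 \<psi>_even \<alpha>_even k_even
proof
  show "0 < 1 - u_even" "1 - u_even < 1 / 4" using u_even_bounds by auto
  show "\<psi>_even holomorphic_on ball 0 (1 / 4)" "\<alpha>_even holomorphic_on ball 0 (1
      / 4)" "k_even holomorphic_on ball 0 (1 / 4)"
    unfolding \<psi>_even_def \<alpha>_even_def k_even_def using even_nonzero t0_even_pos
    by (auto intro!: holomorphic_intros)
  fix z :: complex
  {
    assume "z \<in> ball 0 (1 / 4)"
    then have z: "norm z < 1 / 4" by simp
    note nz = even_nonzero[OF z]
    show "\<psi>_even z \<noteq> 0" using nz by (simp add: \<psi>_even_def)
    show "Re (k_even z) > 0" by (rule Re_k_even[OF z])
    define u :: complex where "u = of_real u_even"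
    have "u ^ 3 = 1 / 2" unfolding u_def by (simp flip: of_real_power add: u_even_cube)
    then have u3: "u * (u * u) = 1 / 2" by (simp add: power3_eq_cube mult.assoc)
    have u3': "u * (u * (u * x)) = x / 2" for x using arg_cong[OF u3, of "\<lambda>y. y * x"]
        by (simp add: mult.assoc)
    have t0: "2 * of_real t0_even = 2 - 3 * u ^ 2" unfolding u_def
        using arg_cong[OF t0_even_eq, of complex_of_real] by simp
    have "2 * (1 - z) * (of_real t0_even * (1 - (of_real (1 - u_even) - z) ^ 2 * k_even z))
      = 2 * of_real t0_even * (1 - z) - (1 - u - z) ^ 2 * (1 - z + 2 * u)"
      using nz(1) t0_even_pos by (simp add: k_even_def u_def field_simps)
    also have "\<dots> = z * (1 - 3 * z + z ^ 2)"
      unfolding t0 by (simp add: power2_eq_square algebra_simps u3 u3')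
    also have "\<dots> = 2 * (1 - z) * (z * \<psi>_even z)" using nz(1) by (simp add: \<psi>_even_def)
    finally show "z * \<psi>_even z = of_real t0_even * (1 - (of_real (1 - u_even) - z) ^ 2 * k_even z)"
      using nz(1) by simp
  }
  show "k_even 0 = of_real (1 / (1 - u_even) ^ 2)"
  proof -
    have "(1 + 2 * u_even) * (1 - u_even) ^ 2 = 2 * t0_even"
      unfolding t0_even_eq using u_even_cube
          by (simp add: power2_eq_square power3_eq_cube algebra_simps)
    then have "(1 + 2 * u_even) / (2 * t0_even) = 1 / (1 - u_even) ^ 2"
      using u_even_bounds t0_even_pos by (simp add: field_simps)
    then have "complex_of_real ((1 + 2 * u_even) / (2 * t0_even)) = of_real (1 / (1 - u_even) ^ 2)"
        by (rule arg_cong)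
    then show ?thesis by (simp add: k_even_def)
  qed
  assume z: "norm z = 1 - u_even"
  show "t0_even ^ 2 * (1 + 1 * norm (z - of_real (1 - u_even)) ^ 2) \<le> norm (z * \<psi>_even z) ^ 2"
  proof -
    have zl: "norm z < 1 / 4" using z u_even_bounds by simp
    define x y where "x = Re z" and "y = Im z"
    define z0 where "z0 = 1 - u_even"
    have xy: "x ^ 2 + y ^ 2 = z0 ^ 2" using z cmod_power2[of z] by (simp add: x_def y_def z0_def)
    have n1: "norm (1 - z) ^ 2 = (1 - x) ^ 2 + y ^ 2" by (simp add: cmod_power2 x_def y_def)
    have n2: "norm (1 - 3 * z + z ^ 2) ^ 2
        = (1 - 3 * x + x ^ 2 - y ^ 2) ^ 2 + (2 * x * y - 3 * y) ^ 2"
      unfolding cmod_power2 x_def y_def by (simp add: power2_eq_square algebra_simps)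
    have n3: "norm (z - of_real z0) ^ 2 = (x - z0) ^ 2 + y ^ 2"
        by (simp add: cmod_power2 x_def y_def)
    have pos: "norm (1 - z) ^ 2 > 0" using even_nonzero(1)[OF zl] by simp
    have t0: "2 * u_even * t0_even = z0 * (1 - 3 * z0 + z0 ^ 2)"
    proof -
      have "2 * u_even * t0_even = u_even * (2 * t0_even)" by simp
      then show ?thesis
        unfolding t0_even_eq z0_def using u_even_cube
            by (simp add: power2_eq_square power3_eq_cube algebra_simps)
    qed
    have "(2 * u_even * t0_even) ^ 2 * (1 + norm (z - of_real z0) ^ 2) * norm (1 - z) ^ 2
        \<le> z0 ^ 2 * (u_even ^ 2 * norm (1 - 3 * z + z ^ 2) ^ 2)"
      using mult_left_mono[OF even_circle[OF xy z0_def u_even_bounds], of "z0 ^ 2"]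
      unfolding t0 n1 n2 n3 by (simp add: power_mult_distrib mult_ac)
    then have "u_even ^ 2 * (t0_even ^ 2 * (1 + norm (z - of_real z0) ^ 2) * (4 * norm (1 - z) ^ 2))
        \<le> u_even ^ 2 * (z0 ^ 2 * norm (1 - 3 * z + z ^ 2) ^ 2)"
      by (simp add: power_mult_distrib mult_ac)
    then have "t0_even ^ 2 * (1 + norm (z - of_real z0) ^ 2) * (4 * norm (1 - z) ^ 2)
        \<le> z0 ^ 2 * norm (1 - 3 * z + z ^ 2) ^ 2"
      by (rule mult_left_le_imp_le) (use u_even_bounds in simp)
    then have "t0_even ^ 2 * (1 + norm (z - of_real z0) ^ 2)
        \<le> z0 ^ 2 * norm (1 - 3 * z + z ^ 2) ^ 2 / (4 * norm (1 - z) ^ 2)"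
      using pos by (simp add: pos_le_divide_eq)
    also have "\<dots> = norm (z * \<psi>_even z) ^ 2"
    proof -
      have "norm (2 * (1 - z)) = 2 * norm (1 - z)" by (simp only: norm_mult norm_numeral)
      then show ?thesis
        unfolding \<psi>_even_def norm_mult[of z] norm_divide
            by (simp only: power_mult_distrib power_divide z z0_def) simp
    qed
    finally show ?thesis by (simp add: z0_def)
  qed
qed (simp_all add: t0_even_pos)

lemma fps_map_\<Psi>_even: "fps_map of_rat (\<Psi>_even :: rat fps) = (\<Psi>_even :: complex fps)"
proof -
  interpret rat: ring_map "of_rat :: rat \<Rightarrow> complex"
      by standard (simp_all add: of_rat_add of_rat_mult)
  have "fps_nth (2 * (1 - fps_X) :: rat fps) 0 \<noteq> 0" by (simp add: numeral_fps_const)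
  note e = fps_map_of_rat_inverse[OF this, where 'a = complex]
  show ?thesis unfolding \<Psi>_even_def rat.fps_map_mult e unfolding rat.fps_map_simps ..
qed

lemma \<psi>_even_expansion: "\<psi>_even has_fps_expansion fps_map of_rat (\<Psi>_even :: rat fps)"
  unfolding fps_map_\<Psi>_even \<psi>_even_def
proof (rule has_fps_expansion_quotient)
  show "(\<lambda>z. 1 - 3 * z + z ^ 2) has_fps_expansion (1 - 3 * fps_X + fps_X ^ 2 :: complex fps)"
    "(\<lambda>z. 2 * (1 - z)) has_fps_expansion (2 * (1 - fps_X) :: complex fps)"
    by (intro fps_expansion_intros)+
  show nz: "fps_nth (2 * (1 - fps_X) :: complex fps) 0 \<noteq> 0" by (simp add: numeral_fps_const)
  show "2 * (1 - fps_X) * \<Psi>_even = (1 - 3 * fps_X + fps_X ^ 2 :: complex fps)"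
    unfolding \<Psi>_even_def mult.left_commute[of "2 * (1 - fps_X)"] mult.commute[of "2 * (1
        - fps_X)" "inverse _"] inverse_mult_eq_1[OF nz] by simp
qed

lemma \<alpha>_even_expansion: "\<alpha>_even has_fps_expansion fps_map of_rat (fps_deriv \<rho>_even
    * inverse \<rho>_even :: rat fps)"
  unfolding \<alpha>_even_def
proof (rule has_fps_expansion_quotient)
  interpret rat: ring_map "of_rat :: rat \<Rightarrow> complex"
      by standard (simp_all add: of_rat_add of_rat_mult)
  show "(\<lambda>z. 3 - 2 * z) has_fps_expansion (3 - 2 * fps_X :: complex fps)"
    "(\<lambda>z. (1 - z) * (2 - z) * (1 - 3 * z + z ^ 2)) has_fps_expansion
      ((1 - fps_X) * (2 - fps_X) * (1 - 3 * fps_X + fps_X ^ 2) :: complex fps)"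
    by (intro fps_expansion_intros)+
  show "fps_nth ((1 - fps_X) * (2 - fps_X) * (1 - 3 * fps_X + fps_X ^ 2) :: complex fps) 0 \<noteq> 0"
    by (simp add: numeral_fps_const)
  show "(1 - fps_X) * (2 - fps_X) * (1 - 3 * fps_X + fps_X ^ 2) * fps_map of_rat (fps_deriv \<rho>_even
      * inverse \<rho>_even :: rat fps)
      = (3 - 2 * fps_X :: complex fps)"
    using arg_cong[OF logderiv_even_eq, of "fps_map of_rat :: rat fps \<Rightarrow> complex fps"]
    by (simp only: rat.fps_map_simps)
qed

theorem even_asymptotics:
  "\<exists>E. E \<in> O(\<lambda>n. 1 / real n ^ 3) \<and> (\<forall>n\<ge>1. fps_nth (real_fps planar_even) n =
     1 / 3 * sqrt ((2 * \<theta> - 1) / pi) * ((1 / t0_even) ^ n / real n powr (7 / 2))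
     * (1 + (- (243 - 8 * \<theta>) / 72) / real n + ((91881 - 2640 * \<theta> - 5696 * \<theta> ^ 2) / 10368)
         / real n ^ 2 + E n))"
  "fps_conv_radius (real_fps planar_even) = ereal t0_even"
proof -
  define c where "c = complex_of_real \<theta>"
  have c: "c ^ 3 = 2" unfolding c_def by (simp flip: of_real_power add: \<theta>_cube)
  define g where "g = complex_of_real (1 / (2 * t0_even))"
  have g: "g \<noteq> 0" using t0_even_pos by (simp add: g_def)
  define N D :: "complex fps" where "N = fps_const (3 * c ^ 2 / 2) - fps_X" and "D
      = fps_const (c ^ 2 / 2) - fps_X"
  define G where "G = fps_const g * N * inverse D"
  have c0: "c \<noteq> 0" using c by auto
  have D0: "fps_nth D 0 \<noteq> 0" using c0 by (simp add: D_def)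
  have cu: "complex_of_real u_even = c ^ 2 / 2" by (simp add: c_def u_even_def)
  have K: "K ^ 2 * D = fps_const g * N" "fps_nth K 0 \<noteq> 0" if "K ^ 2 = G" for K
  proof -
    show "K ^ 2 * D = fps_const g * N"
      unfolding that G_def mult.assoc inverse_mult_eq_1[OF D0] by simp
    show "fps_nth K 0 \<noteq> 0"
    proof
      assume "fps_nth K 0 = 0"
      then have "fps_nth (K ^ 2) 0 = 0" by (simp add: power2_eq_square)
      then show False unfolding that G_def N_def using c0 g D0 by simp
    qed
  qed
  define A1 where "A1 = even_num c * inverse (even_den c)"
  have A1: "(\<lambda>x. \<alpha>_even (of_real (1 - u_even) + x)) has_fps_expansion A1"
  proof -
    have e: "(\<lambda>x. \<alpha>_even (of_real (1 - u_even) + x)) =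
      (\<lambda>x. (2 * (c ^ 2 / 2 - x) + 1) / (((c ^ 2 / 2 - x) ^ 2 + (c ^ 2 / 2 - x)) * ((c ^ 2 / 2
          - x) ^ 2 + (c ^ 2 / 2 - x) - 1)))"
    proof (rule ext)
      fix x
      define u where "u = c ^ 2 / 2 - x"
      have z: "of_real (1 - u_even) + x = 1 - u" by (simp add: cu u_def)
      have "3 - 2 * (1 - u) = 2 * u + 1" "(1 - (1 - u)) * (2 - (1 - u)) * (1 - 3 * (1 - u) + (1
          - u) ^ 2) = (u ^ 2 + u) * (u ^ 2 + u - 1)"
        by (simp_all add: power2_eq_square algebra_simps)
      then show "\<alpha>_even (of_real (1 - u_even) + x)
          = (2 * (c ^ 2 / 2 - x) + 1) / (((c ^ 2 / 2 - x) ^ 2 + (c ^ 2 / 2 - x)) * ((c ^ 2 / 2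
          - x) ^ 2 + (c ^ 2 / 2 - x) - 1))"
        unfolding z u_def[symmetric] \<alpha>_even_def by (simp only:)
    qed
    show ?thesis unfolding e
    proof (rule has_fps_expansion_quotient)
      show "(\<lambda>x. 2 * (c ^ 2 / 2 - x) + 1) has_fps_expansion even_num c"
        unfolding even_num_def by (intro fps_expansion_intros)
      show "(\<lambda>x. ((c ^ 2 / 2 - x) ^ 2 + (c ^ 2 / 2 - x)) * ((c ^ 2 / 2 - x) ^ 2 + (c ^ 2 / 2 - x)
          - 1)) has_fps_expansion even_den c"
        unfolding even_den_def Let_def by (intro fps_expansion_intros)
      show nz: "fps_nth (even_den c) 0 \<noteq> 0" by (rule even_den_nz[OF c])
      show "even_den c * A1 = even_num c"
      proof -
        have "even_den c * A1 = even_num c * (inverse (even_den c) * even_den c)"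
            by (simp only: A1_def mult_ac)
        then show ?thesis by (simp only: inverse_mult_eq_1[OF nz] mult_1_right)
      qed
    qed
  qed
  have G: "(\<lambda>x. k_even (of_real (1 - u_even) + x)) has_fps_expansion G"
  proof -
    have e: "(\<lambda>x. k_even (of_real (1 - u_even) + x))
        = (\<lambda>x. (g * (3 * c ^ 2 / 2 - x)) / (c ^ 2 / 2 - x))"
      by (simp add: fun_eq_iff k_even_def g_def cu)
    show ?thesis unfolding e
    proof (rule has_fps_expansion_quotient)
      show "(\<lambda>x. g * (3 * c ^ 2 / 2 - x)) has_fps_expansion fps_const g * N"
        "(\<lambda>x. c ^ 2 / 2 - x) has_fps_expansion D"
        unfolding N_def D_def by (intro fps_expansion_intros)+
      have "D * G = fps_const g * N * (inverse D * D)" by (simp only: G_def mult_ac)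
      then show "D * G = fps_const g * N" by (simp only: inverse_mult_eq_1[OF D0] mult_1_right)
    qed (rule D0)
  qed
  define a0 where "a0 = 4 / 3 + 2 / 3 * \<theta> + 4 / 3 * \<theta> ^ 2"
  \<comment> \<open>This is \<open>3 / (2 t0_even)\<close>, reduced modulo
    \<open>\<theta>^3 = 2\<close>.\<close>
  define g0 where "g0 = 48 / 5 + 36 / 5 * \<theta> + 27 / 5 * \<theta> ^ 2"
  define r2 where "r2 = 12 + 26 / 3 * \<theta> + 13 / 2 * \<theta> ^ 2"
  define r4 where "r4 = 2714 / 9 + 8635 / 36 * \<theta> + 5090 / 27 * \<theta> ^ 2"
  have a0: "\<alpha>_even (of_real (1 - u_even)) = of_real a0"
    using has_fps_expansion_imp_0_eq_fps_nth_0[OF A1] even_amplitude_0[OF c]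
    by (simp add: a0_def c_def A1_def)
  have a0_pos: "a0 > 0" using \<theta>_bounds by (simp add: a0_def add_pos_pos)
  have g0_pos: "g0 > 0" using \<theta>_bounds by (simp add: g0_def add_pos_pos)
  have g0: "k_even (of_real (1 - u_even)) = of_real g0"
  proof -
    have "k_even (of_real (1 - u_even)) = of_real (3 / (2 * t0_even))"
      using u_even_bounds by (simp add: k_even_def)
    also have "2 * t0_even * g0 = 3" by (simp add: t0_even_def g0_def power2_eq_square field_simps
        \<theta>_cube')
    then have "3 / (2 * t0_even) = g0" using t0_even_pos by (simp add: field_simps)
    finally show ?thesis .
  qed
  have r2: "fps_nth (A1 * inverse K ^ 3) 2 = of_real r2 * fps_nth (A1 * inverse K ^ 3) 0"
      if "K ^ 2 = G" for K
    using even_ratios(1)[OF c K(1)[OF that, unfolded N_def D_def] g K(2)[OF that]]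
        by (simp add: A1_def r2_def c_def)
  have r4: "fps_nth (A1 * inverse K ^ 5) 4 = of_real r4 * fps_nth (A1 * inverse K ^ 5) 0"
      if "K ^ 2 = G" for K
    using even_ratios(2)[OF c K(1)[OF that, unfolded N_def D_def] g K(2)[OF that]]
        by (simp add: A1_def r4_def c_def)
  note asym = even_saddle.asymptotics[OF \<psi>_even_expansion \<alpha>_even_expansion planar_even_coeffs(2) A1
      G a0 a0_pos g0 r2 r4]
  show "fps_conv_radius (real_fps planar_even) = ereal t0_even" by (rule asym(2))
  have c_eq: "a0 / (2 * sqrt (pi * g0)) = 1 / 3 * sqrt ((2 * \<theta> - 1) / pi)"
  proof -
    \<comment> \<open>Squaring reduces the closed form of the constant to an identity modulo
      \<open>\<theta>^3 = 2\<close>.\<close>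
    have a0_sq: "9 * a0 ^ 2 = 4 * g0 * (2 * \<theta> - 1)"
      by (simp add: a0_def g0_def power2_eq_square field_simps \<theta>_cube')
    have "(3 * a0 / (2 * sqrt (pi * g0))) ^ 2 = 9 * a0 ^ 2 / (4 * (pi * g0))"
      using g0_pos by (simp add: power_divide power_mult_distrib)
    also have "\<dots> = (2 * \<theta> - 1) / pi" unfolding a0_sq using g0_pos by simp
    finally have "sqrt ((2 * \<theta> - 1) / pi) = 3 * a0 / (2 * sqrt (pi * g0))"
      by (rule real_sqrt_unique) (use a0_pos g0_pos in simp)
    then show ?thesis by simp
  qed
  have r2_eq: "r2 / g0 = 3 / 2 - 2 / 9 * \<theta>"
  proof -
    have "r2 = (3 / 2 - 2 / 9 * \<theta>) * g0"
        by (simp add: r2_def g0_def power2_eq_square field_simps \<theta>_cube')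
    then show ?thesis using g0_pos by simp
  qed
  have r4_eq: "r4 / g0 ^ 2 = 187 / 72 - 14 / 81 * \<theta> - 178 / 243 * \<theta> ^ 2"
  proof -
    have "r4 = (187 / 72 - 14 / 81 * \<theta> - 178 / 243 * \<theta> ^ 2) * g0 ^ 2"
        by (simp add: r4_def g0_def power2_eq_square field_simps \<theta>_cube')
    then show ?thesis using g0_pos by simp
  qed
  have d1_eq: "- 21 / 8 - r2 / g0 / 2 = - (243 - 8 * \<theta>) / 72"
    unfolding r2_eq by (simp add: field_simps)
  have d2_eq: "777 / 128 + 9 / 16 * (r2 / g0) + 3 / 4 * (r4 / g0 ^ 2)
      = (91881 - 2640 * \<theta> - 5696 * \<theta> ^ 2) / 10368"
    unfolding r2_eq r4_eq by (simp add: field_simps)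
  show "\<exists>E. E \<in> O(\<lambda>n. 1 / real n ^ 3) \<and> (\<forall>n\<ge>1. fps_nth (real_fps planar_even) n =
     1 / 3 * sqrt ((2 * \<theta> - 1) / pi) * ((1 / t0_even) ^ n / real n powr (7 / 2))
     * (1 + (- (243 - 8 * \<theta>) / 72) / real n + ((91881 - 2640 * \<theta> - 5696 * \<theta> ^ 2) / 10368)
         / real n ^ 2 + E n))"
    using asym(1) unfolding c_eq d1_eq d2_eq .
qed

section \<open>The full potential\<close>

text \<open>
  The saddle point is at \<open>1 + z = v\<close>, where \<open>z \<psi>(z)\<close> is critical if \<open>3 v\<^sup>4 - 6 v\<^sup>3 + 4 = 0\<close>. Coefficients are
  reduced modulo this equation.
\<close>

lemma quartic_rules:
  fixes v :: "'a::field_char_0"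
  assumes "3 * v ^ 4 - 6 * v ^ 3 + 4 = 0"
  shows "v * (v * (v * v)) = 2 * (v * (v * v)) - 4 / 3" "v * (v * (v * (v * x)))
      = 2 * (v * (v * (v * x))) - 4 / 3 * x"
proof -
  have "3 * (v * (v * (v * v))) = 6 * (v * (v * v)) - 4" using assms
      by (simp add: eval_nat_numeral algebra_simps eq_diff_eq)
  then show 1: "v * (v * (v * v)) = 2 * (v * (v * v)) - 4 / 3" by (simp add: field_simps)
  have "v * (v * (v * (v * x))) = v * (v * (v * v)) * x" by (simp only: mult.assoc)
  then show "v * (v * (v * (v * x))) = 2 * (v * (v * (v * x))) - 4 / 3 * x" unfolding 1
      by (simp add: left_diff_distrib mult.assoc)
qed

text \<open>Numerator and, below, denominator of \<open>\<alpha>_full\<close> in terms of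
  \<open>V = 1 + z\<close>.\<close>

definition full_num :: "complex \<Rightarrow> complex fps" where
  "full_num v = (let V = fps_const v + fps_X in 2 * V * (3 * V + 4))"

definition full_den :: "complex \<Rightarrow> complex fps" where
  "full_den v = (let V = fps_const v + fps_X in (V ^ 2 - 3 * V - 2) * (3 * V ^ 2 - 3 * V - 2))"

lemma fps_prefix_const_plus_X: "fps_prefix (fps_const c
    + fps_X :: 'a::comm_ring_1 fps) [c, 1, 0, 0, 0]"
  by (simp add: fps_prefix_Cons fps_X_def)

lemma fps_prefix_const_plus_X4: "fps_prefix (fps_const c
    + fps_X :: 'a::comm_ring_1 fps) [c, 1, 0, 0]"
  by (simp add: fps_prefix_Cons fps_X_def)

lemma fps_prefix_const4: "fps_prefix (fps_const c :: 'a::comm_ring_1 fps) [c, 0, 0, 0]"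
  by (simp add: fps_prefix_Cons)

lemma full_den_prefix:
  assumes v: "3 * v ^ 4 - 6 * v ^ 3 + 4 = (0 :: complex)"
  shows "fps_prefix (full_den v) [12 * v + v ^ 2 - 6 * v ^ 3, 12 + 2 * v - 36 * v ^ 2 + 12
      * v ^ 3, 1 - 36 * v + 18 * v ^ 2, - 12 + 12 * v, 3]"
proof -
  note pre = fps_prefix_const_plus_X fps_prefix_mult fps_prefix_diff fps_prefix_power2
      fps_prefix_numeral[where k = 4]
  show ?thesis
    unfolding full_den_def Let_def
  proof (rule fps_prefix_eqI, (rule pre)+)
  qed (simp add: numeral_eq_Suc field_simps quartic_rules[OF v])
qed

lemma full_den_nz:
  assumes v: "3 * v ^ 4 - 6 * v ^ 3 + 4 = (0 :: complex)"
  shows "fps_nth (full_den v) 0 \<noteq> 0"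
proof
  assume 0: "fps_nth (full_den v) 0 = 0"
  have "fps_nth (full_den v) 0 = 12 * v + v ^ 2 - 6 * v ^ 3"
    using fps_prefix_nth[OF full_den_prefix[OF v], of 0] by simp
  \<comment> \<open>The second factor is the inverse of the first modulo the quartic equation of
    \<open>v\<close>.\<close>
  then have "(12 * v + v ^ 2 - 6 * v ^ 3) * (18 / 187 + 39 / 374 * v + 123 / 748 * v ^ 2 - 63 / 374
      * v ^ 3) = 0" using 0 by simp
  moreover have "(12 * v + v ^ 2 - 6 * v ^ 3) * (18 / 187 + 39 / 374 * v + 123 / 748 * v ^ 2 - 63
      / 374 * v ^ 3) = 1"
    by (simp add: eval_nat_numeral field_simps quartic_rules[OF v])
  ultimately show False by (simp only: one_neq_zero)
qed

lemma full_amplitude_prefix: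
  assumes v: "3 * v ^ 4 - 6 * v ^ 3 + 4 = (0 :: complex)"
  shows "fps_prefix (full_num v * inverse (full_den v)) [54 / 17 + 36 / 17 * v + 24 / 17 * v ^ 2
      - 48 / 17 * v ^ 3, 912 / 187 + 1032 / 187 * v + 744 / 187 * v ^ 2 - 540 / 187 * v ^ 3, 114108
      / 3179 + 92256 / 3179 * v + 75546 / 3179 * v ^ 2 - 117585 / 3179 * v ^ 3, 2225184 / 34969
      + 2113704 / 34969 * v + 2131380 / 34969 * v ^ 2 - 1457154 / 34969 * v ^ 3, 266531634 / 594473
      + 206842824 / 594473 * v + 327274677 / 1188946 * v ^ 2 - 260062236 / 594473 * v ^ 3]"
proof (rule fps_prefix_quotient)
  note pre = fps_prefix_const_plus_X fps_prefix_mult fps_prefix_add fps_prefix_numeral[where k = 4]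
  show "fps_prefix (full_den v) [12 * v + v ^ 2 - 6 * v ^ 3, 12 + 2 * v - 36 * v ^ 2 + 12 * v ^ 3, 1
      - 36 * v + 18 * v ^ 2, - 12 + 12 * v, 3]" by (rule full_den_prefix[OF v])
  show "fps_prefix (full_num v) (conv [12 * v + v ^ 2 - 6 * v ^ 3, 12 + 2 * v - 36 * v ^ 2 + 12
      * v ^ 3, 1 - 36 * v + 18 * v ^ 2, - 12 + 12 * v, 3] [54 / 17 + 36 / 17 * v + 24 / 17 * v ^ 2
      - 48 / 17 * v ^ 3, 912 / 187 + 1032 / 187 * v + 744 / 187 * v ^ 2 - 540 / 187 * v ^ 3, 114108
      / 3179 + 92256 / 3179 * v + 75546 / 3179 * v ^ 2 - 117585 / 3179 * v ^ 3, 2225184 / 34969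
      + 2113704 / 34969 * v + 2131380 / 34969 * v ^ 2 - 1457154 / 34969 * v ^ 3, 266531634 / 594473
      + 206842824 / 594473 * v + 327274677 / 1188946 * v ^ 2 - 260062236 / 594473 * v ^ 3])"
    unfolding full_num_def Let_def
  proof (rule fps_prefix_eqI, (rule pre)+)
  qed (simp add: numeral_eq_Suc field_simps quartic_rules[OF v])
  show nz: "fps_nth (full_den v) 0 \<noteq> 0" by (rule full_den_nz[OF v])
  have "full_den v * (full_num v * inverse (full_den v))
      = full_num v * (inverse (full_den v) * full_den v)" by (simp only: mult_ac)
  then show "full_den v * (full_num v * inverse (full_den v)) = full_num v"
    by (simp only: inverse_mult_eq_1[OF nz] mult_1_right)
qed simp

lemma full_amplitude_0:
  "3 * v ^ 4 - 6 * v ^ 3 + 4 = 0 \<Longrightarrow> fps_nth (full_num v * inverse (full_den v)) 0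
      = 54 / 17 + 36 / 17 * v + 24 / 17 * v ^ 2 - 48 / 17 * v ^ 3"
  using fps_prefix_nth[OF full_amplitude_prefix, of v 0] by simp

lemma full_saddle_prefix:
  fixes K :: "complex fps"
  assumes v: "3 * v ^ 4 - 6 * v ^ 3 + 4 = 0"
    and K: "K ^ 2 * (fps_const v + fps_X) ^ 2
        = fps_const g * (fps_const (4 * v) + 8 * (fps_const v + fps_X) - fps_const (3 * v ^ 3)
        * (fps_const v + fps_X) ^ 2)"
    and g: "g \<noteq> 0" and K0: "fps_nth K 0 \<noteq> 0"
  shows "fps_prefix (inverse K ^ 3) (map ((*) (fps_nth (inverse K ^ 3) 0)) [1, 27 / 17 + 18 / 17 * v
      + 63 / 17 * v ^ 2 - 99 / 34 * v ^ 3, 45 / 17 + 225 / 68 * v + 135 / 68 * v ^ 2 - 675 / 272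
      * v ^ 3, 2553 / 578 + 4917 / 1156 * v + 3771 / 1156 * v ^ 2 - 20223 / 4624 * v ^ 3, 2529 / 544
      + 79083 / 18496 * v + 140967 / 36992 * v ^ 2 - 74331 / 18496 * v ^ 3])"
    and "fps_prefix (inverse K ^ 5) (map ((*) (fps_nth (inverse K ^ 5) 0)) [1, 45 / 17 + 30 / 17 * v
        + 105 / 17 * v ^ 2 - 165 / 34 * v ^ 3, 120 / 17 + 735 / 68 * v + 285 / 68 * v ^ 2 - 1845
        / 272 * v ^ 3, 11025 / 578 + 18525 / 1156 * v + 3555 / 289 * v ^ 2 - 76275 / 4624
        * v ^ 3, 259245 / 9248 + 445095 / 18496 * v + 736155 / 36992 * v ^ 2 - 431235 / 18496
        * v ^ 3])"
proof -
  define V :: "complex fps" where "V = fps_const v + fps_X"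
  define N where "N = fps_const (4 * v) + 8 * V - fps_const (3 * v ^ 3) * V ^ 2"
  have "V \<noteq> 0"
  proof
    assume "V = 0"
    then have "fps_nth V 1 = 0" by simp
    then show False by (simp add: V_def)
  qed
  have dV: "fps_deriv V = 1" by (simp add: V_def)
  have rel: "N * fps_deriv (V ^ 2) - fps_deriv N * V ^ 2 = 8 * V * (fps_const v + V)"
    unfolding N_def by (simp add: dV power2_eq_square algebra_simps numeral_fps_const flip:
        fps_const_mult)
  \<comment> \<open>The general equation has the common factor \<open>2 * V\<close>, which is
    cancelled.\<close>
  have ode: "fps_deriv (inverse K ^ numeral m) * (N * V)
      = (numeral m * (4 * (fps_const v + V))) * inverse K ^ numeral m" for m
  proof -
    have "(2 * V) * (fps_deriv (inverse K ^ numeral m) * (N * V))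
        = (2 * V) * ((numeral m * (4 * (fps_const v + V))) * inverse K ^ numeral m)"
    proof -
      have "(2 * V) * (fps_deriv (inverse K ^ numeral m) * (N * V))
          = fps_deriv (inverse K ^ numeral m) * (2 * N * V ^ 2)"
        by (simp only: power2_eq_square mult_ac)
      also have "\<dots> = numeral m * (8 * V * (fps_const v + V)) * inverse K ^ numeral m"
        using inverse_sqrt_power_ode[OF K[folded V_def, folded N_def] K0 g, of "numeral m"]
            by (simp only: rel of_nat_numeral)
      also have "\<dots> = (2 * V) * ((numeral m * (4 * (fps_const v + V))) * inverse K ^ numeral m)"
      proof -
        have "8 = 2 * (4 :: complex fps)" by simp
        then show ?thesis by (simp only: mult_ac)
      qed
      finally show ?thesis .
    qed
    moreover have "2 * V \<noteq> 0" using \<open>V \<noteq> 0\<close> by simp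
    ultimately show ?thesis by (simp only: mult_cancel_left simp_thms)
  qed
  note pre = fps_prefix_const_plus_X4 fps_prefix_const4 fps_prefix_mult fps_prefix_add
      fps_prefix_diff fps_prefix_power2 fps_prefix_numeral[where k = 3]
  have U: "fps_prefix (N * V) [16 + 8 * v + 16 * v ^ 2 - 24 * v ^ 3, 24 + 32 * v - 36 * v ^ 3, 20
      - 18 * v ^ 3, - 3 * v ^ 3]"
    unfolding N_def V_def
  proof (rule fps_prefix_eqI, (rule pre)+)
  qed (simp add: numeral_eq_Suc field_simps quartic_rules[OF v])
  have W: "fps_prefix (numeral m * (4 * (fps_const v + V))) [numeral m * (8 * v), numeral m
      * 4, 0, 0]" for m
    unfolding V_def
  proof (rule fps_prefix_eqI, (rule pre)+)
  qed (simp add: numeral_eq_Suc field_simps)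
  have U0: "fps_nth (N * V) 0 \<noteq> 0"
  proof
    assume 0: "fps_nth (N * V) 0 = 0"
    \<comment> \<open>Again the second factor is the inverse of the first modulo the quartic
      equation.\<close>
    have "(16 + 8 * v + 16 * v ^ 2 - 24 * v ^ 3) * (3 / 68 + 21 / 136 * v - 3 / 136 * v ^ 2 - 27
        / 544 * v ^ 3) = 0" using fps_prefix_nth[OF U, of 0] 0 by simp
    moreover have "(16 + 8 * v + 16 * v ^ 2 - 24 * v ^ 3) * (3 / 68 + 21 / 136 * v - 3 / 136 * v ^ 2
        - 27 / 544 * v ^ 3) = 1"
      by (simp add: eval_nat_numeral field_simps quartic_rules[OF v])
    ultimately show False by (simp only: one_neq_zero)
  qed
  show "fps_prefix (inverse K ^ 3) (map ((*) (fps_nth (inverse K ^ 3) 0)) [1, 27 / 17 + 18 / 17 * v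
      + 63 / 17 * v ^ 2 - 99 / 34 * v ^ 3, 45 / 17 + 225 / 68 * v + 135 / 68 * v ^ 2 - 675 / 272
      * v ^ 3, 2553 / 578 + 4917 / 1156 * v + 3771 / 1156 * v ^ 2 - 20223 / 4624 * v ^ 3, 2529 / 544
      + 79083 / 18496 * v + 140967 / 36992 * v ^ 2 - 74331 / 18496 * v ^ 3])"
    by (rule fps_prefix_ode[OF ode U U0 W]) (simp_all add: power2_eq_square power3_eq_cube
        field_simps quartic_rules[OF v])
  show "fps_prefix (inverse K ^ 5) (map ((*) (fps_nth (inverse K ^ 5) 0)) [1, 45 / 17 + 30 / 17 * v
      + 105 / 17 * v ^ 2 - 165 / 34 * v ^ 3, 120 / 17 + 735 / 68 * v + 285 / 68 * v ^ 2 - 1845 / 272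
      * v ^ 3, 11025 / 578 + 18525 / 1156 * v + 3555 / 289 * v ^ 2 - 76275 / 4624 * v ^ 3, 259245
      / 9248 + 445095 / 18496 * v + 736155 / 36992 * v ^ 2 - 431235 / 18496 * v ^ 3])"
    by (rule fps_prefix_ode[OF ode U U0 W]) (simp_all add: power2_eq_square power3_eq_cube
        field_simps quartic_rules[OF v])
qed

lemma full_ratios:
  fixes K :: "complex fps"
  assumes v: "3 * v ^ 4 - 6 * v ^ 3 + 4 = 0"
    and K: "K ^ 2 * (fps_const v + fps_X) ^ 2
        = fps_const g * (fps_const (4 * v) + 8 * (fps_const v + fps_X) - fps_const (3 * v ^ 3)
        * (fps_const v + fps_X) ^ 2)"
    and g: "g \<noteq> 0" and K0: "fps_nth K 0 \<noteq> 0"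
  defines "A \<equiv> full_num v * inverse (full_den v)"
  shows "fps_nth (A * inverse K ^ 3) 2
      = (279 / 17 + 993 / 68 * v + 1083 / 68 * v ^ 2 - 3915 / 272 * v ^ 3) * fps_nth (A
      * inverse K ^ 3) 0"
    and "fps_nth (A * inverse K ^ 5) 4 = (4217373 / 9248 + 7555239 / 18496 * v + 13018635 / 36992
        * v ^ 2 - 7054731 / 18496 * v ^ 3) * fps_nth (A * inverse K ^ 5) 0"
proof -
  note A = full_amplitude_prefix[OF v, folded A_def]
  note P = full_saddle_prefix[OF v K g K0]
  show "fps_nth (A * inverse K ^ 3) 2 = (279 / 17 + 993 / 68 * v + 1083 / 68 * v ^ 2 - 3915 / 272
      * v ^ 3) * fps_nth (A * inverse K ^ 3) 0"
  proof -
    define Q where "Q = A * inverse K ^ 3"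
    define p where "p = fps_nth (inverse K ^ 3) 0"
    note Q = fps_prefix_mult[OF A P(1), folded Q_def p_def]
    have "fps_nth Q 0 = (54 / 17 + 36 / 17 * v + 24 / 17 * v ^ 2 - 48 / 17 * v ^ 3) * p"
        using fps_prefix_nth[OF Q, of 0] by (simp add: mult.commute)
    moreover have "fps_nth Q 2 = (279 / 17 + 993 / 68 * v + 1083 / 68 * v ^ 2 - 3915 / 272 * v ^ 3)
        * ((54 / 17 + 36 / 17 * v + 24 / 17 * v ^ 2 - 48 / 17 * v ^ 3) * p)"
      by (subst fps_prefix_nth[OF Q]) (simp_all add: power2_eq_square power3_eq_cube field_simps
          quartic_rules[OF v])
    ultimately show ?thesis unfolding Q_def[symmetric] by (simp only:)
  qed
  show "fps_nth (A * inverse K ^ 5) 4 = (4217373 / 9248 + 7555239 / 18496 * v + 13018635 / 36992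
      * v ^ 2 - 7054731 / 18496 * v ^ 3) * fps_nth (A * inverse K ^ 5) 0"
  proof -
    define Q where "Q = A * inverse K ^ 5"
    define p where "p = fps_nth (inverse K ^ 5) 0"
    note Q = fps_prefix_mult[OF A P(2), folded Q_def p_def]
    have "fps_nth Q 0 = (54 / 17 + 36 / 17 * v + 24 / 17 * v ^ 2 - 48 / 17 * v ^ 3) * p"
        using fps_prefix_nth[OF Q, of 0] by (simp add: mult.commute)
    moreover have "fps_nth Q 4 = (4217373 / 9248 + 7555239 / 18496 * v + 13018635 / 36992 * v ^ 2
        - 7054731 / 18496 * v ^ 3) * ((54 / 17 + 36 / 17 * v + 24 / 17 * v ^ 2 - 48 / 17 * v ^ 3)
        * p)"
      by (subst fps_prefix_nth[OF Q]) (simp_all add: power2_eq_square power3_eq_cube field_simps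
          quartic_rules[OF v])
    ultimately show ?thesis unfolding Q_def[symmetric] by (simp only:)
  qed
qed

section \<open>The saddle point of the full potential\<close>

lemma v_full_ex: "\<exists>v::real. 1172213910843570472 / 10 ^ 18 \<le> v \<and> v \<le> 1172213910843570473 / 10 ^ 18
    \<and> 3 * v ^ 4 - 6 * v ^ 3 + 4 = 0"
proof -
  have "continuous_on {1172213910843570472 / 10 ^ 18 .. 1172213910843570473 / 10 ^ 18} (\<lambda>v::real. 3
      * v ^ 4 - 6 * v ^ 3 + 4)"
    by (intro continuous_intros)
  then have "\<exists>v. 1172213910843570472 / 10 ^ 18 \<le> v \<and> v \<le> 1172213910843570473 / 10 ^ 18
      \<and> 3 * v ^ 4 - 6 * v ^ 3 + 4 = (0::real)"
    by (intro IVT2') (simp_all add: power_divide)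
  then show ?thesis .
qed

text \<open>The enclosure is part of the choice and is narrow enough for all the decimal bounds
  proved at the end.\<close>

definition v_full :: real where
  "v_full = (SOME v. 1172213910843570472 / 10 ^ 18 \<le> v \<and> v \<le> 1172213910843570473 / 10 ^ 18
      \<and> 3 * v ^ 4 - 6 * v ^ 3 + 4 = 0)"

lemma v_full_bounds: "1172213910843570472 / 10 ^ 18 \<le> v_full" "v_full
    \<le> 1172213910843570473 / 10 ^ 18"
  and v_full_root: "3 * v_full ^ 4 - 6 * v_full ^ 3 + 4 = 0"
  using someI_ex[OF v_full_ex] unfolding v_full_def by blast+

lemma v_full_coarse: "1172 / 1000 < v_full" "v_full < 1173 / 1000"
  using v_full_bounds by simp_all

lemmas v_full_rules = quartic_rules[OF v_full_root]

text \<open>The value of \<open>z \<psi>(z)\<close> at the saddle point, reduced to a polynomial in \<open>v\<close>.\<close>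

definition t0_full :: real where "t0_full = 13 / 8 - 9 / 4 * v_full + 3 / 4 * v_full ^ 2"

lemma t0_full_factored: "8 * t0_full * v_full ^ 2
    = (v_full - 1) * (v_full - 2) * (3 * v_full ^ 2 - 3 * v_full - 2)"
  by (simp add: t0_full_def eval_nat_numeral field_simps v_full_rules)

lemma t0_full_pos: "t0_full > 0"
proof -
  have "(v_full - 1) * ((2 - v_full) * (2 + 3 * v_full * (1 - v_full))) > 0"
  proof (intro mult_pos_pos)
    have "3 * v_full * (v_full - 1) < 3 * (1173 / 1000) * (173 / 1000)"
      by (rule mult_strict_mono) (use v_full_coarse in auto)
    then show "2 + 3 * v_full * (1 - v_full) > 0" by (simp add: algebra_simps)
  qed (use v_full_coarse in auto)
  then have "8 * t0_full * v_full ^ 2 > 0" unfolding t0_full_factored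
      by (simp add: power2_eq_square algebra_simps)
  then show ?thesis using v_full_coarse by (simp add: zero_less_mult_iff)
qed

definition \<psi>_full :: "complex \<Rightarrow> complex" where "\<psi>_full z
    = ((z - 1) * (3 * z ^ 2 + 3 * z - 2)) / (8 * (1 + z) ^ 2)"
definition \<alpha>_full :: "complex \<Rightarrow> complex" where
  "\<alpha>_full z = (2 * (1 + z) * (7 + 3 * z)) / ((z ^ 2 - z - 4) * (3 * z ^ 2 + 3 * z - 2))"
text \<open>With \<open>V = 1 + z\<close> and \<open>v = v_full\<close>, the quartic equation gives
  \<open>8 v^3 V^2 (t0_full - z \<psi>_full(z)) = (v - V)^2 (4 v + 8 V - 3 v^3 V^2)\<close>; the
  double zero is removed.\<close>

definition k_full :: "complex \<Rightarrow> complex" where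
  "k_full z = (4 * of_real v_full + 8 * (1 + z) - 3 * of_real v_full ^ 3 * (1 + z) ^ 2) / (8
      * of_real t0_full * of_real v_full ^ 3 * (1 + z) ^ 2)"

lemma full_nonzero:
  assumes "norm (z :: complex) < 1 / 5"
  shows "1 + z \<noteq> 0" "z - 1 \<noteq> 0" "z ^ 2 - z - 4 \<noteq> 0" "3 * z ^ 2 + 3 * z - 2 \<noteq> 0"
proof -
  have z2: "norm (z ^ 2) < 1 / 25"
  proof -
    have "norm z ^ 2 < (1 / 5) ^ 2" using assms by (intro power_strict_mono) auto
    also have "(1 / 5 :: real) ^ 2 = 1 / 25" by (simp add: power2_eq_square)
    finally show ?thesis by (simp only: norm_power)
  qed
  have "norm z \<noteq> 1" using assms by simp
  then show "1 + z \<noteq> 0" "z - 1 \<noteq> 0" by (auto simp: add_eq_0_iff)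
  show "z ^ 2 - z - 4 \<noteq> 0"
  proof
    assume "z ^ 2 - z - 4 = 0"
    then have "norm (z ^ 2 - z) = norm (4 :: complex)" by (simp add: algebra_simps)
    then show False using norm_triangle_ineq4[of "z ^ 2" z] z2 assms by simp
  qed
  show "3 * z ^ 2 + 3 * z - 2 \<noteq> 0"
  proof
    assume "3 * z ^ 2 + 3 * z - 2 = 0"
    then have "norm (3 * z ^ 2 + 3 * z) = norm (2 :: complex)" by (simp add: algebra_simps)
    then show False using norm_triangle_ineq[of "3 * z ^ 2" "3 * z"] z2 assms
        by (simp add: norm_mult)
  qed
qed

text \<open>In \<open>i = 1 / (1 + z)\<close> this is a positive multiple of
  \<open>4 v i^2 + 8 i - 3 v^3\<close>. On the disc \<open>i\<close> has real part at least
  \<open>5/6\<close> and \<open>i^2\<close> nonnegative real part, and \<open>20/3\<close> exceeds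
  \<open>3 v^3\<close>.\<close>

lemma Re_k_full:
  assumes z: "norm (z :: complex) < 1 / 5"
  shows "Re (k_full z) > 0"
proof -
  define i where "i = inverse (1 + z)"
  define x y where "x = Re z" and "y = Im z"
  have nz: "1 + z \<noteq> 0" by (rule full_nonzero[OF z])
  have n: "x ^ 2 + y ^ 2 < 1 / 25"
  proof -
    have "norm z ^ 2 < (1 / 5) ^ 2" using z by (intro power_strict_mono) auto
    also have "(1 / 5 :: real) ^ 2 = 1 / 25" by (simp add: power2_eq_square)
    finally show ?thesis by (simp only: cmod_power2 x_def y_def)
  qed
  have x: "\<bar>x\<bar> < 1 / 5" "\<bar>y\<bar> < 1 / 5"
    using z abs_Re_le_cmod[of z] abs_Im_le_cmod[of z] by (auto simp: x_def y_def)
  define W where "W = (1 + x) ^ 2 + y ^ 2"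
  have W: "W > 0" using x by (auto simp: W_def intro!: add_pos_nonneg)
  have Rei: "Re i = (1 + x) / W" and Imi: "Im i = - y / W"
    by (simp_all add: i_def W_def x_def y_def)
  have "5 * W \<le> 6 * (1 + x)" using n x unfolding W_def by (simp add: power2_eq_square algebra_simps)
  then have 1: "Re i \<ge> 5 / 6" unfolding Rei using W by (simp add: field_simps)
  have "y ^ 2 \<le> (1 + x) ^ 2" using x by (intro power2_le_iff_abs_le[THEN iffD2]) auto
  moreover have "Re (i ^ 2) = ((1 + x) ^ 2 - y ^ 2) / W ^ 2"
    by (simp add: power2_eq_square Rei Imi diff_divide_distrib)
  ultimately have 2: "Re (i ^ 2) \<ge> 0" by simp
  have v3: "v_full ^ 3 < (1173 / 1000) ^ 3" using v_full_coarse by (intro power_strict_mono) auto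
  have "k_full z = of_real (1 / (8 * t0_full * v_full ^ 3)) * (of_real (4 * v_full) * i ^ 2 + 8 * i
      - of_real (3 * v_full ^ 3))"
  proof -
    have "(A + 8 * V - C * V ^ 2) / (T * V ^ 2) = 1 / T * (A * inverse V ^ 2 + 8 * inverse V - C)"
        if "V \<noteq> 0" for A C T V :: complex
      using that by (cases "T = 0") (simp_all add: field_simps power2_eq_square)
    from this[OF nz] show ?thesis by (simp add: k_full_def i_def)
  qed
  also have "Re \<dots> = 1 / (8 * t0_full * v_full ^ 3) * (4 * v_full * Re (i ^ 2) + 8 * Re i - 3
      * v_full ^ 3)"
    by simp
  also have "\<dots> > 0"
  proof (intro mult_pos_pos)
    have "4 * v_full * Re (i ^ 2) \<ge> 0" using 2 v_full_coarse by (intro mult_nonneg_nonneg) auto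
    then show "4 * v_full * Re (i ^ 2) + 8 * Re i - 3 * v_full ^ 3 > 0" using 1 v3
        by (simp add: power3_eq_cube)
  qed (use t0_full_pos v_full_coarse in auto)
  finally show ?thesis .
qed

text \<open>Again everything is a polynomial in \<open>s = r - x\<close>. The squared modulus of
  \<open>1 + z\<close> only decreases with \<open>s\<close> and may be replaced by its value at
  \<open>s = 0\<close>; the remaining factors are compared one by one.\<close>

lemma full_circle:
  fixes x y r :: real
  assumes xy: "x ^ 2 + y ^ 2 = r ^ 2" and r: "172 / 1000 < r" "r < 173 / 1000"
  shows "((1 - r) * (3 * r ^ 2 + 3 * r - 2)) ^ 2 * ((1 + x) ^ 2 + y ^ 2) ^ 2 * (1 + ((x - r) ^ 2
      + y ^ 2))
    \<le> (1 + r) ^ 4 * (((x - 1) ^ 2 + y ^ 2) * ((3 * (x ^ 2 - y ^ 2) + 3 * x - 2) ^ 2 + (6 * x * y + 3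
        * y) ^ 2))"
proof -
  define s where "s = r - x"
  have "\<bar>x\<bar> \<le> \<bar>r\<bar>" using xy by (metis abs_le_square_iff le_add_same_cancel1 zero_le_power2)
  then have s: "0 \<le> s" "s \<le> 2 * r" using r by (auto simp: s_def)
  have y2: "y ^ 2 = r ^ 2 - x ^ 2" using xy by simp
  define B where "B = 3 * r ^ 2 + 3 * r - 2"
  have 1: "(x - 1) ^ 2 + y ^ 2 = (1 - r) ^ 2 + 2 * s"
    unfolding y2 s_def by (simp add: power2_eq_square algebra_simps)
  have 2: "(x - r) ^ 2 + y ^ 2 = 2 * r * s"
    unfolding y2 s_def by (simp add: power2_eq_square algebra_simps)
  have 3: "(1 + x) ^ 2 + y ^ 2 = (1 + r) ^ 2 - 2 * s"
    unfolding y2 s_def by (simp add: power2_eq_square algebra_simps)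
  have 4: "(3 * (x ^ 2 - y ^ 2) + 3 * x - 2) ^ 2 + (6 * x * y + 3 * y) ^ 2
      = B ^ 2 + s * (12 - 18 * r ^ 2 + 48 * r - 24 * s)"
  proof -
    have "(6 * x * y + 3 * y) ^ 2 = (6 * x + 3) ^ 2 * y ^ 2"
        by (simp add: power2_eq_square algebra_simps)
    then show ?thesis unfolding y2 B_def s_def by (simp add: power2_eq_square algebra_simps)
  qed
  have r2: "r ^ 2 \<le> (173 / 1000) ^ 2" using r by (intro power_mono) auto
  have W: "0 \<le> (1 + r) ^ 2 - 2 * s" unfolding 3[symmetric] by simp
  have "((1 - r) * B) ^ 2 * ((1 + r) ^ 2 - 2 * s) ^ 2 * (1 + 2 * r * s)
      \<le> ((1 - r) * B) ^ 2 * ((1 + r) ^ 2) ^ 2 * (1 + 2 * r * s)"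
    using W s r by (intro mult_right_mono mult_left_mono power_mono) auto
  also have "\<dots> = (1 + r) ^ 4 * (((1 - r) ^ 2 * (1 + 2 * r * s)) * B ^ 2)"
    by (simp add: power_mult_distrib flip: power_mult)
  also have "\<dots> \<le> (1 + r) ^ 4 * (((1 - r) ^ 2 + 2 * s) * (B ^ 2 + s * (12 - 18 * r ^ 2 + 48 * r - 24
      * s)))"
  proof (intro mult_left_mono mult_mono)
    have "(1 - r) ^ 2 \<le> 1" using r by (intro power_le_one) auto
    then have "(1 - r) ^ 2 * r \<le> 1 * 1" using r by (intro mult_mono) auto
    then have "2 * s * ((1 - r) ^ 2 * r) \<le> 2 * s * 1" using s by (intro mult_left_mono) auto
    then show "(1 - r) ^ 2 * (1 + 2 * r * s) \<le> (1 - r) ^ 2 + 2 * s" by (simp add: algebra_simps)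
    have "0 \<le> 12 - 18 * r ^ 2 + 48 * r - 24 * s" using r r2 s by (simp add: power2_eq_square)
    then show "B ^ 2 \<le> B ^ 2 + s * (12 - 18 * r ^ 2 + 48 * r - 24 * s)" using s by simp
  qed (use s in auto)
  finally show ?thesis unfolding 1 2 3 4 B_def[symmetric] .
qed

interpretation full_saddle: sqrt_saddle "1 / 5" t0_full "v_full - 1" 1 \<psi>_full \<alpha>_full k_full
proof
  show "0 < v_full - 1" "v_full - 1 < 1 / 5" using v_full_coarse by auto
  have nz: "of_real t0_full \<noteq> (0 :: complex)" "of_real v_full \<noteq> (0 :: complex)"
      using t0_full_pos v_full_coarse by auto
  show "\<psi>_full holomorphic_on ball 0 (1 / 5)" "\<alpha>_full holomorphic_on ball 0 (1
      / 5)" "k_full holomorphic_on ball 0 (1 / 5)"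
    unfolding \<psi>_full_def \<alpha>_full_def k_full_def using full_nonzero nz
    by (auto intro!: holomorphic_intros)
  fix z :: complex
  {
    assume "z \<in> ball 0 (1 / 5)"
    then have z: "norm z < 1 / 5" by simp
    note nzz = full_nonzero[OF z]
    show "\<psi>_full z \<noteq> 0" using nzz by (simp add: \<psi>_full_def)
    show "Re (k_full z) > 0" by (rule Re_k_full[OF z])
    define v :: complex where "v = of_real v_full"
    define V where "V = 1 + z"
    have V: "V \<noteq> 0" using nzz by (simp add: V_def)
    have v: "v \<noteq> 0" using nz by (simp add: v_def)
    have root: "3 * v ^ 4 - 6 * v ^ 3 + 4 = 0"
      unfolding v_def using arg_cong[OF v_full_root, of complex_of_real] by simp
    have t0: "of_real t0_full = 13 / 8 - 9 / 4 * v + 3 / 4 * v ^ 2" by (simp add: t0_full_def v_def)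
    have "8 * v ^ 3 * V ^ 2 * (of_real t0_full * (1 - (of_real (v_full - 1) - z) ^ 2 * k_full z))
      = 8 * of_real t0_full * v ^ 3 * V ^ 2 - (v - V) ^ 2 * (4 * v + 8 * V - 3 * v ^ 3 * V ^ 2)"
      unfolding k_full_def V_def[symmetric] v_def[symmetric]
      using V v nz by (simp add: field_simps V_def[symmetric]) (simp add: v_def V_def algebra_simps)
    also have "\<dots> = v ^ 3 * ((V - 1) * (V - 2) * (3 * V ^ 2 - 3 * V - 2))"
      unfolding t0 by (simp add: eval_nat_numeral field_simps quartic_rules[OF root])
    also have "\<dots> = 8 * v ^ 3 * V ^ 2 * (z * \<psi>_full z)"
    proof -
      have "z * ((z - 1) * (3 * z ^ 2 + 3 * z - 2)) = (V - 1) * (V - 2) * (3 * V ^ 2 - 3 * V - 2)"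
        by (simp add: V_def power2_eq_square algebra_simps)
      then have "z * \<psi>_full z = ((V - 1) * (V - 2) * (3 * V ^ 2 - 3 * V - 2)) / (8 * V ^ 2)"
        by (simp add: \<psi>_full_def V_def)
      then show ?thesis using V by simp
    qed
    finally show "z * \<psi>_full z = of_real t0_full * (1 - (of_real (v_full - 1) - z) ^ 2 * k_full z)"
      using V v by simp
  }
  show "k_full 0 = of_real (1 / (v_full - 1) ^ 2)"
  proof -
    have "(4 * v_full + 8 - 3 * v_full ^ 3) * (v_full - 1) ^ 2 = 8 * t0_full * v_full ^ 3"
      by (simp add: t0_full_def eval_nat_numeral field_simps v_full_rules)
    then have "(4 * v_full + 8 - 3 * v_full ^ 3) / (8 * t0_full * v_full ^ 3)
        = 1 / (v_full - 1) ^ 2"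
      using v_full_coarse t0_full_pos by (subst frac_eq_eq) auto
    then have "complex_of_real ((4 * v_full + 8 - 3 * v_full ^ 3) / (8 * t0_full * v_full ^ 3))
        = of_real (1 / (v_full - 1) ^ 2)" by (rule arg_cong)
    then show ?thesis by (simp add: k_full_def)
  qed
  assume z: "norm z = v_full - 1"
  show "t0_full ^ 2 * (1 + 1 * norm (z - of_real (v_full - 1)) ^ 2) \<le> norm (z * \<psi>_full z) ^ 2"
  proof -
    have zl: "norm z < 1 / 5" using z v_full_coarse by simp
    define x y where "x = Re z" and "y = Im z"
    define r where "r = v_full - 1"
    have r: "172 / 1000 < r" "r < 173 / 1000" using v_full_coarse by (auto simp: r_def)
    have xy: "x ^ 2 + y ^ 2 = r ^ 2" using z cmod_power2[of z] by (simp add: x_def y_def r_def)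
    have n1: "norm (1 + z) ^ 2 = (1 + x) ^ 2 + y ^ 2" by (simp add: cmod_power2 x_def y_def)
    have n2: "norm (z - 1) ^ 2 = (x - 1) ^ 2 + y ^ 2" by (simp add: cmod_power2 x_def y_def)
    have n3: "norm (3 * z ^ 2 + 3 * z - 2) ^ 2
        = (3 * (x ^ 2 - y ^ 2) + 3 * x - 2) ^ 2 + (6 * x * y + 3 * y) ^ 2"
      unfolding cmod_power2 x_def y_def by (simp add: power2_eq_square algebra_simps)
    have n4: "norm (z - of_real r) ^ 2 = (x - r) ^ 2 + y ^ 2" by (simp add: cmod_power2 x_def y_def)
    have pos: "norm (1 + z) ^ 2 > 0" using full_nonzero(1)[OF zl] by simp
    have t0: "8 * t0_full * (1 + r) ^ 2 = - (r * ((1 - r) * (3 * r ^ 2 + 3 * r - 2)))"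
      using t0_full_factored by (simp add: r_def power2_eq_square algebra_simps)
    have "(8 * t0_full * (1 + r) ^ 2) ^ 2 * (norm (1 + z) ^ 2) ^ 2 * (1 + norm (z - of_real r) ^ 2)
        \<le> r ^ 2 * ((1 + r) ^ 4 * (norm (z - 1) ^ 2 * norm (3 * z ^ 2 + 3 * z - 2) ^ 2))"
      using mult_left_mono[OF full_circle[OF xy r], of "r ^ 2"]
      unfolding t0 n1 n2 n3 n4 by (simp add: power_mult_distrib mult_ac)
    then have "(1 + r) ^ 4 * (t0_full ^ 2 * (1 + norm (z - of_real r) ^ 2) * (64 * (norm (1
        + z) ^ 2) ^ 2))
        \<le> (1 + r) ^ 4 * (r ^ 2 * (norm (z - 1) ^ 2 * norm (3 * z ^ 2 + 3 * z - 2) ^ 2))"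
      by (simp add: power_mult_distrib mult_ac flip: power_mult)
    then have "t0_full ^ 2 * (1 + norm (z - of_real r) ^ 2) * (64 * (norm (1 + z) ^ 2) ^ 2)
        \<le> r ^ 2 * (norm (z - 1) ^ 2 * norm (3 * z ^ 2 + 3 * z - 2) ^ 2)"
      by (rule mult_left_le_imp_le) (use r in simp)
    then have "t0_full ^ 2 * (1 + norm (z - of_real r) ^ 2)
        \<le> r ^ 2 * (norm (z - 1) ^ 2 * norm (3 * z ^ 2 + 3 * z - 2) ^ 2) / (64 * (norm (1
            + z) ^ 2) ^ 2)"
      by (subst pos_le_divide_eq) (use pos in auto)
    also have "\<dots> = norm (z * \<psi>_full z) ^ 2"
      unfolding \<psi>_full_def by (simp add: norm_mult norm_divide norm_power power_mult_distrib
          power_divide z r_def)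
    finally show ?thesis by (simp add: r_def)
  qed
qed (simp_all add: t0_full_pos)

lemma fps_map_\<Psi>_full: "fps_map of_rat (\<Psi>_full :: rat fps) = (\<Psi>_full :: complex fps)"
proof -
  interpret rat: ring_map "of_rat :: rat \<Rightarrow> complex"
      by standard (simp_all add: of_rat_add of_rat_mult)
  have "fps_nth (8 * (1 + fps_X) ^ 2 :: rat fps) 0 \<noteq> 0"
      by (simp add: numeral_fps_const power2_eq_square)
  note e = fps_map_of_rat_inverse[OF this, where 'a = complex]
  show ?thesis unfolding \<Psi>_full_def rat.fps_map_mult e unfolding rat.fps_map_simps ..
qed

lemma \<psi>_full_expansion: "\<psi>_full has_fps_expansion fps_map of_rat (\<Psi>_full :: rat fps)"
  unfolding fps_map_\<Psi>_full \<psi>_full_def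
proof (rule has_fps_expansion_quotient)
  show "(\<lambda>z. (z - 1) * (3 * z ^ 2 + 3 * z - 2)) has_fps_expansion ((fps_X - 1) * (3 * fps_X ^ 2 + 3
      * fps_X - 2) :: complex fps)"
    "(\<lambda>z. 8 * (1 + z) ^ 2) has_fps_expansion (8 * (1 + fps_X) ^ 2 :: complex fps)"
    by (intro fps_expansion_intros)+
  show nz: "fps_nth (8 * (1 + fps_X) ^ 2 :: complex fps) 0 \<noteq> 0"
      by (simp add: numeral_fps_const power2_eq_square)
  have "8 * (1 + fps_X) ^ 2 * \<Psi>_full
      = (fps_X - 1) * (3 * fps_X ^ 2 + 3 * fps_X - 2) * (inverse (8 * (1 + fps_X) ^ 2) * (8 * (1
      + fps_X) ^ 2) :: complex fps)"
    by (simp only: \<Psi>_full_def mult_ac)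
  then show "8 * (1 + fps_X) ^ 2 * \<Psi>_full
      = ((fps_X - 1) * (3 * fps_X ^ 2 + 3 * fps_X - 2) :: complex fps)"
    by (simp only: inverse_mult_eq_1[OF nz] mult_1_right)
qed

lemma \<alpha>_full_expansion: "\<alpha>_full has_fps_expansion fps_map of_rat (fps_deriv \<rho>_full
    * inverse \<rho>_full :: rat fps)"
  unfolding \<alpha>_full_def
proof (rule has_fps_expansion_quotient)
  interpret rat: ring_map "of_rat :: rat \<Rightarrow> complex"
      by standard (simp_all add: of_rat_add of_rat_mult)
  show "(\<lambda>z. 2 * (1 + z) * (7 + 3 * z)) has_fps_expansion (2 * (1 + fps_X) * (7 + 3
      * fps_X) :: complex fps)"
    "(\<lambda>z. (z ^ 2 - z - 4) * (3 * z ^ 2 + 3 * z - 2)) has_fps_expansion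
      ((fps_X ^ 2 - fps_X - 4) * (3 * fps_X ^ 2 + 3 * fps_X - 2) :: complex fps)"
    by (intro fps_expansion_intros)+
  show "fps_nth ((fps_X ^ 2 - fps_X - 4) * (3 * fps_X ^ 2 + 3 * fps_X - 2) :: complex fps) 0 \<noteq> 0"
    by (simp add: numeral_fps_const power2_eq_square)
  show "(fps_X ^ 2 - fps_X - 4) * (3 * fps_X ^ 2 + 3 * fps_X - 2) * fps_map of_rat (fps_deriv \<rho>_full
      * inverse \<rho>_full :: rat fps)
      = (2 * (1 + fps_X) * (7 + 3 * fps_X) :: complex fps)"
    using arg_cong[OF logderiv_full_eq, of "fps_map of_rat :: rat fps \<Rightarrow> complex fps"]
    by (simp only: rat.fps_map_simps)
qed

section \<open>Constants, asymptotics and numerical values for the full potential\<close>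

definition c_full :: real where
  "c_full = sqrt ((34133 - 914556 * t0_full + 449856 * t0_full ^ 2 - 89344 * t0_full ^ 3) / (176868
      * pi))"
definition d1_full :: real where
  "d1_full = - ((36145645 + 79913928 * t0_full - 39094848 * t0_full ^ 2 + 7808512 * t0_full ^ 3)
      / 11319552)"
definition d2_full :: real where
  "d2_full = (7806311269 + 20984001752 * t0_full - 10129539392 * t0_full ^ 2 + 2006727168
      * t0_full ^ 3) / 1026306048"

text \<open>The stated constants are polynomials in \<open>t0_full\<close>, whereas the saddle point
  yields polynomials in \<open>v_full\<close>. Reduced modulo the quartic equation, both become
  cubics in \<open>v_full\<close>; the same is done for \<open>d1_full\<close> and
  \<open>d2_full\<close>.\<close>

lemma c_full_eq: "c_full = sqrt ((- 8 / 289 + 29 / 578 * v_full + 4 / 289 * v_full ^ 2 + 9 / 289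
    * v_full ^ 3) / pi)"
proof -
  have "34133 - 914556 * t0_full + 449856 * t0_full ^ 2 - 89344 * t0_full ^ 3
      = 176868 * (- 8 / 289 + 29 / 578 * v_full + 4 / 289 * v_full ^ 2 + 9 / 289 * v_full ^ 3)"
    by (simp add: t0_full_def eval_nat_numeral field_simps v_full_rules)
  then have "(34133 - 914556 * t0_full + 449856 * t0_full ^ 2 - 89344 * t0_full ^ 3) / (176868 * pi)
      = (176868 * (- 8 / 289 + 29 / 578 * v_full + 4 / 289 * v_full ^ 2 + 9 / 289 * v_full ^ 3))
          / (176868 * pi)" by (simp only:)
  then show ?thesis unfolding c_full_def
      by (simp only: mult_divide_mult_cancel_left zero_neq_numeral not_False_eq_True)
qed

lemma d1_full_eq: "d1_full = - 21 / 8 - (4181 / 2312 - 241 / 578 * v_full + 587 / 2312 * v_full ^ 2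
    - 801 / 4624 * v_full ^ 3) / 2"
  by (simp add: d1_full_def t0_full_def eval_nat_numeral field_simps v_full_rules)

lemma d2_full_eq: "d2_full = 777 / 128 + 9 / 16 * (4181 / 2312 - 241 / 578 * v_full + 587 / 2312
    * v_full ^ 2 - 801 / 4624 * v_full ^ 3) + 3 / 4 * (1699171 / 628864 - 313683 / 314432 * v_full
    - 49607 / 628864 * v_full ^ 2 + 27443 / 628864 * v_full ^ 3)"
  by (simp add: d2_full_def t0_full_def eval_nat_numeral field_simps v_full_rules)

theorem full_asymptotics:
  "\<exists>E. E \<in> O(\<lambda>n. 1 / real n ^ 3) \<and> (\<forall>n\<ge>1. fps_nth (real_fps planar_full) n =
     c_full * ((1 / t0_full) ^ n / real n powr (7 / 2)) * (1 + d1_full / real n + d2_full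
         / real n ^ 2 + E n))"
  "fps_conv_radius (real_fps planar_full) = ereal t0_full"
proof -
  define v where "v = complex_of_real v_full"
  have v: "3 * v ^ 4 - 6 * v ^ 3 + 4 = 0"
    unfolding v_def using arg_cong[OF v_full_root, of complex_of_real] by simp
  have v0: "v \<noteq> 0" using v_full_coarse by (simp add: v_def)
  define g where "g = complex_of_real (1 / (8 * t0_full * v_full ^ 3))"
  have g: "g \<noteq> 0" using t0_full_pos v_full_coarse by (simp add: g_def)
  define N D :: "complex fps"
    where "N = fps_const (4 * v) + 8 * (fps_const v + fps_X) - fps_const (3 * v ^ 3) * (fps_const v
        + fps_X) ^ 2"
      and "D = (fps_const v + fps_X) ^ 2"
  define G where "G = fps_const g * N * inverse D"
  have D0: "fps_nth D 0 \<noteq> 0" using v0 by (simp add: D_def power2_eq_square)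
  have G: "(\<lambda>x. k_full (of_real (v_full - 1) + x)) has_fps_expansion G"
  proof -
    have e: "(\<lambda>x. k_full (of_real (v_full - 1) + x))
        = (\<lambda>x. (g * (4 * v + 8 * (v + x) - 3 * v ^ 3 * (v + x) ^ 2)) / (v + x) ^ 2)"
    proof (rule ext)
      fix x
      have "1 + (of_real (v_full - 1) + x) = v + x" by (simp add: v_def)
      then show "k_full (of_real (v_full - 1) + x)
          = (g * (4 * v + 8 * (v + x) - 3 * v ^ 3 * (v + x) ^ 2)) / (v + x) ^ 2"
        unfolding k_full_def by (simp add: g_def v_def)
    qed
    show ?thesis unfolding e
    proof (rule has_fps_expansion_quotient)
      show "(\<lambda>x. g * (4 * v + 8 * (v + x) - 3 * v ^ 3 * (v + x) ^ 2)) has_fps_expansion fps_const g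
          * N"
        "(\<lambda>x. (v + x) ^ 2) has_fps_expansion D"
        unfolding N_def D_def by (intro fps_expansion_intros)+
      have "D * G = fps_const g * N * (inverse D * D)" by (simp only: G_def mult_ac)
      then show "D * G = fps_const g * N" by (simp only: inverse_mult_eq_1[OF D0] mult_1_right)
    qed (rule D0)
  qed
  have k_pos: "Re (k_full (of_real (v_full - 1))) > 0"
    using v_full_coarse by (intro Re_k_full) (simp del: of_real_diff)
  have K: "K ^ 2 * D = fps_const g * N" "fps_nth K 0 \<noteq> 0" if "K ^ 2 = G" for K
  proof -
    show "K ^ 2 * D = fps_const g * N"
      unfolding that G_def mult.assoc inverse_mult_eq_1[OF D0] by simp
    have "fps_nth G 0 \<noteq> 0" using has_fps_expansion_imp_0_eq_fps_nth_0[OF G] k_pos by auto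
    then show "fps_nth K 0 \<noteq> 0" unfolding that[symmetric] by (simp add: power2_eq_square)
  qed
  define A1 where "A1 = full_num v * inverse (full_den v)"
  have A1: "(\<lambda>x. \<alpha>_full (of_real (v_full - 1) + x)) has_fps_expansion A1"
  proof -
    have e: "(\<lambda>x. \<alpha>_full (of_real (v_full - 1) + x)) =
      (\<lambda>x. (2 * (v + x) * (3 * (v + x) + 4)) / (((v + x) ^ 2 - 3 * (v + x) - 2) * (3 * (v + x) ^ 2
          - 3 * (v + x) - 2)))"
    proof (rule ext)
      fix x
      define V where "V = v + x"
      have z: "of_real (v_full - 1) + x = V - 1" by (simp add: v_def V_def)
      have "2 * (1 + (V - 1)) * (7 + 3 * (V - 1)) = 2 * V * (3 * V + 4)"
        "((V - 1) ^ 2 - (V - 1) - 4) * (3 * (V - 1) ^ 2 + 3 * (V - 1) - 2)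
            = (V ^ 2 - 3 * V - 2) * (3 * V ^ 2 - 3 * V - 2)"
        by (simp_all add: power2_eq_square algebra_simps)
      then show "\<alpha>_full (of_real (v_full - 1) + x)
          = (2 * (v + x) * (3 * (v + x) + 4)) / (((v + x) ^ 2 - 3 * (v + x) - 2) * (3 * (v + x) ^ 2
          - 3 * (v + x) - 2))"
        unfolding z V_def[symmetric] \<alpha>_full_def by (simp only:)
    qed
    show ?thesis unfolding e
    proof (rule has_fps_expansion_quotient)
      show "(\<lambda>x. 2 * (v + x) * (3 * (v + x) + 4)) has_fps_expansion full_num v"
        unfolding full_num_def Let_def by (intro fps_expansion_intros)
      show "(\<lambda>x. ((v + x) ^ 2 - 3 * (v + x) - 2) * (3 * (v + x) ^ 2 - 3 * (v + x)
          - 2)) has_fps_expansion full_den v"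
        unfolding full_den_def Let_def by (intro fps_expansion_intros)
      show nz: "fps_nth (full_den v) 0 \<noteq> 0" by (rule full_den_nz[OF v])
      have "full_den v * A1 = full_num v * (inverse (full_den v) * full_den v)"
          by (simp only: A1_def mult_ac)
      then show "full_den v * A1 = full_num v" by (simp only: inverse_mult_eq_1[OF nz] mult_1_right)
    qed
  qed
  define a0 where "a0 = 54 / 17 + 36 / 17 * v_full + 24 / 17 * v_full ^ 2 - 48 / 17 * v_full ^ 3"
  define g0 where "g0 = 120 / 11 + 108 / 11 * v_full + 117 / 11 * v_full ^ 2 - 189 / 22
      * v_full ^ 3"
  define r2 where "r2 = 279 / 17 + 993 / 68 * v_full + 1083 / 68 * v_full ^ 2 - 3915 / 272
      * v_full ^ 3"
  define r4 where "r4 = 4217373 / 9248 + 7555239 / 18496 * v_full + 13018635 / 36992 * v_full ^ 2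
      - 7054731 / 18496 * v_full ^ 3"
  have a0: "\<alpha>_full (of_real (v_full - 1)) = of_real a0"
    using has_fps_expansion_imp_0_eq_fps_nth_0[OF A1] full_amplitude_0[OF v]
    by (simp add: a0_def v_def A1_def)
  have a0_pos: "a0 > 0"
  proof -
    have "v_full ^ 3 \<le> (1173 / 1000) ^ 3" using v_full_coarse by (intro power_mono) auto
    then have "v_full ^ 3 \<le> 2" by (simp add: power3_eq_cube)
    moreover have "v_full ^ 2 > 1" using v_full_coarse by (intro one_less_power) auto
    ultimately show ?thesis unfolding a0_def using v_full_coarse by argo
  qed
  have g0: "k_full (of_real (v_full - 1)) = of_real g0"
  proof -
    have "12 * v_full - 3 * v_full ^ 5 = 8 * t0_full * v_full ^ 5 * g0"
      by (simp add: t0_full_def g0_def eval_nat_numeral field_simps v_full_rules)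
    then have "(12 * v_full - 3 * v_full ^ 5) / (8 * t0_full * v_full ^ 5) = g0"
      using t0_full_pos v_full_coarse by simp
    moreover have "k_full (of_real (v_full - 1))
        = of_real ((12 * v_full - 3 * v_full ^ 5) / (8 * t0_full * v_full ^ 5))"
      by (simp add: k_full_def eval_nat_numeral mult_ac)
    ultimately show ?thesis by (simp only:)
  qed
  have g0_pos: "g0 > 0" using k_pos unfolding g0 by simp
  have r2: "fps_nth (A1 * inverse K ^ 3) 2 = of_real r2 * fps_nth (A1 * inverse K ^ 3) 0"
      if "K ^ 2 = G" for K
    using full_ratios(1)[OF v K(1)[OF that, unfolded N_def D_def] g K(2)[OF that]]
        by (simp add: A1_def r2_def v_def)
  have r4: "fps_nth (A1 * inverse K ^ 5) 4 = of_real r4 * fps_nth (A1 * inverse K ^ 5) 0"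
      if "K ^ 2 = G" for K
    using full_ratios(2)[OF v K(1)[OF that, unfolded N_def D_def] g K(2)[OF that]]
        by (simp add: A1_def r4_def v_def)
  note asym = full_saddle.asymptotics[OF \<psi>_full_expansion \<alpha>_full_expansion planar_full_coeffs(2) A1
      G a0 a0_pos g0 r2 r4]
  show "fps_conv_radius (real_fps planar_full) = ereal t0_full" by (rule asym(2))
  have c_eq: "a0 / (2 * sqrt (pi * g0)) = c_full"
  proof -
    have a0_sq: "a0 ^ 2 = 4 * g0 * (- 8 / 289 + 29 / 578 * v_full + 4 / 289 * v_full ^ 2 + 9 / 289
        * v_full ^ 3)"
      by (simp add: a0_def g0_def eval_nat_numeral field_simps v_full_rules)
    have "(a0 / (2 * sqrt (pi * g0))) ^ 2 = a0 ^ 2 / (4 * (pi * g0))"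
      using g0_pos by (simp add: power_divide power_mult_distrib)
    also have "\<dots> = (- 8 / 289 + 29 / 578 * v_full + 4 / 289 * v_full ^ 2 + 9 / 289 * v_full ^ 3)
        / pi" unfolding a0_sq using g0_pos by simp
    finally show ?thesis unfolding c_full_eq
      by (intro real_sqrt_unique[symmetric]) (use a0_pos g0_pos in simp_all)
  qed
  have r2_eq: "r2 / g0 = 4181 / 2312 - 241 / 578 * v_full + 587 / 2312 * v_full ^ 2 - 801 / 4624
      * v_full ^ 3"
  proof -
    have "r2 = (4181 / 2312 - 241 / 578 * v_full + 587 / 2312 * v_full ^ 2 - 801 / 4624
        * v_full ^ 3) * g0" by (simp add: r2_def g0_def eval_nat_numeral field_simps v_full_rules)
    then show ?thesis using g0_pos by simp
  qed
  have r4_eq: "r4 / g0 ^ 2 = 1699171 / 628864 - 313683 / 314432 * v_full - 49607 / 628864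
      * v_full ^ 2 + 27443 / 628864 * v_full ^ 3"
  proof -
    have "r4 = (1699171 / 628864 - 313683 / 314432 * v_full - 49607 / 628864 * v_full ^ 2 + 27443
        / 628864 * v_full ^ 3) * g0 ^ 2" by (simp add: r4_def g0_def eval_nat_numeral field_simps
        v_full_rules)
    then show ?thesis using g0_pos by simp
  qed
  show "\<exists>E. E \<in> O(\<lambda>n. 1 / real n ^ 3) \<and> (\<forall>n\<ge>1. fps_nth (real_fps planar_full) n =
     c_full * ((1 / t0_full) ^ n / real n powr (7 / 2)) * (1 + d1_full / real n + d2_full
         / real n ^ 2 + E n))"
    using asym(1) unfolding c_eq r2_eq r4_eq d1_full_eq[symmetric] d2_full_eq[symmetric] .
qed

text \<open>For \<open>t > 0\<close> the quotient \<open>q t / t\<close> is strictly increasing, so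
  it has at most one zero.\<close>

lemma t0_full_unique:
  assumes "t > 0"
  shows "- 11 - 128 * t + 41088 * t ^ 2 - 20480 * t ^ 3 + 4096 * t ^ 4 = 0 \<longleftrightarrow> t = t0_full"
proof -
  define q where "q = (\<lambda>t::real. - 11 - 128 * t + 41088 * t ^ 2 - 20480 * t ^ 3 + 4096 * t ^ 4)"
  have q0: "q t0_full = 0"
    by (simp add: q_def t0_full_def eval_nat_numeral field_simps v_full_rules)
  have less: "q a * b < q b * a" if "0 < a" "a < b" for a b :: real
  proof -
    define y where "y = 4096 * (b ^ 2 + a * b + a ^ 2) - 20480 * (a + b) + 41088"
    have "0 < y"
    proof -
      \<comment> \<open>The quadratic form is diagonal in \<open>a + b\<close> and
        \<open>a - b\<close>; the square is then completed in \<open>a + b\<close>.\<close>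
      have "y = 3072 * (a + b - 10 / 3) ^ 2 + 1024 * (a - b) ^ 2 + 20864 / 3"
        by (simp add: y_def power2_eq_square field_simps)
      also have "\<dots> > 0" by (intro add_nonneg_pos add_nonneg_nonneg) simp_all
      finally show ?thesis .
    qed
    then have "0 < (b - a) * (a * b * y + 11)"
      using that by (intro mult_pos_pos add_pos_pos) auto
    also have "\<dots> = q b * a - q a * b"
      by (simp add: q_def y_def eval_nat_numeral algebra_simps)
    finally show ?thesis by simp
  qed
  have "q t = 0 \<longleftrightarrow> t = t0_full"
    using less[of t t0_full] less[of t0_full t] assms t0_full_pos q0
        by (cases t t0_full rule: linorder_cases) auto
  then show ?thesis by (simp add: q_def)
qed

text \<open>With enclosures for the first three powers of \<open>v_full\<close>, bounds on cubics in
  it become linear arithmetic.\<close>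

lemma v_full_powers:
  "1172213910843570472 \<le> 1000000000000000000 * v_full" "1000000000000000000 * v_full
      \<le> 1172213910843570473"
  "1374085452775178183 \<le> 1000000000000000000 * v_full ^ 2" "1000000000000000000 * v_full ^ 2
      \<le> 1374085452775178186"
  "1610722082430849883 \<le> 1000000000000000000 * v_full ^ 3" "1000000000000000000 * v_full ^ 3
      \<le> 1610722082430849888"
  using v_full_bounds power_mono[OF v_full_bounds(1), of 2] power_mono[OF v_full_bounds(1), of 3]
    power_mono[OF v_full_bounds(2), of 2] power_mono[OF v_full_bounds(2), of 3] v_full_coarse
  by (simp_all add: power_divide)

lemma t0_full_numeric: "0.0180827901833 \<le> t0_full" "t0_full < 0.0180827901834"
  "55.3012001942 \<le> 1 / t0_full" "1 / t0_full < 55.3012001943"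
proof -
  note b = v_full_powers
  show "0.0180827901833 \<le> t0_full" "t0_full < 0.0180827901834"
    unfolding t0_full_def using b by simp_all
  have "55.3012001942 * t0_full \<le> 1" "1 < 55.3012001943 * t0_full"
    unfolding t0_full_def using b by simp_all
  then show "55.3012001942 \<le> 1 / t0_full" "1 / t0_full < 55.3012001943"
    using t0_full_pos by (simp_all add: field_simps)
qed

lemma d_full_numeric: "3.3197404318 \<le> - d1_full" "- d1_full < 3.3197404319"
  "7.9727292073 \<le> d2_full" "d2_full < 7.9727292074"
proof -
  note b = v_full_powers
  show "3.3197404318 \<le> - d1_full" "- d1_full < 3.3197404319"
    unfolding d1_full_eq using b by simp_all
  have d2: "d2_full = 22925889 / 2515456 - 1236033 / 1257728 * v_full + 210423 / 2515456
      * v_full ^ 2 - 162777 / 2515456 * v_full ^ 3"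
    by (simp add: d2_full_eq field_simps)
  show "7.9727292073 \<le> d2_full" "d2_full < 7.9727292074"
    unfolding d2 using b by simp_all
qed

text \<open>Squaring removes the root; a cubic in \<open>v_full\<close> is then compared with
  rational bounds on \<open>pi\<close>.\<close>

lemma c_full_numeric: "0.1786898225 \<le> c_full" "c_full < 0.1786898226"
proof -
  define P where "P = - 8 / 289 + 29 / 578 * v_full + 4 / 289 * v_full ^ 2 + 9 / 289 * v_full ^ 3"
  note b = v_full_powers
  have "0.1786898225 ^ 2 * 3.1415926535899 \<le> P" "P < 0.1786898226 ^ 2 * 3.141592653588"
    unfolding P_def using b by (simp_all add: power_divide)
  moreover have "0.1786898225 ^ 2 * pi \<le> 0.1786898225 ^ 2 * 3.1415926535899"
    "0.1786898226 ^ 2 * 3.141592653588 \<le> 0.1786898226 ^ 2 * pi"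
    by (rule mult_left_mono[OF pi_approx(2)], simp, rule mult_left_mono[OF pi_approx(1)], simp)
  ultimately have P: "0.1786898225 ^ 2 * pi \<le> P" "P < 0.1786898226 ^ 2 * pi" by linarith+
  have "0.1786898225 ^ 2 \<le> P / pi" "P / pi < 0.1786898226 ^ 2"
    using P by (simp_all only: pos_le_divide_eq[OF pi_gt_zero] pos_divide_less_eq[OF pi_gt_zero])
  from real_le_rsqrt[OF this(1)] real_less_lsqrt[OF _ this(2)]
  have "0.1786898225 \<le> sqrt (P / pi)" "sqrt (P / pi) < 0.1786898226" by simp_all
  moreover have "c_full = sqrt (P / pi)" by (simp add: c_full_eq P_def)
  ultimately show "0.1786898225 \<le> c_full" "c_full < 0.1786898226" by (simp_all only:)
qed

theorem proposition9p2:
  shows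
    "(let f = fps_nth (real_fps planar_even); t0 = (4 - 3 * root 3 2) / 4 in
        f 0 = 0 \<and> f 1 = 1 / 2 \<and> f 2 = 47 / 24 \<and> f 3 = 49 / 4 \<and> f 4 = 11839 / 120
      \<and> f 5 = 9283 / 10 \<and> f 6 = 3260543 / 336 \<and> f 7 = 18387797 / 168
      \<and> f 8 = 941448191 / 720 \<and> f 9 = 490223647 / 30 \<and> f 10 = 93171535189 / 440
      \<and> fps_conv_radius (real_fps planar_even) = ereal t0
      \<and> (\<exists>E. E \<in> O(\<lambda>n. 1 / real n ^ 3) \<and>
          (\<forall>n\<ge>1. f n =
             1 / 3 * sqrt ((2 * root 3 2 - 1) / pi)
             * ((4 / (4 - 3 * root 3 2)) ^ n / real n powr (7 / 2))
             * (1 - (243 - 8 * root 3 2) / (72 * real n)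
                  + (91881 - 2640 * root 3 2 - 5696 * root 3 4) / (10368 * real n ^ 2)
                  + E n))))
   \<and> (let f = fps_nth (real_fps planar_full) in
        planar_full_sqrt = planar_full oo fps_X ^ 2
      \<and> f 0 = 0 \<and> f 1 = 7 / 6 \<and> f 2 = 109 / 8 \<and> f 3 = 15631 / 60 \<and> f 4 = 256629 / 40
      \<and> f 5 = 38720767 / 210 \<and> f 6 = 658811733 / 112
      \<and> (\<exists>t0 c d1 d2 :: real.
           t0 > 0
         \<and> (\<forall>t>0. - 11 - 128 * t + 41088 * t ^ 2 - 20480 * t ^ 3 + 4096 * t ^ 4 = 0 \<longleftrightarrow> t = t0)
         \<and> fps_conv_radius (real_fps planar_full) = ereal t0
         \<and> c = sqrt ((34133 - 914556 * t0 + 449856 * t0 ^ 2 - 89344 * t0 ^ 3) / (176868 * pi))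
         \<and> d1 = - ((36145645 + 79913928 * t0 - 39094848 * t0 ^ 2 + 7808512 * t0 ^ 3) / 11319552)
         \<and> d2 = (7806311269 + 20984001752 * t0 - 10129539392 * t0 ^ 2 + 2006727168 * t0 ^ 3)
                  / 1026306048
         \<and> (\<exists>E. E \<in> O(\<lambda>n. 1 / real n ^ 3) \<and>
             (\<forall>n\<ge>1. f n = c * ((1 / t0) ^ n / real n powr (7 / 2))
                          * (1 + d1 / real n + d2 / real n ^ 2 + E n)))
         \<and> 0.0180827901833 \<le> t0 \<and> t0 < 0.0180827901834
         \<and> 55.3012001942 \<le> 1 / t0 \<and> 1 / t0 < 55.3012001943
         \<and> 0.1786898225 \<le> c \<and> c < 0.1786898226
         \<and> 3.3197404318 \<le> - d1 \<and> - d1 < 3.3197404319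
         \<and> 7.9727292073 \<le> d2 \<and> d2 < 7.9727292074))"
proof (rule conjI, goal_cases)
  case 1
  have nth: "fps_nth (real_fps planar_even) n = of_rat (fps_nth planar_even n)" for n
      by (simp add: real_fps_def)
  have taylor: "fps_nth (real_fps planar_even) 0 = 0" "fps_nth (real_fps planar_even) 1 = 1 / 2"
    "fps_nth (real_fps planar_even) 2 = 47 / 24" "fps_nth (real_fps planar_even) 3 = 49 / 4"
    "fps_nth (real_fps planar_even) 4 = 11839 / 120" "fps_nth (real_fps planar_even) 5 = 9283 / 10"
    "fps_nth (real_fps planar_even) 6 = 3260543 / 336" "fps_nth (real_fps planar_even) 7
        = 18387797 / 168"
    "fps_nth (real_fps planar_even) 8 = 941448191 / 720" "fps_nth (real_fps planar_even) 9
        = 490223647 / 30"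
    "fps_nth (real_fps planar_even) 10 = 93171535189 / 440"
    unfolding nth planar_even_coeffs(1) planar_even_taylor by (simp_all add: of_rat_divide)
  have t0: "(4 - 3 * root 3 2) / 4 = t0_even" by (simp add: t0_even_def \<theta>_def)
  then have t0': "4 / (4 - 3 * root 3 2) = 1 / t0_even" by (simp flip: t0)
  have root4: "root 3 4 = \<theta> ^ 2"
    unfolding \<theta>_def using real_root_power[of 3 2 2] by simp
  have "1 - (243 - 8 * \<theta>) / (72 * real n) + (91881 - 2640 * \<theta> - 5696 * \<theta> ^ 2) / (10368 * real n ^ 2)
      + e
      = 1 + (- (243 - 8 * \<theta>) / 72) / real n + ((91881 - 2640 * \<theta> - 5696 * \<theta> ^ 2) / 10368)
          / real n ^ 2 + e" for n e
    by (simp add: minus_divide_left)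
  then have asym: "\<exists>E. E \<in> O(\<lambda>n. 1 / real n ^ 3) \<and>
      (\<forall>n\<ge>1. fps_nth (real_fps planar_even) n =
         1 / 3 * sqrt ((2 * root 3 2 - 1) / pi) * ((4 / (4 - 3 * root 3 2)) ^ n / real n powr (7
             / 2))
         * (1 - (243 - 8 * root 3 2) / (72 * real n)
            + (91881 - 2640 * root 3 2 - 5696 * root 3 4) / (10368 * real n ^ 2) + E n))"
    unfolding t0' root4 unfolding \<theta>_def[symmetric] using even_asymptotics(1) by (simp only:)
  show ?case
    unfolding Let_def by (intro conjI taylor asym) (simp only: t0 even_asymptotics(2))
next
  case 2
  have nth: "fps_nth (real_fps planar_full) n = of_rat (fps_nth planar_full n)" for n
      by (simp add: real_fps_def)
  have taylor: "fps_nth (real_fps planar_full) 0 = 0" "fps_nth (real_fps planar_full) 1 = 7 / 6"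
    "fps_nth (real_fps planar_full) 2 = 109 / 8" "fps_nth (real_fps planar_full) 3 = 15631 / 60"
    "fps_nth (real_fps planar_full) 4 = 256629 / 40" "fps_nth (real_fps planar_full) 5
        = 38720767 / 210"
    "fps_nth (real_fps planar_full) 6 = 658811733 / 112"
    unfolding nth planar_full_coeffs(1) planar_full_taylor by (simp_all add: of_rat_divide)
  show ?case
    unfolding Let_def
    by (intro conjI exI[of _ t0_full] exI[of _ c_full] exI[of _ d1_full] exI[of _ d2_full] taylor
        allI impI
        planar_full_sqrt_compose t0_full_pos t0_full_unique full_asymptotics t0_full_numeric
            c_full_numeric d_full_numeric
        c_full_def d1_full_def d2_full_def)
qed

end
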